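(* Let $n\ge 7$ and let $L_I$ be a rank $1$ module in $\mathrm{CM}(B_{3,n})$, where $I=\{i_1,i_2,i_3\}$ (with $i_1<i_2<i_3<i_1$ in the cyclic order) is a $3$-subset of $[n]$ with three peaks. Then the Auslander–Reiten sequence ending at $L_I$ is $$0\to\frac{L_X}{L_Y}\to M\to L_I\to 0$$ for $X=\{i_1-2,i_2-2,i_3-2\}$ and $Y=\{i_1-1,i_2-1,i_3-1\}$ (entries modulo $n$). If $M$ is indecomposable, then $P_M=X|I|Y$.
   Context: Category. $[n]=\{1,\dots,n\}$, $k=3$. Let $Q_C$ be the quiver with vertex set $\mathbb{Z}/n$ and arrows $x_i:i-1\to i$, $y_i:i\to i-1$. $B_{k,n}$ is the quotient of the completed path algebra $\widehat{\mathbb{C}Q_C}$ by the ideal generated by the relations $xy=yx$ and $x^k=y^{n-k}$ at each vertex. Its centre is $Z=\mathbb{C}[[t]]$, $t=\sum_i x_iy_i$. $\mathrm{CM}(B_{k,n})$ is the category of $B_{k,n}$-modules $M=(M_i)$ with all $M_i$ free $Z$-modules of the same finite rank, which is the rank of $M$; it is an exact Frobenius category with Auslander–Reiten (almost split) sequences. For a $k$-subset $I\subset[n]$, $L_I$ is the rank 1 module with $\mathbb{C}[[t]]$ at each vertex, $x_i$ acting as $1$ if $i\in I$ and $t$ if $i\notin I$, $y_i$ acting as $t$ if $i\in I$ and $1$ if $i\notin I$. A peak of $I$ (or of $L_I$) is an $i\in\mathbb{Z}/n$ with $i\notin I$, $i+1\in I$; so a 3-subset has three peaks iff no two of its elements are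 cyclically adjacent. Profile. A rank $m$ module $M$ has a filtration with rank 1 factors $L_{I_1},\dots,L_{I_m}$, listed from top to bottom so that $L_{I_m}$ is a submodule of $M$. The profile $P_M=I_1|\cdots|I_m$ of $M$ is the ordered collection of $k$-subsets occurring in the generic filtration of $M$. In terms of the lattice diagram of $M$, where $M$ is given by a configuration of subspaces of $\mathbb{C}^m$ attached to the lattice points, the rims of $L_{I_1},\dots,L_{I_m}$ are the contours separating the regions of different multiplicity (dimension): $1$ between the top two rims, and so on, up to $m$ below the lowest rim. $\frac{L_X}{L_Y}$, also written $L_X|L_Y$, denotes the rigid indecomposable rank 2 module with submodule $L_Y$ and quotient $L_X$, i.e. with profile $X|Y$ (rigid indecomposable modules are determined by their profile; rigid means $\mathrm{Ext}^1(M,M)=0$). *)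

theory Defs
  imports
    "Jordan_Normal_Form.VS_Connect"
    "Jordan_Normal_Form.Matrix_Kernel"
    "HOL-Computational_Algebra.Formal_Laurent_Series"
begin

section \<open>Subsets of the cyclic set of vertices\<close>

text \<open>
  The set \<open>[n]\<close> is \<open>{1..n}\<close>, a set of integers. Everything indexed by the
  vertices or arrows of the cyclic quiver is indexed by all integers and required to be
  \<open>n\<close>-periodic.
\<close>

definition residue :: "nat \<Rightarrow> int \<Rightarrow> int" where
  "residue n i = (i - 1) mod int n + 1"

definition k_subset :: "nat \<Rightarrow> nat \<Rightarrow> int set \<Rightarrow> bool" where
  "k_subset k n I \<longleftrightarrow> I \<subseteq> {1..int n} \<and> card I = k"

definition peaks :: "nat \<Rightarrow> int set \<Rightarrow> int set" where
  "peaks n I = {i \<in> {1..int n}. i \<notin> I \<and> residue n (i + 1) \<in> I}"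

definition cyclic_less3 :: "int \<Rightarrow> int \<Rightarrow> int \<Rightarrow> bool" where
  "cyclic_less3 a b c \<longleftrightarrow> (a < b \<and> b < c) \<or> (b < c \<and> c < a) \<or> (c < a \<and> a < b)"

section \<open>The category of Cohen--Macaulay modules\<close>

text \<open>
  A module with all \<open>M\<^sub>i\<close> free of rank \<open>m\<close> over the centre \<open>Z = \<complex>[[t]]\<close> is
  given, after choosing bases, by \<open>m \<times> m\<close> matrices over \<open>Z\<close>: \<open>xmap M i\<close> is the
  matrix of \<open>x\<^sub>i : M\<^sub>i\<^sub>-\<^sub>1 \<rightarrow> M\<^sub>i\<close> and \<open>ymap M i\<close> that of
  \<open>y\<^sub>i : M\<^sub>i \<rightarrow> M\<^sub>i\<^sub>-\<^sub>1\<close>. The variable \<open>t\<close> is \<^const>\<open>fps_X\<close>.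
\<close>

record cyc_rep =
  rk :: nat
  xmap :: "int \<Rightarrow> complex fps mat"
  ymap :: "int \<Rightarrow> complex fps mat"

text \<open>The action of the paths \<open>x\<^sup>l\<close> and \<open>y\<^sup>l\<close> starting at vertex \<open>i\<close>.\<close>

fun xpath :: "cyc_rep \<Rightarrow> int \<Rightarrow> nat \<Rightarrow> complex fps mat" where
  "xpath M i 0 = 1\<^sub>m (rk M)"
| "xpath M i (Suc l) = xmap M (i + int l + 1) * xpath M i l"

fun ypath :: "cyc_rep \<Rightarrow> int \<Rightarrow> nat \<Rightarrow> complex fps mat" where
  "ypath M i 0 = 1\<^sub>m (rk M)"
| "ypath M i (Suc l) = ymap M (i - int l) * ypath M i l"

text \<open>
  The element \<open>t\<close> is the sum of all \<open>x\<^sub>i y\<^sub>i\<close>, so it acts on \<open>M\<^sub>i\<close> as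
  \<open>x\<^sub>i y\<^sub>i\<close>; this has to be multiplication by the variable of \<open>\<complex>[[t]]\<close>.
\<close>

definition CM :: "nat \<Rightarrow> nat \<Rightarrow> cyc_rep \<Rightarrow> bool" where
  "CM k n M \<longleftrightarrow>
     (\<forall>i. xmap M i \<in> carrier_mat (rk M) (rk M) \<and> ymap M i \<in> carrier_mat (rk M) (rk M) \<and>
          xmap M (i + int n) = xmap M i \<and> ymap M (i + int n) = ymap M i \<and>
          xmap M i * ymap M i = fps_X \<cdot>\<^sub>m 1\<^sub>m (rk M) \<and>
          ymap M (i + 1) * xmap M (i + 1) = xmap M i * ymap M i \<and>
          xpath M i k = ypath M i (n - k))"

definition is_hom :: "nat \<Rightarrow> cyc_rep \<Rightarrow> cyc_rep \<Rightarrow> (int \<Rightarrow> complex fps mat) \<Rightarrow> bool" where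
  "is_hom n M N f \<longleftrightarrow>
     (\<forall>i. f i \<in> carrier_mat (rk N) (rk M) \<and> f (i + int n) = f i \<and>
          f i * xmap M i = xmap N i * f (i - 1) \<and>
          f (i - 1) * ymap M i = ymap N i * f i)"

definition hom_comp ::
  "(int \<Rightarrow> complex fps mat) \<Rightarrow> (int \<Rightarrow> complex fps mat) \<Rightarrow> int \<Rightarrow> complex fps mat" where
  "hom_comp g f = (\<lambda>i. g i * f i)"

definition hom_id :: "cyc_rep \<Rightarrow> int \<Rightarrow> complex fps mat" where
  "hom_id M = (\<lambda>i. 1\<^sub>m (rk M))"

definition isomorphic :: "nat \<Rightarrow> cyc_rep \<Rightarrow> cyc_rep \<Rightarrow> bool" where
  "isomorphic n M N \<longleftrightarrow>
     (\<exists>f g. is_hom n M N f \<and> is_hom n N M g \<and>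
            hom_comp g f = hom_id M \<and> hom_comp f g = hom_id N)"

definition split_mono ::
  "nat \<Rightarrow> cyc_rep \<Rightarrow> cyc_rep \<Rightarrow> (int \<Rightarrow> complex fps mat) \<Rightarrow> bool" where
  "split_mono n M N f \<longleftrightarrow> (\<exists>r. is_hom n N M r \<and> hom_comp r f = hom_id M)"

definition split_epi ::
  "nat \<Rightarrow> cyc_rep \<Rightarrow> cyc_rep \<Rightarrow> (int \<Rightarrow> complex fps mat) \<Rightarrow> bool" where
  "split_epi n M N g \<longleftrightarrow> (\<exists>s. is_hom n N M s \<and> hom_comp g s = hom_id N)"

definition direct_sum :: "cyc_rep \<Rightarrow> cyc_rep \<Rightarrow> cyc_rep" where
  "direct_sum A B =
     \<lparr> rk = rk A + rk B,
       xmap = (\<lambda>i. four_block_mat (xmap A i) (0\<^sub>m (rk A) (rk B)) (0\<^sub>m (rk B) (rk A)) (xmap B i)),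
       ymap = (\<lambda>i. four_block_mat (ymap A i) (0\<^sub>m (rk A) (rk B)) (0\<^sub>m (rk B) (rk A)) (ymap B i)) \<rparr>"

definition indecomposable :: "nat \<Rightarrow> nat \<Rightarrow> cyc_rep \<Rightarrow> bool" where
  "indecomposable k n M \<longleftrightarrow>
     CM k n M \<and> rk M > 0 \<and>
     (\<forall>A B. CM k n A \<and> CM k n B \<and> isomorphic n M (direct_sum A B) \<longrightarrow> rk A = 0 \<or> rk B = 0)"

text \<open>Short exact sequences \<open>0 \<rightarrow> A \<rightarrow> E \<rightarrow> C \<rightarrow> 0\<close> with maps \<open>f\<close>, \<open>g\<close>.\<close>

definition short_exact ::
  "nat \<Rightarrow> nat \<Rightarrow> cyc_rep \<Rightarrow> cyc_rep \<Rightarrow> cyc_rep \<Rightarrow>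
   (int \<Rightarrow> complex fps mat) \<Rightarrow> (int \<Rightarrow> complex fps mat) \<Rightarrow> bool" where
  "short_exact k n A E C f g \<longleftrightarrow>
     CM k n A \<and> CM k n E \<and> CM k n C \<and> is_hom n A E f \<and> is_hom n E C g \<and>
     (\<forall>i. inj_on (\<lambda>v. f i *\<^sub>v v) (carrier_vec (rk A)) \<and>
          (\<lambda>v. f i *\<^sub>v v) ` carrier_vec (rk A) = mat_kernel (g i) \<and>
          (\<lambda>v. g i *\<^sub>v v) ` carrier_vec (rk E) = carrier_vec (rk C))"

text \<open>
  \<open>Ext\<^sup>1(M, M) = 0\<close>, in terms of Yoneda extensions; an extension of two modules that are
  free over the centre is again free over the centre.
\<close>

definition rigid :: "nat \<Rightarrow> nat \<Rightarrow> cyc_rep \<Rightarrow> bool" where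
  "rigid k n M \<longleftrightarrow> CM k n M \<and> (\<forall>E f g. short_exact k n M E M f g \<longrightarrow> split_epi n E M g)"

text \<open>Almost split sequences: exact, with a left and a right almost split map.\<close>

definition AR_sequence ::
  "nat \<Rightarrow> nat \<Rightarrow> cyc_rep \<Rightarrow> cyc_rep \<Rightarrow> cyc_rep \<Rightarrow>
   (int \<Rightarrow> complex fps mat) \<Rightarrow> (int \<Rightarrow> complex fps mat) \<Rightarrow> bool" where
  "AR_sequence k n A E C f g \<longleftrightarrow>
     short_exact k n A E C f g \<and>
     \<not> split_mono n A E f \<and>
     (\<forall>N h. CM k n N \<and> is_hom n A N h \<and> \<not> split_mono n A N h \<longrightarrow>
        (\<exists>h'. is_hom n E N h' \<and> hom_comp h' f = h)) \<and>
     \<not> split_epi n E C g \<and>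
     (\<forall>N h. CM k n N \<and> is_hom n N C h \<and> \<not> split_epi n N C h \<longrightarrow>
        (\<exists>h'. is_hom n N E h' \<and> hom_comp g h' = h))"

definition rank1 :: "nat \<Rightarrow> int set \<Rightarrow> cyc_rep" where
  "rank1 n I =
     \<lparr> rk = 1,
       xmap = (\<lambda>i. mat 1 1 (\<lambda>_. if residue n i \<in> I then 1 else fps_X)),
       ymap = (\<lambda>i. mat 1 1 (\<lambda>_. if residue n i \<in> I then fps_X else 1)) \<rparr>"

section \<open>Profiles\<close>

text \<open>
  Filtrations with rank 1 factors, listed from top to bottom: the last entry is the
  submodule.
\<close>

inductive filtered :: "nat \<Rightarrow> nat \<Rightarrow> cyc_rep \<Rightarrow> int set list \<Rightarrow> bool" for k n where
  zero: "CM k n M \<Longrightarrow> rk M = 0 \<Longrightarrow> filtered k n M []"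
| step: "k_subset k n J \<Longrightarrow> short_exact k n (rank1 n J) M Q f g \<Longrightarrow> filtered k n Q P \<Longrightarrow>
         filtered k n M (P @ [J])"

text \<open>
  The lattice points are the pairs \<open>(i, j)\<close> of integers, where \<open>i\<close> runs through the
  universal cover of the cyclic quiver and \<open>j\<close> is a degree, which increases downwards. The arrow
  \<open>x\<close> goes from \<open>(i - 1, j)\<close> to \<open>(i, j)\<close> and \<open>y\<close> from \<open>(i, j)\<close> to
  \<open>(i - 1, j + 1)\<close>; by \<open>x\<^sup>k = y\<^sup>n\<^sup>-\<^sup>k\<close> the path \<open>x\<^sup>n\<close> equals
  \<open>t\<^sup>n\<^sup>-\<^sup>k\<close>, so \<open>(i + n, j)\<close> and \<open>(i, j + n - k)\<close> are the same point. A
  configuration attaches to each point a subspace of \<open>\<complex>\<^sup>m\<close>.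
\<close>

definition configuration :: "nat \<Rightarrow> nat \<Rightarrow> nat \<Rightarrow> (int \<Rightarrow> int \<Rightarrow> complex vec set) \<Rightarrow> bool" where
  "configuration k n m V \<longleftrightarrow>
     (\<forall>i j. VectorSpace.subspace class_ring (V i j) (module_vec TYPE(complex) m) \<and>
            V (i - 1) j \<subseteq> V i j \<and> V i j \<subseteq> V (i - 1) (j + 1) \<and>
            V (i + int n) j = V i (j + int n - int k)) \<and>
     (\<forall>i. \<exists>a b. (\<forall>j\<le>a. V i j = {0\<^sub>v m}) \<and> (\<forall>j\<ge>b. V i j = carrier_vec m))"

definition multiplicity_at :: "nat \<Rightarrow> (int \<Rightarrow> int \<Rightarrow> complex vec set) \<Rightarrow> int \<Rightarrow> int \<Rightarrow> nat" where
  "multiplicity_at m V i j =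
     vectorspace.dim class_ring ((module_vec TYPE(complex) m)\<lparr>carrier := V i j\<rparr>)"

text \<open>
  The module given by a configuration \<open>V\<close> has at vertex \<open>i\<close> the Laurent series with
  values in \<open>\<complex>\<^sup>m\<close> whose coefficient of \<open>t\<^sup>j\<close> lies in \<open>V i j\<close>, for all
  \<open>j\<close>; the \<open>x\<^sub>i\<close> act as inclusions, hence the \<open>y\<^sub>i\<close> as multiplication by
  \<open>t\<close>. The matrices \<open>\<phi> i\<close> below describe an isomorphism from \<open>M\<close> to this module.
\<close>

definition lattice_diagram ::
  "nat \<Rightarrow> nat \<Rightarrow> cyc_rep \<Rightarrow> (int \<Rightarrow> int \<Rightarrow> complex vec set) \<Rightarrow> bool" where
  "lattice_diagram k n M V \<longleftrightarrow>
     CM k n M \<and> configuration k n (rk M) V \<and>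
     (\<exists>\<phi> :: int \<Rightarrow> complex fls mat. \<forall>i.
        \<phi> i \<in> carrier_mat (rk M) (rk M) \<and>
        \<phi> i * map_mat fps_to_fls (xmap M i) = \<phi> (i - 1) \<and>
        \<phi> (i - 1) * map_mat fps_to_fls (ymap M i) = fls_X \<cdot>\<^sub>m \<phi> i \<and>
        bij_betw (\<lambda>v. \<phi> i *\<^sub>v map_vec fps_to_fls v) (carrier_vec (rk M))
          {w \<in> carrier_vec (rk M). \<forall>j. map_vec (\<lambda>c. fls_nth c j) w \<in> V i j})"

text \<open>
  \<open>h i\<close> is the degree of the highest point of column \<open>i\<close> on or below the rim. In the
  lattice diagram of \<open>L\<^sub>J\<close> itself \<open>x\<^sub>i\<close> preserves the generator for
  \<open>i \<in> J\<close> and multiplies it by \<open>t\<close> otherwise.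
\<close>

definition is_rim :: "nat \<Rightarrow> int set \<Rightarrow> (int \<Rightarrow> int) \<Rightarrow> bool" where
  "is_rim n J h \<longleftrightarrow> (\<forall>i. h i = (if residue n i \<in> J then h (i - 1) else h (i - 1) - 1))"

text \<open>
  \<open>P\<close> lists the factors of a filtration whose rims are the contours of the lattice diagram:
  the \<open>d\<close>-th rim from the top (counted from \<open>0\<close>) bounds the region of multiplicity
  greater than \<open>d\<close>. This is the filtration of \<open>M\<close> induced by a flag in
  \<open>\<complex>\<^sup>m\<close> in general position with respect to the configuration.
\<close>

definition generic_filtration :: "nat \<Rightarrow> nat \<Rightarrow> cyc_rep \<Rightarrow> int set list \<Rightarrow> bool" where
  "generic_filtration k n M P \<longleftrightarrow>
     filtered k n M P \<and> length P = rk M \<and>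
     (\<exists>V. lattice_diagram k n M V \<and>
          (\<forall>d < rk M. \<exists>h. is_rim n (P ! d) h \<and>
             (\<forall>i j. d < multiplicity_at (rk M) V i j \<longleftrightarrow> h i \<le> j)))"

text \<open>\<open>P\<^sub>M = P\<close>, including that the profile of \<open>M\<close> is well defined.\<close>

definition has_profile :: "nat \<Rightarrow> nat \<Rightarrow> cyc_rep \<Rightarrow> int set list \<Rightarrow> bool" where
  "has_profile k n M P \<longleftrightarrow> (\<forall>Q. generic_filtration k n M Q \<longleftrightarrow> Q = P)"

text \<open>
  \<open>N\<close> is (isomorphic to) the rigid indecomposable module \<open>L\<^sub>X|L\<^sub>Y\<close> of rank 2.
\<close>

definition is_rank2 :: "nat \<Rightarrow> nat \<Rightarrow> int set \<Rightarrow> int set \<Rightarrow> cyc_rep \<Rightarrow> bool" where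
  "is_rank2 k n X Y N \<longleftrightarrow>
     CM k n N \<and> rk N = 2 \<and> rigid k n N \<and> indecomposable k n N \<and>
     (\<exists>f g. short_exact k n (rank1 n Y) N (rank1 n X) f g) \<and>
     has_profile k n N [X, Y]"

end

theory Submission imports Defs begin

text \<open>
  A module of rank \<open>m\<close> is a periodic chain of lattices \<open>\<Lambda>\<^sub>i\<close> over \<open>O = \<complex>[[t]]\<close> in
  \<open>K\<^sup>m\<close>, \<open>K = \<complex>((t))\<close>, and morphisms are matrices over \<open>K\<close> that respect the chains;
  \<open>L\<^sub>I\<close> is the chain \<open>t\<^bsup>hI(i)\<^esup> O\<close> given by its rim. Let \<open>g\<^sub>j\<close> be the rim of \<open>X\<close> raised
  by 1 from the \<open>j\<close>-th element of \<open>Y\<close> up to the next element of \<open>X\<close>. The middle term consists of the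
  \<open>v \<in> K\<^sup>3\<close> with \<open>v\<^sub>j \<in> t\<^bsup>g\<^sub>j\<^esup> O\<close> and \<open>v\<^sub>1 + v\<^sub>2 + v\<^sub>3 \<in> t\<^bsup>hI\<^esup> O\<close>, the map to \<open>L\<^sub>I\<close> is
  the sum, and \<open>L\<^sub>X|L\<^sub>Y\<close> is its kernel.

  A map \<open>\<eta> : W \<rightarrow> L\<^sub>I\<close> is a split epimorphism unless it sends \<open>S\<^sub>1 \<inter> S\<^sub>2 \<inter> S\<^sub>3\<close> into \<open>t O\<close>, where
  \<open>S\<^sub>j\<close> is the rescaled lattice of \<open>W\<close> at the \<open>j\<close>-th peak of \<open>I\<close>. In the latter case duality of
  lattices gives \<open>\<eta> = \<beta>\<^sub>1 + \<beta>\<^sub>2 + \<beta>\<^sub>3\<close> with \<open>\<beta>\<^sub>j(S\<^sub>j) \<subseteq> t O\<close>, and the \<open>\<beta>\<^sub>j\<close> are a lift of \<open>\<eta>\<close>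
  to the middle term. The left almost split property follows by a similar alternative for three lattices.

  Up to isomorphism an extension of \<open>L\<^sub>X\<close> by \<open>L\<^sub>Y\<close> is given by three complex numbers, one for
  each segment between \<open>Y\<close> and \<open>X\<close>. It is decomposable if two of them agree and is \<open>L\<^sub>X|L\<^sub>Y\<close> otherwise.

  The profile can be read off one configuration if all its endomorphisms are scalar. For the middle
  term this holds if two of the cyclic gaps of \<open>I\<close> are at least 3. Otherwise two gaps are equal to 2, and the
  middle term is decomposable.
\<close>

text \<open>Everything can be decided at the three peaks because \<open>hI\<close> grows by one with
  each step to the left until an element of \<open>I\<close> is passed, exactly as the arrows y
  multiply by t: a vector that lies, suitably rescaled, in a chain at a peak also lies in it at the
  vertices back to the preceding element of \<open>I\<close>. Dually, a functional bounded at a peak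
  is bounded further left by the same order, and further right with a loss of one per step. Once per
  period the bound on the sum of the three functionals makes up for that loss, and the bounds that
  result are \<open>g1\<close>, \<open>g2\<close>, \<open>g3\<close>; this is the origin of the
  middle term. Two demands of the statement shape the rest. It speaks of every module that qualifies
  as \<open>L_X|L_Y\<close>, not of one model, so extensions have to be classified; uniqueness comes
  from the fact that any three distinct lines in a plane can be moved to any other three. And a
  profile has to be the same for all lattice diagrams of a module, so two arbitrary diagrams must be
  compared although the isomorphism between them need not be homogeneous.\<close>

no_notation fps_nth (infixl "$" 75)

section \<open>Powers of the uniformiser\<close>

definition tpow :: "int \<Rightarrow> complex fls" where
  "tpow d = fls_X_intpow d"

text \<open>The fractional ideal t^d O, with \<open>d\<close> possibly negative. Stating it by
  coefficients avoids the exceptional role that zero has for \<open>fls_subdegree\<close>.\<close>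

definition tO :: "int \<Rightarrow> complex fls set" where
  "tO d = {x. \<forall>j<d. fls_nth x j = 0}"

lemma tpow_nth: "fls_nth (tpow d * x) j = fls_nth x (j - d)"
  by (simp add: tpow_def fls_X_intpow_times_conv_shift)

lemma tpow_coeff: "fls_nth (tpow d) j = (if j = d then 1 else 0)"
  using tpow_nth[of d 1 j] by (auto simp: fls_eq_iff)

lemma tpow_0 [simp]: "tpow 0 = 1"
  by (simp add: tpow_def)

lemma tpow_1: "tpow 1 = fls_X"
  by (simp add: tpow_def fls_X_conv_shift_1)

lemma tpow_add: "tpow (d + e) = tpow d * tpow e"
  by (simp add: tpow_def fls_X_intpow_times_fls_X_intpow)

lemma tpow_nz [simp]: "tpow d \<noteq> 0"
  by (simp add: tpow_def)

lemma tpow_neg [simp]: "tpow d * tpow (- d) = 1" "tpow (- d) * tpow d = 1"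
  by (simp_all add: tpow_add[symmetric])

lemma tpow_neg' [simp]: "tpow d * (tpow (- d) * x) = x" "tpow (- d) * (tpow d * x) = x"
  by (simp_all add: mult.assoc[symmetric])

lemma tO_0 [simp]: "0 \<in> tO d" by (simp add: tO_def)
lemma tO_add: "x \<in> tO d \<Longrightarrow> y \<in> tO d \<Longrightarrow> x + y \<in> tO d" by (simp add: tO_def)
lemma tO_diff: "x \<in> tO d \<Longrightarrow> y \<in> tO d \<Longrightarrow> x - y \<in> tO d" by (simp add: tO_def)
lemma tO_uminus: "x \<in> tO d \<Longrightarrow> - x \<in> tO d" by (simp add: tO_def)
lemma tO_uminus_iff [simp]: "- x \<in> tO d \<longleftrightarrow> x \<in> tO d" by (simp add: tO_def)
lemma tO_mono: "x \<in> tO d \<Longrightarrow> e \<le> d \<Longrightarrow> x \<in> tO e" by (simp add: tO_def)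
lemma tO_sum: "(\<And>i. i \<in> A \<Longrightarrow> f i \<in> tO d) \<Longrightarrow> sum f A \<in> tO d"
  by (induct A rule: infinite_finite_induct) (auto intro: tO_add)

lemma tO_iff_subdegree: "x \<in> tO d \<longleftrightarrow> x = 0 \<or> d \<le> fls_subdegree x"
proof
  assume "x \<in> tO d"
  then show "x = 0 \<or> d \<le> fls_subdegree x"
    using nth_fls_subdegree_nonzero[of x] by (force simp: tO_def not_less)
next
  assume "x = 0 \<or> d \<le> fls_subdegree x"
  then show "x \<in> tO d" by (auto simp: tO_def fls_eq0_below_subdegree)
qed

lemma tO_mult: "x \<in> tO d \<Longrightarrow> y \<in> tO e \<Longrightarrow> x * y \<in> tO (d + e)"
  by (cases "x = 0 \<or> y = 0") (auto simp: tO_iff_subdegree)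

lemma tO_scale: "c \<in> tO 0 \<Longrightarrow> x \<in> tO d \<Longrightarrow> c * x \<in> tO d"
  using tO_mult[of c 0 x d] by simp

lemma tO_tpow [simp]: "tpow e * x \<in> tO d \<longleftrightarrow> x \<in> tO (d - e)"
proof -
  have "(\<forall>j<d. fls_nth x (j - e) = 0) \<longleftrightarrow> (\<forall>j<d - e. fls_nth x j = 0)"
  proof (intro iffI allI impI)
    fix j assume h: "\<forall>j<d. fls_nth x (j - e) = 0" and "j < d - e"
    then show "fls_nth x j = 0" using h[rule_format, of "j + e"] by simp
  qed simp
  then show ?thesis by (simp add: tO_def tpow_nth)
qed

lemma tpow_in_tO [simp]: "tpow e \<in> tO d \<longleftrightarrow> d \<le> e"
  by (auto simp: tO_def tpow_coeff)

lemma one_in_tO [simp]: "1 \<in> tO d \<longleftrightarrow> d \<le> 0"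
  using tpow_in_tO[of 0 d] by simp

lemma tO_exists_bound: "\<exists>d. x \<in> tO d"
  by (meson order_refl tO_iff_subdegree)

lemma tO_exists_bound_finite:
  assumes "finite A"
  shows "\<exists>d. \<forall>x\<in>A. f x \<in> tO d"
  using assms
proof (induct A)
  case (insert a A)
  then obtain d where d: "\<forall>x\<in>A. f x \<in> tO d" by blast
  obtain e where e: "f a \<in> tO e" using tO_exists_bound by blast
  have "\<forall>x\<in>insert a A. f x \<in> tO (min d e)" using d e by (auto intro: tO_mono)
  then show ?case by blast
qed auto

lemma fls_const_in_tO [simp]: "fls_const c \<in> tO 0"
  by (simp add: tO_def)

text \<open>Nonzero integers are units of O because the residue field has characteristic 0. For 2
  and 3 this puts (1,1) and (1,1,1) in general position to the functionals that cut out the chains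
  below.\<close>

lemma numeral_tO: "numeral k * x \<in> tO d \<longleftrightarrow> x \<in> tO d"
proof -
  have e: "(numeral k :: complex fls) = fls_const (numeral k)" by (simp add: fls_const_numeral)
  show ?thesis unfolding e tO_def by simp
qed

lemma const_mult_tO: "x \<in> tO d \<Longrightarrow> fls_const c * x \<in> tO d"
  unfolding tO_def by simp

lemma tO_0_iff_fps: "x \<in> tO 0 \<longleftrightarrow> (\<exists>f. x = fps_to_fls f)"
proof
  assume "x \<in> tO 0"
  then have "x = fps_to_fls (fls_regpart x)"
    by (intro fls_eqI) (auto simp: tO_def)
  then show "\<exists>f. x = fps_to_fls f" by blast
next
  assume "\<exists>f. x = fps_to_fls f"
  then show "x \<in> tO 0" by (auto simp: tO_def)
qed

lemma fps_to_fls_in_tO [simp]: "fps_to_fls f \<in> tO 0"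
  using tO_0_iff_fps by blast

text \<open>O is a local ring with maximal ideal \<open>tO 1\<close>. The splittings in both halves
  of the almost split property are obtained by inverting such a unit.\<close>

lemma tO_inverse:
  assumes "x \<in> tO 0" "x \<notin> tO 1"
  shows "inverse x \<in> tO 0" "x \<noteq> 0"
proof -
  show "x \<noteq> 0" using assms by auto
  then have "fls_subdegree x = 0" using assms by (auto simp: tO_iff_subdegree)
  then show "inverse x \<in> tO 0" by (simp add: tO_iff_subdegree fls_inverse_subdegree)
qed

lemma tO_mult_notin_1:
  assumes "x \<in> tO 0" "y \<in> tO 0" "x \<notin> tO 1" "y \<notin> tO 1"
  shows "x * y \<notin> tO 1"
  using assms by (auto simp: tO_iff_subdegree)

section \<open>Invertible matrices\<close>

lemma mat_inverse_ex:
  fixes A :: "'a :: field mat"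
  assumes A: "A \<in> carrier_mat m m" and d: "det A \<noteq> 0"
  obtains B where "B \<in> carrier_mat m m" "A * B = 1\<^sub>m m" "B * A = 1\<^sub>m m"
proof -
  from det_non_zero_imp_unit[OF A d, of undefined]
  show ?thesis unfolding Units_def ring_mat_def by (auto intro: that)
qed

section \<open>Lattices\<close>

text \<open>An O-submodule squeezed between two multiples of the standard lattice. This form is
  visibly stable under sums, intersections and duals; freeness of rank \<open>m\<close> is recovered
  when a basis is constructed.\<close>

definition lattice :: "nat \<Rightarrow> complex fls vec set \<Rightarrow> bool" where
  "lattice m S \<longleftrightarrow> S \<subseteq> carrier_vec m \<and>
     (\<forall>u\<in>S. \<forall>v\<in>S. u + v \<in> S) \<and> (\<forall>c\<in>tO 0. \<forall>v\<in>S. c \<cdot>\<^sub>v v \<in> S) \<and>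
     (\<exists>b. \<forall>v\<in>S. \<forall>l<m. v $ l \<in> tO b) \<and>
     (\<exists>c. \<forall>v\<in>carrier_vec m. (\<forall>l<m. v $ l \<in> tO c) \<longrightarrow> v \<in> S)"

definition int_vecs :: "nat \<Rightarrow> complex fls vec set" where
  "int_vecs m = {v \<in> carrier_vec m. \<forall>l<m. v $ l \<in> tO 0}"

definition lat :: "complex fls mat \<Rightarrow> complex fls vec set" where
  "lat \<phi> = (\<lambda>v. \<phi> *\<^sub>v v) ` int_vecs (dim_col \<phi>)"

lemma int_vecs_carrier: "v \<in> int_vecs m \<Longrightarrow> v \<in> carrier_vec m"
  by (simp add: int_vecs_def)

lemma int_vecs_fps: "int_vecs m = map_vec fps_to_fls ` carrier_vec m"
proof (intro equalityI subsetI)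
  fix v assume v: "v \<in> int_vecs m"
  then have "\<forall>l<m. \<exists>f. v $ l = fps_to_fls f" by (auto simp: int_vecs_def tO_0_iff_fps)
  then obtain f where f: "\<And>l. l < m \<Longrightarrow> v $ l = fps_to_fls (f l)" by metis
  have "v = map_vec fps_to_fls (vec m f)" using v f by (intro eq_vecI) (auto simp: int_vecs_def)
  then show "v \<in> map_vec fps_to_fls ` carrier_vec m" by auto
qed (auto simp: int_vecs_def)

lemma latticeD:
  assumes "lattice m S"
  shows "v \<in> S \<Longrightarrow> v \<in> carrier_vec m" "u \<in> S \<Longrightarrow> v \<in> S \<Longrightarrow> u + v \<in> S"
    "c \<in> tO 0 \<Longrightarrow> v \<in> S \<Longrightarrow> c \<cdot>\<^sub>v v \<in> S"
    "\<exists>b. \<forall>v\<in>S. \<forall>l<m. v $ l \<in> tO b"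
    "\<exists>c. \<forall>v\<in>carrier_vec m. (\<forall>l<m. v $ l \<in> tO c) \<longrightarrow> v \<in> S"
  using assms by (auto simp: lattice_def)

lemma lattice_zero: "lattice m S \<Longrightarrow> 0\<^sub>v m \<in> S"
  using latticeD(5)[of m S] by auto

lemma lattice_comb:
  assumes S: "lattice m S" and A: "A \<in> carrier_mat m r" and c: "\<And>j. j < r \<Longrightarrow> col A j \<in> S"
    and v: "v \<in> int_vecs r"
  shows "A *\<^sub>v v \<in> S"
proof -
  have "k \<le> r \<Longrightarrow> vec m (\<lambda>i. \<Sum>j<k. A $$ (i,j) * v $ j) \<in> S" for k
  proof (induct k)
    case 0
    have "vec m (\<lambda>i. 0 :: complex fls) = 0\<^sub>v m" by auto
    then show ?case using lattice_zero[OF S] by simp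
  next
    case (Suc k)
    have "vec m (\<lambda>i. \<Sum>j<Suc k. A $$ (i,j) * v $ j)
      = vec m (\<lambda>i. \<Sum>j<k. A $$ (i,j) * v $ j) + v $ k \<cdot>\<^sub>v col A k"
      using A Suc(2) by (intro eq_vecI) (auto simp: mult.commute)
    moreover have "v $ k \<cdot>\<^sub>v col A k \<in> S"
      using Suc(2) v by (intro latticeD(3)[OF S] c) (auto simp: int_vecs_def)
    ultimately show ?case using latticeD(2)[OF S] Suc by simp
  qed
  from this[of r] have "vec m (\<lambda>i. \<Sum>j<r. A $$ (i,j) * v $ j) \<in> S" by simp
  moreover have "vec m (\<lambda>i. \<Sum>j<r. A $$ (i,j) * v $ j) = A *\<^sub>v v"
    using A v by (intro eq_vecI) (auto simp: int_vecs_def scalar_prod_def atLeast0LessThan intro!: sum.cong)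
  ultimately show ?thesis by simp
qed

lemma det_in_tO:
  assumes A: "A \<in> carrier_mat m m" and b: "\<And>i j. i < m \<Longrightarrow> j < m \<Longrightarrow> A $$ (i,j) \<in> tO b"
  shows "det A \<in> tO (int m * b)"
proof -
  have p: "(\<Prod>i\<in>F. f i) \<in> tO (int (card F) * b)" if "finite F" "\<And>i. i \<in> F \<Longrightarrow> f i \<in> tO b"
    for F :: "nat set" and f
    using that
  proof (induct F)
    case (insert x F)
    have "f x * prod f F \<in> tO (b + int (card F) * b)" by (intro tO_mult insert) (auto intro: insert)
    then show ?case using insert by (simp add: algebra_simps)
  qed auto
  have "signof p * (\<Prod>i = 0..<m. A $$ (i, p i)) \<in> tO (int m * b)" if "p permutes {0..<m}" for p
  proof -
    have "(\<Prod>i = 0..<m. A $$ (i, p i)) \<in> tO (int m * b)"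
      using p[of "{0..<m}" "\<lambda>i. A $$ (i, p i)"] b permutes_in_image[OF that] by auto
    then show ?thesis by (cases "sign p = 1") (auto simp: sign_def)
  qed
  then show ?thesis unfolding det_def'[OF A] by (auto intro: tO_sum)
qed

text \<open>A basis is a tuple of lattice vectors whose determinant has minimal order: by Cramer's
  rule the coordinates of any lattice vector are then quotients of determinants with integral
  value.\<close>

lemma lattice_basis:
  assumes S: "lattice m S"
  obtains \<phi> where "\<phi> \<in> carrier_mat m m" "det \<phi> \<noteq> 0" "lat \<phi> = S"
proof -
  define T where "T = {\<phi> \<in> carrier_mat m m. det \<phi> \<noteq> 0 \<and> (\<forall>j<m. col \<phi> j \<in> S)}"
  obtain b where b: "\<And>v l. v \<in> S \<Longrightarrow> l < m \<Longrightarrow> v $ l \<in> tO b" using latticeD(4)[OF S] by blast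
  obtain c where c: "\<And>v. v \<in> carrier_vec m \<Longrightarrow> (\<And>l. l < m \<Longrightarrow> v $ l \<in> tO c) \<Longrightarrow> v \<in> S"
    using latticeD(5)[OF S] by blast
  have "tpow c \<cdot>\<^sub>m 1\<^sub>m m \<in> T"
  proof -
    have "tpow c \<cdot>\<^sub>v unit_vec m j \<in> S" if "j < m" for j
      by (rule c) (auto simp: unit_vec_def)
    moreover have "col (tpow c \<cdot>\<^sub>m 1\<^sub>m m) j = tpow c \<cdot>\<^sub>v unit_vec m j" if "j < m" for j
      using that by (intro eq_vecI) (auto simp: unit_vec_def)
    ultimately show ?thesis unfolding T_def by (auto simp: det_smult)
  qed
  then obtain \<phi> where \<phi>: "\<phi> \<in> T"
    and min: "\<And>\<psi>. \<psi> \<in> T \<Longrightarrow> nat (fls_subdegree (det \<phi>) - int m * b) \<le> nat (fls_subdegree (det \<psi>) - int m * b)"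
    using ex_has_least_nat[of "\<lambda>\<phi>. \<phi> \<in> T" _ "\<lambda>\<phi>. nat (fls_subdegree (det \<phi>) - int m * b)"] by blast
  have ge: "int m * b \<le> fls_subdegree (det \<psi>)" if "\<psi> \<in> T" for \<psi>
  proof -
    have "\<psi> $$ (i,j) \<in> tO b" if "i < m" "j < m" for i j
      using b[of "col \<psi> j" i] \<open>\<psi> \<in> T\<close> that by (auto simp: T_def)
    then have "det \<psi> \<in> tO (int m * b)" using that by (intro det_in_tO) (auto simp: T_def)
    then show ?thesis using that by (auto simp: tO_iff_subdegree T_def)
  qed
  have min': "fls_subdegree (det \<phi>) \<le> fls_subdegree (det \<psi>)" if "\<psi> \<in> T" for \<psi>
    using min[OF that] ge[OF that] ge[OF \<phi>] by auto
  have cm: "\<phi> \<in> carrier_mat m m" and d: "det \<phi> \<noteq> 0" and cS: "\<And>j. j < m \<Longrightarrow> col \<phi> j \<in> S"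
    using \<phi> by (auto simp: T_def)
  have "lat \<phi> = S"
  proof
    show "lat \<phi> \<subseteq> S" unfolding lat_def using lattice_comb[OF S cm cS] cm by auto
    show "S \<subseteq> lat \<phi>"
    proof
      fix v assume v: "v \<in> S"
      have vc: "v \<in> carrier_vec m" using latticeD(1)[OF S v] .
      obtain \<psi> where \<psi>: "\<psi> \<in> carrier_mat m m" "\<phi> * \<psi> = 1\<^sub>m m" using mat_inverse_ex[OF cm d] by blast
      define x where "x = \<psi> *\<^sub>v v"
      have x: "x \<in> carrier_vec m" using \<psi> vc by (simp add: x_def)
      have xv: "\<phi> *\<^sub>v x = v" unfolding x_def using \<psi> vc cm
        by (metis assoc_mult_mat_vec one_mult_mat_vec)
      have "x $ k \<in> tO 0" if k: "k < m" for k
      proof (cases "x $ k = 0")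
        case False
        let ?A = "replace_col \<phi> v k"
        have dA: "det ?A = x $ k * det \<phi>" using cramer_lemma_mat[OF cm x k] xv by simp
        have "col ?A j \<in> S" if "j < m" for j
        proof (cases "j = k")
          case True
          have "col ?A j = v" using True k vc cm by (intro eq_vecI) (auto simp: replace_col_def)
          then show ?thesis using v by simp
        next
          case False
          have "col ?A j = col \<phi> j" using False that cm by (intro eq_vecI) (auto simp: replace_col_def)
          then show ?thesis using cS that by simp
        qed
        moreover have "?A \<in> carrier_mat m m" using cm by (auto simp: replace_col_def)
        ultimately have "?A \<in> T" using dA d False by (simp add: T_def)
        from min'[OF this] dA have "0 \<le> fls_subdegree (x $ k)" using d False by simp
        then show ?thesis by (simp add: tO_iff_subdegree)
      qed simp
      then have "x \<in> int_vecs m" using x by (simp add: int_vecs_def)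
      then show "v \<in> lat \<phi>" using xv cm by (auto simp: lat_def)
    qed
  qed
  then show ?thesis using that cm d by blast
qed

lemma lat_subset_carrier: "\<phi> \<in> carrier_mat m m \<Longrightarrow> v \<in> lat \<phi> \<Longrightarrow> v \<in> carrier_vec m"
  by (auto simp: lat_def int_vecs_def)

lemma mem_lat_iff:
  assumes "\<phi> \<in> carrier_mat m m" "\<psi> \<in> carrier_mat m m" "\<phi> * \<psi> = 1\<^sub>m m" "\<psi> * \<phi> = 1\<^sub>m m"
  shows "v \<in> lat \<phi> \<longleftrightarrow> v \<in> carrier_vec m \<and> \<psi> *\<^sub>v v \<in> int_vecs m"
proof
  assume "v \<in> lat \<phi>"
  then obtain x where x: "x \<in> int_vecs m" "v = \<phi> *\<^sub>v x" using assms by (auto simp: lat_def)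
  have "\<psi> *\<^sub>v v = (\<psi> * \<phi>) *\<^sub>v x"
    unfolding x(2) using x(1) assms(1,2) by (intro assoc_mult_mat_vec[symmetric]) (auto simp: int_vecs_def)
  then show "v \<in> carrier_vec m \<and> \<psi> *\<^sub>v v \<in> int_vecs m" using x assms by (auto simp: int_vecs_def)
next
  assume v: "v \<in> carrier_vec m \<and> \<psi> *\<^sub>v v \<in> int_vecs m"
  have "\<phi> *\<^sub>v (\<psi> *\<^sub>v v) = (\<phi> * \<psi>) *\<^sub>v v"
    using v assms(1,2) by (intro assoc_mult_mat_vec[symmetric]) auto
  then show "v \<in> lat \<phi>" unfolding lat_def using v assms
    by (intro image_eqI[of _ _ "\<psi> *\<^sub>v v"]) auto
qed

lemma latticeI:
  assumes "S \<subseteq> carrier_vec m" "\<And>u v. u \<in> S \<Longrightarrow> v \<in> S \<Longrightarrow> u + v \<in> S"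
    "\<And>c v. c \<in> tO 0 \<Longrightarrow> v \<in> S \<Longrightarrow> c \<cdot>\<^sub>v v \<in> S"
    "\<And>v l. v \<in> S \<Longrightarrow> l < m \<Longrightarrow> v $ l \<in> tO b"
    "\<And>v. v \<in> carrier_vec m \<Longrightarrow> (\<And>l. l < m \<Longrightarrow> v $ l \<in> tO c) \<Longrightarrow> v \<in> S"
  shows "lattice m S"
  using assms unfolding lattice_def by blast

lemma lattice_lat:
  assumes cm: "\<phi> \<in> carrier_mat m m" and d: "det \<phi> \<noteq> 0"
  shows "lattice m (lat \<phi>)"
proof -
  obtain \<psi> where \<psi>: "\<psi> \<in> carrier_mat m m" "\<phi> * \<psi> = 1\<^sub>m m" "\<psi> * \<phi> = 1\<^sub>m m"
    using mat_inverse_ex[OF cm d] .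
  note mem = mem_lat_iff[OF cm \<psi>]
  obtain b where b: "\<forall>x\<in>{..<m} \<times> {..<m}. \<phi> $$ x \<in> tO b" 
    using tO_exists_bound_finite[of "{..<m} \<times> {..<m}"] by (metis finite_cartesian_product finite_lessThan)
  obtain c where c: "\<forall>x\<in>{..<m} \<times> {..<m}. \<psi> $$ x \<in> tO c" 
    using tO_exists_bound_finite[of "{..<m} \<times> {..<m}"] by (metis finite_cartesian_product finite_lessThan)
  have "v $ l \<in> tO b" if "v \<in> lat \<phi>" "l < m" for v l
  proof -
    from that obtain x where x: "x \<in> int_vecs m" "v = \<phi> *\<^sub>v x" using cm by (auto simp: lat_def)
    show ?thesis using x that cm b tO_mult[of _ b _ 0]
      by (auto simp: scalar_prod_def int_vecs_def intro!: tO_sum)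
  qed
  moreover have "v \<in> lat \<phi>" if "v \<in> carrier_vec m" "\<forall>l<m. v $ l \<in> tO (- c)" for v
    unfolding mem using that \<psi> c tO_mult[of _ c _ "-c"]
    by (auto simp: scalar_prod_def int_vecs_def intro!: tO_sum)
  moreover have "u + v \<in> lat \<phi>" if "u \<in> lat \<phi>" "v \<in> lat \<phi>" for u v
    using that \<psi> unfolding mem
    by (auto simp: mult_add_distrib_mat_vec int_vecs_def simp del: index_mult_mat_vec intro: tO_add)
  moreover have "a \<cdot>\<^sub>v v \<in> lat \<phi>" if "a \<in> tO 0" "v \<in> lat \<phi>" for a v
    using that \<psi> unfolding mem
    by (auto simp: mult_mat_vec int_vecs_def simp del: index_mult_mat_vec intro: tO_scale)
  ultimately show ?thesis using lat_subset_carrier[OF cm] by (intro latticeI[of _ m b "- c"]) blast+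
qed

section \<open>Duality of lattices\<close>

text \<open>Functionals are identified with vectors through the scalar product, so that a dual is
  again a lattice in K^m and can be dualised and separated in turn.\<close>

definition dual :: "nat \<Rightarrow> complex fls vec set \<Rightarrow> complex fls vec set" where
  "dual m S = {\<beta> \<in> carrier_vec m. \<forall>s\<in>S. \<beta> \<bullet> s \<in> tO 0}"

lemma lattice_Int:
  assumes "lattice m S" "lattice m T"
  shows "lattice m (S \<inter> T)"
proof -
  obtain c where c: "\<forall>v\<in>carrier_vec m. (\<forall>l<m. v $ l \<in> tO c) \<longrightarrow> v \<in> S" using latticeD(5)[OF assms(1)] ..
  obtain d where d: "\<forall>v\<in>carrier_vec m. (\<forall>l<m. v $ l \<in> tO d) \<longrightarrow> v \<in> T" using latticeD(5)[OF assms(2)] ..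
  obtain b where b: "\<forall>v\<in>S. \<forall>l<m. v $ l \<in> tO b" using latticeD(4)[OF assms(1)] ..
  show ?thesis
  proof (rule latticeI)
    show "v $ l \<in> tO b" if "v \<in> S \<inter> T" "l < m" for v l using b that by blast
    show "v \<in> S \<inter> T" if "v \<in> carrier_vec m" "\<And>l. l < m \<Longrightarrow> v $ l \<in> tO (max c d)" for v
      using c d that by (meson IntI max.cobounded1 max.cobounded2 tO_mono)
  qed (use latticeD[OF assms(1)] latticeD[OF assms(2)] in auto)
qed

lemma lattice_sum:
  assumes S: "lattice m S" and T: "lattice m T"
  shows "lattice m {u + v | u v. u \<in> S \<and> v \<in> T}" (is "lattice m ?L")
proof -
  obtain c where c: "\<forall>v\<in>carrier_vec m. (\<forall>l<m. v $ l \<in> tO c) \<longrightarrow> v \<in> S" using latticeD(5)[OF S] ..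
  obtain b where b: "\<forall>v\<in>S. \<forall>l<m. v $ l \<in> tO b" using latticeD(4)[OF S] ..
  obtain d where d: "\<forall>v\<in>T. \<forall>l<m. v $ l \<in> tO d" using latticeD(4)[OF T] ..
  note cS = latticeD(1)[OF S] and cT = latticeD(1)[OF T]
  have "\<exists>b. \<forall>v\<in>?L. \<forall>l<m. v $ l \<in> tO b"
  proof (rule exI[of _ "min b d"], intro ballI allI impI)
    fix w l assume "w \<in> ?L" "l < m"
    then obtain u v where w: "w = u + v" "u \<in> S" "v \<in> T" by blast
    then have "u $ l \<in> tO b" "v $ l \<in> tO d" using b d \<open>l < m\<close> by auto
    then have "u $ l \<in> tO (min b d)" "v $ l \<in> tO (min b d)" by (auto elim: tO_mono)
    then show "w $ l \<in> tO (min b d)" using w cS[OF w(2)] cT[OF w(3)] \<open>l < m\<close> by (auto intro: tO_add)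
  qed
  moreover have "\<exists>c. \<forall>v\<in>carrier_vec m. (\<forall>l<m. v $ l \<in> tO c) \<longrightarrow> v \<in> ?L"
  proof (rule exI[of _ c], intro ballI impI)
    fix v assume v: "v \<in> carrier_vec m" "\<forall>l<m. v $ l \<in> tO c"
    have "v = v + 0\<^sub>v m" using v by simp
    then show "v \<in> ?L" using c v lattice_zero[OF T] by blast
  qed
  moreover have "w + w' \<in> ?L" if w: "w \<in> ?L" "w' \<in> ?L" for w w'
  proof -
    obtain u v where uv: "w = u + v" "u \<in> S" "v \<in> T" using w by blast
    obtain u' v' where uv': "w' = u' + v'" "u' \<in> S" "v' \<in> T" using w by blast
    have "u \<in> carrier_vec m" "u' \<in> carrier_vec m" "v \<in> carrier_vec m" "v' \<in> carrier_vec m"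
      using uv uv' cS cT by auto
    then have "w + w' = (u + u') + (v + v')" unfolding uv(1) uv'(1) by (intro eq_vecI) auto
    then show ?thesis using uv uv' latticeD(2)[OF S] latticeD(2)[OF T] by blast
  qed
  moreover have "a \<cdot>\<^sub>v w \<in> ?L" if a: "a \<in> tO 0" "w \<in> ?L" for a w
  proof -
    obtain u v where uv: "w = u + v" "u \<in> S" "v \<in> T" using a by blast
    have "a \<cdot>\<^sub>v w = a \<cdot>\<^sub>v u + a \<cdot>\<^sub>v v" using uv cS cT
      by (auto intro: smult_add_distrib_vec)
    then show ?thesis using a uv latticeD(3)[OF S] latticeD(3)[OF T] by blast
  qed
  moreover have "?L \<subseteq> carrier_vec m" using cS cT by auto
  ultimately show ?thesis unfolding lattice_def by blast
qed

lemma lattice_scale: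
  assumes S: "lattice m S"
  shows "lattice m {v \<in> carrier_vec m. tpow d \<cdot>\<^sub>v v \<in> S}" (is "lattice m ?L")
proof -
  obtain c where c: "\<forall>v\<in>carrier_vec m. (\<forall>l<m. v $ l \<in> tO c) \<longrightarrow> v \<in> S" using latticeD(5)[OF S] ..
  obtain b where b: "\<forall>v\<in>S. \<forall>l<m. v $ l \<in> tO b" using latticeD(4)[OF S] ..
  have "\<forall>v\<in>?L. \<forall>l<m. v $ l \<in> tO (b - d)"
  proof (intro ballI allI impI)
    fix v l assume v: "v \<in> ?L" and l: "l < m"
    then have "(tpow d \<cdot>\<^sub>v v) $ l \<in> tO b" using b by blast
    moreover have "v \<in> carrier_vec m" using v by simp
    ultimately show "v $ l \<in> tO (b - d)" using l by auto
  qed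
  moreover have "\<forall>v\<in>carrier_vec m. (\<forall>l<m. v $ l \<in> tO (c - d)) \<longrightarrow> v \<in> ?L"
    using c by (auto dest: carrier_vecD)
  moreover have "u + v \<in> ?L" if "u \<in> ?L" "v \<in> ?L" for u v
    using that latticeD(2)[OF S, of "tpow d \<cdot>\<^sub>v u" "tpow d \<cdot>\<^sub>v v"]
    by (simp add: smult_add_distrib_vec[of u m v])
  moreover have "a \<cdot>\<^sub>v v \<in> ?L" if "a \<in> tO 0" "v \<in> ?L" for a v
    using that latticeD(3)[OF S, of a "tpow d \<cdot>\<^sub>v v"]
    by (simp add: smult_smult_assoc mult.commute)
  ultimately show ?thesis by (intro latticeI[of _ m "b - d" "c - d"]) blast+
qed

lemma lattice_dual:
  assumes S: "lattice m S"
  shows "lattice m (dual m S)"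
proof -
  obtain c where c: "\<forall>v\<in>carrier_vec m. (\<forall>l<m. v $ l \<in> tO c) \<longrightarrow> v \<in> S" using latticeD(5)[OF S] ..
  obtain b where b: "\<forall>v\<in>S. \<forall>l<m. v $ l \<in> tO b" using latticeD(4)[OF S] ..
  note cS = latticeD(1)[OF S]
  have "\<beta> $ l \<in> tO (- c)" if "\<beta> \<in> dual m S" "l < m" for \<beta> l
  proof -
    have "tpow c \<cdot>\<^sub>v unit_vec m l \<in> S" using c by (auto simp: unit_vec_def)
    then have "\<beta> \<bullet> (tpow c \<cdot>\<^sub>v unit_vec m l) \<in> tO 0" using that by (auto simp: dual_def)
    moreover have "\<beta> \<bullet> (tpow c \<cdot>\<^sub>v unit_vec m l) = tpow c * \<beta> $ l"
      using that by (simp add: dual_def scalar_prod_smult_distrib[of \<beta> m])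
    ultimately show ?thesis by simp
  qed
  moreover have "\<beta> \<in> dual m S" if "\<beta> \<in> carrier_vec m" "\<forall>l<m. \<beta> $ l \<in> tO (- b)" for \<beta>
  proof -
    have "\<beta> \<bullet> s \<in> tO 0" if "s \<in> S" for s
      unfolding scalar_prod_def using that \<open>\<forall>l<m. \<beta> $ l \<in> tO (- b)\<close> b cS[OF that] tO_mult[of _ "-b" _ b]
      by (auto intro!: tO_sum)
    then show ?thesis using that by (simp add: dual_def)
  qed
  moreover have "\<beta> + \<gamma> \<in> dual m S" if "\<beta> \<in> dual m S" "\<gamma> \<in> dual m S" for \<beta> \<gamma>
    using that cS by (auto simp: dual_def add_scalar_prod_distrib[of _ m] intro: tO_add)
  moreover have "a \<cdot>\<^sub>v \<beta> \<in> dual m S" if "a \<in> tO 0" "\<beta> \<in> dual m S" for a \<beta>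
    using that cS by (auto simp: dual_def smult_scalar_prod_distrib[of _ m] intro!: tO_scale)
  moreover have "dual m S \<subseteq> carrier_vec m" by (auto simp: dual_def)
  ultimately show ?thesis by (intro latticeI[of _ m "- c" "- b"]) blast+
qed

text \<open>The rows of the inverse of a basis matrix form the dual basis, and a vector outside the
  lattice has a non-integral coordinate with respect to the basis.\<close>

lemma lattice_separation:
  assumes S: "lattice m S" and v: "v \<in> carrier_vec m" "v \<notin> S"
  obtains \<beta> where "\<beta> \<in> dual m S" "\<beta> \<bullet> v \<notin> tO 0"
proof -
  obtain \<phi> where \<phi>: "\<phi> \<in> carrier_mat m m" "det \<phi> \<noteq> 0" "lat \<phi> = S" using lattice_basis[OF S] .
  obtain \<psi> where \<psi>: "\<psi> \<in> carrier_mat m m" "\<phi> * \<psi> = 1\<^sub>m m" "\<psi> * \<phi> = 1\<^sub>m m"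
    using mat_inverse_ex[OF \<phi>(1,2)] .
  note mem = mem_lat_iff[OF \<phi>(1) \<psi>, unfolded \<phi>(3)]
  obtain j where j: "j < m" "(\<psi> *\<^sub>v v) $ j \<notin> tO 0"
    using v mem \<psi> by (auto simp: int_vecs_def simp del: index_mult_mat_vec)
  show ?thesis
  proof (rule that)
    show "row \<psi> j \<bullet> v \<notin> tO 0" using j \<psi> by auto
    show "row \<psi> j \<in> dual m S" unfolding dual_def using mem \<psi> j by (auto simp: int_vecs_def)
  qed
qed

text \<open>Biduality: a vector \<open>s\<close> that separates \<eta> from the sum of the duals is
  integral on both duals, so a second separation forces \<open>s\<close> into S and T, where \<eta>
  is integral.\<close>

lemma dual_Int:
  assumes S: "lattice m S" and T: "lattice m T" and \<eta>: "\<eta> \<in> dual m (S \<inter> T)"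
  obtains \<beta> \<gamma> where "\<beta> \<in> dual m S" "\<gamma> \<in> dual m T" "\<eta> = \<beta> + \<gamma>"
proof -
  let ?D = "{u + v | u v. u \<in> dual m S \<and> v \<in> dual m T}"
  note dS = lattice_dual[OF S] and dT = lattice_dual[OF T]
  have D: "lattice m ?D" by (rule lattice_sum[OF dS dT])
  have "\<eta> \<in> ?D"
  proof (rule ccontr)
    assume nD: "\<eta> \<notin> ?D"
    have "\<eta> \<in> carrier_vec m" using \<eta> by (simp add: dual_def)
    from lattice_separation[OF D this nD] obtain s where s: "s \<in> dual m ?D" "s \<bullet> \<eta> \<notin> tO 0" .
    have sc: "s \<in> carrier_vec m" using s by (simp add: dual_def)
    have "s \<in> S"
    proof (rule ccontr)
      assume "s \<notin> S"
      then obtain \<beta> where \<beta>: "\<beta> \<in> dual m S" "\<beta> \<bullet> s \<notin> tO 0" using lattice_separation[OF S sc] by blast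
      have "\<beta> = \<beta> + 0\<^sub>v m" using \<beta> by (simp add: dual_def)
      then have "\<beta> \<in> ?D" using \<beta> lattice_zero[OF dT] by blast
      then have "s \<bullet> \<beta> \<in> tO 0" using s by (simp add: dual_def)
      then show False using \<beta> sc by (simp add: dual_def comm_scalar_prod[of s m \<beta>])
    qed
    moreover have "s \<in> T"
    proof (rule ccontr)
      assume "s \<notin> T"
      then obtain \<beta> where \<beta>: "\<beta> \<in> dual m T" "\<beta> \<bullet> s \<notin> tO 0" using lattice_separation[OF T sc] by blast
      have "\<beta> = 0\<^sub>v m + \<beta>" using \<beta> by (simp add: dual_def)
      then have "\<beta> \<in> ?D" using \<beta> lattice_zero[OF dS] by blast
      then have "s \<bullet> \<beta> \<in> tO 0" using s by (simp add: dual_def)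
      then show False using \<beta> sc by (simp add: dual_def comm_scalar_prod[of s m \<beta>])
    qed
    ultimately show False using s \<eta> sc by (auto simp: dual_def comm_scalar_prod[of s m \<eta>])
  qed
  then show ?thesis using that by blast
qed

lemma dual_Int3:
  assumes S: "lattice m S1" "lattice m S2" "lattice m S3" and \<eta>: "\<eta> \<in> dual m (S1 \<inter> S2 \<inter> S3)"
  obtains \<beta>1 \<beta>2 \<beta>3 where "\<beta>1 \<in> dual m S1" "\<beta>2 \<in> dual m S2" "\<beta>3 \<in> dual m S3" "\<eta> = \<beta>1 + \<beta>2 + \<beta>3"
proof -
  obtain \<gamma> \<beta>3 where 1: "\<gamma> \<in> dual m (S1 \<inter> S2)" "\<beta>3 \<in> dual m S3" "\<eta> = \<gamma> + \<beta>3"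
    using dual_Int[OF lattice_Int[OF S(1,2)] S(3) \<eta>] .
  obtain \<beta>1 \<beta>2 where "\<beta>1 \<in> dual m S1" "\<beta>2 \<in> dual m S2" "\<gamma> = \<beta>1 + \<beta>2"
    using dual_Int[OF S(1,2) 1(1)] .
  then show ?thesis using that 1 by blast
qed

text \<open>A theorem of the alternative. The hypothesis places \<delta> outside the lattice spanned
  by \<open>S1 \<inter> S2\<close> and \<open>S3\<close>. A functional separating it from that
  lattice is \<beta>3, and the negative of this functional splits over \<open>S1\<close> and
  \<open>S2\<close>.\<close>

lemma three_lattices_alternative:
  assumes S: "lattice m S1" "lattice m S2" "lattice m S3" and \<delta>: "\<delta> \<in> carrier_vec m"
    and no: "\<And>s. s \<in> S1 \<Longrightarrow> s \<in> S2 \<Longrightarrow> s + \<delta> \<notin> S3"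
  obtains \<beta>1 \<beta>2 \<beta>3 where "\<beta>1 \<in> dual m S1" "\<beta>2 \<in> dual m S2" "\<beta>3 \<in> dual m S3"
    "\<beta>1 + \<beta>2 + \<beta>3 = 0\<^sub>v m" "\<beta>3 \<bullet> \<delta> \<notin> tO 0"
proof -
  note I = lattice_Int[OF S(1,2)]
  let ?L = "{u + v | u v. u \<in> S1 \<inter> S2 \<and> v \<in> S3}"
  have L: "lattice m ?L" by (rule lattice_sum[OF I S(3)])
  have nL: "\<delta> \<notin> ?L"
  proof
    assume "\<delta> \<in> ?L"
    then obtain u v where uv: "u \<in> S1 \<inter> S2" "v \<in> S3" "\<delta> = u + v" by blast
    have uc: "u \<in> carrier_vec m" "v \<in> carrier_vec m" using uv latticeD(1)[OF S(1)] latticeD(1)[OF S(3)] by auto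
    have "(-1) \<cdot>\<^sub>v u \<in> S1 \<inter> S2" using uv by (intro latticeD(3)[OF I]) (auto intro: tO_uminus)
    moreover have "(-1) \<cdot>\<^sub>v u + \<delta> = v" unfolding uv(3) using uc by (intro eq_vecI) auto
    ultimately show False using no uv by (metis IntD1 IntD2)
  qed
  from lattice_separation[OF L \<delta> nL] obtain \<beta> where \<beta>: "\<beta> \<in> dual m ?L" "\<beta> \<bullet> \<delta> \<notin> tO 0" .
  have \<beta>c: "\<beta> \<in> carrier_vec m" using \<beta> by (simp add: dual_def)
  have "\<beta> \<bullet> v \<in> tO 0" if "v \<in> S3" for v
  proof -
    have "v = 0\<^sub>v m + v" using latticeD(1)[OF S(3) that] by simp
    then have "v \<in> ?L" using that lattice_zero[OF I] by blast
    then show ?thesis using \<beta> by (simp add: dual_def)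
  qed
  then have b3: "\<beta> \<in> dual m S3" using \<beta>c by (simp add: dual_def)
  have "\<beta> \<bullet> v \<in> tO 0" if "v \<in> S1 \<inter> S2" for v
  proof -
    have "v = v + 0\<^sub>v m" using latticeD(1)[OF I that] by simp
    then have "v \<in> ?L" using that lattice_zero[OF S(3)] by blast
    then show ?thesis using \<beta> by (simp add: dual_def)
  qed
  then have "\<beta> \<in> dual m (S1 \<inter> S2)" using \<beta>c by (simp add: dual_def)
  then have "(-1) \<cdot>\<^sub>v \<beta> \<in> dual m (S1 \<inter> S2)"
    by (intro latticeD(3)[OF lattice_dual[OF I]]) auto
  then obtain \<beta>1 \<beta>2 where b: "\<beta>1 \<in> dual m S1" "\<beta>2 \<in> dual m S2" "(-1) \<cdot>\<^sub>v \<beta> = \<beta>1 + \<beta>2"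
    using dual_Int[OF S(1,2)] by blast
  have "\<beta>1 + \<beta>2 + \<beta> = 0\<^sub>v m" unfolding b(3)[symmetric] using \<beta>c by (intro eq_vecI) auto
  then show ?thesis using that b b3 \<beta> by blast
qed

section \<open>Matrices over power series and over Laurent series\<close>

interpretation fps_fls: comm_ring_hom "fps_to_fls :: complex fps \<Rightarrow> complex fls"
  by unfold_locales (auto simp: fps_to_fls_plus fls_times_fps_to_fls)

abbreviation toK :: "complex fps mat \<Rightarrow> complex fls mat" where
  "toK \<equiv> map_mat fps_to_fls"

lemma toK_mult:
  "A \<in> carrier_mat r m \<Longrightarrow> B \<in> carrier_mat m c \<Longrightarrow> toK (A * B) = toK A * toK B"
  by (rule fps_fls.mat_hom_mult)

lemma toK_one [simp]: "toK (1\<^sub>m m) = 1\<^sub>m m"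
  by (rule fps_fls.mat_hom_one)

lemma toK_X: "toK (fps_X \<cdot>\<^sub>m 1\<^sub>m m) = tpow 1 \<cdot>\<^sub>m 1\<^sub>m m"
  by (intro eq_matI) (auto simp: tpow_1 fps_X_to_fls)

lemma toK_inj: "toK A = toK B \<Longrightarrow> A = B"
proof -
  assume h: "toK A = toK B"
  then have "dim_row A = dim_row B" "dim_col A = dim_col B"
    by (metis index_map_mat(2), metis index_map_mat(3))
  moreover have "A $$ (i,j) = B $$ (i,j)" if "i < dim_row B" "j < dim_col B" for i j
    using arg_cong[OF h, of "\<lambda>M. M $$ (i,j)"] that calculation by auto
  ultimately show ?thesis by (intro eq_matI) auto
qed

lemma one_smult_mat: "(1 :: 'a :: comm_ring_1) \<cdot>\<^sub>m A = A"
  by (intro eq_matI) auto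

lemma mult_scalar_mat:
  fixes A :: "'a :: comm_ring_1 mat"
  assumes "A \<in> carrier_mat r m"
  shows "A * (c \<cdot>\<^sub>m 1\<^sub>m m) = c \<cdot>\<^sub>m A"
  using mult_smult_distrib[OF assms one_carrier_mat, of c] assms by simp

lemma mat_right_cancel:
  fixes P :: "'a :: field mat"
  assumes "A \<in> carrier_mat r m" "B \<in> carrier_mat r m" "P \<in> carrier_mat m m" "det P \<noteq> 0" "A * P = B * P"
  shows "A = B"
proof -
  obtain Q where Q: "Q \<in> carrier_mat m m" "P * Q = 1\<^sub>m m" using mat_inverse_ex[OF assms(3,4)] .
  have "A = A * (P * Q)" using assms Q by simp
  also have "\<dots> = (A * P) * Q" using assoc_mult_mat[OF assms(1,3) Q(1)] by simp
  also have "\<dots> = B * (P * Q)" unfolding assms(5) using assoc_mult_mat[OF assms(2,3) Q(1)] by simp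
  finally show ?thesis unfolding Q(2) right_mult_one_mat[OF assms(2)] .
qed

lemma mat_left_cancel:
  fixes P :: "'a :: field mat"
  assumes "A \<in> carrier_mat m r" "B \<in> carrier_mat m r" "P \<in> carrier_mat m m" "det P \<noteq> 0" "P * A = P * B"
  shows "A = B"
proof -
  obtain Q where Q: "Q \<in> carrier_mat m m" "Q * P = 1\<^sub>m m" using mat_inverse_ex[OF assms(3,4)] .
  have "A = (Q * P) * A" using assms Q by simp
  also have "\<dots> = Q * (P * A)" using assoc_mult_mat[OF Q(1) assms(3,1)] by simp
  also have "\<dots> = (Q * P) * B" unfolding assms(5) using assoc_mult_mat[OF Q(1) assms(3,2)] by simp
  finally show ?thesis unfolding Q(2) left_mult_one_mat[OF assms(2)] .
qed

text \<open>The usual way to verify an identity over O below: multiply by a basis matrix over K,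
  where the structure maps turn into inclusions and powers of t, and cancel it.\<close>

lemma toK_left_cancel:
  assumes "A \<in> carrier_mat m r" "B \<in> carrier_mat m r" "P \<in> carrier_mat m m" "det P \<noteq> 0" "P * toK A = P * toK B"
  shows "A = B"
  by (rule toK_inj, rule mat_left_cancel[OF _ _ assms(3-5)]) (use assms in auto)

lemma integral_mat:
  assumes "A \<in> carrier_mat r c" "\<And>i j. i < r \<Longrightarrow> j < c \<Longrightarrow> A $$ (i,j) \<in> tO 0"
  obtains B where "B \<in> carrier_mat r c" "toK B = A"
proof -
  have "fps_to_fls (fls_regpart (A $$ (i,j))) = A $$ (i,j)" if "i < r" "j < c" for i j
    using assms(2)[OF that] by (auto simp: tO_0_iff_fps)
  then have "toK (map_mat fls_regpart A) = A" using assms(1) by (intro eq_matI) auto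
  then show ?thesis using that assms(1) by (metis map_carrier_mat)
qed

lemma lat_factor:
  assumes \<phi>: "\<phi> \<in> carrier_mat m m" "det \<phi> \<noteq> 0" and A: "A \<in> carrier_mat m r"
    and c: "\<And>j. j < r \<Longrightarrow> col A j \<in> lat \<phi>"
  obtains B where "B \<in> carrier_mat m r" "\<phi> * toK B = A"
proof -
  obtain \<psi> where \<psi>: "\<psi> \<in> carrier_mat m m" "\<phi> * \<psi> = 1\<^sub>m m" "\<psi> * \<phi> = 1\<^sub>m m" using mat_inverse_ex[OF \<phi>] .
  note mem = mem_lat_iff[OF \<phi>(1) \<psi>]
  have "(\<psi> * A) $$ (i,j) \<in> tO 0" if "i < m" "j < r" for i j
    using c[OF that(2)] mem \<psi> A that by (auto simp: int_vecs_def)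
  then obtain B where B: "B \<in> carrier_mat m r" "toK B = \<psi> * A"
    using integral_mat[of "\<psi> * A" m r] \<psi> A by auto
  have "\<phi> * toK B = (\<phi> * \<psi>) * A" unfolding B by (rule assoc_mult_mat[OF \<phi>(1) \<psi>(1) A, symmetric])
  then show ?thesis using that B \<psi> A by simp
qed

lemma lat_mult_subset:
  assumes "\<phi> \<in> carrier_mat m m" "B \<in> carrier_mat m r" "x \<in> int_vecs r"
  shows "(\<phi> * toK B) *\<^sub>v x \<in> lat \<phi>"
proof -
  have "toK B *\<^sub>v x \<in> int_vecs m"
    using assms tO_mult[of _ 0 _ 0] by (auto simp: int_vecs_def scalar_prod_def intro!: tO_sum)
  moreover have "(\<phi> * toK B) *\<^sub>v x = \<phi> *\<^sub>v (toK B *\<^sub>v x)"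
    using assms by (intro assoc_mult_mat_vec) (auto simp: int_vecs_def)
  ultimately show ?thesis using assms by (auto simp: lat_def)
qed

lemma col_in_lat:
  assumes "\<phi> \<in> carrier_mat m m" "j < m"
  shows "col \<phi> j \<in> lat \<phi>"
proof -
  have "\<phi> *\<^sub>v unit_vec m j = col \<phi> j" using assms by (intro eq_vecI) auto
  moreover have "unit_vec m j \<in> int_vecs m" by (auto simp: int_vecs_def unit_vec_def)
  ultimately show ?thesis using assms by (force simp: lat_def)
qed

section \<open>Presentations of modules by lattices\<close>

text \<open>The columns of \<open>\<phi> i\<close> are the images in K^m of the basis of the module
  at vertex i. The equations say that x becomes an inclusion and y multiplication by t. The index
  runs over the universal cover, and going round the quiver once multiplies by a power of t
  (\<open>presents_shift\<close>).\<close>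

definition presents :: "nat \<Rightarrow> nat \<Rightarrow> cyc_rep \<Rightarrow> (int \<Rightarrow> complex fls mat) \<Rightarrow> bool" where
  "presents k n M \<phi> \<longleftrightarrow> CM k n M \<and>
     (\<forall>i. \<phi> i \<in> carrier_mat (rk M) (rk M) \<and> det (\<phi> i) \<noteq> 0 \<and>
          \<phi> i * toK (xmap M i) = \<phi> (i - 1) \<and> \<phi> (i - 1) * toK (ymap M i) = tpow 1 \<cdot>\<^sub>m \<phi> i)"

lemma CM_D:
  assumes "CM k n M"
  shows "xmap M i \<in> carrier_mat (rk M) (rk M)" "ymap M i \<in> carrier_mat (rk M) (rk M)"
    "xmap M (i + int n) = xmap M i" "ymap M (i + int n) = ymap M i"
    "xmap M i * ymap M i = fps_X \<cdot>\<^sub>m 1\<^sub>m (rk M)" "ymap M i * xmap M i = fps_X \<cdot>\<^sub>m 1\<^sub>m (rk M)"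
    "xpath M i k = ypath M i (n - k)"
proof -
  have "ymap M ((i - 1) + 1) * xmap M ((i - 1) + 1) = fps_X \<cdot>\<^sub>m 1\<^sub>m (rk M)"
    using assms unfolding CM_def by metis
  then show "ymap M i * xmap M i = fps_X \<cdot>\<^sub>m 1\<^sub>m (rk M)" by simp
qed (use assms in \<open>auto simp: CM_def\<close>)

lemma path_carrier:
  assumes "\<And>i. xmap M i \<in> carrier_mat (rk M) (rk M)" "\<And>i. ymap M i \<in> carrier_mat (rk M) (rk M)"
  shows "xpath M i l \<in> carrier_mat (rk M) (rk M)" "ypath M i l \<in> carrier_mat (rk M) (rk M)"
  using assms by (induct l) (auto intro: mult_carrier_mat)

lemma path_relations:
  assumes c: "\<And>i. xmap M i \<in> carrier_mat (rk M) (rk M)" "\<And>i. ymap M i \<in> carrier_mat (rk M) (rk M)"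
    and \<phi>: "\<And>i. \<phi> i \<in> carrier_mat (rk M) (rk M)" "\<And>i. \<phi> i * toK (xmap M i) = \<phi> (i - 1)"
      "\<And>i. \<phi> (i - 1) * toK (ymap M i) = tpow 1 \<cdot>\<^sub>m \<phi> i"
  shows "\<phi> (i + int l) * toK (xpath M i l) = \<phi> i"
    and "\<phi> (i - int l) * toK (ypath M i l) = tpow (int l) \<cdot>\<^sub>m \<phi> i"
proof -
  note pc = path_carrier[OF c]
  show "\<phi> (i + int l) * toK (xpath M i l) = \<phi> i"
  proof (induct l)
    case 0 then show ?case using \<phi>(1)[of i] by simp
  next
    case (Suc l)
    have e: "i + int (Suc l) = i + int l + 1" by simp
    have "\<phi> (i + int (Suc l)) * toK (xpath M i (Suc l))
      = (\<phi> (i + int l + 1) * toK (xmap M (i + int l + 1))) * toK (xpath M i l)"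
      unfolding e xpath.simps toK_mult[OF c(1) pc(1)] using c pc \<phi>(1)
      by (intro assoc_mult_mat[of _ "rk M" "rk M" _ "rk M" _ "rk M", symmetric]) auto
    then show ?case unfolding \<phi>(2) using Suc by simp
  qed
  show "\<phi> (i - int l) * toK (ypath M i l) = tpow (int l) \<cdot>\<^sub>m \<phi> i"
  proof (induct l)
    case 0 then show ?case using \<phi>(1)[of i] by (simp add: one_smult_mat)
  next
    case (Suc l)
    have e: "i - int (Suc l) = i - int l - 1" by simp
    have "\<phi> (i - int (Suc l)) * toK (ypath M i (Suc l))
      = (\<phi> (i - int l - 1) * toK (ymap M (i - int l))) * toK (ypath M i l)"
      unfolding e ypath.simps toK_mult[OF c(2) pc(2)] using c pc \<phi>(1)
      by (intro assoc_mult_mat[of _ "rk M" "rk M" _ "rk M" _ "rk M", symmetric]) auto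
    also have "\<dots> = tpow 1 \<cdot>\<^sub>m (\<phi> (i - int l) * toK (ypath M i l))"
      unfolding \<phi>(3) using \<phi>(1) pc by (intro mult_smult_assoc_mat[of _ "rk M" "rk M" _ "rk M"]) (auto intro!: mult_carrier_mat[of _ "rk M" "rk M" _ "rk M"])
    also have "\<dots> = tpow (int (Suc l)) \<cdot>\<^sub>m \<phi> i" unfolding Suc
      by (intro eq_matI) (auto simp: tpow_add mult.assoc[symmetric])
    finally show ?case .
  qed
qed

lemma presentsD:
  assumes "presents k n M \<phi>"
  shows "CM k n M" "\<phi> i \<in> carrier_mat (rk M) (rk M)" "det (\<phi> i) \<noteq> 0"
    "\<phi> i * toK (xmap M i) = \<phi> (i - 1)" "\<phi> (i - 1) * toK (ymap M i) = tpow 1 \<cdot>\<^sub>m \<phi> i"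
    "xmap M i \<in> carrier_mat (rk M) (rk M)" "ymap M i \<in> carrier_mat (rk M) (rk M)"
  using assms CM_D(1,2) unfolding presents_def by blast+

lemma det_toK_xmap:
  assumes "CM k n M"
  shows "det (toK (xmap M i)) \<noteq> 0" "det (toK (ymap M i)) \<noteq> 0"
proof -
  have "toK (xmap M i) * toK (ymap M i) = tpow 1 \<cdot>\<^sub>m 1\<^sub>m (rk M)"
    using toK_mult[OF CM_D(1,2)[OF assms]] CM_D(5)[OF assms] toK_X by metis
  then have "det (toK (xmap M i)) * det (toK (ymap M i)) = tpow 1 ^ rk M"
    using det_mult[of "toK (xmap M i)" "rk M" "toK (ymap M i)"] CM_D(1,2)[OF assms]
    by (simp add: det_smult)
  then show "det (toK (xmap M i)) \<noteq> 0" "det (toK (ymap M i)) \<noteq> 0" by auto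
qed

lemma presents_exists:
  assumes M: "CM k n M"
  obtains \<phi> where "presents k n M \<phi>"
proof -
  let ?m = "rk M"
  \<comment> \<open>Both equations are solved outwards from the identity at vertex 0: to the right
    with t^-1 y, to the left with x, which are invertible over K.\<close>
  define up where "up = rec_nat (1\<^sub>m ?m) (\<lambda>l A. tpow (-1) \<cdot>\<^sub>m (A * toK (ymap M (int l + 1))))"
  define dn where "dn = rec_nat (1\<^sub>m ?m) (\<lambda>l A. A * toK (xmap M (- int l)))"
  have up: "up 0 = 1\<^sub>m ?m" "\<And>l. up (Suc l) = tpow (-1) \<cdot>\<^sub>m (up l * toK (ymap M (int l + 1)))"
    by (simp_all add: up_def)
  have dn: "dn 0 = 1\<^sub>m ?m" "\<And>l. dn (Suc l) = dn l * toK (xmap M (- int l))"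
    by (simp_all add: dn_def)
  note X = CM_D(1)[OF M] and Y = CM_D(2)[OF M]
  have upc: "up l \<in> carrier_mat ?m ?m" "det (up l) \<noteq> 0" for l
  proof (induct l)
    case (Suc l)
    show "up (Suc l) \<in> carrier_mat ?m ?m" unfolding up using Suc Y by auto
    have "det (up l * toK (ymap M (int l + 1))) \<noteq> 0"
      using det_mult[of "up l" ?m "toK (ymap M (int l + 1))"] Suc Y det_toK_xmap[OF M] by simp
    then show "det (up (Suc l)) \<noteq> 0" unfolding up by (simp add: det_smult)
  qed (auto simp: up)
  have dnc: "dn l \<in> carrier_mat ?m ?m" "det (dn l) \<noteq> 0" for l
  proof (induct l)
    case (Suc l)
    show "dn (Suc l) \<in> carrier_mat ?m ?m" unfolding dn using Suc X by auto
    show "det (dn (Suc l)) \<noteq> 0" unfolding dn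
      using det_mult[of "dn l" ?m "toK (xmap M (- int l))"] Suc X det_toK_xmap[OF M] by simp
  qed (auto simp: dn)
  define \<phi> where "\<phi> i = (if 0 \<le> i then up (nat i) else dn (nat (- i)))" for i
  have \<phi>c: "\<phi> i \<in> carrier_mat ?m ?m" "det (\<phi> i) \<noteq> 0" for i
    unfolding \<phi>_def using upc dnc by auto
  have \<phi>x: "\<phi> i * toK (xmap M i) = \<phi> (i - 1)" for i
  proof (cases "0 < i")
    case True
    then have l: "i = int (nat (i - 1)) + 1" by simp
    define l where "l = nat (i - 1)"
    have l: "i = int l + 1" using l by (simp add: l_def)
    have yx: "toK (ymap M i) * toK (xmap M i) = tpow 1 \<cdot>\<^sub>m 1\<^sub>m ?m"
      using toK_mult[OF Y X] CM_D(6)[OF M] toK_X by metis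
    have ni: "nat i = Suc l" "nat (i - 1) = l" using l by auto
    have "\<phi> i * toK (xmap M i) = tpow (-1) \<cdot>\<^sub>m (up l * toK (ymap M i)) * toK (xmap M i)"
      using True ni l by (simp add: \<phi>_def up)
    also have "\<dots> = tpow (-1) \<cdot>\<^sub>m (up l * toK (ymap M i) * toK (xmap M i))"
      using upc X Y by (intro mult_smult_assoc_mat[of _ "rk M" "rk M" _ "rk M"]) (auto intro!: mult_carrier_mat[of _ "rk M" "rk M" _ "rk M"])
    also have "up l * toK (ymap M i) * toK (xmap M i) = up l * (toK (ymap M i) * toK (xmap M i))"
      using upc X Y by (intro assoc_mult_mat[of _ "rk M" "rk M" _ "rk M" _ "rk M"]) auto
    also have "\<dots> = tpow 1 \<cdot>\<^sub>m up l" unfolding yx by (rule mult_scalar_mat[OF upc(1)])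
    also have "tpow (-1) \<cdot>\<^sub>m (tpow 1 \<cdot>\<^sub>m up l) = up l" by (intro eq_matI) auto
    finally show ?thesis using True ni by (simp add: \<phi>_def)
  next
    case False
    have e: "nat (- (i - 1)) = Suc (nat (- i))" "- int (nat (- i)) = i" using False by auto
    have "\<phi> i = dn (nat (- i))" using False up dn by (cases "i = 0") (auto simp: \<phi>_def)
    moreover have "\<phi> (i - 1) = dn (Suc (nat (- i)))" unfolding \<phi>_def e(1)[symmetric] using False by simp
    ultimately show ?thesis unfolding dn e(2) by simp
  qed
  have \<phi>y: "\<phi> (i - 1) * toK (ymap M i) = tpow 1 \<cdot>\<^sub>m \<phi> i" for i
  proof -
    have xy: "toK (xmap M i) * toK (ymap M i) = tpow 1 \<cdot>\<^sub>m 1\<^sub>m ?m"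
      using toK_mult[OF X Y] CM_D(5)[OF M] toK_X by metis
    have "\<phi> (i - 1) * toK (ymap M i) = \<phi> i * (toK (xmap M i) * toK (ymap M i))"
      unfolding \<phi>x[symmetric] using X Y \<phi>c by (intro assoc_mult_mat[of _ "rk M" "rk M" _ "rk M" _ "rk M"]) auto
    then show ?thesis unfolding xy using mult_scalar_mat[OF \<phi>c(1)] by simp
  qed
  show ?thesis using that[of \<phi>] M \<phi>c \<phi>x \<phi>y by (auto simp: presents_def)
qed

text \<open>This is the relation between x^k and y^(n-k), read in K^m: the two paths from
  \<open>j\<close> = i + n - k end at the lifts i + n and i of one vertex, and there they are the
  identity and multiplication by t^(n-k).\<close>

lemma presents_shift:
  assumes P: "presents k n M \<phi>" and kn: "k \<le> n"
  shows "\<phi> i = tpow (int n - int k) \<cdot>\<^sub>m \<phi> (i + int n)"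
proof -
  note D = presentsD[OF P]
  note rel = path_relations[OF D(6) D(7) D(2) D(4) D(5)]
  define j where "j = i + int (n - k)"
  have ij: "i = j - int (n - k)" "j + int k = i + int n" using kn by (auto simp: j_def)
  let ?P = "toK (xpath M j k)"
  have Pc: "?P \<in> carrier_mat (rk M) (rk M)" using path_carrier[OF D(6) D(7)] by auto
  have 1: "\<phi> (i + int n) * ?P = \<phi> j" unfolding ij(2)[symmetric] by (rule rel(1))
  have 2: "\<phi> i * ?P = tpow (int (n - k)) \<cdot>\<^sub>m \<phi> j" 
    unfolding ij(1) CM_D(7)[OF D(1)] by (rule rel(2))
  have "det (\<phi> (i + int n)) * det ?P = det (\<phi> j)" using det_mult[OF D(2) Pc] 1 by metis
  then have dP: "det ?P \<noteq> 0" using D(3)[of j] by auto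
  show ?thesis
  proof (rule mat_right_cancel[OF D(2) _ Pc dP])
    show "tpow (int n - int k) \<cdot>\<^sub>m \<phi> (i + int n) \<in> carrier_mat (rk M) (rk M)" using D(2) by auto
    have "tpow (int n - int k) \<cdot>\<^sub>m \<phi> (i + int n) * ?P = tpow (int n - int k) \<cdot>\<^sub>m \<phi> j"
      unfolding 1[symmetric] using D(2) Pc by (intro mult_smult_assoc_mat[of _ "rk M" "rk M" _ "rk M"]) (auto intro: mult_carrier_mat)
    then show "\<phi> i * ?P = tpow (int n - int k) \<cdot>\<^sub>m \<phi> (i + int n) * ?P" using 2 kn by (simp add: of_nat_diff)
  qed
qed

section \<open>Periodic chains of lattices and the modules they define\<close>

definition lat_family :: "nat \<Rightarrow> nat \<Rightarrow> nat \<Rightarrow> (int \<Rightarrow> complex fls vec set) \<Rightarrow> bool" where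
  "lat_family k n m \<Lambda> \<longleftrightarrow> (\<forall>i. lattice m (\<Lambda> i) \<and> \<Lambda> (i - 1) \<subseteq> \<Lambda> i \<and>
     (\<forall>v\<in>\<Lambda> i. tpow 1 \<cdot>\<^sub>v v \<in> \<Lambda> (i - 1)) \<and>
     (\<forall>v\<in>carrier_vec m. v \<in> \<Lambda> (i + int n) \<longleftrightarrow> tpow (int n - int k) \<cdot>\<^sub>v v \<in> \<Lambda> i))"

text \<open>Equality of chains rather than isomorphism: the coordinates of K^m belong to the data,
  and \<open>models_change\<close> is the means to change them.\<close>

definition models :: "nat \<Rightarrow> nat \<Rightarrow> cyc_rep \<Rightarrow> nat \<Rightarrow> (int \<Rightarrow> complex fls vec set) \<Rightarrow> bool" where
  "models k n M m \<Lambda> \<longleftrightarrow> rk M = m \<and> (\<exists>\<phi>. presents k n M \<phi> \<and> (\<forall>i. lat (\<phi> i) = \<Lambda> i))"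

lemma lat_smult:
  assumes "A \<in> carrier_mat m m"
  shows "lat (c \<cdot>\<^sub>m A) = (\<lambda>v. c \<cdot>\<^sub>v v) ` lat A"
proof -
  have "(c \<cdot>\<^sub>m A) *\<^sub>v x = c \<cdot>\<^sub>v (A *\<^sub>v x)" if "x \<in> int_vecs m" for x
    using assms that by (intro eq_vecI) (auto simp: int_vecs_def scalar_prod_def sum_distrib_left mult.assoc)
  then show ?thesis using assms unfolding lat_def by (auto simp: image_image intro!: image_eqI)
qed

lemma presents_family:
  assumes P: "presents k n M \<phi>" and kn: "k \<le> n"
  shows "lat_family k n (rk M) (\<lambda>i. lat (\<phi> i))"
proof -
  note D = presentsD[OF P]
  have "lat (\<phi> (i - 1)) \<subseteq> lat (\<phi> i)" for i
  proof
    fix v assume "v \<in> lat (\<phi> (i - 1))"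
    then obtain x where "x \<in> int_vecs (rk M)" "v = \<phi> (i - 1) *\<^sub>v x" using D(2)[of "i - 1"] by (auto simp: lat_def)
    then show "v \<in> lat (\<phi> i)" using lat_mult_subset[OF D(2) D(6), of x i i] D(4)[of i] by simp
  qed
  moreover have "tpow 1 \<cdot>\<^sub>v v \<in> lat (\<phi> (i - 1))" if "v \<in> lat (\<phi> i)" for i v
  proof -
    have "tpow 1 \<cdot>\<^sub>v v \<in> lat (tpow 1 \<cdot>\<^sub>m \<phi> i)" using that lat_smult[OF D(2)] by auto
    then obtain x where "x \<in> int_vecs (rk M)" "tpow 1 \<cdot>\<^sub>v v = (\<phi> (i - 1) * toK (ymap M i)) *\<^sub>v x"
      using D(2)[of "i"] unfolding D(5) by (auto simp: lat_def)
    then show ?thesis using lat_mult_subset[OF D(2) D(7), of x "i - 1" i] by simp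
  qed
  moreover have "v \<in> lat (\<phi> (i + int n)) \<longleftrightarrow> tpow (int n - int k) \<cdot>\<^sub>v v \<in> lat (\<phi> i)"
    if "v \<in> carrier_vec (rk M)" for v i
  proof -
    have "v = w" if "w \<in> lat (\<phi> (i + int n))" "tpow (int n - int k) \<cdot>\<^sub>v v = tpow (int n - int k) \<cdot>\<^sub>v w" for w
    proof -
      have "tpow (-(int n - int k)) \<cdot>\<^sub>v (tpow (int n - int k) \<cdot>\<^sub>v v) = tpow (-(int n - int k)) \<cdot>\<^sub>v (tpow (int n - int k) \<cdot>\<^sub>v w)"
        using that by simp
      then show ?thesis unfolding smult_smult_assoc by (simp del: minus_diff_eq)
    qed
    then show ?thesis unfolding presents_shift[OF P kn, of i] lat_smult[OF D(2)] by auto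
  qed
  ultimately show ?thesis using lattice_lat[OF D(2) D(3)] by (auto simp: lat_family_def)
qed

lemma models_family: "models k n M m \<Lambda> \<Longrightarrow> k \<le> n \<Longrightarrow> lat_family k n m \<Lambda>"
proof -
  assume "models k n M m \<Lambda>" "k \<le> n"
  then obtain \<phi> where "presents k n M \<phi>" "rk M = m" "\<And>i. lat (\<phi> i) = \<Lambda> i" by (auto simp: models_def)
  moreover from this(3) have "(\<lambda>i. lat (\<phi> i)) = \<Lambda>" by auto
  ultimately show ?thesis using presents_family[of k n M \<phi>] \<open>k \<le> n\<close> by simp
qed

lemma lat_familyD:
  assumes "lat_family k n m \<Lambda>"
  shows "lattice m (\<Lambda> i)" "v \<in> \<Lambda> (i - 1) \<Longrightarrow> v \<in> \<Lambda> i" "v \<in> \<Lambda> i \<Longrightarrow> tpow 1 \<cdot>\<^sub>v v \<in> \<Lambda> (i - 1)"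
    "v \<in> carrier_vec m \<Longrightarrow> v \<in> \<Lambda> (i + int n) \<longleftrightarrow> tpow (int n - int k) \<cdot>\<^sub>v v \<in> \<Lambda> i"
  using assms unfolding lat_family_def by blast+

lemma lat_family_shift:
  assumes F: "lat_family k n m \<Lambda>" and v: "v \<in> carrier_vec m"
  shows "v \<in> \<Lambda> (i + q * int n) \<longleftrightarrow> tpow (q * (int n - int k)) \<cdot>\<^sub>v v \<in> \<Lambda> i"
proof -
  have nn: "v \<in> \<Lambda> (i + int l * int n) \<longleftrightarrow> tpow (int l * (int n - int k)) \<cdot>\<^sub>v v \<in> \<Lambda> i"
    if "v \<in> carrier_vec m" for v l i
    using that
  proof (induct l arbitrary: v)
    case (Suc l)
    have "v \<in> \<Lambda> (i + int (Suc l) * int n) \<longleftrightarrow> tpow (int n - int k) \<cdot>\<^sub>v v \<in> \<Lambda> (i + int l * int n)"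
      using lat_familyD(4)[OF F Suc(2), of "i + int l * int n"] by (simp add: algebra_simps)
    then show ?case using Suc(1)[of "tpow (int n - int k) \<cdot>\<^sub>v v"] Suc(2)
      by (simp add: smult_smult_assoc tpow_add[symmetric] algebra_simps)
  qed simp
  show ?thesis
  proof (cases "0 \<le> q")
    case True
    then show ?thesis using nn[OF v, of i "nat q"] by simp
  next
    case False
    then have q: "q = - int (nat (- q))" by simp
    let ?l = "nat (- q)"
    have "tpow (q * (int n - int k)) \<cdot>\<^sub>v v \<in> \<Lambda> i \<longleftrightarrow>
      tpow (int ?l * (int n - int k)) \<cdot>\<^sub>v (tpow (q * (int n - int k)) \<cdot>\<^sub>v v) \<in> \<Lambda> (i + q * int n)"
      using nn[of "tpow (q * (int n - int k)) \<cdot>\<^sub>v v" "i + q * int n" ?l] v False by (simp add: algebra_simps)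
    also have "tpow (int ?l * (int n - int k)) \<cdot>\<^sub>v (tpow (q * (int n - int k)) \<cdot>\<^sub>v v) = v"
      unfolding smult_smult_assoc tpow_add[symmetric] using False by (simp add: algebra_simps)
    finally show ?thesis by simp
  qed
qed

text \<open>The relations of the algebra are consequences of the basis matrices: multiplied by them,
  both sides of a relation become the same power of t times one basis matrix. Periodicity of the
  arrows comes from quasi-periodicity of \<phi>.\<close>

lemma presentsI:
  assumes X: "\<And>i. X i \<in> carrier_mat m m" "\<And>i. \<phi> i * toK (X i) = \<phi> (i - 1)"
    and Y: "\<And>i. Y i \<in> carrier_mat m m" "\<And>i. \<phi> (i - 1) * toK (Y i) = tpow 1 \<cdot>\<^sub>m \<phi> i"
    and c: "\<And>i. \<phi> i \<in> carrier_mat m m" and d: "\<And>i. det (\<phi> i) \<noteq> 0"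
    and per: "\<And>i. \<phi> i = tpow (int n - int k) \<cdot>\<^sub>m \<phi> (i + int n)" and kn: "k \<le> n"
  shows "presents k n \<lparr>rk = m, xmap = X, ymap = Y\<rparr> \<phi>"
proof -
  define M where "M = \<lparr>rk = m, xmap = X, ymap = Y\<rparr>"
  have xy: "X i * Y i = fps_X \<cdot>\<^sub>m 1\<^sub>m m" for i
  proof (rule toK_left_cancel[OF _ _ c[of i] d])
    have "\<phi> i * toK (X i * Y i) = \<phi> i * toK (X i) * toK (Y i)"
      unfolding toK_mult[OF X(1) Y(1)] using c X Y
      by (intro assoc_mult_mat[of _ m m _ m _ m, symmetric]) auto
    also have "\<dots> = tpow 1 \<cdot>\<^sub>m \<phi> i" unfolding X Y ..
    also have "\<dots> = \<phi> i * toK (fps_X \<cdot>\<^sub>m 1\<^sub>m m)" unfolding toK_X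
      by (rule mult_scalar_mat[OF c, symmetric])
    finally show "\<phi> i * toK (X i * Y i) = \<phi> i * toK (fps_X \<cdot>\<^sub>m 1\<^sub>m m)" .
  qed (use X Y in \<open>auto intro!: mult_carrier_mat[of _ m m _ m]\<close>)
  have yx: "Y i * X i = fps_X \<cdot>\<^sub>m 1\<^sub>m m" for i
  proof (rule toK_left_cancel[OF _ _ c[of "i - 1"] d])
    have "\<phi> (i - 1) * toK (Y i * X i) = \<phi> (i - 1) * toK (Y i) * toK (X i)"
      unfolding toK_mult[OF Y(1) X(1)] using c X Y
      by (intro assoc_mult_mat[of _ m m _ m _ m, symmetric]) auto
    also have "\<dots> = tpow 1 \<cdot>\<^sub>m (\<phi> i * toK (X i))" unfolding Y
      using c X by (intro mult_smult_assoc_mat[of _ m m _ m]) auto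
    also have "\<dots> = tpow 1 \<cdot>\<^sub>m \<phi> (i - 1)" unfolding X ..
    also have "\<dots> = \<phi> (i - 1) * toK (fps_X \<cdot>\<^sub>m 1\<^sub>m m)" unfolding toK_X
      by (rule mult_scalar_mat[OF c, symmetric])
    finally show "\<phi> (i - 1) * toK (Y i * X i) = \<phi> (i - 1) * toK (fps_X \<cdot>\<^sub>m 1\<^sub>m m)" .
  qed (use X Y in \<open>auto intro!: mult_carrier_mat[of _ m m _ m]\<close>)
  have Xp: "X (i + int n) = X i" for i
  proof (rule toK_left_cancel[OF X(1) X(1) c[of i] d])
    have "\<phi> i * toK (X (i + int n)) = tpow (int n - int k) \<cdot>\<^sub>m (\<phi> (i + int n) * toK (X (i + int n)))"
      unfolding per[of i] using c X by (intro mult_smult_assoc_mat[of _ m m _ m]) auto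
    also have "\<dots> = \<phi> (i - 1)" unfolding X per[of "i - 1"] by (simp add: algebra_simps)
    finally show "\<phi> i * toK (X (i + int n)) = \<phi> i * toK (X i)" using X by simp
  qed
  have Yp: "Y (i + int n) = Y i" for i
  proof (rule toK_left_cancel[OF Y(1) Y(1) c[of "i - 1"] d])
    have "\<phi> (i - 1) * toK (Y (i + int n)) = tpow (int n - int k) \<cdot>\<^sub>m (\<phi> (i + int n - 1) * toK (Y (i + int n)))"
      unfolding per[of "i - 1"] using c[of "i + int n - 1"] Y(1)[of "i + int n"]
      by (subst mult_smult_assoc_mat[of _ m m _ m]) (auto simp: algebra_simps)
    also have "\<dots> = tpow (int n - int k) \<cdot>\<^sub>m (tpow 1 \<cdot>\<^sub>m \<phi> (i + int n))" unfolding Y ..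
    also have "\<dots> = tpow 1 \<cdot>\<^sub>m \<phi> i" unfolding per[of i] by (intro eq_matI) (auto simp: ac_simps)
    finally show "\<phi> (i - 1) * toK (Y (i + int n)) = \<phi> (i - 1) * toK (Y i)" using Y by simp
  qed
  have rel: "\<phi> (i + int l) * toK (xpath M i l) = \<phi> i" "\<phi> (i - int l) * toK (ypath M i l) = tpow (int l) \<cdot>\<^sub>m \<phi> i"
    and pc: "xpath M i l \<in> carrier_mat m m" "ypath M i l \<in> carrier_mat m m" for i l
    using path_relations[of M \<phi> i l] path_carrier[of M i l] X Y c by (auto simp: M_def)
  have path: "xpath M i k = ypath M i (n - k)" for i
  proof (rule toK_left_cancel[OF pc(1) pc(2) c[of "i + int k"] d])
    have "\<phi> (i - int (n - k)) = tpow (int n - int k) \<cdot>\<^sub>m \<phi> (i + int k)"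
      unfolding per[of "i - int (n - k)"] using kn by (simp add: of_nat_diff algebra_simps)
    then have "tpow (int n - int k) \<cdot>\<^sub>m \<phi> i = tpow (int n - int k) \<cdot>\<^sub>m (\<phi> (i + int k) * toK (ypath M i (n - k)))"
      using rel(2)[of i "n - k"] c[of "i + int k"] pc(2)[of i "n - k"] kn
      by (simp add: mult_smult_assoc_mat[of _ m m _ m] of_nat_diff)
    then have "tpow (- (int n - int k)) \<cdot>\<^sub>m (tpow (int n - int k) \<cdot>\<^sub>m \<phi> i) =
      tpow (- (int n - int k)) \<cdot>\<^sub>m (tpow (int n - int k) \<cdot>\<^sub>m (\<phi> (i + int k) * toK (ypath M i (n - k))))" by simp
    moreover have "tpow (- d) \<cdot>\<^sub>m (tpow d \<cdot>\<^sub>m A) = A" for d A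
      by (intro eq_matI) auto
    ultimately have "\<phi> i = \<phi> (i + int k) * toK (ypath M i (n - k))" by (simp del: minus_diff_eq)
    then show "\<phi> (i + int k) * toK (xpath M i k) = \<phi> (i + int k) * toK (ypath M i (n - k))"
      using rel(1)[of i k] by simp
  qed
  have "CM k n M" unfolding CM_def using X(1) Y(1) Xp Yp xy yx path by (auto simp: M_def)
  then show ?thesis unfolding presents_def M_def using X Y c d by auto
qed

lemma model_exists:
  assumes F: "lat_family k n m \<Lambda>" and kn: "k \<le> n" "0 < n"
  obtains M where "models k n M m \<Lambda>"
proof -
  have "\<exists>\<phi>. \<phi> \<in> carrier_mat m m \<and> det \<phi> \<noteq> 0 \<and> lat \<phi> = \<Lambda> i" for i
    using lattice_basis[OF lat_familyD(1)[OF F, of i]] by blast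
  then obtain \<phi>0 where \<phi>0: "\<And>i. \<phi>0 i \<in> carrier_mat m m" "\<And>i. det (\<phi>0 i) \<noteq> 0" "\<And>i. lat (\<phi>0 i) = \<Lambda> i"
    by metis
  \<comment> \<open>Bases are chosen on one period and carried to the others by powers of t.
    Quasi-periodicity then holds exactly, and the arrow matrices come out periodic.\<close>
  define \<phi> where "\<phi> i = tpow (- (i div int n) * (int n - int k)) \<cdot>\<^sub>m \<phi>0 (i mod int n)" for i
  have c: "\<phi> i \<in> carrier_mat m m" and d: "det (\<phi> i) \<noteq> 0" for i
    using \<phi>0 by (auto simp: \<phi>_def det_smult)
  have lat: "lat (\<phi> i) = \<Lambda> i" for i
  proof -
    have e: "i mod int n + (i div int n) * int n = i" by simp
    let ?e = "i div int n * (int n - int k)"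
    have "v \<in> lat (\<phi> i) \<longleftrightarrow> v \<in> \<Lambda> i" if v: "v \<in> carrier_vec m" for v
    proof -
      have "v \<in> lat (\<phi> i) \<longleftrightarrow> (\<exists>w\<in>\<Lambda> (i mod int n). v = tpow (- ?e) \<cdot>\<^sub>v w)"
        unfolding \<phi>_def lat_smult[OF \<phi>0(1)] \<phi>0(3) by auto
      also have "\<dots> \<longleftrightarrow> tpow ?e \<cdot>\<^sub>v v \<in> \<Lambda> (i mod int n)"
      proof
        assume "\<exists>w\<in>\<Lambda> (i mod int n). v = tpow (- ?e) \<cdot>\<^sub>v w"
        then show "tpow ?e \<cdot>\<^sub>v v \<in> \<Lambda> (i mod int n)" by (auto simp: smult_smult_assoc)
      next
        assume "tpow ?e \<cdot>\<^sub>v v \<in> \<Lambda> (i mod int n)"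
        moreover have "v = tpow (- ?e) \<cdot>\<^sub>v (tpow ?e \<cdot>\<^sub>v v)" by (simp add: smult_smult_assoc)
        ultimately show "\<exists>w\<in>\<Lambda> (i mod int n). v = tpow (- ?e) \<cdot>\<^sub>v w" by blast
      qed
      also have "\<dots> \<longleftrightarrow> v \<in> \<Lambda> i" using lat_family_shift[OF F v, of "i mod int n" "i div int n"] e by simp
      finally show ?thesis .
    qed
    then show ?thesis using latticeD(1)[OF lat_familyD(1)[OF F]] lat_subset_carrier[OF c] by blast
  qed
  have per: "\<phi> i = tpow (int n - int k) \<cdot>\<^sub>m \<phi> (i + int n)" for i
  proof -
    have "tpow (- (i div int n) * (int n - int k)) = tpow (int n - int k) * tpow (- ((i + int n) div int n) * (int n - int k))"
      using kn by (simp add: tpow_add[symmetric] algebra_simps)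
    then show ?thesis unfolding \<phi>_def by (intro eq_matI) (auto simp: mult.assoc)
  qed
  have cl: "col (\<phi> i) j \<in> \<Lambda> i" if "j < m" for i j using col_in_lat[OF c that] lat by simp
  have "\<exists>X. X \<in> carrier_mat m m \<and> \<phi> i * toK X = \<phi> (i - 1)" for i
  proof -
    have "col (\<phi> (i - 1)) j \<in> lat (\<phi> i)" if "j < m" for j
      using cl[OF that] lat_familyD(2)[OF F] lat by simp
    from lat_factor[OF c d c this] show ?thesis by blast
  qed
  then obtain X where X: "\<And>i. X i \<in> carrier_mat m m" "\<And>i. \<phi> i * toK (X i) = \<phi> (i - 1)" by metis
  have "\<exists>Y. Y \<in> carrier_mat m m \<and> \<phi> (i - 1) * toK Y = tpow 1 \<cdot>\<^sub>m \<phi> i" for i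
  proof -
    have "col (tpow 1 \<cdot>\<^sub>m \<phi> i) j \<in> lat (\<phi> (i - 1))" if "j < m" for j
    proof -
      have "col (tpow 1 \<cdot>\<^sub>m \<phi> i) j = tpow 1 \<cdot>\<^sub>v col (\<phi> i) j" using c[of i] that by (intro eq_vecI) auto
      then show ?thesis using cl[OF that] lat_familyD(3)[OF F] lat by simp
    qed
    from lat_factor[OF c d _ this] show ?thesis using c[of i] by (metis smult_carrier_mat)
  qed
  then obtain Y where Y: "\<And>i. Y i \<in> carrier_mat m m" "\<And>i. \<phi> (i - 1) * toK (Y i) = tpow 1 \<cdot>\<^sub>m \<phi> i" by metis
  define M where "M = \<lparr>rk = m, xmap = X, ymap = Y\<rparr>"
  have "presents k n M \<phi>" unfolding M_def by (rule presentsI[OF X Y c d per kn(1)])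
  then show ?thesis using that[of M] lat by (auto simp: models_def M_def)
qed

section \<open>Morphisms as matrices over Laurent series\<close>

text \<open>The arrows x are invertible over K, so the component at vertex 0 determines a morphism;
  written in the coordinates of K^m all components are one and the same matrix.\<close>

lemma hom_matrix:
  assumes M: "presents k n M \<phi>" and N: "presents k n N \<psi>" and f: "is_hom n M N f"
  obtains F where "F \<in> carrier_mat (rk N) (rk M)" "\<And>i. \<psi> i * toK (f i) = F * \<phi> i"
proof -
  note D = presentsD[OF M] and E = presentsD[OF N]
  have fc: "f i \<in> carrier_mat (rk N) (rk M)" and fx: "f i * xmap M i = xmap N i * f (i - 1)" for i
    using f by (auto simp: is_hom_def)
  obtain G where G: "G \<in> carrier_mat (rk M) (rk M)" "G * \<phi> 0 = 1\<^sub>m (rk M)" using mat_inverse_ex[OF D(2,3)] by metis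
  define F where "F = \<psi> 0 * toK (f 0) * G"
  have fKc: "toK (f i) \<in> carrier_mat (rk N) (rk M)" for i using fc by simp
  have Fc: "F \<in> carrier_mat (rk N) (rk M)" unfolding F_def
    by (rule mult_carrier_mat[OF mult_carrier_mat[OF E(2) fKc] G(1)])
  have step: "\<psi> (i - 1) * toK (f (i - 1)) = (\<psi> i * toK (f i)) * toK (xmap M i)" for i
  proof -
    have "(\<psi> i * toK (f i)) * toK (xmap M i) = \<psi> i * (toK (f i) * toK (xmap M i))"
      using E(2) fc D(6) by (intro assoc_mult_mat[of _ "rk N" "rk N" _ "rk M" _ "rk M"]) auto
    also have "\<dots> = \<psi> i * (toK (xmap N i) * toK (f (i - 1)))"
      using toK_mult[OF fc[of i] D(6)[of i]] toK_mult[OF E(6)[of i] fc[of "i - 1"]] fx by metis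
    also have "\<dots> = \<psi> (i - 1) * toK (f (i - 1))"
      unfolding E(4)[symmetric] using E(2) fc E(6)
      by (intro assoc_mult_mat[of _ "rk N" "rk N" _ "rk N" _ "rk M", symmetric]) auto
    finally show ?thesis by simp
  qed
  have F1: "(F * \<phi> i) * toK (xmap M i) = F * \<phi> (i - 1)" for i
    unfolding D(4)[symmetric] using Fc D(2,6) by (intro assoc_mult_mat[of _ "rk N" "rk M" _ "rk M" _ "rk M"]) auto
  have "\<psi> i * toK (f i) = F * \<phi> i" for i
  proof (induct i rule: int_induct[where k = 0])
    case base
    have "F * \<phi> 0 = \<psi> 0 * toK (f 0) * (G * \<phi> 0)" unfolding F_def
      
      by (rule assoc_mult_mat[OF mult_carrier_mat[OF E(2) fKc] G(1) D(2)])
    then show ?case unfolding G(2) right_mult_one_mat[OF mult_carrier_mat[OF E(2) fKc]] by simp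
  next
    case (step1 i)
    show ?case
    proof (rule mat_right_cancel[of _ "rk N" "rk M"])
      show "\<psi> (i + 1) * toK (f (i + 1)) * toK (xmap M (i + 1)) = F * \<phi> (i + 1) * toK (xmap M (i + 1))"
        using step[of "i + 1"] F1[of "i + 1"] step1 by simp
      show "det (toK (xmap M (i + 1))) \<noteq> 0" by (rule det_toK_xmap[OF D(1)])
      show "\<psi> (i + 1) * toK (f (i + 1)) \<in> carrier_mat (rk N) (rk M)" by (rule mult_carrier_mat[OF E(2) fKc])
      show "F * \<phi> (i + 1) \<in> carrier_mat (rk N) (rk M)" by (rule mult_carrier_mat[OF Fc D(2)])
      show "toK (xmap M (i + 1)) \<in> carrier_mat (rk M) (rk M)" using D(6) by simp
    qed
  next
    case (step2 i)
    then show ?case using step[of i] F1[of i] by simp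
  qed
  then show ?thesis using that Fc by blast
qed

lemma hom_of_matrix:
  assumes M: "presents k n M \<phi>" and N: "presents k n N \<psi>" and kn: "k \<le> n"
    and F: "F \<in> carrier_mat (rk N) (rk M)" and FL: "\<And>i v. v \<in> lat (\<phi> i) \<Longrightarrow> F *\<^sub>v v \<in> lat (\<psi> i)"
  obtains f where "is_hom n M N f" "\<And>i. \<psi> i * toK (f i) = F * \<phi> i"
proof -
  note D = presentsD[OF M] and E = presentsD[OF N]
  have "\<exists>f. f \<in> carrier_mat (rk N) (rk M) \<and> \<psi> i * toK f = F * \<phi> i" for i
  proof -
    have "col (F * \<phi> i) j \<in> lat (\<psi> i)" if "j < rk M" for j
    proof -
      have "col (F * \<phi> i) j = F *\<^sub>v col (\<phi> i) j" using F D(2)[of i] that by (intro eq_vecI) auto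
      then show ?thesis using FL col_in_lat[OF D(2) that] by simp
    qed
    from lat_factor[OF E(2,3) _ this] show ?thesis using F D(2) by (metis mult_carrier_mat)
  qed
  then obtain f where f: "\<And>i. f i \<in> carrier_mat (rk N) (rk M)" "\<And>i. \<psi> i * toK (f i) = F * \<phi> i" by metis
  have per: "f (i + int n) = f i" for i
  proof (rule toK_left_cancel[OF f(1) f(1) E(2) E(3)])
    let ?c = "tpow (int n - int k)"
    have "\<psi> i * toK (f (i + int n)) = ?c \<cdot>\<^sub>m (\<psi> (i + int n) * toK (f (i + int n)))"
      unfolding presents_shift[OF N kn, of i] using E(2) f(1) by (intro mult_smult_assoc_mat[of _ "rk N" "rk N" _ "rk M"]) auto
    also have "\<dots> = F * (?c \<cdot>\<^sub>m \<phi> (i + int n))" unfolding f(2) using F D(2)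
      by (intro mult_smult_distrib[of _ "rk N" "rk M" _ "rk M", symmetric]) auto
    also have "\<dots> = \<psi> i * toK (f i)" unfolding presents_shift[OF M kn, of i, symmetric] f(2) ..
    finally show "\<psi> i * toK (f (i + int n)) = \<psi> i * toK (f i)" .
  qed
  have fx: "f i * xmap M i = xmap N i * f (i - 1)" for i
  proof (rule toK_left_cancel[OF _ _ E(2) E(3)])
    have "\<psi> i * toK (f i * xmap M i) = (\<psi> i * toK (f i)) * toK (xmap M i)"
      unfolding toK_mult[OF f(1) D(6)] using E(2) f(1) D(6)
      by (intro assoc_mult_mat[of _ "rk N" "rk N" _ "rk M" _ "rk M", symmetric]) auto
    also have "\<dots> = F * (\<phi> i * toK (xmap M i))" unfolding f(2) using F D(2,6)
      by (intro assoc_mult_mat[of _ "rk N" "rk M" _ "rk M" _ "rk M"]) auto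
    also have "\<dots> = (\<psi> i * toK (xmap N i)) * toK (f (i - 1))" unfolding D(4) E(4) f(2) ..
    also have "\<dots> = \<psi> i * toK (xmap N i * f (i - 1))" unfolding toK_mult[OF E(6) f(1)]
      using E(2,6) f(1) by (intro assoc_mult_mat[of _ "rk N" "rk N" _ "rk N" _ "rk M"]) auto
    finally show "\<psi> i * toK (f i * xmap M i) = \<psi> i * toK (xmap N i * f (i - 1))" .
    show "f i * xmap M i \<in> carrier_mat (rk N) (rk M)" by (rule mult_carrier_mat[OF f(1) D(6)])
    show "xmap N i * f (i - 1) \<in> carrier_mat (rk N) (rk M)" by (rule mult_carrier_mat[OF E(6) f(1)])
  qed
  have fy: "f (i - 1) * ymap M i = ymap N i * f i" for i
  proof (rule toK_left_cancel[OF _ _ E(2)[of "i - 1"] E(3)])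
    have "\<psi> (i - 1) * toK (f (i - 1) * ymap M i) = (\<psi> (i - 1) * toK (f (i - 1))) * toK (ymap M i)"
      unfolding toK_mult[OF f(1) D(7)] using E(2) f(1) D(7)
      by (intro assoc_mult_mat[of _ "rk N" "rk N" _ "rk M" _ "rk M", symmetric]) auto
    also have "\<dots> = F * (\<phi> (i - 1) * toK (ymap M i))" unfolding f(2) using F D(2,7)
      by (intro assoc_mult_mat[of _ "rk N" "rk M" _ "rk M" _ "rk M"]) auto
    also have "\<dots> = tpow 1 \<cdot>\<^sub>m (F * \<phi> i)" unfolding D(5) using F D(2)
      by (intro mult_smult_distrib[of _ "rk N" "rk M" _ "rk M"]) auto
    also have "\<dots> = (\<psi> (i - 1) * toK (ymap N i)) * toK (f i)" unfolding E(5) f(2)[symmetric]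
      using E(2) f(1) by (intro mult_smult_assoc_mat[of _ "rk N" "rk N" _ "rk M", symmetric]) auto
    also have "\<dots> = \<psi> (i - 1) * toK (ymap N i * f i)" unfolding toK_mult[OF E(7) f(1)]
      using E(2,7) f(1) by (intro assoc_mult_mat[of _ "rk N" "rk N" _ "rk N" _ "rk M"]) auto
    finally show "\<psi> (i - 1) * toK (f (i - 1) * ymap M i) = \<psi> (i - 1) * toK (ymap N i * f i)" .
    show "f (i - 1) * ymap M i \<in> carrier_mat (rk N) (rk M)" by (rule mult_carrier_mat[OF f(1) D(7)])
    show "ymap N i * f i \<in> carrier_mat (rk N) (rk M)" by (rule mult_carrier_mat[OF E(7) f(1)])
  qed
  show ?thesis using that[of f] f per fx fy by (auto simp: is_hom_def)
qed

lemma hom_matrix_lat: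
  assumes M: "presents k n M \<phi>" and N: "presents k n N \<psi>" and f: "f i \<in> carrier_mat (rk N) (rk M)"
    and F: "F \<in> carrier_mat (rk N) (rk M)" "\<psi> i * toK (f i) = F * \<phi> i" and v: "v \<in> lat (\<phi> i)"
  shows "F *\<^sub>v v \<in> lat (\<psi> i)"
proof -
  note D = presentsD[OF M] and E = presentsD[OF N]
  obtain x where x: "x \<in> int_vecs (rk M)" "v = \<phi> i *\<^sub>v x" using v D(2)[of i] by (auto simp: lat_def)
  have "F *\<^sub>v v = (\<psi> i * toK (f i)) *\<^sub>v x" unfolding x(2) F(2) using x F D(2)
    by (intro assoc_mult_mat_vec[symmetric]) (auto simp: int_vecs_def)
  then show ?thesis using lat_mult_subset[OF E(2) f x(1)] by simp
qed

section \<open>Homological algebra of short exact sequences\<close>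

definition hom_sub ::
  "(int \<Rightarrow> complex fps mat) \<Rightarrow> (int \<Rightarrow> complex fps mat) \<Rightarrow> int \<Rightarrow> complex fps mat" where
  "hom_sub f g = (\<lambda>i. f i - g i)"

definition hom_add ::
  "(int \<Rightarrow> complex fps mat) \<Rightarrow> (int \<Rightarrow> complex fps mat) \<Rightarrow> int \<Rightarrow> complex fps mat" where
  "hom_add f g = (\<lambda>i. f i + g i)"

lemma is_homD:
  assumes "is_hom n M N f"
  shows "f i \<in> carrier_mat (rk N) (rk M)" "f (i + int n) = f i"
    "f i * xmap M i = xmap N i * f (i - 1)" "f (i - 1) * ymap M i = ymap N i * f i"
  using assms by (auto simp: is_hom_def)

lemma is_hom_comp:
  assumes "CM k n A" "CM k n B" "CM k n C" and f: "is_hom n A B f" and g: "is_hom n B C g"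
  shows "is_hom n A C (hom_comp g f)"
proof -
  note fc = is_homD[OF f] and gc = is_homD[OF g]
  note XA = CM_D(1,2)[OF assms(1)] and XB = CM_D(1,2)[OF assms(2)] and XC = CM_D(1,2)[OF assms(3)]
  show ?thesis unfolding is_hom_def hom_comp_def
  proof (intro allI conjI)
    fix i
    show "g i * f i \<in> carrier_mat (rk C) (rk A)" by (rule mult_carrier_mat[OF gc(1) fc(1)])
    show "g (i + int n) * f (i + int n) = g i * f i" using fc gc by simp
    have "g i * f i * xmap A i = g i * (xmap B i * f (i - 1))"
      using assoc_mult_mat[OF gc(1) fc(1) XA(1)] fc(3) by simp
    also have "\<dots> = xmap C i * g (i - 1) * f (i - 1)"
      using assoc_mult_mat[OF gc(1) XB(1) fc(1)] gc(3) by metis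
    finally show "g i * f i * xmap A i = xmap C i * (g (i - 1) * f (i - 1))"
      using assoc_mult_mat[OF XC(1) gc(1) fc(1)] by simp
    have "g (i - 1) * f (i - 1) * ymap A i = g (i - 1) * (ymap B i * f i)"
      using assoc_mult_mat[OF gc(1) fc(1) XA(2)] fc(4) by simp
    also have "\<dots> = ymap C i * g i * f i"
      using assoc_mult_mat[OF gc(1) XB(2) fc(1)] gc(4) by metis
    finally show "g (i - 1) * f (i - 1) * ymap A i = ymap C i * (g i * f i)"
      using assoc_mult_mat[OF XC(2) gc(1) fc(1)] by simp
  qed
qed

lemma is_hom_sub:
  assumes "CM k n A" "CM k n B" and f: "is_hom n A B f" and g: "is_hom n A B g"
  shows "is_hom n A B (hom_sub f g)"
proof -
  note fc = is_homD[OF f] and gc = is_homD[OF g]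
  note XA = CM_D(1,2)[OF assms(1)] and XB = CM_D(1,2)[OF assms(2)]
  show ?thesis unfolding is_hom_def hom_sub_def
    using fc gc minus_mult_distrib_mat[OF fc(1) gc(1) XA(1)] minus_mult_distrib_mat[OF fc(1) gc(1) XA(2)]
      mult_minus_distrib_mat[OF XB(1) fc(1) gc(1)] mult_minus_distrib_mat[OF XB(2) fc(1) gc(1)]
      minus_carrier_mat[OF gc(1)]
    by auto
qed

lemma is_hom_add:
  assumes "CM k n A" "CM k n B" and f: "is_hom n A B f" and g: "is_hom n A B g"
  shows "is_hom n A B (hom_add f g)"
proof -
  note fc = is_homD[OF f] and gc = is_homD[OF g]
  note XA = CM_D(1,2)[OF assms(1)] and XB = CM_D(1,2)[OF assms(2)]
  show ?thesis unfolding is_hom_def hom_add_def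
    using fc gc add_mult_distrib_mat[OF fc(1) gc(1) XA(1)] add_mult_distrib_mat[OF fc(1) gc(1) XA(2)]
      mult_add_distrib_mat[OF XB(1) fc(1) gc(1)] mult_add_distrib_mat[OF XB(2) fc(1) gc(1)]
    by auto
qed

lemma is_hom_id: "CM k n A \<Longrightarrow> is_hom n A A (hom_id A)"
  using left_mult_one_mat[OF CM_D(1)[of k n A]] left_mult_one_mat[OF CM_D(2)[of k n A]]
    right_mult_one_mat[OF CM_D(1)[of k n A]] right_mult_one_mat[OF CM_D(2)[of k n A]]
  by (simp add: is_hom_def hom_id_def)

lemma hom_comp_assoc:
  assumes "is_hom n A B f" "is_hom n B C g" "is_hom n C D h"
  shows "hom_comp (hom_comp h g) f = hom_comp h (hom_comp g f)"
  unfolding hom_comp_def using assoc_mult_mat[OF is_homD(1)[OF assms(3)] is_homD(1)[OF assms(2)] is_homD(1)[OF assms(1)]] by auto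

lemma hom_comp_id:
  assumes "is_hom n A B f"
  shows "hom_comp f (hom_id A) = f" "hom_comp (hom_id B) f = f"
  unfolding hom_comp_def hom_id_def
  using left_mult_one_mat[OF is_homD(1)[OF assms]] right_mult_one_mat[OF is_homD(1)[OF assms]] by auto

lemma hom_comp_sub_right:
  assumes "is_hom n A B f" "is_hom n A B f'" "is_hom n B C g"
  shows "hom_comp g (hom_sub f f') = hom_sub (hom_comp g f) (hom_comp g f')"
  unfolding hom_comp_def hom_sub_def
  using mult_minus_distrib_mat[OF is_homD(1)[OF assms(3)] is_homD(1)[OF assms(1)] is_homD(1)[OF assms(2)]] by auto

lemma hom_comp_sub_left:
  assumes "is_hom n A B f" "is_hom n B C g" "is_hom n B C g'"
  shows "hom_comp (hom_sub g g') f = hom_sub (hom_comp g f) (hom_comp g' f)"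
  unfolding hom_comp_def hom_sub_def
  using minus_mult_distrib_mat[OF is_homD(1)[OF assms(2)] is_homD(1)[OF assms(3)] is_homD(1)[OF assms(1)]] by auto

definition hom_zero :: "cyc_rep \<Rightarrow> cyc_rep \<Rightarrow> int \<Rightarrow> complex fps mat" where
  "hom_zero A B = (\<lambda>i. 0\<^sub>m (rk B) (rk A))"

lemma hom_sub_self:
  assumes "is_hom n A B f"
  shows "hom_sub f f = hom_zero A B"
  unfolding hom_sub_def hom_zero_def using minus_r_inv_mat[OF is_homD(1)[OF assms]] by auto

lemma hom_sub_zero:
  assumes "is_hom n A B f"
  shows "hom_sub f (hom_zero A B) = f"
  unfolding hom_sub_def hom_zero_def
proof
  fix i show "f i - 0\<^sub>m (rk B) (rk A) = f i"
    using is_homD(1)[OF assms, of i] by (intro eq_matI) auto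
qed

lemma hom_comp_zero:
  assumes "is_hom n A B f"
  shows "hom_comp (hom_zero B C) f = hom_zero A C" "hom_comp f (hom_zero C A) = hom_zero C B"
  unfolding hom_comp_def hom_zero_def
  using left_mult_zero_mat[OF is_homD(1)[OF assms]] right_mult_zero_mat[OF is_homD(1)[OF assms]] by blast+

lemma fps_mat_inverse_comm:
  fixes A B :: "complex fps mat"
  assumes "A \<in> carrier_mat m m" "B \<in> carrier_mat m m" "A * B = 1\<^sub>m m"
  shows "B * A = 1\<^sub>m m"
proof (rule toK_inj)
  have "toK A * toK B = 1\<^sub>m m" using toK_mult[OF assms(1,2)] assms(3) by simp
  moreover have "toK A \<in> carrier_mat m m" "toK B \<in> carrier_mat m m" using assms by auto
  ultimately have "toK B * toK A = 1\<^sub>m m" by (metis mat_mult_left_right_inverse)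
  then show "toK (B * A) = toK (1\<^sub>m m)" using toK_mult[OF assms(2,1)] by simp
qed

section \<open>Cancellation, and factorisation through kernels and cokernels\<close>

lemma short_exactD:
  assumes "short_exact k n A E C f g"
  shows "CM k n A" "CM k n E" "CM k n C" "is_hom n A E f" "is_hom n E C g"
    "inj_on (\<lambda>v. f i *\<^sub>v v) (carrier_vec (rk A))"
    "(\<lambda>v. f i *\<^sub>v v) ` carrier_vec (rk A) = mat_kernel (g i)"
    "(\<lambda>v. g i *\<^sub>v v) ` carrier_vec (rk E) = carrier_vec (rk C)"
  using assms unfolding short_exact_def by blast+

lemma mat_left_cancel_inj:
  assumes inj: "inj_on (\<lambda>v. F *\<^sub>v v) (carrier_vec m)" and F: "F \<in> carrier_mat r m"
    and A: "A \<in> carrier_mat m c" "B \<in> carrier_mat m c" "F * A = F * B"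
  shows "A = B"
proof (rule mat_col_eqI)
  fix j assume j: "j < dim_col B"
  then have jc: "j < c" using A by simp
  have "F *\<^sub>v col A j = F *\<^sub>v col B j"
    using col_mult2[OF F A(1) jc] col_mult2[OF F A(2) jc] A(3) by simp
  moreover have "col A j \<in> carrier_vec m" "col B j \<in> carrier_vec m" using A by auto
  ultimately show "col A j = col B j" by (rule inj_onD[OF inj])
qed (use A in auto)

lemma hom_mono:
  assumes E: "short_exact k n A E C f g" and u: "is_hom n B A u" "is_hom n B A u'"
    and e: "hom_comp f u = hom_comp f u'"
  shows "u = u'"
proof
  fix i
  have "f i * u i = f i * u' i" using e unfolding hom_comp_def by metis
  then show "u i = u' i"
    using mat_left_cancel_inj[OF short_exactD(6)[OF E] is_homD(1)[OF short_exactD(4)[OF E]]] u is_homD(1) by blast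
qed

lemma columns_lift:
  assumes F: "F \<in> carrier_mat r m" and A: "A \<in> carrier_mat r c"
    and im: "\<And>j. j < c \<Longrightarrow> col A j \<in> (\<lambda>v. F *\<^sub>v v) ` carrier_vec m"
  obtains B where "B \<in> carrier_mat m c" "F * B = A"
proof -
  have "\<exists>v. j < c \<longrightarrow> v \<in> carrier_vec m \<and> F *\<^sub>v v = col A j" for j using im[of j] by (metis imageE)
  then obtain v where v: "\<And>j. j < c \<Longrightarrow> v j \<in> carrier_vec m" "\<And>j. j < c \<Longrightarrow> F *\<^sub>v v j = col A j" by metis
  define B where "B = mat m c (\<lambda>(i,j). v j $ i)"
  have B: "B \<in> carrier_mat m c" by (simp add: B_def)
  have cB: "col B j = v j" if "j < c" for j using v(1)[OF that] that by (intro eq_vecI) (auto simp: B_def)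
  have "F * B = A"
  proof (rule mat_col_eqI)
    fix j assume "j < dim_col A"
    then have j: "j < c" using A by simp
    show "col (F * B) j = col A j" using v(2)[OF j] cB[OF j] col_mult2[OF F B j] by simp
  qed (use F A B in auto)
  then show ?thesis using that B by blast
qed

lemma exact_right_inverse:
  assumes E: "short_exact k n A E C f g"
  obtains s where "s \<in> carrier_mat (rk E) (rk C)" "g i * s = 1\<^sub>m (rk C)"
proof -
  have "col (1\<^sub>m (rk C)) j \<in> (\<lambda>v. g i *\<^sub>v v) ` carrier_vec (rk E)" if "j < rk C" for j
    unfolding short_exactD(8)[OF E] using that by simp
  from columns_lift[OF is_homD(1)[OF short_exactD(5)[OF E]] one_carrier_mat this] show ?thesis using that by blast
qed

lemma mat_right_cancel_surj:
  fixes A :: "'a :: comm_ring_1 mat"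
  assumes "A \<in> carrier_mat r c" "B \<in> carrier_mat r c" "G \<in> carrier_mat c e" "s \<in> carrier_mat e c"
    "G * s = 1\<^sub>m c" "A * G = B * G"
  shows "A = B"
proof -
  have "A = A * G * s" using assms(1,5) assoc_mult_mat[OF assms(1,3,4)] by simp
  also have "\<dots> = B" unfolding assms(6) using assms(2,5) assoc_mult_mat[OF assms(2,3,4)] by simp
  finally show ?thesis .
qed

lemma hom_epi:
  assumes E: "short_exact k n A E C f g" and u: "is_hom n C B u" "is_hom n C B u'"
    and e: "hom_comp u g = hom_comp u' g"
  shows "u = u'"
proof
  fix i
  obtain s where s: "s \<in> carrier_mat (rk E) (rk C)" "g i * s = 1\<^sub>m (rk C)" using exact_right_inverse[OF E] .
  have "u i * g i = u' i * g i" using e unfolding hom_comp_def by metis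
  then show "u i = u' i"
    using mat_right_cancel_surj[OF is_homD(1)[OF u(1)] is_homD(1)[OF u(2)] is_homD(1)[OF short_exactD(5)[OF E]] s] by blast
qed

lemma exact_comp_zero:
  assumes E: "short_exact k n A E C f g"
  shows "hom_comp g f = hom_zero A C"
  unfolding hom_comp_def hom_zero_def
proof
  fix i
  note fc = is_homD(1)[OF short_exactD(4)[OF E], of i] and gc = is_homD(1)[OF short_exactD(5)[OF E], of i]
  show "g i * f i = 0\<^sub>m (rk C) (rk A)"
  proof (rule mat_col_eqI)
    fix j assume "j < dim_col (0\<^sub>m (rk C) (rk A) :: complex fps mat)"
    then have j: "j < rk A" by simp
    have "col (f i) j = f i *\<^sub>v unit_vec (rk A) j" using fc j by (intro eq_vecI) auto
    then have "col (f i) j \<in> mat_kernel (g i)" unfolding short_exactD(7)[OF E, of i, symmetric] by auto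
    then show "col (g i * f i) j = col (0\<^sub>m (rk C) (rk A)) j"
      using col_mult2[OF gc fc j] gc j by (auto simp: mat_kernel_def)
  qed (use fc gc in auto)
qed

lemma hom_kernel_factor:
  assumes E: "short_exact k n A E C f g" and B: "CM k n B" and u: "is_hom n B E u"
    and z: "hom_comp g u = hom_zero B C"
  obtains w where "is_hom n B A w" "hom_comp f w = u"
proof -
  note fh = short_exactD(4)[OF E] and gh = short_exactD(5)[OF E]
  note fc = is_homD[OF fh] and gc = is_homD[OF gh] and uc = is_homD[OF u]
  note inj = mat_left_cancel_inj[OF short_exactD(6)[OF E] fc(1)]
  note XA = CM_D(1,2)[OF short_exactD(1)[OF E]] and XE = CM_D(1,2)[OF short_exactD(2)[OF E]]
    and XB = CM_D(1,2)[OF B]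
  have "\<exists>w. w \<in> carrier_mat (rk A) (rk B) \<and> f i * w = u i" for i
  proof -
    have gu: "g i * u i = 0\<^sub>m (rk C) (rk B)" using z unfolding hom_comp_def hom_zero_def by metis
    have "col (u i) j \<in> (\<lambda>v. f i *\<^sub>v v) ` carrier_vec (rk A)" if j: "j < rk B" for j
      unfolding short_exactD(7)[OF E] mat_kernel_def
      using col_mult2[OF gc(1) uc(1) j, of i i] gu uc(1)[of i] gc(1)[of i] j by auto
    from columns_lift[OF fc(1) uc(1) this] show ?thesis by blast
  qed
  then obtain w where w: "\<And>i. w i \<in> carrier_mat (rk A) (rk B)" "\<And>i. f i * w i = u i" by metis
  have "is_hom n B A w" unfolding is_hom_def
  proof (intro allI conjI)
    fix i
    show "w i \<in> carrier_mat (rk A) (rk B)" by fact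
    show "w (i + int n) = w i"
      by (rule inj[OF w(1) w(1), of i]) (metis w(2) uc(2) fc(2))
    show "w i * xmap B i = xmap A i * w (i - 1)"
    proof (rule inj[OF mult_carrier_mat[OF w(1) XB(1)] mult_carrier_mat[OF XA(1) w(1)], of i])
      show "f i * (w i * xmap B i) = f i * (xmap A i * w (i - 1))"
        using assoc_mult_mat[OF fc(1) w(1) XB(1)] assoc_mult_mat[OF fc(1) XA(1) w(1)]
          assoc_mult_mat[OF XE(1) fc(1) w(1)] w(2) uc(3) fc(3) by metis
    qed
    show "w (i - 1) * ymap B i = ymap A i * w i"
    proof (rule inj[OF mult_carrier_mat[OF w(1) XB(2)] mult_carrier_mat[OF XA(2) w(1)], of "i - 1"])
      show "f (i - 1) * (w (i - 1) * ymap B i) = f (i - 1) * (ymap A i * w i)"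
        using assoc_mult_mat[OF fc(1) w(1) XB(2)] assoc_mult_mat[OF fc(1) XA(2) w(1)]
          assoc_mult_mat[OF XE(2) fc(1) w(1)] w(2) uc(4) fc(4) by metis
    qed
  qed
  moreover have "hom_comp f w = u" using w(2) by (auto simp: hom_comp_def)
  ultimately show ?thesis using that by blast
qed

lemma hom_cokernel_factor:
  assumes E: "short_exact k n A E C f g" and B: "CM k n B" and u: "is_hom n E B u"
    and z: "hom_comp u f = hom_zero A B"
  obtains w where "is_hom n C B w" "hom_comp w g = u"
proof -
  note fh = short_exactD(4)[OF E] and gh = short_exactD(5)[OF E]
  note fc = is_homD[OF fh] and gc = is_homD[OF gh] and uc = is_homD[OF u]
  note XC = CM_D(1,2)[OF short_exactD(3)[OF E]] and XE = CM_D(1,2)[OF short_exactD(2)[OF E]]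
    and XB = CM_D(1,2)[OF B]
  have "\<exists>s. s \<in> carrier_mat (rk E) (rk C) \<and> g i * s = 1\<^sub>m (rk C)" for i
    using exact_right_inverse[OF E] by metis
  then obtain s where s: "\<And>i. s i \<in> carrier_mat (rk E) (rk C)" "\<And>i. g i * s i = 1\<^sub>m (rk C)" by metis
  define w where "w i = u i * s i" for i
  have wc: "w i \<in> carrier_mat (rk B) (rk C)" for i unfolding w_def by (rule mult_carrier_mat[OF uc(1) s(1)])
  have wg: "w i * g i = u i" for i
  proof -
    have uf: "u i * f i = 0\<^sub>m (rk B) (rk A)" using z unfolding hom_comp_def hom_zero_def by metis
    have uker: "u i *\<^sub>v v = 0\<^sub>v (rk B)" if v: "v \<in> mat_kernel (g i)" for v
    proof -
      obtain x where x: "x \<in> carrier_vec (rk A)" "v = f i *\<^sub>v x" using v short_exactD(7)[OF E, of i] by blast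
      have "u i *\<^sub>v v = (u i * f i) *\<^sub>v x" unfolding x(2) using assoc_mult_mat_vec[OF uc(1) fc(1) x(1)] by simp
      then show ?thesis unfolding uf using x(1) by auto
    qed
    \<comment> \<open>The sections \<open>s i\<close> are chosen vertex by vertex and need not form
      a morphism. The columns of \<open>?d\<close> lie in the kernel of \<open>g i\<close>, hence in
      the image of \<open>f i\<close>, which \<open>u i\<close> annihilates; this is what makes
      \<open>u i * s i\<close> factor \<open>u i\<close>.\<close>
    let ?d = "1\<^sub>m (rk E) - s i * g i"
    have sg: "s i * g i \<in> carrier_mat (rk E) (rk E)" by (rule mult_carrier_mat[OF s(1) gc(1)])
    have d: "?d \<in> carrier_mat (rk E) (rk E)" by (rule minus_carrier_mat[OF sg])
    have "g i * ?d = g i - g i * (s i * g i)"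
      using mult_minus_distrib_mat[OF gc(1) one_carrier_mat sg] gc(1)[of i] by simp
    also have "g i * (s i * g i) = g i" using assoc_mult_mat[OF gc(1) s(1) gc(1), of i i i, symmetric] s(2) gc(1)[of i] by simp
    finally have gd: "g i * ?d = 0\<^sub>m (rk C) (rk E)" using minus_r_inv_mat[OF gc(1)] by simp
    have "u i * ?d = 0\<^sub>m (rk B) (rk E)"
    proof (rule mat_col_eqI)
      fix j assume "j < dim_col (0\<^sub>m (rk B) (rk E) :: complex fps mat)"
      then have j: "j < rk E" by simp
      have "g i *\<^sub>v col ?d j = 0\<^sub>v (rk C)" using col_mult2[OF gc(1) d j, symmetric] gd j by simp
      then have "col ?d j \<in> mat_kernel (g i)" using d j gc(1)[of i] by (auto simp: mat_kernel_def)
      then show "col (u i * ?d) j = col (0\<^sub>m (rk B) (rk E)) j" using uker col_mult2[OF uc(1) d j] j by simp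
    qed (use uc(1)[of i] d in auto)
    moreover have "u i * ?d = u i - w i * g i" unfolding w_def
      using mult_minus_distrib_mat[OF uc(1) one_carrier_mat sg, of i] uc(1)[of i] assoc_mult_mat[OF uc(1) s(1) gc(1), of i i i] by simp
    ultimately have e: "u i - w i * g i = 0\<^sub>m (rk B) (rk E)" by simp
    have wgc: "w i * g i \<in> carrier_mat (rk B) (rk E)" by (rule mult_carrier_mat[OF wc gc(1)])
    show "w i * g i = u i"
    proof (rule eq_matI)
      fix a b assume ab: "a < dim_row (u i)" "b < dim_col (u i)"
      then have "(u i - w i * g i) $$ (a,b) = 0" unfolding e using uc(1)[of i] by simp
      moreover have "(u i - w i * g i) $$ (a,b) = u i $$ (a,b) - (w i * g i) $$ (a,b)"
        using ab uc(1)[of i] wgc by (intro index_minus_mat) auto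
      ultimately show "(w i * g i) $$ (a,b) = u i $$ (a,b)" by simp
    qed (use wgc uc(1)[of i] in auto)
  qed
  note canc = mat_right_cancel_surj[OF _ _ gc(1) s]
  have "is_hom n C B w" unfolding is_hom_def
  proof (intro allI conjI)
    fix i
    show "w i \<in> carrier_mat (rk B) (rk C)" by fact
    have "w (i + int n) * g i = w i * g i" by (metis wg uc(2) gc(2))
    then show "w (i + int n) = w i" by (rule canc[OF wc wc])
    show "w i * xmap C i = xmap B i * w (i - 1)"
    proof (rule canc[OF mult_carrier_mat[OF wc XC(1)] mult_carrier_mat[OF XB(1) wc]])
      show "w i * xmap C i * g (i - 1) = xmap B i * w (i - 1) * g (i - 1)"
        using assoc_mult_mat[OF wc XC(1) gc(1)] assoc_mult_mat[OF XB(1) wc gc(1)]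
          assoc_mult_mat[OF wc gc(1) XE(1)] wg uc(3) gc(3) by metis
    qed
    show "w (i - 1) * ymap C i = ymap B i * w i"
    proof (rule canc[OF mult_carrier_mat[OF wc XC(2)] mult_carrier_mat[OF XB(2) wc]])
      show "w (i - 1) * ymap C i * g i = ymap B i * w i * g i"
        using assoc_mult_mat[OF wc XC(2) gc(1)] assoc_mult_mat[OF XB(2) wc gc(1)]
          assoc_mult_mat[OF wc gc(1) XE(2)] wg uc(4) gc(4) by metis
    qed
  qed
  moreover have "hom_comp w g = u" using wg by (auto simp: hom_comp_def)
  ultimately show ?thesis using that by blast
qed

text \<open>If \<open>r\<close> retracts \<open>f\<close>, then 1 - f r annihilates \<open>f\<close>
  and factors as w g. Composing with \<open>g\<close> on the left and cancelling \<open>g\<close> on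
  the right shows that \<open>w\<close> is a section.\<close>

lemma split_mono_imp_split_epi:
  assumes E: "short_exact k n A E C f g" and s: "split_mono n A E f"
  shows "split_epi n E C g"
proof -
  note D = short_exactD[OF E]
  obtain r where r: "is_hom n E A r" "hom_comp r f = hom_id A" using s by (auto simp: split_mono_def)
  have fr: "is_hom n E E (hom_comp f r)" by (rule is_hom_comp[OF D(2,1,2) r(1) D(4)])
  have id: "is_hom n E E (hom_id E)" by (rule is_hom_id[OF D(2)])
  let ?u = "hom_sub (hom_id E) (hom_comp f r)"
  have u: "is_hom n E E ?u" by (rule is_hom_sub[OF D(2,2) id fr])
  have "hom_comp ?u f = hom_sub f f"
    by (simp add: hom_comp_sub_left[OF D(4) id fr] hom_comp_id[OF D(4)] hom_comp_assoc[OF D(4) r(1) D(4)] r(2))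
  then have "hom_comp ?u f = hom_zero A E" using hom_sub_self[OF D(4)] by simp
  from hom_cokernel_factor[OF E D(2) u this] obtain w where w: "is_hom n C E w" "hom_comp w g = ?u" .
  have "hom_comp (hom_comp g w) g = hom_comp g ?u" using hom_comp_assoc[OF D(5) w(1) D(5)] w(2) by simp
  also have "\<dots> = hom_sub g (hom_comp (hom_comp g f) r)"
    by (simp add: hom_comp_sub_right[OF id fr D(5)] hom_comp_id[OF D(5)] hom_comp_assoc[OF r(1) D(4,5)])
  also have "\<dots> = g" unfolding exact_comp_zero[OF E] hom_comp_zero(1)[OF r(1)] by (rule hom_sub_zero[OF D(5)])
  also have "\<dots> = hom_comp (hom_id C) g" by (simp add: hom_comp_id[OF D(5)])
  finally have "hom_comp g w = hom_id C"
    using hom_epi[OF E is_hom_comp[OF D(3,2,3) w(1) D(5)] is_hom_id[OF D(3)]] by blast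
  then show ?thesis using w by (auto simp: split_epi_def)
qed

section \<open>Almost split sequences: minimality, uniqueness, a splitting criterion\<close>

lemma AR_D:
  assumes "AR_sequence k n A E C f g"
  shows "short_exact k n A E C f g" "\<not> split_mono n A E f" "\<not> split_epi n E C g"
    "CM k n N \<Longrightarrow> is_hom n A N h \<Longrightarrow> \<not> split_mono n A N h \<Longrightarrow> \<exists>h'. is_hom n E N h' \<and> hom_comp h' f = h"
    "CM k n N \<Longrightarrow> is_hom n N C u \<Longrightarrow> \<not> split_epi n N C u \<Longrightarrow> \<exists>h'. is_hom n N E h' \<and> hom_comp g h' = u"
  using assms unfolding AR_sequence_def by blast+

text \<open>An endomorphism \<open>p\<close> of the middle term over \<open>C\<close> is \<open>1 - f z\<close>, and if \<open>r\<close> inverts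
  \<open>1 - z f\<close>, then \<open>1 + f r z\<close> inverts \<open>p\<close>.\<close>

lemma AR_minimal:
  assumes AR: "AR_sequence k n A E C f g" and p: "is_hom n E E p" "hom_comp g p = g"
  obtains q where "is_hom n E E q" "hom_comp p q = hom_id E" "hom_comp q p = hom_id E"
proof -
  note S = AR_D(1)[OF AR]
  note D = short_exactD[OF S]
  have id: "is_hom n E E (hom_id E)" by (rule is_hom_id[OF D(2)])
  have idA: "is_hom n A A (hom_id A)" by (rule is_hom_id[OF D(1)])
  let ?d = "hom_sub (hom_id E) p"
  have d: "is_hom n E E ?d" by (rule is_hom_sub[OF D(2,2) id p(1)])
  have "hom_comp g ?d = hom_zero E C"
    by (simp add: hom_comp_sub_right[OF id p(1) D(5)] hom_comp_id[OF D(5)] p(2) hom_sub_self[OF D(5)])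
  from hom_kernel_factor[OF S D(2) d this] obtain z where z: "is_hom n E A z" "hom_comp f z = ?d" .
  have zf: "is_hom n A A (hom_comp z f)" by (rule is_hom_comp[OF D(1,2,1,4) z(1)])
  let ?v = "hom_sub (hom_id A) (hom_comp z f)"
  have v: "is_hom n A A ?v" by (rule is_hom_sub[OF D(1,1) idA zf])
  have pf: "is_hom n A E (hom_comp p f)" by (rule is_hom_comp[OF D(1,2,2,4) p(1)])
  have pfv: "hom_comp p f = hom_comp f ?v"
  proof -
    have "hom_comp f ?v = hom_sub f (hom_comp (hom_comp f z) f)"
      by (simp add: hom_comp_sub_right[OF idA zf D(4)] hom_comp_id[OF D(4)] hom_comp_assoc[OF D(4) z(1) D(4)])
    also have "hom_comp (hom_comp f z) f = hom_sub f (hom_comp p f)"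
      unfolding z(2) by (simp add: hom_comp_sub_left[OF D(4) id p(1)] hom_comp_id[OF D(4)])
    also have "hom_sub f (hom_sub f (hom_comp p f)) = hom_comp p f"
    proof
      fix i show "hom_sub f (hom_sub f (hom_comp p f)) i = hom_comp p f i"
        using is_homD(1)[OF D(4), of i] is_homD(1)[OF pf, of i]
        by (intro eq_matI) (auto simp: hom_sub_def)
    qed
    finally show ?thesis by simp
  qed
  \<comment> \<open>Otherwise 1 - z f extends along \<open>f\<close> to some \<open>w\<close> on the
    middle term. Then p - f w annihilates \<open>f\<close>, and its factorisation through
    \<open>g\<close> provides a section of \<open>g\<close>.\<close>
  have "split_mono n A A ?v"
  proof (rule ccontr)
    assume "\<not> split_mono n A A ?v"
    from AR_D(4)[OF AR D(1) v this] obtain w where w: "is_hom n E A w" "hom_comp w f = ?v" by blast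
    have fw: "is_hom n E E (hom_comp f w)" by (rule is_hom_comp[OF D(2,1,2) w(1) D(4)])
    let ?u = "hom_sub p (hom_comp f w)"
    have u: "is_hom n E E ?u" by (rule is_hom_sub[OF D(2,2) p(1) fw])
    have "hom_comp ?u f = hom_zero A E"
      by (simp add: hom_comp_sub_left[OF D(4) p(1) fw] hom_comp_assoc[OF D(4) w(1) D(4)] w(2) pfv[symmetric] hom_sub_self[OF pf])
    from hom_cokernel_factor[OF S D(2) u this] obtain s where s: "is_hom n C E s" "hom_comp s g = ?u" .
    have "hom_comp (hom_comp g s) g = hom_comp g ?u" using hom_comp_assoc[OF D(5) s(1) D(5)] s(2) by simp
    also have "\<dots> = hom_sub g (hom_comp (hom_comp g f) w)"
      by (simp add: hom_comp_sub_right[OF p(1) fw D(5)] p(2) hom_comp_assoc[OF w(1) D(4,5)])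
    also have "\<dots> = g" unfolding exact_comp_zero[OF S] hom_comp_zero(1)[OF w(1)] by (rule hom_sub_zero[OF D(5)])
    also have "\<dots> = hom_comp (hom_id C) g" by (simp add: hom_comp_id[OF D(5)])
    finally have "hom_comp g s = hom_id C"
      using hom_epi[OF S is_hom_comp[OF D(3,2,3) s(1) D(5)] is_hom_id[OF D(3)]] by blast
    then show False using AR_D(3)[OF AR] s by (auto simp: split_epi_def)
  qed
  then obtain r where r: "is_hom n A A r" "hom_comp r ?v = hom_id A" by (auto simp: split_mono_def)
  have vr: "hom_comp ?v r = hom_id A"
  proof
    fix i
    have "r i * ?v i = 1\<^sub>m (rk A)" using r(2) unfolding hom_comp_def hom_id_def by metis
    then show "hom_comp ?v r i = hom_id A i"
      using fps_mat_inverse_comm[OF is_homD(1)[OF r(1)] is_homD(1)[OF v]] by (simp add: hom_comp_def hom_id_def)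
  qed
  have rz: "is_hom n E A (hom_comp r z)" by (rule is_hom_comp[OF D(2,1,1) z(1) r(1)])
  have frz: "is_hom n E E (hom_comp f (hom_comp r z))" by (rule is_hom_comp[OF D(2,1,2) rz D(4)])
  let ?q = "hom_add (hom_id E) (hom_comp f (hom_comp r z))"
  have q: "is_hom n E E ?q" by (rule is_hom_add[OF D(2,2) id frz])
  have pq: "p i * ?q i = 1\<^sub>m (rk E)" for i
  proof -
    have pc: "p i \<in> carrier_mat (rk E) (rk E)" and frzc: "f i * (r i * z i) \<in> carrier_mat (rk E) (rk E)"
      using is_homD(1)[OF p(1)] is_homD(1)[OF frz] by (auto simp: hom_comp_def)
    have "p i * (f i * (r i * z i)) = (p i * f i) * (r i * z i)"
      using assoc_mult_mat[OF is_homD(1)[OF p(1)] is_homD(1)[OF D(4)] is_homD(1)[OF rz], of i i i] by (simp add: hom_comp_def)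
    also have "p i * f i = f i * ?v i" using pfv unfolding hom_comp_def by metis
    also have "f i * ?v i * (r i * z i) = f i * (?v i * (r i * z i))"
      using assoc_mult_mat[OF is_homD(1)[OF D(4)] is_homD(1)[OF v] is_homD(1)[OF rz], of i i i] by (simp add: hom_comp_def)
    also have "?v i * (r i * z i) = ?v i * r i * z i"
      using assoc_mult_mat[OF is_homD(1)[OF v] is_homD(1)[OF r(1)] is_homD(1)[OF z(1)], of i i i] by simp
    also have "?v i * r i = 1\<^sub>m (rk A)" using vr unfolding hom_comp_def hom_id_def by metis
    also have "f i * (1\<^sub>m (rk A) * z i) = 1\<^sub>m (rk E) - p i"
      using left_mult_one_mat[OF is_homD(1)[OF z(1)], of i] z(2) unfolding hom_comp_def hom_sub_def hom_id_def by metis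
    finally have 1: "p i * (f i * (r i * z i)) = 1\<^sub>m (rk E) - p i" .
    have "p i * ?q i = p i * 1\<^sub>m (rk E) + p i * (f i * (r i * z i))"
      using mult_add_distrib_mat[OF pc one_carrier_mat frzc] by (simp add: hom_add_def hom_comp_def hom_id_def)
    also have "\<dots> = 1\<^sub>m (rk E)" unfolding 1 using pc by (intro eq_matI) auto
    finally show ?thesis .
  qed
  have qp: "?q i * p i = 1\<^sub>m (rk E)" for i
    by (rule fps_mat_inverse_comm[OF is_homD(1)[OF p(1)] is_homD(1)[OF q] pq])
  show ?thesis using that[OF q] pq qp by (auto simp: hom_comp_def hom_id_def)
qed

lemma hom_iso_from_sides:
  assumes "CM k n M" "CM k n N" and u: "is_hom n M N u" and w: "is_hom n N M w" "hom_comp w u = hom_id M"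
    and w': "is_hom n N M w'" "hom_comp u w' = hom_id N"
  shows "hom_comp u w = hom_id N"
proof -
  have "w = hom_comp w (hom_comp u w')" using hom_comp_id[OF w(1)] w'(2) by simp
  also have "\<dots> = w'" using hom_comp_assoc[OF w'(1) u w(1)] w(2) hom_comp_id[OF w'(1)] by simp
  finally show ?thesis using w' by simp
qed

text \<open>Each of \<open>g\<close> and \<open>g'\<close> lifts through the other. Both composites
  of the lifts are endomorphisms over \<open>C\<close>, hence invertible by minimality, so the lifts
  are isomorphisms. They restrict to the kernels.\<close>

lemma AR_unique:
  assumes AR: "AR_sequence k n A E C f g" and AR': "AR_sequence k n A' E' C f' g'"
  shows "isomorphic n E E'" "isomorphic n A A'"
proof -
  note S = AR_D(1)[OF AR] and S' = AR_D(1)[OF AR']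
  note D = short_exactD[OF S] and D' = short_exactD[OF S']
  obtain u where u: "is_hom n E E' u" "hom_comp g' u = g" using AR_D(5)[OF AR' D(2) D(5) AR_D(3)[OF AR]] by blast
  obtain u' where u': "is_hom n E' E u'" "hom_comp g u' = g'" using AR_D(5)[OF AR D'(2) D'(5) AR_D(3)[OF AR']] by blast
  have p: "is_hom n E E (hom_comp u' u)" by (rule is_hom_comp[OF D(2) D'(2) D(2) u(1) u'(1)])
  have p': "is_hom n E' E' (hom_comp u u')" by (rule is_hom_comp[OF D'(2) D(2) D'(2) u'(1) u(1)])
  have "hom_comp g (hom_comp u' u) = g" using hom_comp_assoc[OF u(1) u'(1) D(5)] u u' by simp
  from AR_minimal[OF AR p this] obtain q where q: "is_hom n E E q" "hom_comp q (hom_comp u' u) = hom_id E" by blast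
  have "hom_comp g' (hom_comp u u') = g'" using hom_comp_assoc[OF u'(1) u(1) D'(5)] u u' by simp
  from AR_minimal[OF AR' p' this] obtain q' where q': "is_hom n E' E' q'" "hom_comp (hom_comp u u') q' = hom_id E'" by blast
  define w where "w = hom_comp q u'"
  have w: "is_hom n E' E w" unfolding w_def by (rule is_hom_comp[OF D'(2) D(2,2) u'(1) q(1)])
  have wu: "hom_comp w u = hom_id E" unfolding w_def using hom_comp_assoc[OF u(1) u'(1) q(1)] q(2) by simp
  have uq: "hom_comp u (hom_comp u' q') = hom_id E'" using hom_comp_assoc[OF q'(1) u'(1) u(1)] q'(2) by simp
  have uw: "hom_comp u w = hom_id E'"
    by (rule hom_iso_from_sides[OF D(2) D'(2) u(1) w wu is_hom_comp[OF D'(2) D'(2) D(2) q'(1) u'(1)] uq])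
  show "isomorphic n E E'" unfolding isomorphic_def using u(1) w wu uw by blast
  have gw: "hom_comp g w = g'"
  proof -
    have "hom_comp g w = hom_comp (hom_comp g' u) w" using u by simp
    also have "\<dots> = g'" using hom_comp_assoc[OF w u(1) D'(5)] uw hom_comp_id[OF D'(5)] by simp
    finally show ?thesis .
  qed
  have uf: "is_hom n A E' (hom_comp u f)" by (rule is_hom_comp[OF D(1,2) D'(2) D(4) u(1)])
  have wf: "is_hom n A' E (hom_comp w f')" by (rule is_hom_comp[OF D'(1,2) D(2) D'(4) w])
  have "hom_comp g' (hom_comp u f) = hom_zero A C"
    using hom_comp_assoc[OF D(4) u(1) D'(5)] u(2) exact_comp_zero[OF S] by simp
  from hom_kernel_factor[OF S' D(1) uf this] obtain v where v: "is_hom n A A' v" "hom_comp f' v = hom_comp u f" .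
  have "hom_comp g (hom_comp w f') = hom_zero A' C"
    using hom_comp_assoc[OF D'(4) w D(5)] gw exact_comp_zero[OF S'] by simp
  from hom_kernel_factor[OF S D'(1) wf this] obtain v' where v': "is_hom n A' A v'" "hom_comp f v' = hom_comp w f'" .
  have "hom_comp f (hom_comp v' v) = hom_comp w (hom_comp f' v)"
    using hom_comp_assoc[OF v(1) v'(1) D(4)] hom_comp_assoc[OF v(1) D'(4) w] v'(2) by simp
  also have "\<dots> = hom_comp f (hom_id A)" unfolding v(2)
    using hom_comp_assoc[OF D(4) u(1) w] wu hom_comp_id[OF D(4)] by simp
  finally have 1: "hom_comp v' v = hom_id A"
    using hom_mono[OF S is_hom_comp[OF D(1) D'(1) D(1) v(1) v'(1)] is_hom_id[OF D(1)]] by blast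
  have "hom_comp f' (hom_comp v v') = hom_comp u (hom_comp f v')"
    using hom_comp_assoc[OF v'(1) v(1) D'(4)] hom_comp_assoc[OF v'(1) D(4) u(1)] v(2) by simp
  also have "\<dots> = hom_comp f' (hom_id A')" unfolding v'(2)
    using hom_comp_assoc[OF D'(4) w u(1)] uw hom_comp_id[OF D'(4)] by simp
  finally have 2: "hom_comp v v' = hom_id A'"
    using hom_mono[OF S' is_hom_comp[OF D'(1) D(1) D'(1) v'(1) v(1)] is_hom_id[OF D'(1)]] by blast
  show "isomorphic n A A'" unfolding isomorphic_def using v(1) v'(1) 1 2 by blast
qed

text \<open>If \<open>f : A \<rightarrow> E\<close> did not split, it would extend to the middle term of the almost split
  sequence, and \<open>0 \<rightarrow> A \<rightarrow> E \<rightarrow> D \<rightarrow> 0\<close> would pull back to that sequence along some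
  \<open>C \<rightarrow> D\<close>, which lifts to \<open>E\<close>.\<close>

lemma extension_splits_if_lifts:
  assumes S0: "short_exact k n A E0 C f0 g0" and ns: "\<not> split_mono n A E0 f0"
    and left: "\<And>N h. CM k n N \<Longrightarrow> is_hom n A N h \<Longrightarrow> \<not> split_mono n A N h \<Longrightarrow>
      \<exists>h'. is_hom n E0 N h' \<and> hom_comp h' f0 = h"
    and S: "short_exact k n A E D f g"
    and lift: "\<And>q. is_hom n C D q \<Longrightarrow> \<exists>q'. is_hom n C E q' \<and> hom_comp g q' = q"
  shows "split_epi n E D g"
proof (rule split_mono_imp_split_epi[OF S], rule ccontr)
  note H0 = short_exactD[OF S0] and H = short_exactD[OF S]
  assume "\<not> split_mono n A E f"
  from left[OF H(2) H(4) this] obtain u where u: "is_hom n E0 E u" "hom_comp u f0 = f" by blast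
  have gu: "is_hom n E0 D (hom_comp g u)" by (rule is_hom_comp[OF H0(2) H(2,3) u(1) H(5)])
  have "hom_comp (hom_comp g u) f0 = hom_zero A D"
    using hom_comp_assoc[OF H0(4) u(1) H(5)] u(2) exact_comp_zero[OF S] by simp
  from hom_cokernel_factor[OF S0 H(3) gu this] obtain q where q: "is_hom n C D q" "hom_comp q g0 = hom_comp g u" .
  obtain q' where q': "is_hom n C E q'" "hom_comp g q' = q" using lift[OF q(1)] by blast
  have qg: "is_hom n E0 E (hom_comp q' g0)" by (rule is_hom_comp[OF H0(2,3) H(2) H0(5) q'(1)])
  let ?d = "hom_sub u (hom_comp q' g0)"
  have d: "is_hom n E0 E ?d" by (rule is_hom_sub[OF H0(2) H(2) u(1) qg])
  have "hom_comp g ?d = hom_zero E0 D"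
    by (simp add: hom_comp_sub_right[OF u(1) qg H(5)] hom_comp_assoc[OF H0(5) q'(1) H(5), symmetric] q'(2) q(2) hom_sub_self[OF gu])
  from hom_kernel_factor[OF S H0(2) d this] obtain z where z: "is_hom n E0 A z" "hom_comp f z = ?d" .
  have "hom_comp f (hom_comp z f0) = hom_comp ?d f0"
    using hom_comp_assoc[OF H0(4) z(1) H(4)] z(2) by simp
  also have "\<dots> = hom_sub f (hom_comp q' (hom_comp g0 f0))"
    by (simp add: hom_comp_sub_left[OF H0(4) u(1) qg] u(2) hom_comp_assoc[OF H0(4) H0(5) q'(1)])
  also have "\<dots> = f" unfolding exact_comp_zero[OF S0] hom_comp_zero(2)[OF q'(1)] by (rule hom_sub_zero[OF H(4)])
  also have "\<dots> = hom_comp f (hom_id A)" by (simp add: hom_comp_id[OF H(4)])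
  finally have "hom_comp z f0 = hom_id A"
    using hom_mono[OF S is_hom_comp[OF H0(1,2,1) H0(4) z(1)] is_hom_id[OF H0(1)]] by blast
  then show False using ns z by (auto simp: split_mono_def)
qed

section \<open>Modules and their lattices\<close>

text \<open>A B and B A have the same trace, and an integer is determined by its image in a ring of
  characteristic 0.\<close>

lemma rank_unique:
  fixes A B :: "complex fps mat"
  assumes A: "A \<in> carrier_mat r m" and B: "B \<in> carrier_mat m r" and AB: "A * B = 1\<^sub>m r" and BA: "B * A = 1\<^sub>m m"
  shows "r = m"
proof -
  have "(\<Sum>i<r. (A * B) $$ (i,i)) = (\<Sum>i<r. \<Sum>j<m. A $$ (i,j) * B $$ (j,i))"
    using A B by (intro sum.cong) (auto simp: scalar_prod_def atLeast0LessThan)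
  also have "\<dots> = (\<Sum>j<m. \<Sum>i<r. A $$ (i,j) * B $$ (j,i))" by (rule sum.swap)
  also have "\<dots> = (\<Sum>j<m. (B * A) $$ (j,j))"
    using A B by (intro sum.cong) (auto simp: scalar_prod_def atLeast0LessThan mult.commute)
  finally have "of_nat r = (of_nat m :: complex fps)" unfolding AB BA by simp
  then show ?thesis by (simp only: of_nat_eq_iff)
qed

lemma isomorphicD:
  assumes "isomorphic n M N"
  obtains f g where "is_hom n M N f" "is_hom n N M g" "\<And>i. g i * f i = 1\<^sub>m (rk M)" "\<And>i. f i * g i = 1\<^sub>m (rk N)"
proof -
  obtain f g where fg: "is_hom n M N f" "is_hom n N M g" "hom_comp g f = hom_id M" "hom_comp f g = hom_id N"
    using assms by (auto simp: isomorphic_def)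
  have "\<And>i. g i * f i = 1\<^sub>m (rk M)" "\<And>i. f i * g i = 1\<^sub>m (rk N)"
    using fg(3,4) unfolding hom_comp_def hom_id_def by metis+
  with that fg(1,2) show ?thesis by blast
qed

lemma isomorphic_rk: "isomorphic n M N \<Longrightarrow> rk M = rk N"
  by (elim isomorphicD) (metis is_homD(1) rank_unique)

lemma lat_mult_le:
  assumes "\<phi> \<in> carrier_mat m m" "B \<in> carrier_mat m m"
  shows "lat (\<phi> * toK B) \<subseteq> lat \<phi>"
proof
  fix v assume "v \<in> lat (\<phi> * toK B)"
  then obtain x where "x \<in> int_vecs m" "v = (\<phi> * toK B) *\<^sub>v x" using assms by (auto simp: lat_def)
  then show "v \<in> lat \<phi>" using lat_mult_subset[OF assms] by simp
qed

section \<open>Chains under isomorphisms and changes of coordinates\<close>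

lemma models_iso:
  assumes M: "models k n M m \<Lambda>" and iso: "isomorphic n M N" and N: "CM k n N"
  shows "models k n N m \<Lambda>"
proof -
  obtain \<phi> where P: "presents k n M \<phi>" and lat: "\<And>i. lat (\<phi> i) = \<Lambda> i" and m: "rk M = m" using M by (auto simp: models_def)
  note D = presentsD[OF P]
  obtain f g where f: "is_hom n M N f" and g: "is_hom n N M g"
    and gf: "\<And>i. g i * f i = 1\<^sub>m (rk M)" and fg: "\<And>i. f i * g i = 1\<^sub>m (rk N)"
    by (rule isomorphicD[OF iso]) metis
  have rk: "rk N = rk M" using isomorphic_rk[OF iso] by simp
  have fc: "f i \<in> carrier_mat m m" and gc: "g i \<in> carrier_mat m m" for i
    using is_homD(1)[OF f, of i] is_homD(1)[OF g, of i] rk m by auto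
  have pc: "\<phi> i \<in> carrier_mat m m" for i using D(2) m by simp
  have XN: "xmap N i \<in> carrier_mat m m" "ymap N i \<in> carrier_mat m m" for i using CM_D(1,2)[OF N, of i] rk m by auto
  have XM: "xmap M i \<in> carrier_mat m m" "ymap M i \<in> carrier_mat m m" for i using D(6,7)[of i] m by auto
  define \<psi> where "\<psi> i = \<phi> i * toK (g i)" for i
  have \<psi>c: "\<psi> i \<in> carrier_mat m m" for i unfolding \<psi>_def by (rule mult_carrier_mat[OF pc]) (use gc in simp)
  have bck: "\<psi> i * toK (f i) = \<phi> i" for i
  proof -
    have "toK (g i) * toK (f i) = 1\<^sub>m m" using toK_mult[OF gc fc, of i i] gf m by simp
    moreover have "\<psi> i * toK (f i) = \<phi> i * (toK (g i) * toK (f i))"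
      unfolding \<psi>_def using pc gc fc by (intro assoc_mult_mat[of _ m m _ m _ m]) auto
    ultimately show ?thesis using pc[of i] by simp
  qed
  have det: "det (\<psi> i) \<noteq> 0" for i
  proof -
    have "det (\<psi> i) * det (toK (f i)) = det (\<phi> i)" using det_mult[OF \<psi>c, of "toK (f i)" i] fc bck by simp
    then show ?thesis using D(3)[of i] by auto
  qed
  have x: "\<psi> i * toK (xmap N i) = \<psi> (i - 1)" for i
  proof -
    have "\<psi> i * toK (xmap N i) = \<phi> i * toK (g i * xmap N i)"
      unfolding \<psi>_def toK_mult[OF gc XN(1)] using pc gc XN by (intro assoc_mult_mat[of _ m m _ m _ m]) auto
    also have "\<dots> = \<phi> i * toK (xmap M i) * toK (g (i - 1))"
      unfolding is_homD(3)[OF g] toK_mult[OF XM(1) gc] using pc gc XM by (intro assoc_mult_mat[of _ m m _ m _ m, symmetric]) auto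
    finally show ?thesis unfolding D(4) \<psi>_def .
  qed
  have y: "\<psi> (i - 1) * toK (ymap N i) = tpow 1 \<cdot>\<^sub>m \<psi> i" for i
  proof -
    have "\<psi> (i - 1) * toK (ymap N i) = \<phi> (i - 1) * toK (g (i - 1) * ymap N i)"
      unfolding \<psi>_def toK_mult[OF gc XN(2)] using pc gc XN by (intro assoc_mult_mat[of _ m m _ m _ m]) auto
    also have "\<dots> = \<phi> (i - 1) * toK (ymap M i) * toK (g i)"
      unfolding is_homD(4)[OF g] toK_mult[OF XM(2) gc] using pc gc XM by (intro assoc_mult_mat[of _ m m _ m _ m, symmetric]) auto
    also have "\<dots> = tpow 1 \<cdot>\<^sub>m \<psi> i" unfolding D(5) \<psi>_def using pc gc by (intro mult_smult_assoc_mat[of _ m m _ m]) auto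
    finally show ?thesis .
  qed
  have "presents k n N \<psi>" unfolding presents_def using N \<psi>c det x y rk m by simp
  moreover have "lat (\<psi> i) = \<Lambda> i" for i
    using lat_mult_le[OF pc gc, of i i] lat_mult_le[OF \<psi>c fc, of i i] bck lat[of i] by (simp add: \<psi>_def)
  ultimately show ?thesis using rk m by (auto simp: models_def)
qed

lemma models_change:
  assumes M: "models k n M m \<Lambda>" and P: "P \<in> carrier_mat m m" "det P \<noteq> 0"
    and L: "\<And>i v. v \<in> carrier_vec m \<Longrightarrow> v \<in> \<Lambda> i \<longleftrightarrow> P *\<^sub>v v \<in> \<Lambda>' i" and c: "\<And>i. \<Lambda>' i \<subseteq> carrier_vec m"
  shows "models k n M m \<Lambda>'"
proof -
  obtain \<phi> where Pr: "presents k n M \<phi>" and lat: "\<And>i. lat (\<phi> i) = \<Lambda> i" and m: "rk M = m" using M by (auto simp: models_def)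
  note D = presentsD[OF Pr, unfolded m]
  obtain Q where Q: "Q \<in> carrier_mat m m" "P * Q = 1\<^sub>m m" "Q * P = 1\<^sub>m m" using mat_inverse_ex[OF P] .
  have "det (P * \<phi> i) \<noteq> 0" for i using det_mult[OF P(1) D(2)] P D(3) by simp
  moreover have "P * \<phi> i \<in> carrier_mat m m" for i by (rule mult_carrier_mat[OF P(1) D(2)])
  moreover have "P * \<phi> i * toK (xmap M i) = P * \<phi> (i - 1)" for i
    unfolding D(4)[symmetric] using P D(2,6) by (intro assoc_mult_mat[of _ m m _ m _ m]) auto
  moreover have "P * \<phi> (i - 1) * toK (ymap M i) = tpow 1 \<cdot>\<^sub>m (P * \<phi> i)" for i
  proof -
    have "P * \<phi> (i - 1) * toK (ymap M i) = P * (\<phi> (i - 1) * toK (ymap M i))"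
      using P D(2,7) by (intro assoc_mult_mat[of _ m m _ m _ m]) auto
    then show ?thesis unfolding D(5) using mult_smult_distrib[OF P(1) D(2)] by simp
  qed
  ultimately have "presents k n M (\<lambda>i. P * \<phi> i)" unfolding presents_def m using D(1) by simp
  moreover have "lat (P * \<phi> i) = \<Lambda>' i" for i
  proof -
    have "lat (P * \<phi> i) = (\<lambda>v. P *\<^sub>v v) ` lat (\<phi> i)"
    proof -
      have dc: "dim_col (P * \<phi> i) = m" "dim_col (\<phi> i) = m" using D(2)[of i] by auto
      have "(P * \<phi> i) *\<^sub>v x = P *\<^sub>v (\<phi> i *\<^sub>v x)" if "x \<in> int_vecs m" for x
        using P D(2) that by (intro assoc_mult_mat_vec[of _ m m _ m]) (auto simp: int_vecs_def)
      then show ?thesis unfolding lat_def dc image_image by (intro image_cong) auto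
    qed
    also have "\<dots> = \<Lambda>' i"
    proof (intro equalityI subsetI)
      fix w assume "w \<in> (\<lambda>v. P *\<^sub>v v) ` lat (\<phi> i)"
      then show "w \<in> \<Lambda>' i" using L lat lat_subset_carrier[OF D(2)] by blast
    next
      fix w assume w: "w \<in> \<Lambda>' i"
      then have wc: "w \<in> carrier_vec m" using c by blast
      have "P *\<^sub>v (Q *\<^sub>v w) = w" using assoc_mult_mat_vec[OF P(1) Q(1) wc] Q(2) wc by simp
      moreover have Qw: "Q *\<^sub>v w \<in> carrier_vec m" using Q(1) by (rule mult_mat_vec_carrier[OF _ wc])
      ultimately have "Q *\<^sub>v w \<in> lat (\<phi> i)" unfolding lat using L[OF Qw] w by simp
      then show "w \<in> (\<lambda>v. P *\<^sub>v v) ` lat (\<phi> i)" using \<open>P *\<^sub>v (Q *\<^sub>v w) = w\<close> by (metis image_eqI)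
    qed
    finally show ?thesis .
  qed
  ultimately show ?thesis using m by (auto simp: models_def)
qed

lemma hom_comp_matrix:
  assumes A: "presents k n A \<phi>" and B: "presents k n B \<psi>" and C: "presents k n C \<chi>"
    and f: "is_hom n A B f" and g: "is_hom n B C g"
    and F: "F \<in> carrier_mat (rk B) (rk A)" "\<psi> i * toK (f i) = F * \<phi> i"
    and G: "G \<in> carrier_mat (rk C) (rk B)" "\<chi> i * toK (g i) = G * \<psi> i"
  shows "\<chi> i * toK (hom_comp g f i) = (G * F) * \<phi> i"
proof -
  note fc = is_homD(1)[OF f, of i] and gc = is_homD(1)[OF g, of i]
  have tf: "toK (f i) \<in> carrier_mat (rk B) (rk A)" and tg: "toK (g i) \<in> carrier_mat (rk C) (rk B)" using fc gc by auto
  have "\<chi> i * toK (hom_comp g f i) = \<chi> i * toK (g i) * toK (f i)"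
    unfolding hom_comp_def toK_mult[OF gc fc] by (rule assoc_mult_mat[OF presentsD(2)[OF C] tg tf, symmetric])
  also have "\<dots> = G * (F * \<phi> i)" unfolding G(2) F(2)[symmetric] by (rule assoc_mult_mat[OF G(1) presentsD(2)[OF B] tf])
  also have "\<dots> = (G * F) * \<phi> i" by (rule assoc_mult_mat[OF G(1) F(1) presentsD(2)[OF A], symmetric])
  finally show ?thesis .
qed

lemma hom_eq_if_matrix_eq:
  assumes A: "presents k n A \<phi>" and B: "presents k n B \<psi>" and f: "is_hom n A B f" "is_hom n A B f'"
    and e: "\<And>i. \<psi> i * toK (f i) = \<psi> i * toK (f' i)"
  shows "f = f'"
proof
  fix i show "f i = f' i"
    by (rule toK_left_cancel[OF is_homD(1)[OF f(1)] is_homD(1)[OF f(2)] presentsD(2)[OF B] presentsD(3)[OF B] e])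
qed

text \<open>The identity matrix of K^m respects the common chain in both directions and induces
  mutually inverse morphisms.\<close>

lemma models_isomorphic:
  assumes M: "models k n M m \<Lambda>" and N: "models k n N m \<Lambda>" and kn: "k \<le> n"
  shows "isomorphic n M N"
proof -
  obtain \<phi> where P: "presents k n M \<phi>" and lat: "\<And>i. lat (\<phi> i) = \<Lambda> i" and m: "rk M = m" using M by (auto simp: models_def)
  obtain \<psi> where Q: "presents k n N \<psi>" and lat': "\<And>i. lat (\<psi> i) = \<Lambda> i" and m': "rk N = m" using N by (auto simp: models_def)
  have one: "1\<^sub>m m *\<^sub>v v = v" if "v \<in> \<Lambda> i" for v i
  proof -
    have "v \<in> carrier_vec m" using that lat_subset_carrier[OF presentsD(2)[OF P]] m unfolding lat[symmetric] by auto
    then show ?thesis by simp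
  qed
  obtain f where f: "is_hom n M N f" "\<And>i. \<psi> i * toK (f i) = 1\<^sub>m m * \<phi> i"
    by (rule hom_of_matrix[OF P Q kn, of "1\<^sub>m m"]) (use m m' lat lat' one in auto)
  obtain g where g: "is_hom n N M g" "\<And>i. \<phi> i * toK (g i) = 1\<^sub>m m * \<psi> i"
    by (rule hom_of_matrix[OF Q P kn, of "1\<^sub>m m"]) (use m m' lat lat' one in auto)
  have pc: "\<phi> i \<in> carrier_mat m m" "\<psi> i \<in> carrier_mat m m" for i using presentsD(2)[OF P] presentsD(2)[OF Q] m m' by auto
  note CM = presentsD(1)[OF P] presentsD(1)[OF Q]
  have "hom_comp g f = hom_id M"
  proof (rule hom_eq_if_matrix_eq[OF P P is_hom_comp[OF CM(1,2,1) f(1) g(1)] is_hom_id[OF CM(1)]])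
    fix i show "\<phi> i * toK (hom_comp g f i) = \<phi> i * toK (hom_id M i)"
      using hom_comp_matrix[OF P Q P f(1) g(1) _ f(2) _ g(2)] m m' pc[of i] by (simp add: hom_id_def)
  qed
  moreover have "hom_comp f g = hom_id N"
  proof (rule hom_eq_if_matrix_eq[OF Q Q is_hom_comp[OF CM(2,1,2) g(1) f(1)] is_hom_id[OF CM(2)]])
    fix i show "\<psi> i * toK (hom_comp f g i) = \<psi> i * toK (hom_id N i)"
      using hom_comp_matrix[OF Q P Q g(1) f(1) _ g(2) _ f(2)] m m' pc[of i] by (simp add: hom_id_def)
  qed
  ultimately show ?thesis using f g by (auto simp: isomorphic_def)
qed

lemma hom_vec:
  assumes "\<psi> \<in> carrier_mat r r" "\<phi> \<in> carrier_mat m m" "f \<in> carrier_mat r m" "F \<in> carrier_mat r m"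
    "\<psi> * toK f = F * \<phi>" "x \<in> carrier_vec m"
  shows "\<psi> *\<^sub>v map_vec fps_to_fls (f *\<^sub>v x) = F *\<^sub>v (\<phi> *\<^sub>v map_vec fps_to_fls x)"
proof -
  have tx: "map_vec fps_to_fls x \<in> carrier_vec m" using assms by simp
  have "\<psi> *\<^sub>v map_vec fps_to_fls (f *\<^sub>v x) = (\<psi> * toK f) *\<^sub>v map_vec fps_to_fls x"
    unfolding fps_fls.mult_mat_vec_hom[OF assms(3,6)] using assms by (intro assoc_mult_mat_vec[of _ r r _ m, symmetric]) auto
  also have "\<dots> = F *\<^sub>v (\<phi> *\<^sub>v map_vec fps_to_fls x)"
    unfolding assms(5) by (rule assoc_mult_mat_vec[OF assms(4,2) tx])
  finally show ?thesis .
qed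

lemma basis_vec_inj:
  fixes x y :: "complex fps vec"
  assumes "\<phi> \<in> carrier_mat m m" "det \<phi> \<noteq> 0" "x \<in> carrier_vec m" "y \<in> carrier_vec m"
    "\<phi> *\<^sub>v map_vec fps_to_fls x = \<phi> *\<^sub>v map_vec fps_to_fls y"
  shows "x = y"
proof -
  obtain \<psi> where \<psi>: "\<psi> \<in> carrier_mat m m" "\<psi> * \<phi> = 1\<^sub>m m" using mat_inverse_ex[OF assms(1,2)] .
  have "\<psi> *\<^sub>v (\<phi> *\<^sub>v map_vec fps_to_fls z) = map_vec fps_to_fls z" if "z \<in> carrier_vec m" for z
    using assoc_mult_mat_vec[OF \<psi>(1) assms(1), of "map_vec fps_to_fls z", symmetric] \<psi>(2) that by simp
  then have e: "map_vec fps_to_fls x = map_vec fps_to_fls y" using assms by metis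
  show ?thesis
  proof (rule eq_vecI)
    fix i assume "i < dim_vec y"
    then show "x $ i = y $ i" using arg_cong[OF e, of "\<lambda>v. v $ i"] assms by simp
  qed (use assms in auto)
qed

lemma lat_fps: "\<phi> \<in> carrier_mat m m \<Longrightarrow> lat \<phi> = (\<lambda>x. \<phi> *\<^sub>v map_vec fps_to_fls x) ` carrier_vec m"
  by (simp add: lat_def int_vecs_fps image_image)

text \<open>Exactness only has to be tested on vectors of the chains; the basis matrices, being
  injective, carry it back to the free modules over O.\<close>

lemma short_exact_of_matrices:
  assumes A: "presents k n A \<phi>" and E: "presents k n E \<psi>" and C: "presents k n C \<chi>" and kn: "k \<le> n"
    and F: "F \<in> carrier_mat (rk E) (rk A)" and G: "G \<in> carrier_mat (rk C) (rk E)"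
    and Fl: "\<And>i v. v \<in> lat (\<phi> i) \<Longrightarrow> F *\<^sub>v v \<in> lat (\<psi> i)"
    and Gl: "\<And>i v. v \<in> lat (\<psi> i) \<Longrightarrow> G *\<^sub>v v \<in> lat (\<chi> i)"
    and inj: "\<And>u v. u \<in> carrier_vec (rk A) \<Longrightarrow> v \<in> carrier_vec (rk A) \<Longrightarrow> F *\<^sub>v u = F *\<^sub>v v \<Longrightarrow> u = v"
    and GF: "\<And>v. v \<in> carrier_vec (rk A) \<Longrightarrow> G *\<^sub>v (F *\<^sub>v v) = 0\<^sub>v (rk C)"
    and ker: "\<And>i v. v \<in> lat (\<psi> i) \<Longrightarrow> G *\<^sub>v v = 0\<^sub>v (rk C) \<Longrightarrow> \<exists>u\<in>lat (\<phi> i). F *\<^sub>v u = v"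
    and surj: "\<And>i w. w \<in> lat (\<chi> i) \<Longrightarrow> \<exists>v\<in>lat (\<psi> i). G *\<^sub>v v = w"
  obtains f g where "short_exact k n A E C f g" "\<And>i. \<psi> i * toK (f i) = F * \<phi> i" "\<And>i. \<chi> i * toK (g i) = G * \<psi> i"
proof -
  obtain f where f: "is_hom n A E f" "\<And>i. \<psi> i * toK (f i) = F * \<phi> i" using hom_of_matrix[OF A E kn F Fl] by blast
  obtain g where g: "is_hom n E C g" "\<And>i. \<chi> i * toK (g i) = G * \<psi> i" using hom_of_matrix[OF E C kn G Gl] by blast
  note DA = presentsD[OF A] and DE = presentsD[OF E] and DC = presentsD[OF C]
  note fc = is_homD(1)[OF f(1)] and gc = is_homD(1)[OF g(1)]
  let ?K = "map_vec fps_to_fls :: complex fps vec \<Rightarrow> _"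
  note fv = hom_vec[OF DE(2) DA(2) fc F f(2)] and gv = hom_vec[OF DC(2) DE(2) gc G g(2)]
  have cK: "\<phi> i *\<^sub>v ?K x \<in> carrier_vec (rk A)" if "x \<in> carrier_vec (rk A)" for i x
    using DA(2)[of i] that by (intro mult_mat_vec_carrier) auto
  have inj': "inj_on (\<lambda>v. f i *\<^sub>v v) (carrier_vec (rk A))" for i
  proof (rule inj_onI)
    fix x y assume xy: "x \<in> carrier_vec (rk A)" "y \<in> carrier_vec (rk A)" "f i *\<^sub>v x = f i *\<^sub>v y"
    have "F *\<^sub>v (\<phi> i *\<^sub>v ?K x) = F *\<^sub>v (\<phi> i *\<^sub>v ?K y)" using fv[OF xy(1), of i] fv[OF xy(2), of i] xy(3) by simp
    then have "\<phi> i *\<^sub>v ?K x = \<phi> i *\<^sub>v ?K y" using inj cK xy by blast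
    then show "x = y" using basis_vec_inj[OF DA(2,3)] xy by blast
  qed
  have z0: "?K (0\<^sub>v r) = 0\<^sub>v r" for r by (intro eq_vecI) auto
  have mz: "M *\<^sub>v 0\<^sub>v m = 0\<^sub>v r" if "M \<in> carrier_mat r m" for M :: "complex fls mat" and r m
    using that by (intro eq_vecI) auto
  have ker': "(\<lambda>v. f i *\<^sub>v v) ` carrier_vec (rk A) = mat_kernel (g i)" for i
  proof (intro equalityI subsetI)
    fix w assume "w \<in> (\<lambda>v. f i *\<^sub>v v) ` carrier_vec (rk A)"
    then obtain x where x: "x \<in> carrier_vec (rk A)" "w = f i *\<^sub>v x" by auto
    have w: "w \<in> carrier_vec (rk E)" unfolding x(2) by (rule mult_mat_vec_carrier[OF fc x(1)])
    have "\<chi> i *\<^sub>v ?K (g i *\<^sub>v w) = G *\<^sub>v (F *\<^sub>v (\<phi> i *\<^sub>v ?K x))" using gv[OF w, of i] fv[OF x(1), of i] x(2) by simp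
    also have "\<dots> = \<chi> i *\<^sub>v ?K (0\<^sub>v (rk C))" using GF[OF cK[OF x(1)]] z0 mz[OF DC(2)] by simp
    finally have "g i *\<^sub>v w = 0\<^sub>v (rk C)"
      using basis_vec_inj[OF DC(2,3) mult_mat_vec_carrier[OF gc w] zero_carrier_vec] by blast
    then show "w \<in> mat_kernel (g i)" using gc[of i] w by (intro mat_kernelI[of _ "rk C" "rk E"]) auto
  next
    fix w assume "w \<in> mat_kernel (g i)"
    then have w: "w \<in> carrier_vec (rk E)" "g i *\<^sub>v w = 0\<^sub>v (rk C)" using mat_kernelD[OF gc] by auto
    have "G *\<^sub>v (\<psi> i *\<^sub>v ?K w) = 0\<^sub>v (rk C)" using gv[OF w(1), of i] w(2) z0 mz[OF DC(2)] by simp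
    moreover have "\<psi> i *\<^sub>v ?K w \<in> lat (\<psi> i)" using w(1) lat_fps[OF DE(2)] by auto
    ultimately obtain u where u: "u \<in> lat (\<phi> i)" "F *\<^sub>v u = \<psi> i *\<^sub>v ?K w" using ker by blast
    obtain x where x: "x \<in> carrier_vec (rk A)" "u = \<phi> i *\<^sub>v ?K x" using u(1) lat_fps[OF DA(2)] by auto
    have "f i *\<^sub>v x = w"
      using basis_vec_inj[OF DE(2,3) mult_mat_vec_carrier[OF fc x(1)] w(1)] fv[OF x(1), of i] u(2) x(2) by simp
    then show "w \<in> (\<lambda>v. f i *\<^sub>v v) ` carrier_vec (rk A)" using x(1) by blast
  qed
  have surj': "(\<lambda>v. g i *\<^sub>v v) ` carrier_vec (rk E) = carrier_vec (rk C)" for i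
  proof (intro equalityI subsetI)
    fix w assume "w \<in> (\<lambda>v. g i *\<^sub>v v) ` carrier_vec (rk E)"
    then show "w \<in> carrier_vec (rk C)" using mult_mat_vec_carrier[OF gc] by auto
  next
    fix w :: "complex fps vec" assume w: "w \<in> carrier_vec (rk C)"
    then have "\<chi> i *\<^sub>v ?K w \<in> lat (\<chi> i)" using lat_fps[OF DC(2)] by auto
    then obtain v where v: "v \<in> lat (\<psi> i)" "G *\<^sub>v v = \<chi> i *\<^sub>v ?K w" using surj by blast
    obtain x where x: "x \<in> carrier_vec (rk E)" "v = \<psi> i *\<^sub>v ?K x" using v(1) lat_fps[OF DE(2)] by auto
    have "g i *\<^sub>v x = w"
      using basis_vec_inj[OF DC(2,3) mult_mat_vec_carrier[OF gc x(1)] w] gv[OF x(1), of i] v(2) x(2) by simp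
    then show "w \<in> (\<lambda>v. g i *\<^sub>v v) ` carrier_vec (rk E)" using x(1) by blast
  qed
  have "short_exact k n A E C f g" unfolding short_exact_def
    using DA(1) DE(1) DC(1) f(1) g(1) inj' ker' surj' by blast
  then show ?thesis using that f(2) g(2) by blast
qed

section \<open>Direct sums\<close>

definition diag_mat :: "'a :: zero mat \<Rightarrow> 'a mat \<Rightarrow> 'a mat" where
  "diag_mat A B = four_block_mat A (0\<^sub>m (dim_row A) (dim_col B)) (0\<^sub>m (dim_row B) (dim_col A)) B"

lemma diag_mat_carrier: "A \<in> carrier_mat r r \<Longrightarrow> B \<in> carrier_mat s s \<Longrightarrow> diag_mat A B \<in> carrier_mat (r + s) (r + s)"
  unfolding diag_mat_def by auto

lemma diag_mat_mult:
  fixes A B C D :: "'a :: comm_ring_1 mat"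
  assumes "A \<in> carrier_mat r r" "C \<in> carrier_mat r r" "B \<in> carrier_mat s s" "D \<in> carrier_mat s s"
  shows "diag_mat A B * diag_mat C D = diag_mat (A * C) (B * D)"
proof -
  have d: "dim_row A = r" "dim_col A = r" "dim_row B = s" "dim_col B = s"
    "dim_row C = r" "dim_col C = r" "dim_row D = s" "dim_col D = s" using assms by auto
  show ?thesis unfolding diag_mat_def d
    using assms d by (subst mult_four_block_mat[of _ r r _ s _ s _ _ r _ s]) auto
qed

lemma diag_mat_scalar: "diag_mat (c \<cdot>\<^sub>m 1\<^sub>m r) (c \<cdot>\<^sub>m 1\<^sub>m s) = (c :: 'a :: comm_ring_1) \<cdot>\<^sub>m 1\<^sub>m (r + s)"
  unfolding diag_mat_def by (intro eq_matI) auto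

lemma diag_mat_one: "diag_mat (1\<^sub>m r) (1\<^sub>m s) = (1\<^sub>m (r + s) :: 'a :: comm_ring_1 mat)"
  unfolding diag_mat_def by (intro eq_matI) auto

lemma diag_mat_smult: "c \<cdot>\<^sub>m diag_mat A B = diag_mat (c \<cdot>\<^sub>m A) ((c :: 'a :: comm_ring_1) \<cdot>\<^sub>m B)"
  unfolding diag_mat_def by (intro eq_matI) auto

lemma toK_diag: "toK (diag_mat A B) = diag_mat (toK A) (toK B)"
  unfolding diag_mat_def by (intro eq_matI) auto

lemma det_diag_mat:
  fixes A B :: "'a :: idom mat"
  assumes "A \<in> carrier_mat r r" "B \<in> carrier_mat s s"
  shows "det (diag_mat A B) = det A * det B"
  unfolding diag_mat_def using assms by (intro det_four_block_mat_lower_left_zero) auto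

lemma diag_mat_vec:
  fixes A B :: "'a :: comm_ring_1 mat"
  assumes "A \<in> carrier_mat r r" "B \<in> carrier_mat s s" "u \<in> carrier_vec r" "v \<in> carrier_vec s"
  shows "diag_mat A B *\<^sub>v (u @\<^sub>v v) = (A *\<^sub>v u) @\<^sub>v (B *\<^sub>v v)"
proof -
  have d: "dim_row A = r" "dim_col A = r" "dim_row B = s" "dim_col B = s" using assms by auto
  have "diag_mat A B *\<^sub>v (u @\<^sub>v v) = (A *\<^sub>v u + 0\<^sub>m r s *\<^sub>v v) @\<^sub>v (0\<^sub>m s r *\<^sub>v u + B *\<^sub>v v)"
    unfolding diag_mat_def d using assms by (intro four_block_mat_mult_vec) auto
  moreover have "0\<^sub>m r s *\<^sub>v v = 0\<^sub>v r" "0\<^sub>m s r *\<^sub>v u = 0\<^sub>v s" using assms by auto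
  ultimately show ?thesis using assms by (simp add: mult_mat_vec_carrier[of _ r r] mult_mat_vec_carrier[of _ s s])
qed

lemma direct_sum_sel:
  assumes "CM k n A" "CM k n B"
  shows "rk (direct_sum A B) = rk A + rk B" "xmap (direct_sum A B) i = diag_mat (xmap A i) (xmap B i)"
    "ymap (direct_sum A B) i = diag_mat (ymap A i) (ymap B i)"
  using CM_D(1,2)[OF assms(1), of i] CM_D(1,2)[OF assms(2), of i] by (auto simp: direct_sum_def diag_mat_def)

lemma direct_sum_CM:
  assumes A: "CM k n A" and B: "CM k n B"
  shows "CM k n (direct_sum A B)"
proof -
  note sel = direct_sum_sel[OF A B]
  note DA = CM_D[OF A] and DB = CM_D[OF B]
  note pA = path_carrier[of A, OF DA(1,2)] and pB = path_carrier[of B, OF DB(1,2)]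
  have x: "xpath (direct_sum A B) i l = diag_mat (xpath A i l) (xpath B i l)" for i l
    by (induct l) (simp_all add: sel diag_mat_one diag_mat_mult[OF DA(1) pA(1) DB(1) pB(1)])
  have y: "ypath (direct_sum A B) i l = diag_mat (ypath A i l) (ypath B i l)" for i l
    by (induct l) (simp_all add: sel diag_mat_one diag_mat_mult[OF DA(2) pA(2) DB(2) pB(2)])
  show ?thesis unfolding CM_def
    by (simp add: sel x y DA DB diag_mat_carrier diag_mat_mult[OF DA(1,2) DB(1,2)]
        diag_mat_mult[OF DA(2,1) DB(2,1)] diag_mat_scalar)
qed

lemma direct_sum_models:
  assumes A: "models k n A r \<Lambda>" and B: "models k n B s \<Lambda>'"
  shows "models k n (direct_sum A B) (r + s) (\<lambda>i. {u @\<^sub>v v | u v. u \<in> \<Lambda> i \<and> v \<in> \<Lambda>' i})"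
proof -
  obtain \<phi> where P: "presents k n A \<phi>" and lat: "\<And>i. lat (\<phi> i) = \<Lambda> i" and r: "rk A = r" using A by (auto simp: models_def)
  obtain \<psi> where Q: "presents k n B \<psi>" and lat': "\<And>i. lat (\<psi> i) = \<Lambda>' i" and s: "rk B = s" using B by (auto simp: models_def)
  note DP = presentsD[OF P, unfolded r] and DQ = presentsD[OF Q, unfolded s]
  note sel = direct_sum_sel[OF DP(1) DQ(1)]
  have tx: "toK (xmap A i) \<in> carrier_mat r r" "toK (xmap B i) \<in> carrier_mat s s"
    "toK (ymap A i) \<in> carrier_mat r r" "toK (ymap B i) \<in> carrier_mat s s" for i using DP(6,7) DQ(6,7) by auto
  have "presents k n (direct_sum A B) (\<lambda>i. diag_mat (\<phi> i) (\<psi> i))"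
    unfolding presents_def
    by (simp add: sel r s direct_sum_CM[OF DP(1) DQ(1)] diag_mat_carrier[OF DP(2) DQ(2)] det_diag_mat[OF DP(2) DQ(2)]
        DP(3) DQ(3) toK_diag diag_mat_mult[OF DP(2) tx(1) DQ(2) tx(2)] diag_mat_mult[OF DP(2) tx(3) DQ(2) tx(4)]
        DP(4,5) DQ(4,5) diag_mat_smult)
  moreover have "lat (diag_mat (\<phi> i) (\<psi> i)) = {u @\<^sub>v v | u v. u \<in> \<Lambda> i \<and> v \<in> \<Lambda>' i}" for i
  proof -
    have iv: "int_vecs (r + s) = {u @\<^sub>v v | u v. u \<in> int_vecs r \<and> v \<in> int_vecs s}"
    proof (intro equalityI subsetI)
      fix w assume w: "w \<in> int_vecs (r + s)"
      have "w = vec_first w r @\<^sub>v vec_last w s" using w by (intro vec_first_last_append[symmetric]) (simp add: int_vecs_def)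
      moreover have "vec_first w r \<in> int_vecs r" "vec_last w s \<in> int_vecs s" using w by (auto simp: int_vecs_def vec_first_def vec_last_def)
      ultimately show "w \<in> {u @\<^sub>v v | u v. u \<in> int_vecs r \<and> v \<in> int_vecs s}" by blast
    qed (auto simp: int_vecs_def)
    have "lat (diag_mat (\<phi> i) (\<psi> i)) = {diag_mat (\<phi> i) (\<psi> i) *\<^sub>v (u @\<^sub>v v) | u v. u \<in> int_vecs r \<and> v \<in> int_vecs s}"
      using diag_mat_carrier[OF DP(2) DQ(2), of i i] iv unfolding lat_def by auto
    also have "\<dots> = {(\<phi> i *\<^sub>v u) @\<^sub>v (\<psi> i *\<^sub>v v) | u v. u \<in> int_vecs r \<and> v \<in> int_vecs s}"
      using diag_mat_vec[OF DP(2) DQ(2)] int_vecs_carrier by (metis (no_types, opaque_lifting))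
    also have "\<dots> = {u @\<^sub>v v | u v. u \<in> \<Lambda> i \<and> v \<in> \<Lambda>' i}"
      unfolding lat[symmetric] lat'[symmetric] lat_def using DP(2)[of i] DQ(2)[of i] by auto
    finally show ?thesis .
  qed
  ultimately show ?thesis using r s sel(1) by (auto simp: models_def)
qed

lemma not_indecomposable_if_split:
  assumes M: "models k n M (r + s) (\<lambda>i. {u @\<^sub>v v | u v. u \<in> \<Lambda> i \<and> v \<in> \<Lambda>' i})"
    and L: "lat_family k n r \<Lambda>" "lat_family k n s \<Lambda>'" and kn: "k \<le> n" "0 < n" and rs: "0 < r" "0 < s"
  shows "\<not> indecomposable k n M"
proof
  assume ind: "indecomposable k n M"
  obtain A where A: "models k n A r \<Lambda>" using model_exists[OF L(1) kn] .
  obtain B where B: "models k n B s \<Lambda>'" using model_exists[OF L(2) kn] .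
  have "isomorphic n M (direct_sum A B)" by (rule models_isomorphic[OF M direct_sum_models[OF A B] kn(1)])
  moreover have "CM k n A" "CM k n B" "rk A = r" "rk B = s" using A B by (auto simp: models_def presents_def)
  ultimately show False using ind rs unfolding indecomposable_def by (metis less_irrefl)
qed

section \<open>Lattices cut out by order conditions on functionals\<close>

text \<open>The conditions under which the ideals t^g(i) O form a periodic chain, that is, a module
  of rank 1.\<close>

definition rimfun :: "nat \<Rightarrow> nat \<Rightarrow> (int \<Rightarrow> int) \<Rightarrow> bool" where
  "rimfun k n g \<longleftrightarrow> (\<forall>i. g i \<le> g (i - 1) \<and> g (i - 1) \<le> g i + 1 \<and> g (i + int n) = g i - (int n - int k))"

definition flat :: "nat \<Rightarrow> (complex fls vec \<times> (int \<Rightarrow> int)) list \<Rightarrow> int \<Rightarrow> complex fls vec set" where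
  "flat m A i = {v \<in> carrier_vec m. \<forall>(\<alpha>, g) \<in> set A. \<alpha> \<bullet> v \<in> tO (g i)}"

text \<open>Each condition passes along the arrows and round the period by itself because its bound
  is a rim. The unit vectors have to be among the functionals so that the lattices are
  bounded.\<close>

lemma flat_family:
  assumes A: "\<And>\<alpha> g. (\<alpha>, g) \<in> set A \<Longrightarrow> \<alpha> \<in> carrier_vec m \<and> rimfun k n g"
    and coord: "\<And>l. l < m \<Longrightarrow> \<exists>g. (unit_vec m l, g) \<in> set A"
  shows "lat_family k n m (flat m A)"
proof -
  have sm: "\<alpha> \<bullet> (tpow e \<cdot>\<^sub>v v) = tpow e * (\<alpha> \<bullet> v)" if "(\<alpha>, g) \<in> set A" "v \<in> carrier_vec m" for \<alpha> g v e
    using A[OF that(1)] that(2) by (auto intro: scalar_prod_smult_distrib)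
  have "lattice m (flat m A i)" for i
  proof -
    obtain g where g: "\<And>l. l < m \<Longrightarrow> (unit_vec m l, g l) \<in> set A" using coord by metis
    have "\<exists>b. \<forall>l<m. b \<le> g l i"
      using Min_le[of "(\<lambda>l. g l i) ` {..<m}"] by (metis finite_imageI finite_lessThan imageI lessThan_iff)
    then obtain b where b: "\<And>l. l < m \<Longrightarrow> b \<le> g l i" by blast
    have "\<exists>c. \<forall>v. v \<in> carrier_vec m \<longrightarrow> (\<forall>l<m. v $ l \<in> tO c) \<longrightarrow> (\<forall>(\<alpha>, g) \<in> set B. \<alpha> \<bullet> v \<in> tO (g i))" for B :: "(complex fls vec \<times> (int \<Rightarrow> int)) list"
    proof (induct B)
      case (Cons x B)
      obtain \<alpha> h where x: "x = (\<alpha>, h)" by force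
      obtain c where c: "\<And>v. v \<in> carrier_vec m \<Longrightarrow> \<forall>l<m. v $ l \<in> tO c \<Longrightarrow> \<forall>(\<alpha>, g) \<in> set B. \<alpha> \<bullet> v \<in> tO (g i)" using Cons by blast
      obtain d where d: "\<forall>l\<in>{..<m}. \<alpha> $ l \<in> tO d" using tO_exists_bound_finite[of "{..<m}" "\<lambda>l. \<alpha> $ l"] by auto
      have "\<alpha> \<bullet> v \<in> tO (h i)" if "v \<in> carrier_vec m" "\<forall>l<m. v $ l \<in> tO (h i - d)" for v
        unfolding scalar_prod_def using that d tO_mult[of _ d _ "h i - d"] by (auto intro!: tO_sum)
      moreover have "\<forall>l<m. v $ l \<in> tO c" "\<forall>l<m. v $ l \<in> tO (h i - d)"
        if "\<forall>l<m. v $ l \<in> tO (max c (h i - d))" for v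
        using that by (meson max.cobounded1 tO_mono, meson max.cobounded2 tO_mono)
      ultimately have "\<forall>(\<alpha>, g) \<in> set (x # B). \<alpha> \<bullet> v \<in> tO (g i)"
        if "v \<in> carrier_vec m" "\<forall>l<m. v $ l \<in> tO (max c (h i - d))" for v
        using c[of v] x that by simp
      then show ?case by blast
    qed auto
    then obtain c where c: "\<And>v. v \<in> carrier_vec m \<Longrightarrow> \<forall>l<m. v $ l \<in> tO c \<Longrightarrow> \<forall>(\<alpha>, g) \<in> set A. \<alpha> \<bullet> v \<in> tO (g i)" by blast
    show ?thesis
    proof (rule latticeI)
      show "v $ l \<in> tO b" if "v \<in> flat m A i" "l < m" for v l
        using that g[OF that(2)] b[OF that(2)] by (auto simp: flat_def elim: tO_mono dest!: bspec)
      show "v \<in> flat m A i" if "v \<in> carrier_vec m" "\<And>l. l < m \<Longrightarrow> v $ l \<in> tO c" for v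
        using c[OF that(1)] that by (auto simp: flat_def)
      show "u + v \<in> flat m A i" if "u \<in> flat m A i" "v \<in> flat m A i" for u v
        using that A by (fastforce simp: flat_def scalar_prod_add_distrib intro: tO_add)
      show "e \<cdot>\<^sub>v v \<in> flat m A i" if "e \<in> tO 0" "v \<in> flat m A i" for e v
        using that A by (fastforce simp: flat_def scalar_prod_smult_distrib intro: tO_scale)
    qed (auto simp: flat_def)
  qed
  moreover have "flat m A (i - 1) \<subseteq> flat m A i" for i
    using A by (fastforce simp: flat_def rimfun_def elim: tO_mono)
  moreover have "tpow 1 \<cdot>\<^sub>v v \<in> flat m A (i - 1)" if v: "v \<in> flat m A i" for v i
  proof -
    have vc: "v \<in> carrier_vec m" using v by (simp add: flat_def)
    have "\<alpha> \<bullet> (tpow 1 \<cdot>\<^sub>v v) \<in> tO (g (i - 1))" if ag: "(\<alpha>, g) \<in> set A" for \<alpha> g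
    proof -
      have "\<alpha> \<bullet> v \<in> tO (g i)" using v ag by (auto simp: flat_def)
      moreover have "g (i - 1) - 1 \<le> g i" using A[OF ag] by (simp add: rimfun_def algebra_simps)
      ultimately show ?thesis unfolding sm[OF ag vc] by (auto elim: tO_mono)
    qed
    then show ?thesis using vc by (auto simp: flat_def)
  qed
  moreover have "v \<in> flat m A (i + int n) \<longleftrightarrow> tpow (int n - int k) \<cdot>\<^sub>v v \<in> flat m A i" if v: "v \<in> carrier_vec m" for v i
  proof -
    have "\<alpha> \<bullet> v \<in> tO (g (i + int n)) \<longleftrightarrow> \<alpha> \<bullet> (tpow (int n - int k) \<cdot>\<^sub>v v) \<in> tO (g i)" if ag: "(\<alpha>, g) \<in> set A" for \<alpha> g
    proof -
      have "g (i + int n) = g i - (int n - int k)" using A[OF ag] by (auto simp: rimfun_def)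
      then show ?thesis unfolding sm[OF ag v] tO_tpow by simp
    qed
    then have "(\<forall>(\<alpha>, g)\<in>set A. \<alpha> \<bullet> v \<in> tO (g (i + int n))) \<longleftrightarrow>
      (\<forall>(\<alpha>, g)\<in>set A. \<alpha> \<bullet> (tpow (int n - int k) \<cdot>\<^sub>v v) \<in> tO (g i))" by fast
    then show ?thesis using v unfolding flat_def by simp
  qed
  ultimately show ?thesis unfolding lat_family_def by blast
qed

section \<open>Moving vectors and bounds on functionals along a chain\<close>

lemma fam_right:
  assumes "lat_family k n m W" "u \<in> W i"
  shows "u \<in> W (i + int l)"
proof (induct l)
  case (Suc l)
  then show ?case using lat_familyD(2)[OF assms(1), of u "i + int l + 1"] by (simp add: algebra_simps)
qed (use assms in simp)

lemma fam_left:
  assumes W: "lat_family k n m W" and u: "u \<in> W i"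
  shows "tpow (int l) \<cdot>\<^sub>v u \<in> W (i - int l)"
proof (induct l)
  case 0 then show ?case using u by (simp add: one_smult_vec)
next
  case (Suc l)
  have "tpow 1 \<cdot>\<^sub>v (tpow (int l) \<cdot>\<^sub>v u) \<in> W (i - int l - 1)" by (rule lat_familyD(3)[OF W Suc])
  then show ?case by (simp add: smult_smult_assoc tpow_add algebra_simps)
qed

text \<open>A functional that satisfies such a bound with d = h(i) at every vertex i is a morphism
  from the chain to the rank 1 module with rim h.\<close>

definition bd :: "(int \<Rightarrow> complex fls vec set) \<Rightarrow> complex fls vec \<Rightarrow> int \<Rightarrow> int \<Rightarrow> bool" where
  "bd W \<beta> i d \<longleftrightarrow> (\<forall>v\<in>W i. \<beta> \<bullet> v \<in> tO d)"

lemma bd_mono: "bd W \<beta> i d \<Longrightarrow> e \<le> d \<Longrightarrow> bd W \<beta> i e"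
  by (auto simp: bd_def elim: tO_mono)

lemma bd_left:
  assumes W: "lat_family k n m W" and b: "bd W \<beta> i d" and j: "j \<le> i"
  shows "bd W \<beta> j d"
  using b fam_right[OF W, of _ j "nat (i - j)"] j by (simp add: bd_def)

lemma bd_right:
  assumes W: "lat_family k n m W" and \<beta>: "\<beta> \<in> carrier_vec m" and b: "bd W \<beta> i d" and j: "i \<le> j"
  shows "bd W \<beta> j (d - (j - i))"
  unfolding bd_def
proof
  fix v assume v: "v \<in> W j"
  have vc: "v \<in> carrier_vec m" using latticeD(1)[OF lat_familyD(1)[OF W] v] .
  have "tpow (j - i) \<cdot>\<^sub>v v \<in> W i" using fam_left[OF W v, of "nat (j - i)"] j by simp
  then have "\<beta> \<bullet> (tpow (j - i) \<cdot>\<^sub>v v) \<in> tO d" using b by (simp add: bd_def)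
  then show "\<beta> \<bullet> v \<in> tO (d - (j - i))" using scalar_prod_smult_distrib[OF \<beta> vc] by simp
qed

lemma bd_shift:
  assumes W: "lat_family k n m W" and \<beta>: "\<beta> \<in> carrier_vec m" and b: "bd W \<beta> i d"
  shows "bd W \<beta> (i + q * int n) (d - q * (int n - int k))"
  unfolding bd_def
proof
  fix v assume v: "v \<in> W (i + q * int n)"
  have vc: "v \<in> carrier_vec m" using latticeD(1)[OF lat_familyD(1)[OF W] v] .
  have "tpow (q * (int n - int k)) \<cdot>\<^sub>v v \<in> W i" using lat_family_shift[OF W vc] v by blast
  then have "\<beta> \<bullet> (tpow (q * (int n - int k)) \<cdot>\<^sub>v v) \<in> tO d" using b by (simp add: bd_def)
  then show "\<beta> \<bullet> v \<in> tO (d - q * (int n - int k))" using scalar_prod_smult_distrib[OF \<beta> vc] by simp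
qed

section \<open>The combinatorics of a subset with three peaks\<close>

locale three_peaks =
  fixes n :: nat and a b c :: int
  assumes gaps: "a + 2 \<le> b" "b + 2 \<le> c" "c + 2 \<le> a + int n"
begin

lemma n_ge: "6 \<le> n" using gaps by linarith

lemma rotate: "three_peaks n b c (a + int n)"
  using gaps by unfold_locales auto

definition r :: "int \<Rightarrow> int \<Rightarrow> int" where "r x i = (i - x) div int n"

lemma r_shift: "r x (i + q * int n) = r x i + q"
proof -
  have e: "i + q * int n - x = (i - x) + q * int n" by simp
  show ?thesis unfolding r_def e using n_ge by (subst div_mult_self1) auto
qed

lemma r_shift1: "r x (i + int n) = r x i + 1" using r_shift[of x i 1] by simp
lemma r_rot: "r (x + int n) i = r x i - 1" using r_shift[of x "i - int n" 1] n_ge by (simp add: r_def algebra_simps)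

lemma r_0: "x \<le> i \<Longrightarrow> i < x + int n \<Longrightarrow> r x i = 0"
  unfolding r_def by (intro div_pos_pos_trivial) auto

lemma r_m1: "x - int n \<le> i \<Longrightarrow> i < x \<Longrightarrow> r x i = -1"
  using r_0[of "x - int n" i] r_rot[of "x - int n" i] by simp

lemma r_step: "r x i = r x (i - 1) + (if int n dvd i - x then 1 else 0)"
proof -
  define j where "j = i - 1 - x"
  have "(j + 1) div int n = j div int n + (if int n dvd j + 1 then 1 else 0)"
  proof -
    have m: "0 \<le> j mod int n" "j mod int n < int n" using n_ge by auto
    have je: "j = j div int n * int n + j mod int n" by simp
    show ?thesis
    proof (cases "j mod int n = int n - 1")
      case True
      then have "j + 1 = j div int n * int n + int n" using je by linarith
      then have e: "j + 1 = (j div int n + 1) * int n" by (simp add: algebra_simps)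
      have "(j + 1) div int n = j div int n + 1" unfolding e using n_ge by simp
      moreover have "int n dvd j + 1" unfolding e by simp
      ultimately show ?thesis by simp
    next
      case False
      then have lt: "0 \<le> j mod int n + 1" "j mod int n + 1 < int n" using m by auto
      define q s where "q = j div int n" and "s = j mod int n"
      have e: "j + 1 = s + 1 + q * int n" using je by (simp add: q_def s_def)
      have s: "0 \<le> s + 1" "s + 1 < int n" using lt by (auto simp: s_def)
      have "(j + 1) div int n = q" unfolding e using s n_ge by simp
      moreover have "(j + 1) mod int n = s + 1" unfolding e using s by simp
      then have "\<not> int n dvd j + 1" using m by (simp add: dvd_eq_mod_eq_0 s_def)
      moreover note q_def
      ultimately show ?thesis by simp
    qed
  qed
  then show ?thesis by (simp add: r_def j_def algebra_simps)
qed

text \<open>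
  The numbers \<open>a < b < c < a + n\<close> are integer lifts of the elements of \<open>I\<close>. The function \<open>r x\<close> steps
  up by 1 at the lifts of \<open>x\<close>, and \<open>hI\<close>, \<open>hX\<close>, \<open>hY\<close> are rims of \<open>I\<close>, \<open>X\<close>, \<open>Y\<close>. Within a
  period, \<open>g1\<close>, \<open>g2\<close>, \<open>g3\<close> exceed \<open>hX\<close> by 1 on the intervals \<open>[a - 1, b - 3]\<close>, \<open>[b - 1, c - 3]\<close>,
  \<open>[c - 1, a + n - 3]\<close>, and \<open>k1\<close>, \<open>k2\<close>, \<open>k3\<close> on the same intervals without their first elements.
\<close>

definition hI where "hI i = - i + r a i + r b i + r c i"
definition hX where "hX i = - i - 1 + r (a - 2) i + r (b - 2) i + r (c - 2) i"
definition hY where "hY i = - i + r (a - 1) i + r (b - 1) i + r (c - 1) i"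
definition g1 where "g1 i = hX i + r (a - 1) i - r (b - 2) i"
definition g2 where "g2 i = hX i + r (b - 1) i - r (c - 2) i"
definition g3 where "g3 i = hX i + r (c - 1) i - r (a - 2) i + 1"
definition k1 where "k1 i = hX i + r a i - r (b - 2) i"
definition k2 where "k2 i = hX i + r b i - r (c - 2) i"
definition k3 where "k3 i = hX i + r c i - r (a - 2) i + 1"

lemmas h_defs = hI_def hX_def hY_def g1_def g2_def g3_def k1_def k2_def k3_def

lemma h_shift:
  "hI (i + q * int n) = hI i - q * (int n - 3)" "hX (i + q * int n) = hX i - q * (int n - 3)"
  "hY (i + q * int n) = hY i - q * (int n - 3)" "g1 (i + q * int n) = g1 i - q * (int n - 3)"
  "g2 (i + q * int n) = g2 i - q * (int n - 3)" "g3 (i + q * int n) = g3 i - q * (int n - 3)"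
  "k1 (i + q * int n) = k1 i - q * (int n - 3)" "k2 (i + q * int n) = k2 i - q * (int n - 3)"
  "k3 (i + q * int n) = k3 i - q * (int n - 3)"
  unfolding h_defs r_shift by (simp_all add: algebra_simps)

lemma h_shift1:
  "hI (i + int n) = hI i - (int n - 3)" "hX (i + int n) = hX i - (int n - 3)"
  "hY (i + int n) = hY i - (int n - 3)" "g1 (i + int n) = g1 i - (int n - 3)"
  "g2 (i + int n) = g2 i - (int n - 3)" "g3 (i + int n) = g3 i - (int n - 3)"
  "k1 (i + int n) = k1 i - (int n - 3)" "k2 (i + int n) = k2 i - (int n - 3)"
  "k3 (i + int n) = k3 i - (int n - 3)"
  using h_shift[of i 1] by simp_all

lemma r_val: "a - 2 \<le> p \<Longrightarrow> p < a - 2 + int n \<Longrightarrow> a - 2 \<le> x \<Longrightarrow> x \<le> a - 2 + int n \<Longrightarrow> r x p = (if p < x then -1 else 0)"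
  using r_0[of x p] r_m1[of x p] by auto

lemma h_val:
  assumes "a - 2 \<le> p" "p < a - 2 + int n"
  shows "hI p = - p - (if p < a then 1 else 0) - (if p < b then 1 else 0) - (if p < c then 1 else 0)"
    "hX p = - p - 1 - (if p < b - 2 then 1 else 0) - (if p < c - 2 then 1 else 0)"
    "hY p = - p - (if p < a - 1 then 1 else 0) - (if p < b - 1 then 1 else 0) - (if p < c - 1 then 1 else 0)"
    "g1 p = hX p - (if p < a - 1 then 1 else 0) + (if p < b - 2 then 1 else 0)"
    "g2 p = hX p - (if p < b - 1 then 1 else 0) + (if p < c - 2 then 1 else 0)"
    "g3 p = hX p - (if p < c - 1 then 1 else 0) + 1"
    "k1 p = hX p - (if p < a then 1 else 0) + (if p < b - 2 then 1 else 0)"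
    "k2 p = hX p - (if p < b then 1 else 0) + (if p < c - 2 then 1 else 0)"
    "k3 p = hX p - (if p < c then 1 else 0) + 1"
  using assms gaps unfolding h_defs by (simp_all add: r_val)

text \<open>All claims about vertices are reduced to the window of length \<open>n\<close> that
  begins at a - 2, where the piecewise formulas \<open>h_val\<close> hold.\<close>

lemma vertex:
  obtains p q where "i = p + q * int n" "a - 2 \<le> p" "p < a - 2 + int n"
proof -
  let ?q = "(i - (a - 2)) div int n"
  have "0 \<le> (i - (a - 2)) mod int n" "(i - (a - 2)) mod int n < int n" using n_ge by auto
  moreover have "(i - (a - 2)) mod int n = i - (a - 2) - ?q * int n" by (simp add: minus_div_mult_eq_mod)
  ultimately show ?thesis by (intro that[of "i - ?q * int n" ?q]) auto
qed

lemma not_dvd_close: "0 < d \<Longrightarrow> d < int n \<Longrightarrow> \<not> int n dvd d"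
  by (auto dest: zdvd_imp_le)

text \<open>Since x, y, z lie within less than one period, at most one of the three counters jumps
  at a vertex, so the slope is 0 or -1.\<close>

lemma rimfun3:
  assumes g: "\<And>i. g i = - i + e + r x i + r y i + r z i" and xyz: "x < y" "y < z" "z < x + int n"
  shows "rimfun 3 n g" "g i = (if int n dvd i - x \<or> int n dvd i - y \<or> int n dvd i - z then g (i - 1) else g (i - 1) - 1)"
proof -
  have d: "\<not> (int n dvd i - u \<and> int n dvd i - v)" if "u < v" "v < u + int n" for u v i
  proof
    assume "int n dvd i - u \<and> int n dvd i - v"
    then have "int n dvd (i - u) - (i - v)" by (blast intro: dvd_diff)
    then show False using not_dvd_close[of "v - u"] that by simp
  qed
  have step: "g i = (if int n dvd i - x \<or> int n dvd i - y \<or> int n dvd i - z then g (i - 1) else g (i - 1) - 1)" for i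
    using d[of x y i] d[of y z i] d[of x z i] xyz unfolding g r_step[of x i] r_step[of y i] r_step[of z i] by auto
  then show "g i = (if int n dvd i - x \<or> int n dvd i - y \<or> int n dvd i - z then g (i - 1) else g (i - 1) - 1)" .
  have "g i \<le> g (i - 1) \<and> g (i - 1) \<le> g i + 1" for i using step[of i] by (auto split: if_splits)
  moreover have "g (i + int n) = g i - (int n - int 3)" for i unfolding g r_shift1 by simp
  ultimately show "rimfun 3 n g" unfolding rimfun_def by blast
qed

lemma rimfun_hI: "rimfun 3 n hI" by (rule rimfun3[of _ 0 a b c]) (use gaps in \<open>auto simp: h_defs\<close>)
lemma rimfun_hX: "rimfun 3 n hX" by (rule rimfun3[of _ "-1" "a - 2" "b - 2" "c - 2"]) (use gaps in \<open>auto simp: h_defs\<close>)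
lemma rimfun_hY: "rimfun 3 n hY" by (rule rimfun3[of _ 0 "a - 1" "b - 1" "c - 1"]) (use gaps in \<open>auto simp: h_defs\<close>)
text \<open>So \<open>g1\<close> is itself a rim, that of \<open>X\<close> with b - 2 exchanged for
  a - 1. In the same way \<open>g2\<close> exchanges c - 2 for b - 1 and \<open>g3\<close> exchanges
  a - 2 for c - 1, while the \<open>k\<close> functions bring in a, b, c instead.\<close>

lemma rimfun_g1: "rimfun 3 n g1" by (rule rimfun3[of _ "-1" "a - 2" "a - 1" "c - 2"]) (use gaps in \<open>auto simp: h_defs\<close>)
lemma rimfun_g2: "rimfun 3 n g2" by (rule rimfun3[of _ "-1" "a - 2" "b - 2" "b - 1"]) (use gaps in \<open>auto simp: h_defs\<close>)
lemma rimfun_g3: "rimfun 3 n g3" by (rule rimfun3[of _ 0 "b - 2" "c - 2" "c - 1"]) (use gaps in \<open>auto simp: h_defs\<close>)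
lemma rimfun_k1: "rimfun 3 n k1" by (rule rimfun3[of _ "-1" "a - 2" "a" "c - 2"]) (use gaps in \<open>auto simp: h_defs\<close>)
lemma rimfun_k2: "rimfun 3 n k2" by (rule rimfun3[of _ "-1" "a - 2" "b - 2" "b"]) (use gaps in \<open>auto simp: h_defs\<close>)
lemma rimfun_k3: "rimfun 3 n k3" by (rule rimfun3[of _ 0 "b - 2" "c - 2" "c"]) (use gaps in \<open>auto simp: h_defs\<close>)

lemma h_le:
  "hX i \<le> hI i" "hI i \<le> hY i" "hY i \<le> hX i + 1" "hX i \<le> g1 i" "g1 i \<le> hY i" "hX i \<le> g2 i" "g2 i \<le> hY i" "hX i \<le> g3 i" "g3 i \<le> hY i"
  "hY i = max (g1 i) (max (g2 i) (g3 i))"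
  "hX i \<le> k1 i" "k1 i \<le> hI i" "hX i \<le> k2 i" "k2 i \<le> hI i" "hX i \<le> k3 i" "k3 i \<le> hI i"
  "k1 i \<le> g1 i" "k2 i \<le> g2 i" "k3 i \<le> g3 i" "hI i = max (k1 i) (max (k2 i) (k3 i))"
proof -
  obtain p q where p: "i = p + q * int n" "a - 2 \<le> p" "p < a - 2 + int n" using vertex .
  note v = h_val[OF p(2,3)]
  show "hX i \<le> hI i" "hI i \<le> hY i" "hY i \<le> hX i + 1" "hX i \<le> g1 i" "g1 i \<le> hY i" "hX i \<le> g2 i" "g2 i \<le> hY i" "hX i \<le> g3 i" "g3 i \<le> hY i"
    "hY i = max (g1 i) (max (g2 i) (g3 i))"
    "hX i \<le> k1 i" "k1 i \<le> hI i" "hX i \<le> k2 i" "k2 i \<le> hI i" "hX i \<le> k3 i" "k3 i \<le> hI i"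
    "k1 i \<le> g1 i" "k2 i \<le> g2 i" "k3 i \<le> g3 i" "hI i = max (k1 i) (max (k2 i) (k3 i))"
    unfolding p(1) h_shift unfolding v using gaps p by auto
qed

text \<open>From the peak a - 1 the bound on \<beta>1 is kept to the left and decreases by one per
  step to the right, which agrees with \<open>g1\<close> up to c - 3. At c - 2 the rim
  \<open>g1\<close> does not drop, and the better bound comes from \<beta>1 being the sum minus
  \<beta>2 and \<beta>3. The offset \<open>e\<close> allows for rotated lifts, whose rims are
  normalised differently.\<close>

lemma bd_g1:
  assumes W: "lat_family 3 n m W" and C: "\<beta>1 \<in> carrier_vec m" "\<beta>2 \<in> carrier_vec m" "\<beta>3 \<in> carrier_vec m"
    and \<eta>: "bd W (\<beta>1 + \<beta>2 + \<beta>3) (c - 2) (hI (c - 2) + e)"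
    and B: "bd W \<beta>1 (a - 1) (hI (a - 1) + 1 + e)" "bd W \<beta>2 (b - 1) (hI (b - 1) + 1 + e)" "bd W \<beta>3 (c - 1) (hI (c - 1) + 1 + e)"
  shows "bd W \<beta>1 i (g1 i + e)"
proof -
  obtain p q where p: "i = p + q * int n" "a - 2 \<le> p" "p < a - 2 + int n" using vertex .
  note v = h_val[OF p(2,3)]
  have vc: "hI (c - 2) = - c + 1" "hI (c - 1) = - c" "hI (b - 1) = - b - 1" "hI (a - 1) = - a - 2"
    using gaps by (simp_all add: h_val)
  have b2: "bd W \<beta>2 (c - 2) (- c + 1 + e)" by (rule bd_mono[OF bd_right[OF W C(2) B(2), of "c - 2"]]) (use gaps vc in auto)
  have b3: "bd W \<beta>3 (c - 2) (- c + 1 + e)" by (rule bd_mono[OF bd_left[OF W B(3), of "c - 2"]]) (use gaps vc in auto)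
  \<comment> \<open>At c - 2 the other two functionals still satisfy the bound of \<open>hI\<close>:
    \<beta>2 after its descent from b - 1, and \<beta>3 by moving left from c - 1.\<close>
  have b1: "bd W \<beta>1 (c - 2) (- c + 1 + e)" unfolding bd_def
  proof
    fix v assume v: "v \<in> W (c - 2)"
    have vC: "v \<in> carrier_vec m" using latticeD(1)[OF lat_familyD(1)[OF W] v] .
    have "(\<beta>1 + \<beta>2 + \<beta>3) \<bullet> v - \<beta>2 \<bullet> v - \<beta>3 \<bullet> v \<in> tO (- c + 1 + e)"
      using \<eta> b2 b3 v vc by (intro tO_diff) (auto simp: bd_def)
    then show "\<beta>1 \<bullet> v \<in> tO (- c + 1 + e)" using C vC
      by (simp add: add_scalar_prod_distrib[of _ m])
  qed
  have "bd W \<beta>1 p (g1 p + e)"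
  proof -
    consider "p = a - 2" | "a - 1 \<le> p" "p \<le> c - 3" | "c - 2 \<le> p" using p by linarith
    then show ?thesis
    proof cases
      case 1
      show ?thesis by (rule bd_mono[OF bd_left[OF W B(1), of p]]) (use 1 gaps vc v in auto)
    next
      case 2
      show ?thesis by (rule bd_mono[OF bd_right[OF W C(1) B(1), of p]]) (use 2 gaps vc v in auto)
    next
      case 3
      show ?thesis by (rule bd_mono[OF bd_right[OF W C(1) b1, of p]]) (use 3 gaps vc v p in auto)
    qed
  qed
  from bd_shift[OF W C(1) this, of q] show ?thesis unfolding p(1) h_shift by (simp add: algebra_simps)
qed

end

text \<open>Replacing \<open>a\<close> by a + n lowers its counter by 1 everywhere, so all rims
  shift by the same constant while the three segments are permuted cyclically. Statements about
  \<open>g1\<close> thereby yield those about \<open>g2\<close> and \<open>g3\<close>, with offsets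
  1 and 2 in \<open>bd_g1\<close>.\<close>

lemma (in three_peaks) h_rotate:
  "three_peaks.hI n b c (a + int n) i = hI i - 1" "three_peaks.hX n b c (a + int n) i = hX i - 1"
  "three_peaks.g1 n b c (a + int n) i = g2 i - 1" "three_peaks.g2 n b c (a + int n) i = g3 i - 1"
  "three_peaks.g3 n b c (a + int n) i = g1 i - 1"
proof -
  interpret R: three_peaks n b c "a + int n" by (rule rotate)
  have e: "a + int n - 2 = (a - 2) + int n" "a + int n - 1 = (a - 1) + int n" by auto
  have "R.r = r" by (simp add: fun_eq_iff R.r_def r_def)
  then show "R.hI i = hI i - 1" "R.hX i = hX i - 1" "R.g1 i = g2 i - 1" "R.g2 i = g3 i - 1" "R.g3 i = g1 i - 1"
    unfolding R.h_defs h_defs e by (simp_all add: r_rot)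
qed

lemma (in three_peaks) bd_all:
  assumes W: "lat_family 3 n m W" and C: "\<beta>1 \<in> carrier_vec m" "\<beta>2 \<in> carrier_vec m" "\<beta>3 \<in> carrier_vec m"
    and \<eta>: "\<And>i. bd W (\<beta>1 + \<beta>2 + \<beta>3) i (hI i)"
    and B: "bd W \<beta>1 (a - 1) (hI (a - 1) + 1)" "bd W \<beta>2 (b - 1) (hI (b - 1) + 1)" "bd W \<beta>3 (c - 1) (hI (c - 1) + 1)"
  shows "bd W \<beta>1 i (g1 i)" "bd W \<beta>2 i (g2 i)" "bd W \<beta>3 i (g3 i)"
proof -
  interpret R: three_peaks n b c "a + int n" by (rule rotate)
  interpret S: three_peaks n c "a + int n" "b + int n" by (rule R.rotate)
  have e: "a + int n - 1 = (a - 1) + 1 * int n" "b + int n - 1 = (b - 1) + 1 * int n" by auto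
  have B1: "bd W \<beta>1 (a + int n - 1) (hI (a + int n - 1) + 1)"
    using bd_shift[OF W C(1) B(1), of 1] unfolding e h_shift by (simp add: algebra_simps)
  have B2: "bd W \<beta>2 (b + int n - 1) (hI (b + int n - 1) + 1)"
    using bd_shift[OF W C(2) B(2), of 1] unfolding e h_shift by (simp add: algebra_simps)
  have p1: "\<beta>2 + \<beta>3 + \<beta>1 = \<beta>1 + \<beta>2 + \<beta>3" "\<beta>3 + \<beta>1 + \<beta>2 = \<beta>1 + \<beta>2 + \<beta>3" using C by (auto intro!: eq_vecI)
  show "bd W \<beta>1 i (g1 i)" using bd_g1[OF W C, of 0] \<eta> B by simp
  show "bd W \<beta>2 i (g2 i)"
    using R.bd_g1[OF W C(2,3,1), of 1 i] p1 \<eta>[of "a + int n - 2"] B B1 by (simp add: h_rotate)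
  show "bd W \<beta>3 i (g3 i)"
    using S.bd_g1[OF W C(3,1,2), of 2 i] p1 \<eta>[of "b + int n - 2"] B B1 B2 by (simp add: h_rotate R.h_rotate add.commute)
qed

section \<open>The lattices of the rank 2 module and of the middle term\<close>

lemma sum2: "(\<Sum>i = 0..<2::nat. f i) = f 0 + (f 1 :: 'a :: comm_monoid_add)"
  by (simp add: numeral_2_eq_2)

lemma sum3: "(\<Sum>i = 0..<3::nat. f i) = f 0 + f 1 + (f 2 :: 'a :: comm_monoid_add)"
  by (simp add: numeral_3_eq_3 numeral_2_eq_2)

lemma less2: "l < (2::nat) \<longleftrightarrow> l = 0 \<or> l = 1" by auto
lemma less3: "l < (3::nat) \<longleftrightarrow> l = 0 \<or> l = 1 \<or> l = 2" by auto

definition vec2 :: "'a \<Rightarrow> 'a \<Rightarrow> 'a vec" where "vec2 x y = vec 2 (\<lambda>l. if l = 0 then x else y)"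
definition vec3 :: "'a \<Rightarrow> 'a \<Rightarrow> 'a \<Rightarrow> 'a vec" where "vec3 x y z = vec 3 (\<lambda>l. if l = 0 then x else if l = 1 then y else z)"

lemma vec2_simps [simp]: "vec2 x y \<in> carrier_vec 2" "vec2 x y $ 0 = x" "vec2 x y $ 1 = y" "vec2 x y $ Suc 0 = y" "dim_vec (vec2 x y) = 2"
  by (auto simp: vec2_def)
lemma vec3_simps [simp]: "vec3 x y z \<in> carrier_vec 3" "vec3 x y z $ 0 = x" "vec3 x y z $ 1 = y" "vec3 x y z $ Suc 0 = y" "vec3 x y z $ 2 = z" "dim_vec (vec3 x y z) = 3"
  by (auto simp: vec3_def)

lemma vec2_eta: "v \<in> carrier_vec 2 \<Longrightarrow> vec2 (v $ 0) (v $ 1) = v"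
  by (intro eq_vecI) (auto simp: less2)
lemma vec3_eta: "v \<in> carrier_vec 3 \<Longrightarrow> vec3 (v $ 0) (v $ 1) (v $ 2) = v"
  by (intro eq_vecI) (auto simp: less3)

lemma vec2_scalar: "v \<in> carrier_vec 2 \<Longrightarrow> vec2 x y \<bullet> v = x * v $ 0 + y * (v $ 1 :: 'a :: comm_ring_1)"
  by (simp add: scalar_prod_def sum2)
lemma vec3_scalar: "v \<in> carrier_vec 3 \<Longrightarrow> vec3 x y z \<bullet> v = x * v $ 0 + y * v $ 1 + z * (v $ 2 :: 'a :: comm_ring_1)"
  by (simp add: scalar_prod_def sum3)

lemma unit_vec2: "unit_vec 2 0 = vec2 1 0" "unit_vec 2 1 = vec2 0 1" "unit_vec 2 (Suc 0) = vec2 0 (1::'a::comm_ring_1)"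
  by (auto intro!: eq_vecI simp: less2)
lemma unit_vec3: "unit_vec 3 0 = vec3 1 0 0" "unit_vec 3 1 = vec3 0 1 0" "unit_vec 3 (Suc 0) = vec3 0 1 0" "unit_vec 3 2 = vec3 0 0 (1::'a::comm_ring_1)"
  by (auto intro!: eq_vecI simp: less3)

definition line_lat :: "(int \<Rightarrow> int) \<Rightarrow> int \<Rightarrow> complex fls vec set" where
  "line_lat h i = {v \<in> carrier_vec 1. v $ 0 \<in> tO (h i)}"

lemma line_lat_family: "rimfun k n h \<Longrightarrow> lat_family k n 1 (line_lat h)"
proof -
  assume h: "rimfun k n h"
  have "line_lat h = flat 1 [(unit_vec 1 0, h)]"
    by (intro ext) (auto simp: line_lat_def flat_def scalar_prod_left_unit)
  then show ?thesis using h by (auto intro!: flat_family)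
qed

context three_peaks
begin

text \<open>\<open>LN\<close> is the chain of \<open>L\<^sub>X|L\<^sub>Y\<close> and \<open>LM\<close> that of the middle term; the inclusion is
  \<open>(v\<^sub>0, v\<^sub>1) \<mapsto> (v\<^sub>0, v\<^sub>1, - v\<^sub>0 - v\<^sub>1)\<close>.\<close>

definition LN :: "int \<Rightarrow> complex fls vec set" where
  "LN i = {v \<in> carrier_vec 2. v $ 0 \<in> tO (g1 i) \<and> v $ 1 \<in> tO (g2 i) \<and> v $ 0 + v $ 1 \<in> tO (g3 i)}"

definition LM :: "int \<Rightarrow> complex fls vec set" where
  "LM i = {v \<in> carrier_vec 3. v $ 0 \<in> tO (g1 i) \<and> v $ 1 \<in> tO (g2 i) \<and> v $ 2 \<in> tO (g3 i) \<and> v $ 0 + v $ 1 + v $ 2 \<in> tO (hI i)}"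

lemma LN_family: "lat_family 3 n 2 LN"
proof -
  have "LN = flat 2 [(vec2 1 0, g1), (vec2 0 1, g2), (vec2 1 1, g3)]"
    by (intro ext) (auto simp: LN_def flat_def vec2_scalar)
  moreover have "lat_family 3 n 2 (flat 2 [(vec2 1 0, g1), (vec2 0 1, g2), (vec2 1 1, g3)])"
    by (rule flat_family) (auto simp: rimfun_g1 rimfun_g2 rimfun_g3 less2 unit_vec2)
  ultimately show ?thesis by simp
qed

lemma LM_family: "lat_family 3 n 3 LM"
proof -
  have "LM = flat 3 [(vec3 1 0 0, g1), (vec3 0 1 0, g2), (vec3 0 0 1, g3), (vec3 1 1 1, hI)]"
    by (intro ext) (auto simp: LM_def flat_def vec3_scalar)
  moreover have "lat_family 3 n 3 (flat 3 [(vec3 1 0 0, g1), (vec3 0 1 0, g2), (vec3 0 0 1, g3), (vec3 1 1 1, hI)])"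
    by (rule flat_family) (auto simp: rimfun_g1 rimfun_g2 rimfun_g3 rimfun_hI less3 unit_vec3)
  ultimately show ?thesis by simp
qed

section \<open>Vectors defining morphisms from \<open>L_I\<close>, tested at the peaks\<close>

lemma transfer_left:
  assumes W: "lat_family 3 n m W" and s: "tpow (hI j) \<cdot>\<^sub>v s \<in> W j" and p: "p \<le> j" "hI p = hI j + (j - p)"
  shows "tpow (hI p) \<cdot>\<^sub>v s \<in> W p"
  using fam_left[OF W s, of "nat (j - p)"] p by (simp add: smult_smult_assoc tpow_add[symmetric] add.commute)

lemma transfer_shift:
  assumes W: "lat_family 3 n m W" and s: "s \<in> carrier_vec m"
  shows "tpow (hI (i + q * int n)) \<cdot>\<^sub>v s \<in> W (i + q * int n) \<longleftrightarrow> tpow (hI i) \<cdot>\<^sub>v s \<in> W i"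
proof -
  have "tpow (q * (int n - int 3)) \<cdot>\<^sub>v (tpow (hI (i + q * int n)) \<cdot>\<^sub>v s) = tpow (hI i) \<cdot>\<^sub>v s"
    unfolding smult_smult_assoc tpow_add[symmetric] h_shift by simp
  then show ?thesis using lat_family_shift[OF W, of "tpow (hI (i + q * int n)) \<cdot>\<^sub>v s" i q] s by simp
qed

text \<open>Each vertex depends on one peak only, the next one at or to the right of it. The
  hypotheses are kept separate because the vectors in \<open>left_lattice\<close> are controlled at
  some of the peaks only. For \<open>c \<le> p\<close> the relevant peak is a - 1 in the next
  period.\<close>

lemma transfer_block:
  assumes W: "lat_family 3 n m W" and s: "s \<in> carrier_vec m" and p: "a - 2 \<le> p" "p < a - 2 + int n"
    and 1: "p < a \<or> c \<le> p \<Longrightarrow> tpow (hI (a - 1)) \<cdot>\<^sub>v s \<in> W (a - 1)"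
    and 2: "a \<le> p \<Longrightarrow> p < b \<Longrightarrow> tpow (hI (b - 1)) \<cdot>\<^sub>v s \<in> W (b - 1)"
    and 3: "b \<le> p \<Longrightarrow> p < c \<Longrightarrow> tpow (hI (c - 1)) \<cdot>\<^sub>v s \<in> W (c - 1)"
  shows "tpow (hI p) \<cdot>\<^sub>v s \<in> W p"
proof -
  have v: "hI (c - 1) = - c" "hI (b - 1) = - b - 1" "hI (a - 1) = - a - 2"
    using gaps by (simp_all add: h_val)
  have v1: "hI (a - 1 + int n) = hI (a - 1) - (int n - 3)" using h_shift1(1)[of "a - 1"] by simp
  consider "p < a" | "a \<le> p" "p < b" | "b \<le> p" "p < c" | "c \<le> p" by linarith
  then show ?thesis
  proof cases
    case 1
    have T: "tpow (hI (a - 1)) \<cdot>\<^sub>v s \<in> W (a - 1)" using assms(5) 1 by blast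
    have e: "hI p = hI (a - 1) + (a - 1 - p)" unfolding v h_val[OF p] using gaps p 1 by auto
    show ?thesis by (rule transfer_left[OF W T _ e]) (use 1 p in auto)
  next
    case 2
    have T: "tpow (hI (b - 1)) \<cdot>\<^sub>v s \<in> W (b - 1)" using assms(6) 2 by blast
    have e: "hI p = hI (b - 1) + (b - 1 - p)" unfolding v h_val[OF p] using gaps p 2 by auto
    show ?thesis by (rule transfer_left[OF W T _ e]) (use 2 p in auto)
  next
    case 3
    have T: "tpow (hI (c - 1)) \<cdot>\<^sub>v s \<in> W (c - 1)" using assms(7) 3 by blast
    have e: "hI p = hI (c - 1) + (c - 1 - p)" unfolding v h_val[OF p] using gaps p 3 by auto
    show ?thesis by (rule transfer_left[OF W T _ e]) (use 3 p in auto)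
  next
    case 4
    have T: "tpow (hI (a - 1 + int n)) \<cdot>\<^sub>v s \<in> W (a - 1 + int n)"
      using transfer_shift[OF W s, of "a - 1" 1] assms(5) 4 by simp
    have e: "hI p = hI (a - 1 + int n) + (a - 1 + int n - p)" unfolding v1 v h_val[OF p] using gaps p 4 by auto
    show ?thesis by (rule transfer_left[OF W T _ e]) (use 4 p in auto)
  qed
qed

lemma transfer_all:
  assumes W: "lat_family 3 n m W" and s: "s \<in> carrier_vec m"
    "tpow (hI (a - 1)) \<cdot>\<^sub>v s \<in> W (a - 1)" "tpow (hI (b - 1)) \<cdot>\<^sub>v s \<in> W (b - 1)" "tpow (hI (c - 1)) \<cdot>\<^sub>v s \<in> W (c - 1)"
  shows "tpow (hI i) \<cdot>\<^sub>v s \<in> W i"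
proof -
  obtain p q where p: "i = p + q * int n" "a - 2 \<le> p" "p < a - 2 + int n" using vertex .
  show ?thesis unfolding p(1) transfer_shift[OF W s(1)]
    by (rule transfer_block[OF W s(1) p(2,3) s(2,3,4)])
qed

text \<open>A vector that belongs to this lattice at every vertex is the image of 1 under a morphism
  from \<open>L_I\<close> to the chain.\<close>

definition Sl where "Sl m W j = {s \<in> carrier_vec m. tpow (hI j) \<cdot>\<^sub>v s \<in> W j}"

lemma Sl_lattice: "lat_family 3 n m W \<Longrightarrow> lattice m (Sl m W j)"
  unfolding Sl_def by (rule lattice_scale) (rule lat_familyD(1))

text \<open>The factor t raises integrality on the rescaled lattice to order
  \<open>hI j + 1\<close>, which at the j-th peak is the value of g_j.\<close>

lemma dual_Sl_bd:
  assumes W: "lat_family 3 n m W" and \<beta>: "\<beta> \<in> dual m (Sl m W j)"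
  shows "bd W (tpow 1 \<cdot>\<^sub>v \<beta>) j (hI j + 1)"
  unfolding bd_def
proof
  fix v assume v: "v \<in> W j"
  have vc: "v \<in> carrier_vec m" using latticeD(1)[OF lat_familyD(1)[OF W] v] .
  have \<beta>c: "\<beta> \<in> carrier_vec m" using \<beta> by (simp add: dual_def)
  have "tpow (hI j) \<cdot>\<^sub>v (tpow (- hI j) \<cdot>\<^sub>v v) = v" by (simp add: smult_smult_assoc)
  then have "tpow (- hI j) \<cdot>\<^sub>v v \<in> Sl m W j" using v vc by (simp add: Sl_def)
  then have "\<beta> \<bullet> (tpow (- hI j) \<cdot>\<^sub>v v) \<in> tO 0" using \<beta> by (auto simp: dual_def)
  then show "(tpow 1 \<cdot>\<^sub>v \<beta>) \<bullet> v \<in> tO (hI j + 1)"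
    using scalar_prod_smult_distrib[OF \<beta>c vc] smult_scalar_prod_distrib[OF \<beta>c vc] by simp
qed

lemma right_lattice:
  assumes W: "lat_family 3 n m W" and \<eta>: "\<eta> \<in> carrier_vec m" "\<And>i. bd W \<eta> i (hI i)"
  obtains s where "s \<in> carrier_vec m" "\<And>i. tpow (hI i) \<cdot>\<^sub>v s \<in> W i" "\<eta> \<bullet> s = 1"
  | \<beta>1 \<beta>2 \<beta>3 where "\<beta>1 \<in> carrier_vec m" "\<beta>2 \<in> carrier_vec m" "\<beta>3 \<in> carrier_vec m" "\<eta> = \<beta>1 + \<beta>2 + \<beta>3"
     "\<And>i. bd W \<beta>1 i (g1 i)" "\<And>i. bd W \<beta>2 i (g2 i)" "\<And>i. bd W \<beta>3 i (g3 i)"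
proof -
  note L = Sl_lattice[OF W]
  have S_all: "tpow (hI i) \<cdot>\<^sub>v s \<in> W i" if "s \<in> Sl m W (a - 1)" "s \<in> Sl m W (b - 1)" "s \<in> Sl m W (c - 1)" for s i
    by (rule transfer_all[OF W]) (use that in \<open>auto simp: Sl_def\<close>)
  show ?thesis
  proof (cases "\<exists>s\<in>Sl m W (a - 1) \<inter> Sl m W (b - 1) \<inter> Sl m W (c - 1). \<eta> \<bullet> s \<notin> tO 1")
    case True
    then obtain s where s: "s \<in> Sl m W (a - 1)" "s \<in> Sl m W (b - 1)" "s \<in> Sl m W (c - 1)" "\<eta> \<bullet> s \<notin> tO 1" by blast
    have sc: "s \<in> carrier_vec m" using s by (simp add: Sl_def)
    have "\<eta> \<bullet> (tpow (hI a) \<cdot>\<^sub>v s) \<in> tO (hI a)" using \<eta>(2)[of a] S_all[OF s(1-3), of a] by (simp add: bd_def)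
    then have u: "\<eta> \<bullet> s \<in> tO 0" using scalar_prod_smult_distrib[OF \<eta>(1) sc] by simp
    note inv = tO_inverse[OF u s(4)]
    let ?s = "inverse (\<eta> \<bullet> s) \<cdot>\<^sub>v s"
    have 1: "\<eta> \<bullet> ?s = 1" using scalar_prod_smult_distrib[OF \<eta>(1) sc] inv by simp
    have 2: "tpow (hI i) \<cdot>\<^sub>v ?s \<in> W i" for i
      by (rule S_all) (use latticeD(3)[OF L inv(1)] s in auto)
    show ?thesis by (rule that(1)[OF _ 2 1]) (use sc in simp)
  next
    case False
    \<comment> \<open>Values in \<open>tO 1\<close> become integral after division by t; the factor
      t returns with \<open>dual_Sl_bd\<close>, separately for each summand.\<close>
    have "tpow (-1) \<cdot>\<^sub>v \<eta> \<in> dual m (Sl m W (a - 1) \<inter> Sl m W (b - 1) \<inter> Sl m W (c - 1))"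
      unfolding dual_def
    proof (intro CollectI conjI ballI)
      fix s assume s: "s \<in> Sl m W (a - 1) \<inter> Sl m W (b - 1) \<inter> Sl m W (c - 1)"
      then have sc: "s \<in> carrier_vec m" by (simp add: Sl_def)
      have "\<eta> \<bullet> s \<in> tO 1" using False s by blast
      then show "(tpow (-1) \<cdot>\<^sub>v \<eta>) \<bullet> s \<in> tO 0" using smult_scalar_prod_distrib[OF \<eta>(1) sc] by simp
    qed (use \<eta> in simp)
    from dual_Int3[OF L L L this] obtain \<gamma>1 \<gamma>2 \<gamma>3 where \<gamma>: "\<gamma>1 \<in> dual m (Sl m W (a - 1))" "\<gamma>2 \<in> dual m (Sl m W (b - 1))"
      "\<gamma>3 \<in> dual m (Sl m W (c - 1))" "tpow (-1) \<cdot>\<^sub>v \<eta> = \<gamma>1 + \<gamma>2 + \<gamma>3" .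
    have c: "\<gamma>1 \<in> carrier_vec m" "\<gamma>2 \<in> carrier_vec m" "\<gamma>3 \<in> carrier_vec m" using \<gamma> by (auto simp: dual_def)
    have e: "\<eta> = tpow 1 \<cdot>\<^sub>v \<gamma>1 + tpow 1 \<cdot>\<^sub>v \<gamma>2 + tpow 1 \<cdot>\<^sub>v \<gamma>3"
    proof -
      have "\<eta> = tpow 1 \<cdot>\<^sub>v (tpow (-1) \<cdot>\<^sub>v \<eta>)" by (simp add: smult_smult_assoc)
      also have "\<dots> = tpow 1 \<cdot>\<^sub>v \<gamma>1 + tpow 1 \<cdot>\<^sub>v \<gamma>2 + tpow 1 \<cdot>\<^sub>v \<gamma>3" unfolding \<gamma>(4)
        using c by (intro eq_vecI) (auto simp: algebra_simps)
      finally show ?thesis .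
    qed
    have sc: "tpow 1 \<cdot>\<^sub>v \<gamma>1 \<in> carrier_vec m" "tpow 1 \<cdot>\<^sub>v \<gamma>2 \<in> carrier_vec m" "tpow 1 \<cdot>\<^sub>v \<gamma>3 \<in> carrier_vec m" using c by auto
    have \<eta>': "\<And>i. bd W (tpow 1 \<cdot>\<^sub>v \<gamma>1 + tpow 1 \<cdot>\<^sub>v \<gamma>2 + tpow 1 \<cdot>\<^sub>v \<gamma>3) i (hI i)" using \<eta>(2) e by simp
    note all = bd_all[OF W sc \<eta>' dual_Sl_bd[OF W \<gamma>(1)] dual_Sl_bd[OF W \<gamma>(2)] dual_Sl_bd[OF W \<gamma>(3)]]
    show ?thesis by (rule that(2)[OF sc e all])
  qed
qed

lemma LN_bounds:
  "v \<in> LN i \<Longrightarrow> v $ 0 \<in> tO (hX i)" "v \<in> LN i \<Longrightarrow> v $ 1 \<in> tO (hX i)"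
  using h_le(4,6)[of i] by (auto simp: LN_def elim: tO_mono)

text \<open>At a - 2 the three bounds coincide, so \<open>LN\<close> is there a multiple of the
  standard lattice. At each peak exactly one of them is larger by one, and \<open>LN\<close> singles
  out a line modulo t.\<close>

lemma h_peaks:
  "hX (a - 2) = g1 (a - 2)" "hX (a - 2) = g2 (a - 2)" "hX (a - 2) = g3 (a - 2)"
  "g1 (a - 1) = hX (a - 1) + 1" "g2 (a - 1) = hX (a - 1)" "g3 (a - 1) = hX (a - 1)"
  "g2 (b - 1) = hX (b - 1) + 1" "g1 (b - 1) = hX (b - 1)" "g3 (b - 1) = hX (b - 1)"
  "g3 (c - 1) = hX (c - 1) + 1" "g1 (c - 1) = hX (c - 1)" "g2 (c - 1) = hX (c - 1)"
  "hI (a - 1) = hX (a - 1)" "hI (b - 1) = hX (b - 1)" "hI (c - 1) = hX (c - 1)" "hI (a - 2) = hX (a - 2)"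
  using gaps by (simp_all add: h_val)

text \<open>The endomorphism ring consists of the matrices that are scalar modulo t, a local ring.
  Integrality is read off at a - 2; at the three peaks the reduction must preserve the lines spanned
  by (0,1), (1,0) and (1,-1), and a linear map of the plane with three invariant lines is a
  scalar.\<close>

lemma LN_endo:
  "(\<forall>i. \<forall>v\<in>LN i. vec2 (p * v $ 0 + q * v $ 1) (u * v $ 0 + s * v $ 1) \<in> LN i) \<longleftrightarrow>
   p \<in> tO 0 \<and> s \<in> tO 0 \<and> q \<in> tO 1 \<and> u \<in> tO 1 \<and> p - s \<in> tO 1" (is "?L \<longleftrightarrow> ?R")
proof
  assume L: ?L
  have L': "vec2 (p * x + q * y) (u * x + s * y) \<in> LN i" if "vec2 x y \<in> LN i" for x y i
    using L[rule_format, OF that] by simp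
  have 1: "vec2 (tpow (hX (a - 2))) 0 \<in> LN (a - 2)" "vec2 0 (tpow (hX (a - 2))) \<in> LN (a - 2)"
    using h_peaks(1-3) by (auto simp: LN_def)
  have 2: "vec2 0 (tpow (hX (a - 1))) \<in> LN (a - 1)" using h_peaks(4-6) by (auto simp: LN_def)
  have 3: "vec2 (tpow (hX (b - 1))) 0 \<in> LN (b - 1)" using h_peaks(7-9) by (auto simp: LN_def)
  have 4: "vec2 (tpow (hX (c - 1))) (- tpow (hX (c - 1))) \<in> LN (c - 1)" using h_peaks(10-12) by (auto simp: LN_def)
  have p: "p \<in> tO 0" and s: "s \<in> tO 0" using L'[OF 1(1)] L'[OF 1(2)] h_peaks(1-3)
    by (auto simp: LN_def mult.commute[of _ "tpow _"])
  have q: "q \<in> tO 1" using L'[OF 2] h_peaks(4-6) by (auto simp: LN_def mult.commute[of _ "tpow _"])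
  have u: "u \<in> tO 1" using L'[OF 3] h_peaks(7-9) by (auto simp: LN_def mult.commute[of _ "tpow _"])
  have "tpow (hX (c - 1)) * ((p - q) + (u - s)) \<in> tO (hX (c - 1) + 1)"
    using L'[OF 4] h_peaks(10) by (simp add: LN_def algebra_simps)
  then have "(p - q) + (u - s) \<in> tO 1" by simp
  then have "(p - q) + (u - s) + q - u \<in> tO 1" using q u tO_add tO_diff by blast
  then show ?R using p s q u by (simp add: algebra_simps)
next
  assume R: ?R
  show ?L
  proof (intro allI ballI)
    fix i v assume v: "v \<in> LN i"
    have vc: "v $ 0 \<in> tO (g1 i)" "v $ 1 \<in> tO (g2 i)" "v $ 0 + v $ 1 \<in> tO (g3 i)" using v by (auto simp: LN_def)
    have small: "x * v $ l \<in> tO (hX i + 1)" if "x \<in> tO 1" "l = 0 \<or> l = 1" for x l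
      using tO_mult[OF that(1), of "v $ l" "hX i"] LN_bounds[OF v] that(2) by (auto simp: add.commute)
    have m: "hX i + 1 \<ge> g1 i" "hX i + 1 \<ge> g2 i" "hX i + 1 \<ge> g3 i" using h_le(3,5,7,9)[of i] by auto
    have sm: "x \<in> tO (g1 i)" "x \<in> tO (g2 i)" "x \<in> tO (g3 i)" if "x \<in> tO (hX i + 1)" for x
      using that m tO_mono by blast+
    have R': "p \<in> tO 0" "s \<in> tO 0" "q \<in> tO 1" "u \<in> tO 1" "p - s \<in> tO 1" using R by auto
    have "p * v $ 0 + q * v $ 1 \<in> tO (g1 i)" by (intro tO_add[OF tO_scale[OF R'(1) vc(1)] sm(1)] small R') simp
    moreover have "u * v $ 0 + s * v $ 1 \<in> tO (g2 i)" by (intro tO_add[OF sm(2) tO_scale[OF R'(2) vc(2)]] small R') simp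
    moreover have "s * (v $ 0 + v $ 1) + (p - s) * v $ 0 + q * v $ 1 + u * v $ 0 \<in> tO (g3 i)"
      by (intro tO_add[OF tO_add[OF tO_add[OF tO_scale[OF R'(2) vc(3)]]]] sm(3) small R') simp_all
    then have "p * v $ 0 + q * v $ 1 + (u * v $ 0 + s * v $ 1) \<in> tO (g3 i)" by (simp add: algebra_simps)
    ultimately show "vec2 (p * v $ 0 + q * v $ 1) (u * v $ 0 + s * v $ 1) \<in> LN i" by (simp add: LN_def)
  qed
qed

end

section \<open>Small vectors and matrices, and the chains of rank 1 modules\<close>

definition vec1 :: "'a \<Rightarrow> 'a vec" where "vec1 x = vec 1 (\<lambda>_. x)"

lemma vec1_simps [simp]: "vec1 x \<in> carrier_vec 1" "vec1 x \<in> carrier_vec (Suc 0)" "vec1 x $ 0 = x" "dim_vec (vec1 x) = 1"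
  by (auto simp: vec1_def)

lemma vec1_eta: "v \<in> carrier_vec 1 \<Longrightarrow> vec1 (v $ 0) = v"
  by (intro eq_vecI) auto

lemma vec_eq1: "u \<in> carrier_vec 1 \<Longrightarrow> v \<in> carrier_vec 1 \<Longrightarrow> u = v \<longleftrightarrow> u $ 0 = v $ 0"
  using vec1_eta by metis
lemma vec_eq2: "u \<in> carrier_vec 2 \<Longrightarrow> v \<in> carrier_vec 2 \<Longrightarrow> u = v \<longleftrightarrow> u $ 0 = v $ 0 \<and> u $ 1 = v $ 1"
  using vec2_eta by metis
lemma vec_eq3: "u \<in> carrier_vec 3 \<Longrightarrow> v \<in> carrier_vec 3 \<Longrightarrow> u = v \<longleftrightarrow> u $ 0 = v $ 0 \<and> u $ 1 = v $ 1 \<and> u $ 2 = v $ 2"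
  using vec3_eta by metis

lemma rows1_vec: "mat_of_rows m [x] *\<^sub>v v = vec1 (x \<bullet> v)" if "x \<in> carrier_vec m"
  using that by (intro eq_vecI) auto
lemma rows2_vec: "mat_of_rows m [x, y] *\<^sub>v v = vec2 (x \<bullet> v) (y \<bullet> v)" if "x \<in> carrier_vec m" "y \<in> carrier_vec m"
  using that by (intro eq_vecI) (auto simp: less2 less_Suc_eq)
lemma rows3_vec: "mat_of_rows m [x, y, z] *\<^sub>v v = vec3 (x \<bullet> v) (y \<bullet> v) (z \<bullet> v)"
  if "x \<in> carrier_vec m" "y \<in> carrier_vec m" "z \<in> carrier_vec m"
  using that by (intro eq_vecI) (auto simp: less3 less_Suc_eq numeral_2_eq_2 numeral_3_eq_3 vec3_def)

lemma rows_carrier [simp]: "mat_of_rows m [x] \<in> carrier_mat 1 m" "mat_of_rows m [x] \<in> carrier_mat (Suc 0) m" "mat_of_rows m [x, y] \<in> carrier_mat 2 m"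
  "mat_of_rows m [x, y, z] \<in> carrier_mat 3 m"
  using mat_of_rows_carrier(1)[of m "[x]"] mat_of_rows_carrier(1)[of m "[x, y]"] mat_of_rows_carrier(1)[of m "[x, y, z]"]
  by (auto simp: numeral_2_eq_2 numeral_3_eq_3)

lemma mat_vec_1:
  fixes A :: "'a :: comm_ring_1 mat"
  assumes "A \<in> carrier_mat m 1" "v \<in> carrier_vec 1"
  shows "A *\<^sub>v v = v $ 0 \<cdot>\<^sub>v col A 0"
  using assms by (intro eq_vecI) (auto simp: scalar_prod_def mult.commute)
lemma mat_vec_2:
  fixes A :: "'a :: comm_ring_1 mat"
  assumes "A \<in> carrier_mat m 2" "v \<in> carrier_vec 2"
  shows "A *\<^sub>v v = v $ 0 \<cdot>\<^sub>v col A 0 + v $ 1 \<cdot>\<^sub>v col A 1"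
  using assms by (intro eq_vecI) (auto simp: scalar_prod_def sum2 mult.commute)
lemma mat_vec_3:
  fixes A :: "'a :: comm_ring_1 mat"
  assumes "A \<in> carrier_mat m 3" "v \<in> carrier_vec 3"
  shows "A *\<^sub>v v = v $ 0 \<cdot>\<^sub>v col A 0 + v $ 1 \<cdot>\<^sub>v col A 1 + v $ 2 \<cdot>\<^sub>v col A 2"
  using assms by (intro eq_vecI) (auto simp: scalar_prod_def sum3 mult.commute)

lemma mat_eq_if_vec_eq:
  fixes A B :: "'a :: comm_ring_1 mat"
  assumes "A \<in> carrier_mat r m" "B \<in> carrier_mat r m" "\<And>v. v \<in> carrier_vec m \<Longrightarrow> A *\<^sub>v v = B *\<^sub>v v"
  shows "A = B"
proof (rule mat_col_eqI)
  fix j assume "j < dim_col B"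
  then have "j < m" using assms by simp
  then have "A *\<^sub>v unit_vec m j = col A j" "B *\<^sub>v unit_vec m j = col B j"
    using assms(1,2) by (intro eq_vecI; auto)+
  moreover have "A *\<^sub>v unit_vec m j = B *\<^sub>v unit_vec m j" using assms(3) by simp
  ultimately show "col A j = col B j" using assms by simp
qed (use assms in auto)

lemma modelsD:
  assumes "models k n M m \<Lambda>"
  obtains \<phi> where "presents k n M \<phi>" "\<And>i. lat (\<phi> i) = \<Lambda> i" "rk M = m"
  using assms by (auto simp: models_def)

lemma hom_comp_eq:
  assumes A: "presents k n A \<phi>" and B: "presents k n B \<psi>" and C: "presents k n C \<chi>"
    and f: "is_hom n A B f" and g: "is_hom n B C g" and h: "is_hom n A C h"
    and F: "F \<in> carrier_mat (rk B) (rk A)" "\<And>i. \<psi> i * toK (f i) = F * \<phi> i"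
    and G: "G \<in> carrier_mat (rk C) (rk B)" "\<And>i. \<chi> i * toK (g i) = G * \<psi> i"
    and H: "H \<in> carrier_mat (rk C) (rk A)" "\<And>i. \<chi> i * toK (h i) = H * \<phi> i"
    and e: "\<And>v. v \<in> carrier_vec (rk A) \<Longrightarrow> G *\<^sub>v (F *\<^sub>v v) = H *\<^sub>v v"
  shows "hom_comp g f = h"
proof (rule hom_eq_if_matrix_eq[OF A C is_hom_comp[OF _ _ _ f g] h])
  fix i
  have "G * F = H" by (rule mat_eq_if_vec_eq[OF mult_carrier_mat[OF G(1) F(1)] H(1)])
    (simp add: assoc_mult_mat_vec[OF G(1) F(1)] e)
  then show "\<chi> i * toK (hom_comp g f i) = \<chi> i * toK (h i)"
    using hom_comp_matrix[OF A B C f g F G] H by simp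
qed (use presentsD(1) A B C in auto)

lemma hom_id_matrix: "presents k n A \<phi> \<Longrightarrow> \<phi> i * toK (hom_id A i) = 1\<^sub>m (rk A) * \<phi> i"
  using presentsD(2)[of k n A \<phi> i] by (simp add: hom_id_def)

text \<open>The 1 by 1 matrices t^h(i) present the module, since x multiplies the generator by t
  exactly where the rim drops.\<close>

lemma rank1_models:
  assumes h: "is_rim n J h" and rim: "rimfun k n h" and kn: "k \<le> n"
  shows "models k n (rank1 n J) 1 (line_lat h)"
proof -
  define \<phi> where "\<phi> i = tpow (h i) \<cdot>\<^sub>m 1\<^sub>m 1" for i
  have hs: "h i = (if residue n i \<in> J then h (i - 1) else h (i - 1) - 1)" for i using h unfolding is_rim_def by blast
  have ent: "A = B" if "A \<in> carrier_mat 1 1" "B \<in> carrier_mat 1 1" "A $$ (0,0) = B $$ (0,0)" for A B :: "complex fls mat"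
    using that by (intro eq_matI) auto
  have tX: "fls_X = tpow 1" by (simp add: tpow_1)
  have "presents k n \<lparr>rk = 1, xmap = (\<lambda>i. mat 1 1 (\<lambda>_. if residue n i \<in> J then 1 else fps_X)),
       ymap = (\<lambda>i. mat 1 1 (\<lambda>_. if residue n i \<in> J then fps_X else 1))\<rparr> \<phi>"
  proof (rule presentsI[OF _ _ _ _ _ _ _ kn])
    fix i
    show "\<phi> i * toK (mat 1 1 (\<lambda>_. if residue n i \<in> J then 1 else fps_X)) = \<phi> (i - 1)"
      by (rule ent) (use hs[of i] in \<open>auto simp: \<phi>_def scalar_prod_def tX tpow_add[symmetric]\<close>)
    show "\<phi> (i - 1) * toK (mat 1 1 (\<lambda>_. if residue n i \<in> J then fps_X else 1)) = tpow 1 \<cdot>\<^sub>m \<phi> i"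
      by (rule ent) (use hs[of i] in \<open>auto simp: \<phi>_def scalar_prod_def tX tpow_add[symmetric] add.commute\<close>)
    have "h i = (int n - int k) + h (i + int n)" using rim by (auto simp: rimfun_def)
    then have "tpow (h i) = tpow (int n - int k) * tpow (h (i + int n))" by (simp only: tpow_add)
    then show "\<phi> i = tpow (int n - int k) \<cdot>\<^sub>m \<phi> (i + int n)" by (intro ent) (auto simp: \<phi>_def)
    show "det (\<phi> i) \<noteq> 0" by (simp add: \<phi>_def det_smult)
  qed (auto simp: \<phi>_def)
  moreover have "lat (\<phi> i) = line_lat h i" for i
  proof -
    have c: "\<phi> i \<in> carrier_mat 1 1" "tpow (- h i) \<cdot>\<^sub>m 1\<^sub>m 1 \<in> carrier_mat 1 1" by (auto simp: \<phi>_def)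
    have "\<phi> i * (tpow (- h i) \<cdot>\<^sub>m 1\<^sub>m 1) = 1\<^sub>m 1" "(tpow (- h i) \<cdot>\<^sub>m 1\<^sub>m 1) * \<phi> i = 1\<^sub>m 1"
      by (auto intro!: ent simp: \<phi>_def scalar_prod_def)
    note mem = mem_lat_iff[OF c this]
    have "v \<in> lat (\<phi> i) \<longleftrightarrow> v \<in> line_lat h i" for v
    proof (cases "v \<in> carrier_vec 1")
      case True
      then have "((tpow (- h i) \<cdot>\<^sub>m 1\<^sub>m 1) *\<^sub>v v) $ 0 = tpow (- h i) * v $ 0" by (auto simp: scalar_prod_def)
      moreover have "(tpow (- h i) \<cdot>\<^sub>m 1\<^sub>m 1) *\<^sub>v v \<in> carrier_vec 1" by (rule mult_mat_vec_carrier[OF c(2) True])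
      ultimately show ?thesis unfolding mem using True by (auto simp: int_vecs_def line_lat_def simp del: index_mult_mat_vec)
    qed (auto simp: mem line_lat_def)
    then show ?thesis by blast
  qed
  ultimately show ?thesis by (auto simp: models_def rank1_def)
qed

section \<open>The left almost split property in terms of lattices\<close>

context three_peaks
begin

text \<open>Here \<nu>1 and \<nu>2 are the images of the basis vectors under a morphism from
  \<open>L_X|L_Y\<close>. These basis vectors become e1 - e3 and e2 - e3 in the middle term, so an
  extension is fixed by the image \<open>w\<close> of e3. A suitable \<open>w\<close> is any vector
  of the first two rescaled lattices with w + \<nu>2 in the third. If there is none, duality yields
  a morphism back to \<open>LN\<close> whose composite with the given one is invertible.\<close>

lemma left_lattice:
  assumes W: "lat_family 3 n m W" and \<nu>: "\<nu>1 \<in> carrier_vec m" "\<nu>2 \<in> carrier_vec m"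
    and N: "\<And>i v. v \<in> LN i \<Longrightarrow> v $ 0 \<cdot>\<^sub>v \<nu>1 + v $ 1 \<cdot>\<^sub>v \<nu>2 \<in> W i"
  obtains w where "w \<in> carrier_vec m"
     "\<And>i v. v \<in> LM i \<Longrightarrow> v $ 0 \<cdot>\<^sub>v (w + \<nu>1) + v $ 1 \<cdot>\<^sub>v (w + \<nu>2) + v $ 2 \<cdot>\<^sub>v w \<in> W i"
  | \<rho>1 \<rho>2 where "\<rho>1 \<in> carrier_vec m" "\<rho>2 \<in> carrier_vec m" "\<And>i v. v \<in> W i \<Longrightarrow> vec2 (\<rho>1 \<bullet> v) (\<rho>2 \<bullet> v) \<in> LN i"
     "\<rho>1 \<bullet> \<nu>1 = 1" "\<rho>1 \<bullet> \<nu>2 = 0" "\<rho>2 \<bullet> \<nu>1 = 0" "\<rho>2 \<bullet> \<nu>2 = 1"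
proof -
  note L = Sl_lattice[OF W]
  note LW = lat_familyD(1)[OF W]
  have N': "x \<cdot>\<^sub>v \<nu>1 + y \<cdot>\<^sub>v \<nu>2 \<in> W i" if "vec2 x y \<in> LN i" for x y i using N[OF that] by simp
  have S: "x \<cdot>\<^sub>v \<nu>1 + y \<cdot>\<^sub>v \<nu>2 \<in> Sl m W i" if "vec2 (tpow (hI i) * x) (tpow (hI i) * y) \<in> LN i" for x y i
  proof -
    have "tpow (hI i) \<cdot>\<^sub>v (x \<cdot>\<^sub>v \<nu>1 + y \<cdot>\<^sub>v \<nu>2) = (tpow (hI i) * x) \<cdot>\<^sub>v \<nu>1 + (tpow (hI i) * y) \<cdot>\<^sub>v \<nu>2"
      using \<nu> by (intro eq_vecI) (auto simp: algebra_simps)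
    then show ?thesis using N'[OF that] \<nu> by (simp add: Sl_def)
  qed
  \<comment> \<open>At the three peaks \<open>LN\<close> contains the multiples by t^hI of (0,1),
    (1,0) and (1,-1) respectively, and their images lie in \<open>W\<close>.\<close>
  have d1: "\<nu>2 \<in> Sl m W (a - 1)"
  proof -
    have "0 \<cdot>\<^sub>v \<nu>1 + 1 \<cdot>\<^sub>v \<nu>2 \<in> Sl m W (a - 1)" using h_peaks by (intro S) (simp add: LN_def)
    moreover have "0 \<cdot>\<^sub>v \<nu>1 + 1 \<cdot>\<^sub>v \<nu>2 = \<nu>2" using \<nu> by (intro eq_vecI) auto
    ultimately show ?thesis by simp
  qed
  have d2: "\<nu>1 \<in> Sl m W (b - 1)"
  proof -
    have "1 \<cdot>\<^sub>v \<nu>1 + 0 \<cdot>\<^sub>v \<nu>2 \<in> Sl m W (b - 1)" using h_peaks by (intro S) (simp add: LN_def)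
    moreover have "1 \<cdot>\<^sub>v \<nu>1 + 0 \<cdot>\<^sub>v \<nu>2 = \<nu>1" using \<nu> by (intro eq_vecI) auto
    ultimately show ?thesis by simp
  qed
  have d3: "\<nu>1 - \<nu>2 \<in> Sl m W (c - 1)"
  proof -
    have "1 \<cdot>\<^sub>v \<nu>1 + (-1) \<cdot>\<^sub>v \<nu>2 \<in> Sl m W (c - 1)" using h_peaks by (intro S) (simp add: LN_def)
    moreover have "1 \<cdot>\<^sub>v \<nu>1 + (-1) \<cdot>\<^sub>v \<nu>2 = \<nu>1 - \<nu>2" using \<nu> by (intro eq_vecI) auto
    ultimately show ?thesis by simp
  qed
  show ?thesis
  proof (cases "\<exists>s. s \<in> Sl m W (a - 1) \<and> s \<in> Sl m W (b - 1) \<and> s + \<nu>2 \<in> Sl m W (c - 1)")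
    case True
    then obtain s where s: "s \<in> Sl m W (a - 1)" "s \<in> Sl m W (b - 1)" "s + \<nu>2 \<in> Sl m W (c - 1)" by blast
    have sc: "s \<in> carrier_vec m" using s by (simp add: Sl_def)
    have w1: "s + \<nu>1 \<in> Sl m W (b - 1)" using latticeD(2)[OF L s(2) d2] .
    have w1': "s + \<nu>1 \<in> Sl m W (c - 1)"
    proof -
      have "(s + \<nu>2) + (\<nu>1 - \<nu>2) \<in> Sl m W (c - 1)" using latticeD(2)[OF L s(3) d3] .
      moreover have "(s + \<nu>2) + (\<nu>1 - \<nu>2) = s + \<nu>1" using sc \<nu> by (intro eq_vecI) auto
      ultimately show ?thesis by simp
    qed
    have w2: "s + \<nu>2 \<in> Sl m W (a - 1)" using latticeD(2)[OF L s(1) d1] .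
    have ext: "v $ 0 \<cdot>\<^sub>v (s + \<nu>1) + v $ 1 \<cdot>\<^sub>v (s + \<nu>2) + v $ 2 \<cdot>\<^sub>v s \<in> W i" if v: "v \<in> LM i" for i v
    proof -
      obtain p q where p: "i = p + q * int n" "a - 2 \<le> p" "p < a - 2 + int n" using vertex .
      define \<sigma> where "\<sigma> = v $ 0 + v $ 1 + v $ 2"
      have vc: "v $ 0 \<in> tO (g1 i)" "v $ 1 \<in> tO (g2 i)" "v $ 2 \<in> tO (g3 i)" "\<sigma> \<in> tO (hI i)"
        using v by (auto simp: LM_def \<sigma>_def)
      have scale: "\<sigma> \<cdot>\<^sub>v w \<in> W i" if w: "w \<in> carrier_vec m" "tpow (hI p) \<cdot>\<^sub>v w \<in> W p" for w
      proof -
        have T: "tpow (hI i) \<cdot>\<^sub>v w \<in> W i" using transfer_shift[OF W w(1)] w(2) p by simp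
        have "tpow (- hI i) * \<sigma> \<in> tO 0" using vc by simp
        from latticeD(3)[OF LW this T] show ?thesis by (simp add: smult_smult_assoc mult.assoc mult.commute[of \<sigma>])
      qed
      show ?thesis
      \<comment> \<open>On this range \<open>g1\<close> is at most \<open>hI\<close>, so v is
        \<sigma> e1 plus a vector coming from \<open>LN\<close>, and the image s + \<nu>1 of e1 is
        controlled at the peaks b - 1 and c - 1 that govern the range. On the remaining vertices,
        governed by a - 1, the same is done with e2 and s + \<nu>2.\<close>
      proof (cases "a \<le> p \<and> p < c")
        case True
        have "tpow (hI p) \<cdot>\<^sub>v (s + \<nu>1) \<in> W p"
          by (rule transfer_block[OF W _ p(2,3)]) (use True w1 w1' in \<open>auto simp: Sl_def\<close>)
        then have 1: "\<sigma> \<cdot>\<^sub>v (s + \<nu>1) \<in> W i" using scale sc \<nu> by simp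
        have "g1 p \<le> hI p" using True gaps p by (simp add: h_val)
        then have "g1 i \<le> hI i" unfolding p(1) h_shift by simp
        then have "\<sigma> \<in> tO (g1 i)" using vc(4) by (rule tO_mono[rotated])
        then have "v $ 0 - \<sigma> \<in> tO (g1 i)" using vc(1) by (intro tO_diff)
        moreover have "(v $ 0 - \<sigma>) + (v $ 1) = - v $ 2" by (simp add: \<sigma>_def)
        ultimately have "vec2 (v $ 0 - \<sigma>) (v $ 1) \<in> LN i" unfolding LN_def using vc by simp
        from latticeD(2)[OF LW 1 N'[OF this]]
        have "\<sigma> \<cdot>\<^sub>v (s + \<nu>1) + ((v $ 0 - \<sigma>) \<cdot>\<^sub>v \<nu>1 + v $ 1 \<cdot>\<^sub>v \<nu>2) \<in> W i" .
        moreover have "\<sigma> \<cdot>\<^sub>v (s + \<nu>1) + ((v $ 0 - \<sigma>) \<cdot>\<^sub>v \<nu>1 + v $ 1 \<cdot>\<^sub>v \<nu>2)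
          = v $ 0 \<cdot>\<^sub>v (s + \<nu>1) + v $ 1 \<cdot>\<^sub>v (s + \<nu>2) + v $ 2 \<cdot>\<^sub>v s"
          using sc \<nu> unfolding \<sigma>_def by (intro eq_vecI) (auto simp: algebra_simps)
        ultimately show ?thesis by simp
      next
        case False
        have "tpow (hI p) \<cdot>\<^sub>v (s + \<nu>2) \<in> W p"
          by (rule transfer_block[OF W _ p(2,3)]) (use False gaps w2 in \<open>auto simp: Sl_def\<close>)
        then have 1: "\<sigma> \<cdot>\<^sub>v (s + \<nu>2) \<in> W i" using scale sc \<nu> by simp
        have "g2 p \<le> hI p" using False gaps p by (auto simp: h_val)
        then have "g2 i \<le> hI i" unfolding p(1) h_shift by simp
        then have "\<sigma> \<in> tO (g2 i)" using vc(4) by (rule tO_mono[rotated])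
        then have "v $ 1 - \<sigma> \<in> tO (g2 i)" using vc(2) by (intro tO_diff)
        moreover have "(v $ 0) + (v $ 1 - \<sigma>) = - v $ 2" by (simp add: \<sigma>_def)
        ultimately have "vec2 (v $ 0) (v $ 1 - \<sigma>) \<in> LN i" unfolding LN_def using vc by simp
        from latticeD(2)[OF LW 1 N'[OF this]]
        have "\<sigma> \<cdot>\<^sub>v (s + \<nu>2) + (v $ 0 \<cdot>\<^sub>v \<nu>1 + (v $ 1 - \<sigma>) \<cdot>\<^sub>v \<nu>2) \<in> W i" .
        moreover have "\<sigma> \<cdot>\<^sub>v (s + \<nu>2) + (v $ 0 \<cdot>\<^sub>v \<nu>1 + (v $ 1 - \<sigma>) \<cdot>\<^sub>v \<nu>2)
          = v $ 0 \<cdot>\<^sub>v (s + \<nu>1) + v $ 1 \<cdot>\<^sub>v (s + \<nu>2) + v $ 2 \<cdot>\<^sub>v s"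
          using sc \<nu> unfolding \<sigma>_def by (intro eq_vecI) (auto simp: algebra_simps)
        ultimately show ?thesis by simp
      qed
    qed
    show ?thesis by (rule that(1)[OF sc ext])
  next
    case False
    then have no: "\<And>s. s \<in> Sl m W (a - 1) \<Longrightarrow> s \<in> Sl m W (b - 1) \<Longrightarrow> s + \<nu>2 \<notin> Sl m W (c - 1)" by blast
    obtain \<gamma>1 \<gamma>2 \<gamma>3 where \<gamma>: "\<gamma>1 \<in> dual m (Sl m W (a - 1))" "\<gamma>2 \<in> dual m (Sl m W (b - 1))"
      "\<gamma>3 \<in> dual m (Sl m W (c - 1))" "\<gamma>1 + \<gamma>2 + \<gamma>3 = 0\<^sub>v m" "\<gamma>3 \<bullet> \<nu>2 \<notin> tO 0"
      by (rule three_lattices_alternative[OF L L L \<nu>(2) no])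
    define \<beta>1 \<beta>2 \<beta>3 where "\<beta>1 = tpow 1 \<cdot>\<^sub>v \<gamma>1" and "\<beta>2 = tpow 1 \<cdot>\<^sub>v \<gamma>2" and "\<beta>3 = tpow 1 \<cdot>\<^sub>v \<gamma>3"
    note \<beta>_def = this
    have gc: "\<gamma>1 \<in> carrier_vec m" "\<gamma>2 \<in> carrier_vec m" "\<gamma>3 \<in> carrier_vec m" using \<gamma> by (auto simp: dual_def)
    then have bc: "\<beta>1 \<in> carrier_vec m" "\<beta>2 \<in> carrier_vec m" "\<beta>3 \<in> carrier_vec m" by (auto simp: \<beta>_def)
    have "\<beta>1 + \<beta>2 + \<beta>3 = tpow 1 \<cdot>\<^sub>v (\<gamma>1 + \<gamma>2 + \<gamma>3)" using gc unfolding \<beta>_def by (intro eq_vecI) (auto simp: algebra_simps)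
    then have z: "\<beta>1 + \<beta>2 + \<beta>3 = 0\<^sub>v m" unfolding \<gamma>(4) by (auto intro!: eq_vecI)
    have sumz: "\<beta>1 \<bullet> v + \<beta>2 \<bullet> v + \<beta>3 \<bullet> v = 0" if "v \<in> carrier_vec m" for v
    proof -
      have "\<beta>1 \<bullet> v + \<beta>2 \<bullet> v + \<beta>3 \<bullet> v = (\<beta>1 + \<beta>2 + \<beta>3) \<bullet> v"
        using that bc by (simp add: add_scalar_prod_distrib[of _ m])
      then show ?thesis unfolding z using that by simp
    qed
    have \<eta>: "\<And>i. bd W (\<beta>1 + \<beta>2 + \<beta>3) i (hI i)" unfolding z bd_def using latticeD(1)[OF LW] by auto
    note all = bd_all[OF W bc \<eta> dual_Sl_bd[OF W \<gamma>(1), folded \<beta>_def] dual_Sl_bd[OF W \<gamma>(2), folded \<beta>_def] dual_Sl_bd[OF W \<gamma>(3), folded \<beta>_def]]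
    have toN: "vec2 (\<beta>1 \<bullet> v) (\<beta>2 \<bullet> v) \<in> LN i" if v: "v \<in> W i" for v i
    proof -
      have "\<beta>1 \<bullet> v + \<beta>2 \<bullet> v = - (\<beta>3 \<bullet> v)" using sumz[OF latticeD(1)[OF LW v]] by (simp add: eq_neg_iff_add_eq_0)
      then show ?thesis using all[of i] v by (simp add: LN_def bd_def)
    qed
    define p q u s where "p = \<beta>1 \<bullet> \<nu>1" and "q = \<beta>1 \<bullet> \<nu>2" and "u = \<beta>2 \<bullet> \<nu>1" and "s = \<beta>2 \<bullet> \<nu>2"
    note pq = this
    have lin: "\<beta> \<bullet> (x \<cdot>\<^sub>v \<nu>1 + y \<cdot>\<^sub>v \<nu>2) = (\<beta> \<bullet> \<nu>1) * x + (\<beta> \<bullet> \<nu>2) * y" if "\<beta> \<in> carrier_vec m" for \<beta> x y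
      using that \<nu> by (simp add: scalar_prod_add_distrib[of _ m] scalar_prod_smult_distrib[of _ m] mult.commute)
    have "\<forall>i. \<forall>v\<in>LN i. vec2 (p * v $ 0 + q * v $ 1) (u * v $ 0 + s * v $ 1) \<in> LN i"
      using toN[OF N] lin[OF bc(1)] lin[OF bc(2)] unfolding pq by simp
    then have E: "p \<in> tO 0" "s \<in> tO 0" "q \<in> tO 1" "u \<in> tO 1" "p - s \<in> tO 1" unfolding LN_endo by auto
    have "q + s \<notin> tO 1"
    proof
      assume "q + s \<in> tO 1"
      then have "- (q + s) \<in> tO 1" by (rule tO_uminus)
      moreover have "- (q + s) = \<beta>3 \<bullet> \<nu>2" unfolding pq by (rule minus_unique) (rule sumz[OF \<nu>(2)])
      ultimately have "tpow 1 * (\<gamma>3 \<bullet> \<nu>2) \<in> tO 1" using smult_scalar_prod_distrib[OF gc(3) \<nu>(2)] by (simp add: \<beta>_def)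
      then show False using \<gamma>(5) by simp
    qed
    then have s1: "s \<notin> tO 1" using E(3) tO_add by blast
    have p1: "p \<notin> tO 1" using s1 tO_diff[OF _ E(5), of p] by auto
    define d where "d = p * s - q * u"
    have d0: "d \<in> tO 0" unfolding d_def using E by (auto intro!: tO_diff tO_scale elim: tO_mono)
    have qu: "q * u \<in> tO 1" using tO_mult[OF E(3,4)] by (auto elim: tO_mono)
    have d1: "d \<notin> tO 1"
    proof
      assume "d \<in> tO 1"
      then have "d + q * u \<in> tO 1" using qu by (rule tO_add)
      then show False using tO_mult_notin_1[OF E(1,2) p1 s1] by (simp add: d_def)
    qed
    note inv = tO_inverse[OF d0 d1]
    define e where "e = inverse d"
    have ed: "e * d = 1" using inv by (simp add: e_def)
    have e0: "e \<in> tO 0" using inv by (simp add: e_def)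
    have E': "e * s \<in> tO 0 \<and> e * p \<in> tO 0 \<and> - (e * q) \<in> tO 1 \<and> - (e * u) \<in> tO 1 \<and> e * s - e * p \<in> tO 1"
    proof -
      have "e * (- (p - s)) \<in> tO 1" by (rule tO_scale[OF e0 tO_uminus[OF E(5)]])
      then show ?thesis using E e0 by (auto intro: tO_scale tO_uminus simp: algebra_simps)
    qed
    \<comment> \<open>The rows of the inverse of the matrix with entries p, q, u, s, written as
      \<open>e\<close> times the adjugate, applied to \<beta>1 and \<beta>2. The inverse is again an
      endomorphism of \<open>LN\<close>.\<close>
    define \<rho>1 where "\<rho>1 = (e * s) \<cdot>\<^sub>v \<beta>1 + (- (e * q)) \<cdot>\<^sub>v \<beta>2"
    define \<rho>2 where "\<rho>2 = (- (e * u)) \<cdot>\<^sub>v \<beta>1 + (e * p) \<cdot>\<^sub>v \<beta>2"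
    have rc: "\<rho>1 \<in> carrier_vec m" "\<rho>2 \<in> carrier_vec m" using bc by (auto simp: \<rho>1_def \<rho>2_def)
    have rv: "\<rho>1 \<bullet> v = (e * s) * (\<beta>1 \<bullet> v) + (- (e * q)) * (\<beta>2 \<bullet> v)" "\<rho>2 \<bullet> v = (- (e * u)) * (\<beta>1 \<bullet> v) + (e * p) * (\<beta>2 \<bullet> v)"
      if "v \<in> carrier_vec m" for v
      unfolding \<rho>1_def \<rho>2_def using that bc
      by (simp_all add: add_scalar_prod_distrib[of _ m] smult_scalar_prod_distrib[of _ m])
    show ?thesis
    proof (rule that(2)[OF rc])
      fix i v assume v: "v \<in> W i"
      have vc: "v \<in> carrier_vec m" using latticeD(1)[OF LW v] .
      show "vec2 (\<rho>1 \<bullet> v) (\<rho>2 \<bullet> v) \<in> LN i" unfolding rv[OF vc]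
        using LN_endo[THEN iffD2, OF E', rule_format, OF toN[OF v]] by simp
    next
      have "e * s * p - e * q * u = 1" using ed unfolding d_def by (simp add: algebra_simps)
      then show "\<rho>1 \<bullet> \<nu>1 = 1" "\<rho>1 \<bullet> \<nu>2 = 0" "\<rho>2 \<bullet> \<nu>1 = 0" "\<rho>2 \<bullet> \<nu>2 = 1"
        unfolding rv[OF \<nu>(1)] rv[OF \<nu>(2)] pq[symmetric] by (auto simp: algebra_simps)
    qed
  qed
qed

end

section \<open>The almost split sequence\<close>

lemma lat_carrier: "presents k n M \<phi> \<Longrightarrow> v \<in> lat (\<phi> i) \<Longrightarrow> v \<in> carrier_vec (rk M)"
  using lat_subset_carrier presentsD(2) by blast

lemma hom_lat:
  assumes M: "presents k n M \<phi>" and N: "presents k n N \<psi>" and f: "is_hom n M N f"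
    and F: "F \<in> carrier_mat (rk N) (rk M)" "\<And>i. \<psi> i * toK (f i) = F * \<phi> i" and v: "v \<in> lat (\<phi> i)"
  shows "F *\<^sub>v v \<in> lat (\<psi> i)"
  by (rule hom_matrix_lat[where f = f, OF M N is_homD(1)[OF f, of i] F(1) F(2)[of i] v])

lemma exact_surj_lat:
  assumes S: "short_exact k n A E C f g" and E: "presents k n E \<psi>" and C: "presents k n C \<chi>"
    and G: "G \<in> carrier_mat (rk C) (rk E)" "\<And>i. \<chi> i * toK (g i) = G * \<psi> i" and w: "w \<in> lat (\<chi> i)"
  obtains v where "v \<in> lat (\<psi> i)" "G *\<^sub>v v = w"
proof -
  obtain x where x: "x \<in> carrier_vec (rk C)" "w = \<chi> i *\<^sub>v map_vec fps_to_fls x" using w lat_fps[OF presentsD(2)[OF C]] by auto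
  obtain y where y: "y \<in> carrier_vec (rk E)" "x = g i *\<^sub>v y" using short_exactD(8)[OF S, of i] x(1) by blast
  have "G *\<^sub>v (\<psi> i *\<^sub>v map_vec fps_to_fls y) = w"
    using hom_vec[OF presentsD(2)[OF C] presentsD(2)[OF E] is_homD(1)[OF short_exactD(5)[OF S]] G(1) G(2) y(1)] x(2) y(2) by simp
  moreover have "\<psi> i *\<^sub>v map_vec fps_to_fls y \<in> lat (\<psi> i)" using y(1) lat_fps[OF presentsD(2)[OF E]] by auto
  ultimately show ?thesis using that by blast
qed

context three_peaks
begin

lemma three_le: "3 \<le> n" "0 < n" using n_ge by auto

lemma LM_to_LN: "v \<in> LM i \<Longrightarrow> v $ 0 + v $ 1 + v $ 2 = 0 \<Longrightarrow> vec2 (v $ 0) (v $ 1) \<in> LN i"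
proof -
  assume v: "v \<in> LM i" and z: "v $ 0 + v $ 1 + v $ 2 = 0"
  have "v $ 0 + v $ 1 = - v $ 2" using z by (simp add: eq_neg_iff_add_eq_0)
  then show ?thesis using v by (simp add: LM_def LN_def)
qed

lemma LN_to_LM: "v \<in> LN i \<Longrightarrow> vec3 (v $ 0) (v $ 1) (- (v $ 0) - v $ 1) \<in> LM i"
proof -
  assume v: "v \<in> LN i"
  have e: "- (v $ 0) - v $ 1 = - (v $ 0 + v $ 1)" by simp
  have "- (v $ 0) - v $ 1 \<in> tO (g3 i)" unfolding e using v by (intro tO_uminus) (simp add: LN_def)
  then show ?thesis using v by (simp add: LM_def LN_def)
qed

text \<open>At every vertex \<open>g1\<close> or \<open>g2\<close> is at most \<open>hI\<close>, so
  a single coordinate already reaches every value of the sum.\<close>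

lemma LM_surj:
  assumes "x \<in> tO (hI i)"
  shows "\<exists>v\<in>LM i. v $ 0 + v $ 1 + v $ 2 = x"
proof -
  obtain p q where p: "i = p + q * int n" "a - 2 \<le> p" "p < a - 2 + int n" using vertex .
  have "g1 p \<le> hI p \<or> g2 p \<le> hI p" unfolding h_val[OF p(2,3)] using gaps p by auto
  then have "g1 i \<le> hI i \<or> g2 i \<le> hI i" unfolding p(1) h_shift by simp
  then show ?thesis
  proof
    assume "g1 i \<le> hI i"
    then show ?thesis using assms by (intro bexI[of _ "vec3 x 0 0"]) (auto simp: LM_def elim: tO_mono)
  next
    assume "g2 i \<le> hI i"
    then show ?thesis using assms by (intro bexI[of _ "vec3 0 x 0"]) (auto simp: LM_def elim: tO_mono)
  qed
qed

theorem AR_sequence_exists: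
  assumes N: "models 3 n N 2 LN" and M: "models 3 n M 3 LM" and L: "models 3 n L 1 (line_lat hI)"
  obtains f g where "AR_sequence 3 n N M L f g"
proof -
  obtain \<phi> where PN: "presents 3 n N \<phi>" and latN: "\<And>i. lat (\<phi> i) = LN i" and rN: "rk N = 2" by (rule modelsD[OF N]) metis
  obtain \<psi> where PM: "presents 3 n M \<psi>" and latM: "\<And>i. lat (\<psi> i) = LM i" and rM: "rk M = 3" by (rule modelsD[OF M]) metis
  obtain \<chi> where PL: "presents 3 n L \<chi>" and latL: "\<And>i. lat (\<chi> i) = line_lat hI i" and rL: "rk L = 1" by (rule modelsD[OF L]) metis
  note kn = three_le(1)
  define F :: "complex fls mat" where "F = mat_of_rows 2 [vec2 1 0, vec2 0 1, vec2 (-1) (-1)]"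
  define G :: "complex fls mat" where "G = mat_of_rows 3 [vec3 1 1 1]"
  have Fc: "F \<in> carrier_mat (rk M) (rk N)" and Gc: "G \<in> carrier_mat (rk L) (rk M)" by (simp_all add: F_def G_def rN rM rL)
  have Fv: "F *\<^sub>v v = vec3 (v $ 0) (v $ 1) (- (v $ 0) - v $ 1)" if "v \<in> carrier_vec 2" for v
    unfolding F_def using that by (simp add: rows3_vec vec2_scalar)
  have Gv: "G *\<^sub>v v = vec1 (v $ 0 + v $ 1 + v $ 2)" if "v \<in> carrier_vec 3" for v
    unfolding G_def using that by (simp add: rows1_vec vec3_scalar)
  obtain f g where S: "short_exact 3 n N M L f g" and f: "\<And>i. \<psi> i * toK (f i) = F * \<phi> i" and g: "\<And>i. \<chi> i * toK (g i) = G * \<psi> i"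
  proof (rule short_exact_of_matrices[OF PN PM PL kn Fc Gc])
    show "F *\<^sub>v v \<in> lat (\<psi> i)" if "v \<in> lat (\<phi> i)" for i v
      using that LN_to_LM[of v i] unfolding latN latM by (simp add: Fv LN_def)
    show "G *\<^sub>v v \<in> lat (\<chi> i)" if "v \<in> lat (\<psi> i)" for i v
      using that unfolding latM latL by (simp add: Gv LM_def line_lat_def)
    show "u = v" if "u \<in> carrier_vec (rk N)" "v \<in> carrier_vec (rk N)" "F *\<^sub>v u = F *\<^sub>v v" for u v
      using that by (simp add: rN Fv vec_eq2 vec_eq3)
    show "G *\<^sub>v (F *\<^sub>v v) = 0\<^sub>v (rk L)" if "v \<in> carrier_vec (rk N)" for v
      using that by (simp add: rN rL Fv Gv vec_eq1)
    show "\<exists>u\<in>lat (\<phi> i). F *\<^sub>v u = v" if "v \<in> lat (\<psi> i)" "G *\<^sub>v v = 0\<^sub>v (rk L)" for i v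
    proof -
      have vM: "v \<in> LM i" and vc: "v \<in> carrier_vec 3" using that(1) latM by (auto simp: LM_def)
      have z: "v $ 0 + v $ 1 + v $ 2 = 0" using that(2) by (simp add: Gv vc rL vec_eq1)
      have z': "- (v $ 0) - v $ 1 = v $ 2" using minus_unique[OF z] by simp
      show ?thesis unfolding latN
        by (rule bexI[OF _ LM_to_LN[OF vM z]]) (use vc z' in \<open>simp add: Fv vec_eq3\<close>)
    qed
    show "\<exists>v\<in>lat (\<psi> i). G *\<^sub>v v = w" if "w \<in> lat (\<chi> i)" for i w
    proof -
      have w: "w \<in> carrier_vec 1" "w $ 0 \<in> tO (hI i)" using that latL by (auto simp: line_lat_def)
      obtain v where v: "v \<in> LM i" "v $ 0 + v $ 1 + v $ 2 = w $ 0" using LM_surj[OF w(2)] by blast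
      then show ?thesis unfolding latM using w(1) by (intro bexI[of _ v]) (auto simp: Gv LM_def vec1_eta)
    qed
  qed blast
  note SD = short_exactD[OF S]
  \<comment> \<open>A section would be a vector y with t^hI y in \<open>LM\<close> at all vertices.
    The j-th peak forces its j-th coordinate into \<open>tO 1\<close>, so the coordinates cannot add
    up to 1.\<close>
  have nse: "\<not> split_epi n M L g"
  proof
    assume "split_epi n M L g"
    then obtain s where s: "is_hom n L M s" "hom_comp g s = hom_id L" by (auto simp: split_epi_def)
    from hom_matrix[OF PL PM s(1)] obtain T where T: "T \<in> carrier_mat (rk M) (rk L)" "\<And>i. \<psi> i * toK (s i) = T * \<chi> i" by metis
    have Tc: "T \<in> carrier_mat 3 1" using T rM rL by simp
    define y where "y = col T 0"
    have y: "y \<in> carrier_vec 3" unfolding y_def by (rule col_carrier_vec[OF _ Tc]) simp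
    have yM: "tpow (hI i) \<cdot>\<^sub>v y \<in> LM i" for i
    proof -
      have "vec1 (tpow (hI i)) \<in> lat (\<chi> i)" unfolding latL by (simp add: line_lat_def)
      from hom_lat[OF PL PM s(1) T(1) T(2) this]
      show ?thesis unfolding latM mat_vec_1[OF Tc vec1_simps(1)] by (simp add: y_def)
    qed
    have y1: "y $ 0 \<in> tO 1" "y $ 1 \<in> tO 1" "y $ 2 \<in> tO 1"
      using yM[of "a - 1"] yM[of "b - 1"] yM[of "c - 1"] y h_peaks by (auto simp: LM_def)
    have "G * T = 1\<^sub>m (rk L)"
    proof (rule mat_right_cancel[OF mult_carrier_mat[OF Gc T(1)] one_carrier_mat presentsD(2)[OF PL] presentsD(3)[OF PL]])
      show "G * T * \<chi> 0 = 1\<^sub>m (rk L) * \<chi> 0"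
        using hom_comp_matrix[OF PL PM PL s(1) SD(5) T(1) T(2) Gc g, of 0] hom_id_matrix[OF PL, of 0] s(2) by simp
    qed
    then have "G *\<^sub>v (T *\<^sub>v vec1 1) = vec1 1" using assoc_mult_mat_vec[OF Gc T(1), of "vec1 1"] rL by simp
    moreover have "T *\<^sub>v vec1 1 = y" unfolding mat_vec_1[OF Tc vec1_simps(1)] by (simp add: y_def one_smult_vec)
    ultimately have "y $ 0 + y $ 1 + y $ 2 = 1" using y by (simp add: Gv vec_eq1)
    moreover have "y $ 0 + y $ 1 + y $ 2 \<in> tO 1" using y1 by (intro tO_add)
    ultimately show False by simp
  qed
  have nsm: "\<not> split_mono n N M f" using split_mono_imp_split_epi[OF S] nse by blast
  have left: "\<exists>h'. is_hom n M W h' \<and> hom_comp h' f = h" if W: "CM 3 n W" and h: "is_hom n N W h" and ns: "\<not> split_mono n N W h" for W h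
  proof -
    obtain \<omega> where PW: "presents 3 n W \<omega>" using presents_exists[OF W] .
    let ?m = "rk W"
    have fam: "lat_family 3 n ?m (\<lambda>i. lat (\<omega> i))" by (rule presents_family[OF PW kn])
    from hom_matrix[OF PN PW h] obtain V where V: "V \<in> carrier_mat ?m (rk N)" "\<And>i. \<omega> i * toK (h i) = V * \<phi> i" by metis
    have Vc: "V \<in> carrier_mat ?m 2" using V rN by simp
    have nu: "col V 0 \<in> carrier_vec ?m" "col V 1 \<in> carrier_vec ?m" using col_carrier_vec[OF _ Vc] by auto
    have VN: "v $ 0 \<cdot>\<^sub>v col V 0 + v $ 1 \<cdot>\<^sub>v col V 1 \<in> lat (\<omega> i)" if "v \<in> LN i" for v i
      using hom_lat[OF PN PW h V(1) V(2), of v i] that mat_vec_2[OF Vc, of v] latN by (simp add: LN_def)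
    show ?thesis
    proof (rule left_lattice[OF fam nu VN])
      fix w assume w: "w \<in> carrier_vec ?m"
        and ext: "\<And>i v. v \<in> LM i \<Longrightarrow> v $ 0 \<cdot>\<^sub>v (w + col V 0) + v $ 1 \<cdot>\<^sub>v (w + col V 1) + v $ 2 \<cdot>\<^sub>v w \<in> lat (\<omega> i)"
      \<comment> \<open>The columns are the images of e1, e2, e3; on differences with e3 they
        reproduce the given morphism.\<close>
      define H where "H = mat_of_cols ?m [w + col V 0, w + col V 1, w]"
      have Hc: "H \<in> carrier_mat ?m 3" using mat_of_cols_carrier(1)[of ?m "[w + col V 0, w + col V 1, w]"] by (simp add: H_def numeral_3_eq_3)
      have cols: "col H 0 = w + col V 0" "col H 1 = w + col V 1" "col H 2 = w"
        unfolding H_def using w nu by (auto intro!: col_mat_of_cols simp: numeral_2_eq_2)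
      note Hv = mat_vec_3[OF Hc, unfolded cols]
      have Hc': "H \<in> carrier_mat (rk W) (rk M)" using Hc rM by simp
      obtain h' where h': "is_hom n M W h'" "\<And>i. \<omega> i * toK (h' i) = H * \<psi> i"
      proof (rule hom_of_matrix[OF PM PW kn Hc'])
        show "H *\<^sub>v v \<in> lat (\<omega> i)" if "v \<in> lat (\<psi> i)" for i v
          using ext[of v i] that latM Hv[of v] by (simp add: LM_def)
      qed blast
      have "hom_comp h' f = h"
      proof (rule hom_comp_eq[OF PN PM PW SD(4) h'(1) h Fc f Hc' h'(2) V])
        fix v :: "complex fls vec" assume "v \<in> carrier_vec (rk N)"
        then have v: "v \<in> carrier_vec 2" using rN by simp
        have gen: "p \<cdot>\<^sub>v (w + x) + q \<cdot>\<^sub>v (w + y) + (- p - q) \<cdot>\<^sub>v w = p \<cdot>\<^sub>v x + q \<cdot>\<^sub>v y"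
          if "x \<in> carrier_vec ?m" "y \<in> carrier_vec ?m" for x y p q
          using w that by (intro eq_vecI) (auto simp: algebra_simps)
        show "H *\<^sub>v (F *\<^sub>v v) = V *\<^sub>v v"
          unfolding Fv[OF v] Hv[OF vec3_simps(1)] mat_vec_2[OF Vc v] vec3_simps by (rule gen[OF nu])
      qed
      then show ?thesis using h' by blast
    next
      fix \<rho>1 \<rho>2 assume rc: "\<rho>1 \<in> carrier_vec ?m" "\<rho>2 \<in> carrier_vec ?m"
        and toN: "\<And>i v. v \<in> lat (\<omega> i) \<Longrightarrow> vec2 (\<rho>1 \<bullet> v) (\<rho>2 \<bullet> v) \<in> LN i"
        and id: "\<rho>1 \<bullet> col V 0 = 1" "\<rho>1 \<bullet> col V 1 = 0" "\<rho>2 \<bullet> col V 0 = 0" "\<rho>2 \<bullet> col V 1 = 1"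
      define R where "R = mat_of_rows ?m [\<rho>1, \<rho>2]"
      have Rc: "R \<in> carrier_mat (rk N) (rk W)" by (simp add: R_def rN)
      have Rv: "R *\<^sub>v v = vec2 (\<rho>1 \<bullet> v) (\<rho>2 \<bullet> v)" for v unfolding R_def using rc by (rule rows2_vec)
      obtain r where r: "is_hom n W N r" "\<And>i. \<phi> i * toK (r i) = R * \<omega> i"
      proof (rule hom_of_matrix[OF PW PN kn Rc])
        show "R *\<^sub>v v \<in> lat (\<phi> i)" if "v \<in> lat (\<omega> i)" for i v unfolding Rv latN using toN[OF that] .
      qed blast
      have "hom_comp r h = hom_id N"
      proof (rule hom_comp_eq[OF PN PW PN h r(1) is_hom_id[OF SD(1)] V Rc r(2) _ hom_id_matrix[OF PN]])
        fix v :: "complex fls vec" assume "v \<in> carrier_vec (rk N)"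
        then have v: "v \<in> carrier_vec 2" using rN by simp
        have "\<rho> \<bullet> (V *\<^sub>v v) = v $ 0 * (\<rho> \<bullet> col V 0) + v $ 1 * (\<rho> \<bullet> col V 1)" if "\<rho> \<in> carrier_vec ?m" for \<rho>
          unfolding mat_vec_2[OF Vc v] using that nu by (simp add: scalar_prod_add_distrib[of _ ?m] scalar_prod_smult_distrib[of _ ?m])
        then show "R *\<^sub>v (V *\<^sub>v v) = 1\<^sub>m (rk N) *\<^sub>v v" unfolding Rv using rc id rN v vec2_eta[OF v] by simp
      qed simp
      then show ?thesis using ns r by (auto simp: split_mono_def)
    qed
  qed
  have right: "\<exists>h'. is_hom n W M h' \<and> hom_comp g h' = h" if W: "CM 3 n W" and h: "is_hom n W L h" and ns: "\<not> split_epi n W L h" for W h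
  proof -
    obtain \<omega> where PW: "presents 3 n W \<omega>" using presents_exists[OF W] .
    let ?m = "rk W"
    have fam: "lat_family 3 n ?m (\<lambda>i. lat (\<omega> i))" by (rule presents_family[OF PW kn])
    from hom_matrix[OF PW PL h] obtain H where H: "H \<in> carrier_mat (rk L) ?m" "\<And>i. \<chi> i * toK (h i) = H * \<omega> i" by metis
    define \<eta> where "\<eta> = row H 0"
    have eta: "\<eta> \<in> carrier_vec ?m" unfolding \<eta>_def by (rule row_carrier_vec[OF _ H(1)]) (simp add: rL)
    have Hv: "H *\<^sub>v v = vec1 (\<eta> \<bullet> v)" for v using H(1) rL by (intro eq_vecI) (auto simp: \<eta>_def)
    have bdH: "bd (\<lambda>i. lat (\<omega> i)) \<eta> i (hI i)" for i unfolding bd_def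
      using hom_lat[OF PW PL h H(1) H(2)] latL by (simp add: Hv line_lat_def)
    show ?thesis
    proof (rule right_lattice[OF fam eta bdH])
      fix s assume s: "s \<in> carrier_vec ?m" "\<And>i. tpow (hI i) \<cdot>\<^sub>v s \<in> lat (\<omega> i)" "\<eta> \<bullet> s = 1"
      define T where "T = mat_of_cols ?m [s]"
      have Tc: "T \<in> carrier_mat ?m 1" using mat_of_cols_carrier(1)[of ?m "[s]"] by (simp add: T_def)
      have Tv: "T *\<^sub>v v = v $ 0 \<cdot>\<^sub>v s" if "v \<in> carrier_vec 1" for v
        using mat_vec_1[OF Tc that] s(1) by (simp add: T_def)
      have Tc': "T \<in> carrier_mat (rk W) (rk L)" using Tc rL by simp
      obtain t where t: "is_hom n L W t" "\<And>i. \<omega> i * toK (t i) = T * \<chi> i"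
      proof (rule hom_of_matrix[OF PL PW kn Tc'])
        fix i v assume "v \<in> lat (\<chi> i)"
        then have v: "v \<in> carrier_vec 1" "v $ 0 \<in> tO (hI i)" using latL by (auto simp: line_lat_def)
        have "tpow (- hI i) * v $ 0 \<in> tO 0" using v by simp
        from latticeD(3)[OF lat_familyD(1)[OF fam] this s(2)[of i]]
        show "T *\<^sub>v v \<in> lat (\<omega> i)" unfolding Tv[OF v(1)] by (simp add: smult_smult_assoc mult.assoc mult.commute[of "v $ 0"])
      qed blast
      have "hom_comp h t = hom_id L"
      proof (rule hom_comp_eq[OF PL PW PL t(1) h is_hom_id[OF SD(3)] Tc' t(2) H _ hom_id_matrix[OF PL]])
        fix v :: "complex fls vec" assume "v \<in> carrier_vec (rk L)"
        then have v: "v \<in> carrier_vec 1" using rL by simp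
        then show "H *\<^sub>v (T *\<^sub>v v) = 1\<^sub>m (rk L) *\<^sub>v v" unfolding Tv[OF v] Hv
          using scalar_prod_smult_distrib[OF eta s(1)] s(3) rL by (simp add: vec1_eta)
      qed simp
      then show ?thesis using ns t by (auto simp: split_epi_def)
    next
      fix \<beta>1 \<beta>2 \<beta>3 assume bc: "\<beta>1 \<in> carrier_vec ?m" "\<beta>2 \<in> carrier_vec ?m" "\<beta>3 \<in> carrier_vec ?m" and e: "\<eta> = \<beta>1 + \<beta>2 + \<beta>3"
        and b: "\<And>i. bd (\<lambda>i. lat (\<omega> i)) \<beta>1 i (g1 i)" "\<And>i. bd (\<lambda>i. lat (\<omega> i)) \<beta>2 i (g2 i)" "\<And>i. bd (\<lambda>i. lat (\<omega> i)) \<beta>3 i (g3 i)"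
      define B where "B = mat_of_rows ?m [\<beta>1, \<beta>2, \<beta>3]"
      have Bc: "B \<in> carrier_mat (rk M) (rk W)" by (simp add: B_def rM)
      have Bv: "B *\<^sub>v v = vec3 (\<beta>1 \<bullet> v) (\<beta>2 \<bullet> v) (\<beta>3 \<bullet> v)" for v unfolding B_def using bc by (rule rows3_vec)
      have sum: "\<beta>1 \<bullet> v + \<beta>2 \<bullet> v + \<beta>3 \<bullet> v = \<eta> \<bullet> v" if "v \<in> carrier_vec ?m" for v
        unfolding e using that bc by (simp add: add_scalar_prod_distrib[of _ ?m])
      obtain h' where h': "is_hom n W M h'" "\<And>i. \<psi> i * toK (h' i) = B * \<omega> i"
      proof (rule hom_of_matrix[OF PW PM kn Bc])
        fix i v assume v: "v \<in> lat (\<omega> i)"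
        show "B *\<^sub>v v \<in> lat (\<psi> i)" unfolding Bv latM LM_def
          using sum[OF lat_carrier[OF PW v]] b[of i] bdH[of i] v by (simp add: bd_def)
      qed blast
      have "hom_comp g h' = h"
      proof (rule hom_comp_eq[OF PW PM PL h'(1) SD(5) h Bc h'(2) Gc g H])
        fix v :: "complex fls vec" assume v: "v \<in> carrier_vec (rk W)"
        show "G *\<^sub>v (B *\<^sub>v v) = H *\<^sub>v v" unfolding Bv Hv using sum[OF v] by (simp add: Gv)
      qed
      then show ?thesis using h' by blast
    qed
  qed
  have "AR_sequence 3 n N M L f g" unfolding AR_sequence_def
    using S nse nsm left right by blast
  then show ?thesis using that by blast
qed

end

section \<open>Rigidity and indecomposability of the rank 2 module\<close>

lemma fam_scale_up:
  assumes W: "lat_family k n m W" and e: "tpow x \<cdot>\<^sub>v e \<in> W p" and xy: "x \<le> y"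
  shows "tpow y \<cdot>\<^sub>v e \<in> W p"
proof -
  have "tpow (y - x) \<in> tO 0" using xy by simp
  from latticeD(3)[OF lat_familyD(1)[OF W] this e] show ?thesis by (simp add: smult_smult_assoc tpow_add[symmetric])
qed

lemma indecomposable_if:
  assumes N: "CM k n N" and pos: "0 < rk N"
    and idem: "\<And>e. is_hom n N N e \<Longrightarrow> hom_comp e e = e \<Longrightarrow> e = hom_zero N N \<or> e = hom_id N"
  shows "indecomposable k n N"
proof -
  have "rk A = 0 \<or> rk B = 0" if A: "CM k n A" and B: "CM k n B" and iso: "isomorphic n N (direct_sum A B)" for A B
  proof -
    let ?D = "direct_sum A B"
    note sel = direct_sum_sel[OF A B]
    have D: "CM k n ?D" by (rule direct_sum_CM[OF A B])
    obtain f g where f: "is_hom n N ?D f" and g: "is_hom n ?D N g" and gf: "hom_comp g f = hom_id N" and fg: "hom_comp f g = hom_id ?D"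
      using iso by (auto simp: isomorphic_def)
    define \<pi> where "\<pi> = (\<lambda>i :: int. diag_mat (1\<^sub>m (rk A)) (0\<^sub>m (rk B) (rk B)) :: complex fps mat)"
    have o: "(1\<^sub>m (rk A) :: complex fps mat) \<in> carrier_mat (rk A) (rk A)" "(0\<^sub>m (rk B) (rk B) :: complex fps mat) \<in> carrier_mat (rk B) (rk B)" by auto
    note XA = CM_D(1,2)[OF A] and XB = CM_D(1,2)[OF B]
    have \<pi>: "is_hom n ?D ?D \<pi>" unfolding is_hom_def \<pi>_def
      by (simp add: sel diag_mat_carrier[OF o] diag_mat_mult[OF o(1) XA(1) o(2) XB(1)] diag_mat_mult[OF XA(1) o(1) XB(1) o(2)]
          diag_mat_mult[OF o(1) XA(2) o(2) XB(2)] diag_mat_mult[OF XA(2) o(1) XB(2) o(2)]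
          left_mult_one_mat[OF XA(1)] left_mult_one_mat[OF XA(2)] right_mult_one_mat[OF XA(1)] right_mult_one_mat[OF XA(2)]
          left_mult_zero_mat[OF XB(1)] left_mult_zero_mat[OF XB(2)] right_mult_zero_mat[OF XB(1)] right_mult_zero_mat[OF XB(2)])
    have \<pi>\<pi>: "hom_comp \<pi> \<pi> = \<pi>" unfolding hom_comp_def \<pi>_def by (simp add: diag_mat_mult[OF o(1) o(1) o(2) o(2)])
    have \<pi>f: "is_hom n N ?D (hom_comp \<pi> f)" by (rule is_hom_comp[OF N D D f \<pi>])
    define e where "e = hom_comp g (hom_comp \<pi> f)"
    have e: "is_hom n N N e" unfolding e_def by (rule is_hom_comp[OF N D N \<pi>f g])
    have fe: "hom_comp f e = hom_comp \<pi> f" unfolding e_def hom_comp_assoc[OF \<pi>f g f, symmetric] fg by (rule hom_comp_id(2)[OF \<pi>f])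
    have "hom_comp e e = hom_comp g (hom_comp (hom_comp \<pi> f) e)" unfolding e_def
      by (rule hom_comp_assoc[OF _ \<pi>f g]) (rule e[unfolded e_def])
    also have "hom_comp (hom_comp \<pi> f) e = hom_comp \<pi> (hom_comp \<pi> f)" unfolding hom_comp_assoc[OF e f \<pi>] fe ..
    also have "\<dots> = hom_comp \<pi> f" unfolding hom_comp_assoc[OF f \<pi> \<pi>, symmetric] \<pi>\<pi> ..
    finally have "hom_comp e e = e" unfolding e_def .
    from idem[OF e this] show ?thesis
    proof
      assume z: "e = hom_zero N N"
      have "hom_comp \<pi> f = hom_zero N ?D" unfolding fe[symmetric] z by (rule hom_comp_zero(2)[OF f])
      then have "hom_comp (hom_comp \<pi> f) g = hom_zero ?D ?D" using hom_comp_zero(1)[OF g] by simp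
      then have "\<pi> = hom_zero ?D ?D" unfolding hom_comp_assoc[OF g f \<pi>] fg hom_comp_id(1)[OF \<pi>] .
      then have m: "diag_mat (1\<^sub>m (rk A)) (0\<^sub>m (rk B) (rk B)) = (0\<^sub>m (rk A + rk B) (rk A + rk B) :: complex fps mat)"
        unfolding \<pi>_def hom_zero_def sel by (rule fun_cong)
      show ?thesis
      proof (rule ccontr)
        assume nz: "\<not> ?thesis"
        then have "(1 :: complex fps) = diag_mat (1\<^sub>m (rk A)) (0\<^sub>m (rk B) (rk B)) $$ (0,0)" by (simp add: diag_mat_def)
        also have "\<dots> = 0" unfolding m using nz by simp
        finally show False by simp
      qed
    next
      assume z: "e = hom_id N"
      have "hom_comp \<pi> f = f" unfolding fe[symmetric] z by (rule hom_comp_id(1)[OF f])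
      then have "\<pi> = hom_id ?D" using hom_comp_assoc[OF g f \<pi>] fg hom_comp_id(1)[OF \<pi>] by simp
      then have m: "diag_mat (1\<^sub>m (rk A)) (0\<^sub>m (rk B) (rk B)) = (1\<^sub>m (rk A + rk B) :: complex fps mat)"
        unfolding \<pi>_def hom_id_def sel by (rule fun_cong)
      show ?thesis
      proof (rule ccontr)
        assume nz: "\<not> ?thesis"
        then have pos: "0 < rk B" by simp
        have "diag_mat (1\<^sub>m (rk A)) (0\<^sub>m (rk B) (rk B)) $$ (rk A, rk A) = (0 :: complex fps)"
          unfolding diag_mat_def using pos by (subst index_mat_four_block(1)) simp_all
        then show False unfolding m using pos by simp
      qed
    qed
  qed
  with N pos show ?thesis unfolding indecomposable_def by simp
qed

context three_peaks
begin

text \<open>A vector of \<open>W\<close> at b - 3 is a morphism from the projective at that vertex,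
  which is the rank 1 module of the subset b - 2, b - 1, b. The exponent 1 - hX(b - 3) = b + 1 is
  that of a morphism from \<open>L_I\<close> into this projective, so every such vector also gives a
  morphism from \<open>L_I\<close>. The cases follow the rim of the projective.\<close>

lemma lift_peak:
  assumes W: "lat_family 3 n m W" and e: "e \<in> W (b - 3)"
  shows "tpow (hI i) \<cdot>\<^sub>v (tpow (1 - hX (b - 3)) \<cdot>\<^sub>v e) \<in> W i"
proof -
  have ec: "e \<in> carrier_vec m" using latticeD(1)[OF lat_familyD(1)[OF W] e] .
  obtain p q where p: "i = p + q * int n" "a - 2 \<le> p" "p < a - 2 + int n" using vertex .
  have hb: "hX (b - 3) = - b" using gaps by (simp add: h_val)
  have up: "tpow (hI p) \<cdot>\<^sub>v (tpow (1 - hX (b - 3)) \<cdot>\<^sub>v e) \<in> W p" if "tpow x \<cdot>\<^sub>v e \<in> W p" "x \<le> hI p + 1 + b" for x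
    using fam_scale_up[OF W that] by (simp add: smult_smult_assoc tpow_add[symmetric] hb add.assoc)
  have "tpow (hI p) \<cdot>\<^sub>v (tpow (1 - hX (b - 3)) \<cdot>\<^sub>v e) \<in> W p"
  proof -
    consider "p \<le> b - 3" | "b - 3 < p" "p \<le> b" | "b < p" by linarith
    then show ?thesis
    proof cases
      case 1
      have "tpow (b - 3 - p) \<cdot>\<^sub>v e \<in> W p" using fam_left[OF W e, of "nat (b - 3 - p)"] 1 by simp
      moreover have "b - 3 - p \<le> hI p + 1 + b" unfolding h_val[OF p(2,3)] by simp
      ultimately show ?thesis by (rule up)
    next
      case 2
      have "tpow 0 \<cdot>\<^sub>v e \<in> W p" using fam_right[OF W e, of "nat (p - (b - 3))"] 2 by (simp add: one_smult_vec)
      moreover have "0 \<le> hI p + 1 + b" unfolding h_val[OF p(2,3)] using 2 gaps by auto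
      ultimately show ?thesis by (rule up)
    next
      case 3
      have "tpow (int n - 3) \<cdot>\<^sub>v (tpow (- (int n - 3)) \<cdot>\<^sub>v e) = e" by (simp add: smult_smult_assoc del: minus_diff_eq)
      then have "tpow (- (int n - 3)) \<cdot>\<^sub>v e \<in> W (b - 3 + int n)"
        using lat_familyD(4)[OF W, of "tpow (- (int n - 3)) \<cdot>\<^sub>v e" "b - 3"] e ec by simp
      from fam_left[OF W this, of "nat (b - 3 + int n - p)"]
      have "tpow (b - 3 + int n - p) \<cdot>\<^sub>v (tpow (- (int n - 3)) \<cdot>\<^sub>v e) \<in> W p" using p gaps by simp
      then have "tpow (b - p) \<cdot>\<^sub>v e \<in> W p" by (simp add: smult_smult_assoc tpow_add[symmetric])
      moreover have "b - p \<le> hI p + 1 + b" unfolding h_val[OF p(2,3)] using 3 gaps by auto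
      ultimately show ?thesis by (rule up)
    qed
  qed
  then show ?thesis using transfer_shift[OF W, of "tpow (1 - hX (b - 3)) \<cdot>\<^sub>v e" p q] ec p(1) by simp
qed

lemma lift_peak2:
  assumes W: "lat_family 3 n m W" and e: "e \<in> W (c - 3)"
  shows "tpow (hI i) \<cdot>\<^sub>v (tpow (1 - hX (c - 3)) \<cdot>\<^sub>v e) \<in> W i"
proof -
  interpret R: three_peaks n b c "a + int n" by (rule rotate)
  show ?thesis using R.lift_peak[OF W e, of i] by (simp add: h_rotate smult_smult_assoc tpow_add[symmetric] algebra_simps)
qed

text \<open>By the splitting criterion it is enough to lift every morphism from \<open>L_I\<close>
  to N along the surjection of the extension. Each is a sum of two morphisms that factor through the
  projectives at b - 3 and c - 3, and those lift.\<close>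

lemma rank2_rigid:
  assumes N: "models 3 n N 2 LN"
  shows "rigid 3 n N"
proof -
  note kn = three_le(1)
  obtain M where M: "models 3 n M 3 LM" using model_exists[OF LM_family three_le] .
  obtain L where L: "models 3 n L 1 (line_lat hI)" using model_exists[OF line_lat_family[OF rimfun_hI] three_le] .
  obtain f0 g0 where AR: "AR_sequence 3 n N M L f0 g0" by (rule AR_sequence_exists[OF N M L])
  note S0 = AR_D(1)[OF AR]
  obtain \<phi> where PN: "presents 3 n N \<phi>" and latN: "\<And>i. lat (\<phi> i) = LN i" and rN: "rk N = 2" by (rule modelsD[OF N]) metis
  obtain \<chi> where PL: "presents 3 n L \<chi>" and latL: "\<And>i. lat (\<chi> i) = line_lat hI i" and rL: "rk L = 1" by (rule modelsD[OF L]) metis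
  have "split_epi n E N g" if S: "short_exact 3 n N E N f g" for E f g
  proof (rule extension_splits_if_lifts[OF S0 AR_D(2)[OF AR] _ S])
    show "\<exists>h'. is_hom n M W h' \<and> hom_comp h' f0 = h" if "CM 3 n W" "is_hom n N W h" "\<not> split_mono n N W h" for W h
      using AR_D(4)[OF AR that] .
  next
    fix q assume q: "is_hom n L N q"
    note SD = short_exactD[OF S]
    obtain \<omega> where PE: "presents 3 n E \<omega>" using presents_exists[OF SD(2)] .
    let ?m = "rk E"
    have fam: "lat_family 3 n ?m (\<lambda>i. lat (\<omega> i))" by (rule presents_family[OF PE kn])
    from hom_matrix[OF PE PN SD(5)] obtain G where G: "G \<in> carrier_mat (rk N) (rk E)" "\<And>i. \<phi> i * toK (g i) = G * \<omega> i" by metis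
    from hom_matrix[OF PL PN q] obtain Q where Q: "Q \<in> carrier_mat (rk N) (rk L)" "\<And>i. \<phi> i * toK (q i) = Q * \<chi> i" by metis
    have Qc: "Q \<in> carrier_mat 2 1" using Q rN rL by simp
    define y where "y = col Q 0"
    have y: "y \<in> carrier_vec 2" unfolding y_def by (rule col_carrier_vec[OF _ Qc]) simp
    have yN: "tpow (hI i) \<cdot>\<^sub>v y \<in> LN i" for i
    proof -
      have "vec1 (tpow (hI i)) \<in> lat (\<chi> i)" unfolding latL by (simp add: line_lat_def)
      from hom_lat[OF PL PN q Q(1) Q(2) this]
      show ?thesis unfolding latN mat_vec_1[OF Qc vec1_simps(1)] by (simp add: y_def)
    qed
    \<comment> \<open>At the first two peaks \<open>hI\<close> equals \<open>hX\<close>, whereas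
      \<open>g1\<close> respectively \<open>g2\<close> is larger by one.\<close>
    have y1: "y $ 0 \<in> tO 1" "y $ 1 \<in> tO 1" using yN[of "a - 1"] yN[of "b - 1"] y h_peaks by (auto simp: LN_def)
    have lift: "\<exists>s\<in>carrier_vec ?m. G *\<^sub>v s = x \<and> (\<forall>i. tpow (hI i) \<cdot>\<^sub>v s \<in> lat (\<omega> i))"
      if x: "x \<in> carrier_vec 2" "tpow (hX v - 1) \<cdot>\<^sub>v x \<in> LN v"
        and lp: "\<And>e i. e \<in> lat (\<omega> v) \<Longrightarrow> tpow (hI i) \<cdot>\<^sub>v (tpow (1 - hX v) \<cdot>\<^sub>v e) \<in> lat (\<omega> i)" for x v
    proof -
      obtain e where e: "e \<in> lat (\<omega> v)" "G *\<^sub>v e = tpow (hX v - 1) \<cdot>\<^sub>v x"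
        by (rule exact_surj_lat[OF S PE PN G, of "tpow (hX v - 1) \<cdot>\<^sub>v x" v]) (use x(2) latN in auto)
      have ec: "e \<in> carrier_vec ?m" using lat_carrier[OF PE e(1)] .
      have "G *\<^sub>v (tpow (1 - hX v) \<cdot>\<^sub>v e) = tpow (1 - hX v) \<cdot>\<^sub>v (tpow (hX v - 1) \<cdot>\<^sub>v x)"
        using mult_mat_vec[OF G(1) ec] e(2) by simp
      also have "\<dots> = x" by (simp add: smult_smult_assoc tpow_add[symmetric] one_smult_vec)
      finally show ?thesis using lp[OF e(1)] ec by (intro bexI[of _ "tpow (1 - hX v) \<cdot>\<^sub>v e"]) auto
    qed
    \<comment> \<open>The vertices b - 3 and c - 3 are the last ones of the first two segments. At b
      - 3 only \<open>g1\<close> exceeds \<open>hX\<close>, so the factor t in the second coordinate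
      of y pays for the exponent hX - 1; at c - 3 only \<open>g2\<close> does, which suits the first
      coordinate.\<close>
    have hb: "g2 (b - 3) = hX (b - 3)" "g3 (b - 3) = hX (b - 3)" using gaps by (auto simp: h_val)
    have hc: "g1 (c - 3) = hX (c - 3)" "g3 (c - 3) = hX (c - 3)" using gaps by (auto simp: h_val)
    have "\<exists>s\<in>carrier_vec ?m. G *\<^sub>v s = vec2 0 (y $ 1) \<and> (\<forall>i. tpow (hI i) \<cdot>\<^sub>v s \<in> lat (\<omega> i))"
      by (rule lift[of _ "b - 3"]) (use y1 hb lift_peak[OF fam] in \<open>auto simp: LN_def\<close>)
    then obtain s1 where s1: "s1 \<in> carrier_vec ?m" "G *\<^sub>v s1 = vec2 0 (y $ 1)" "\<And>i. tpow (hI i) \<cdot>\<^sub>v s1 \<in> lat (\<omega> i)" by blast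
    have "\<exists>s\<in>carrier_vec ?m. G *\<^sub>v s = vec2 (y $ 0) 0 \<and> (\<forall>i. tpow (hI i) \<cdot>\<^sub>v s \<in> lat (\<omega> i))"
      by (rule lift[of _ "c - 3"]) (use y1 hc lift_peak2[OF fam] in \<open>auto simp: LN_def\<close>)
    then obtain s2 where s2: "s2 \<in> carrier_vec ?m" "G *\<^sub>v s2 = vec2 (y $ 0) 0" "\<And>i. tpow (hI i) \<cdot>\<^sub>v s2 \<in> lat (\<omega> i)" by blast
    define s where "s = s1 + s2"
    have s: "s \<in> carrier_vec ?m" using s1 s2 by (simp add: s_def)
    have "G *\<^sub>v s = G *\<^sub>v s1 + G *\<^sub>v s2" unfolding s_def by (rule mult_add_distrib_mat_vec[OF G(1) s1(1) s2(1)])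
    also have "\<dots> = y" unfolding s1 s2 using y by (intro eq_vecI) (auto simp: less2)
    finally have Gs: "G *\<^sub>v s = y" .
    have sW: "tpow (hI i) \<cdot>\<^sub>v s \<in> lat (\<omega> i)" for i
      unfolding s_def smult_add_distrib_vec[OF s1(1) s2(1)] by (rule latticeD(2)[OF lat_familyD(1)[OF fam] s1(3) s2(3)])
    define T where "T = mat_of_cols ?m [s]"
    have Tc: "T \<in> carrier_mat ?m 1" using mat_of_cols_carrier(1)[of ?m "[s]"] by (simp add: T_def)
    have Tv: "T *\<^sub>v v = v $ 0 \<cdot>\<^sub>v s" if "v \<in> carrier_vec 1" for v
      using mat_vec_1[OF Tc that] s(1) by (simp add: T_def)
    have Tc': "T \<in> carrier_mat (rk E) (rk L)" using Tc rL by simp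
    obtain t where t: "is_hom n L E t" "\<And>i. \<omega> i * toK (t i) = T * \<chi> i"
    proof (rule hom_of_matrix[OF PL PE kn Tc'])
      fix i v assume "v \<in> lat (\<chi> i)"
      then have v: "v \<in> carrier_vec 1" "v $ 0 \<in> tO (hI i)" using latL by (auto simp: line_lat_def)
      have "tpow (- hI i) * v $ 0 \<in> tO 0" using v by simp
      from latticeD(3)[OF lat_familyD(1)[OF fam] this sW[of i]]
      show "T *\<^sub>v v \<in> lat (\<omega> i)" unfolding Tv[OF v(1)] by (simp add: smult_smult_assoc mult.assoc mult.commute[of "v $ 0"])
    qed blast
    have "hom_comp g t = q"
    proof (rule hom_comp_eq[OF PL PE PN t(1) SD(5) q Tc' t(2) G Q])
      fix v :: "complex fls vec" assume "v \<in> carrier_vec (rk L)"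
      then have v: "v \<in> carrier_vec 1" using rL by simp
      show "G *\<^sub>v (T *\<^sub>v v) = Q *\<^sub>v v" unfolding Tv[OF v] mat_vec_1[OF Qc v] mult_mat_vec[OF G(1) s] Gs by (simp add: y_def)
    qed
    then show "\<exists>q'. is_hom n L E q' \<and> hom_comp g q' = q" using t by blast
  qed
  then show ?thesis using presentsD(1)[OF PN] by (auto simp: rigid_def)
qed

lemma rank2_indecomposable:
  assumes N: "models 3 n N 2 LN"
  shows "indecomposable 3 n N"
proof -
  obtain \<phi> where PN: "presents 3 n N \<phi>" and latN: "\<And>i. lat (\<phi> i) = LN i" and rN: "rk N = 2" by (rule modelsD[OF N]) metis
  note D = presentsD[OF PN]
  show ?thesis
  proof (rule indecomposable_if[OF D(1)])
    fix e assume e: "is_hom n N N e" "hom_comp e e = e"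
    from hom_matrix[OF PN PN e(1)] obtain E where E: "E \<in> carrier_mat (rk N) (rk N)" "\<And>i. \<phi> i * toK (e i) = E * \<phi> i" by metis
    have Ec: "E \<in> carrier_mat 2 2" using E rN by simp
    define p q u s where "p = E $$ (0,0)" and "q = E $$ (0,1)" and "u = E $$ (1,0)" and "s = E $$ (1,1)"
    note pq = this
    have Ev: "E *\<^sub>v v = vec2 (p * v $ 0 + q * v $ 1) (u * v $ 0 + s * v $ 1)" if "v \<in> carrier_vec 2" for v
      using that Ec unfolding pq by (intro eq_vecI) (auto simp: less2 scalar_prod_def sum2)
    have "\<forall>i. \<forall>v\<in>LN i. vec2 (p * v $ 0 + q * v $ 1) (u * v $ 0 + s * v $ 1) \<in> LN i"
      using hom_lat[OF PN PN e(1) E] latN Ev by (auto simp: LN_def)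
    then have R: "p \<in> tO 0" "s \<in> tO 0" "q \<in> tO 1" "u \<in> tO 1" "p - s \<in> tO 1" unfolding LN_endo by auto
    have EE: "E * E = E"
    proof (rule mat_right_cancel[OF mult_carrier_mat[OF E(1) E(1)] E(1) D(2) D(3)])
      show "E * E * \<phi> 0 = E * \<phi> 0" using hom_comp_matrix[OF PN PN PN e(1) e(1) E(1) E(2) E(1) E(2), of 0] e(2) E(2)[of 0] by simp
    qed
    have ent: "(E * E) $$ (i,j) = E $$ (i,0) * E $$ (0,j) + E $$ (i,1) * E $$ (1,j)" if "i < 2" "j < 2" for i j
      using that Ec by (auto simp: scalar_prod_def sum2)
    have eqs: "p * p + q * u = p" "p * q + q * s = q" "u * p + s * u = u" "u * q + s * s = s"
      using ent[of 0 0] ent[of 0 1] ent[of 1 0] ent[of 1 1] unfolding EE pq by auto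
    have qu: "q * u \<in> tO 1" using tO_mult[OF R(3,4)] by (auto elim: tO_mono)
    have one: "(1 :: complex fls) \<notin> tO 1" by simp
    have "p \<in> tO 1 \<or> 1 - p \<in> tO 1"
    proof (rule ccontr)
      assume h: "\<not> ?thesis"
      have "p * (1 - p) \<notin> tO 1" by (rule tO_mult_notin_1) (use h R(1) in \<open>auto intro!: tO_diff\<close>)
      moreover have "p * (1 - p) = q * u" using eqs(1) by (simp add: algebra_simps)
      ultimately show False using qu by simp
    qed
    \<comment> \<open>Modulo t the diagonal entries are equal and idempotent, so p + s - 1 is 1 or
      -1 there. The equations for the off-diagonal entries then make these vanish.\<close>
    then have ps: "p + s - 1 \<noteq> 0"
    proof
      assume "p \<in> tO 1"
      moreover have "s \<in> tO 1" using tO_diff[OF \<open>p \<in> tO 1\<close> R(5)] by simp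
      ultimately have "p + s \<in> tO 1" by (rule tO_add)
      then show ?thesis using one by auto
    next
      assume h: "1 - p \<in> tO 1"
      have "(1 - p) + ((1 - p) + (p - s)) \<in> tO 1" by (intro tO_add h R(5))
      moreover have "(1 - p) + ((1 - p) + (p - s)) = 1 - (p + s - 1)" by (simp add: algebra_simps)
      ultimately have "1 - (p + s - 1) \<in> tO 1" by metis
      then show ?thesis using one by (metis diff_zero)
    qed
    have "q * (p + s - 1) = 0" "u * (p + s - 1) = 0" using eqs(2,3) by (simp_all add: algebra_simps)
    then have q0: "q = 0" "u = 0" using ps by auto
    have "p * (p - 1) = 0" "s * (s - 1) = 0" using eqs(1,4) q0 by (simp_all add: algebra_simps)
    then have "p = 0 \<or> p = 1" "s = 0 \<or> s = 1" by auto
    moreover have "p = s" using calculation R(5) one tO_uminus[of "-1" 1] by auto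
    ultimately have "E = 0\<^sub>m 2 2 \<or> E = 1\<^sub>m 2"
    proof -
      assume "p = 0 \<or> p = 1" "p = s"
      then show ?thesis using q0 Ec unfolding pq by (elim disjE) (auto intro!: eq_matI simp: less2)
    qed
    then show "e = hom_zero N N \<or> e = hom_id N"
    proof
      assume z: "E = 0\<^sub>m 2 2"
      have zh: "is_hom n N N (hom_zero N N)" using is_hom_sub[OF D(1,1) e(1) e(1)] hom_sub_self[OF e(1)] by simp
      have "e = hom_zero N N"
      proof (rule hom_eq_if_matrix_eq[OF PN PN e(1) zh])
        fix i show "\<phi> i * toK (e i) = \<phi> i * toK (hom_zero N N i)"
        proof -
          have "toK (hom_zero N N i) = 0\<^sub>m (rk N) (rk N)" by (auto simp: hom_zero_def)
          then show ?thesis unfolding E(2) z using D(2)[of i] rN by simp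
        qed
      qed
      then show ?thesis ..
    next
      assume z: "E = 1\<^sub>m 2"
      have "e = hom_id N"
      proof (rule hom_eq_if_matrix_eq[OF PN PN e(1) is_hom_id[OF D(1)]])
        fix i show "\<phi> i * toK (e i) = \<phi> i * toK (hom_id N i)" unfolding E(2) hom_id_matrix[OF PN] z rN ..
      qed
      then show ?thesis ..
    qed
  qed (use rN in simp)
qed

end

section \<open>Lattice diagrams and profiles\<close>

lemma subspace_iff:
  "VectorSpace.subspace class_ring S (module_vec TYPE(complex) m) \<longleftrightarrow>
    S \<subseteq> carrier_vec m \<and> 0\<^sub>v m \<in> S \<and> (\<forall>u\<in>S. \<forall>v\<in>S. u + v \<in> S) \<and> (\<forall>c. \<forall>v\<in>S. c \<cdot>\<^sub>v v \<in> S)"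
  (is "?L \<longleftrightarrow> ?R")
proof
  assume ?L
  then have s: "submodule class_ring S (module_vec TYPE(complex) m)" by (simp add: VectorSpace.subspace_def)
  show ?R using submodule.subset[OF s] submodule.m_closed[OF s] submodule.zero_closed[OF s] submodule.smult_closed[OF s]
    by (auto simp: module_vec_simps class_ring_simps)
next
  assume R: ?R
  have vs: "vectorspace class_ring (module_vec TYPE(complex) m)" by (rule vec_vs)
  have "submodule class_ring S (module_vec TYPE(complex) m)"
    by (rule submodule.intro) (use R vec_module in \<open>auto simp: module_vec_simps class_ring_simps\<close>)
  then show ?L using vs by (simp add: VectorSpace.subspace_def)
qed

text \<open>The dimension is transported from C^r along an injective matrix, so no basis of the
  subspace has to be exhibited.\<close>

lemma multiplicity_image:
  assumes A: "A \<in> carrier_mat m r" and inj: "inj_on (\<lambda>v. A *\<^sub>v v) (carrier_vec r)"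
    and V: "V i j = (\<lambda>v. A *\<^sub>v v) ` carrier_vec r"
  shows "multiplicity_at m V i j = r"
proof -
  let ?W = "(module_vec TYPE(complex) m)\<lparr>carrier := V i j\<rparr>" and ?U = "module_vec TYPE(complex) r"
  interpret U: vec_space "TYPE(complex)" r .
  have Ac: "A *\<^sub>v v \<in> carrier_vec m" if "v \<in> carrier_vec r" for v using mult_mat_vec_carrier[OF A that] .
  have "VectorSpace.subspace class_ring (V i j) (module_vec TYPE(complex) m)"
    unfolding subspace_iff V
  proof (intro conjI ballI allI)
    show "0\<^sub>v m \<in> (\<lambda>v. A *\<^sub>v v) ` carrier_vec r" by (rule image_eqI[of _ _ "0\<^sub>v r"]) (use A in \<open>auto intro!: eq_vecI\<close>)
    fix u assume "u \<in> (\<lambda>v. A *\<^sub>v v) ` carrier_vec r"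
    then obtain x where x: "x \<in> carrier_vec r" "u = A *\<^sub>v x" by auto
    show "c \<cdot>\<^sub>v u \<in> (\<lambda>v. A *\<^sub>v v) ` carrier_vec r" for c
      by (rule image_eqI[of _ _ "c \<cdot>\<^sub>v x"]) (use A x in \<open>auto simp: mult_mat_vec\<close>)
    fix v assume "v \<in> (\<lambda>v. A *\<^sub>v v) ` carrier_vec r"
    then obtain y where y: "y \<in> carrier_vec r" "v = A *\<^sub>v y" by auto
    show "u + v \<in> (\<lambda>v. A *\<^sub>v v) ` carrier_vec r"
      by (rule image_eqI[of _ _ "x + y"]) (use A x y in \<open>auto simp: mult_add_distrib_mat_vec\<close>)
  qed (use Ac in auto)
  then have W: "vectorspace class_ring ?W" by (rule vectorspace.subspace_is_vs[OF vec_vs])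
  interpret W: vectorspace class_ring ?W by (rule W)
  have "linear_map class_ring ?U ?W (\<lambda>v. A *\<^sub>v v)"
  proof (intro linear_map.intro mod_hom.intro mod_hom_axioms.intro vec_vs W)
    show "Module.module class_ring ?U" by (rule vec_module)
    show "Module.module class_ring ?W" using W by (rule vectorspace.axioms)
    show "(\<lambda>v. A *\<^sub>v v) \<in> LinearCombinations.module_hom class_ring ?U ?W"
      unfolding LinearCombinations.module_hom_def using A V
      by (auto simp: module_vec_simps class_ring_simps mult_add_distrib_mat_vec[OF A] mult_mat_vec[OF A])
  qed
  then interpret T: linear_map class_ring ?U ?W "\<lambda>v. A *\<^sub>v v" .
  have "vectorspace.dim class_ring ?U = vectorspace.dim class_ring ?W"
    by (rule T.dim_eq) (use inj V in \<open>auto simp: module_vec_simps\<close>)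
  then show ?thesis unfolding multiplicity_at_def using U.dim_is_n by simp
qed

section \<open>Lattice diagrams as presentations\<close>

definition diag_lat :: "nat \<Rightarrow> (int \<Rightarrow> int \<Rightarrow> complex vec set) \<Rightarrow> int \<Rightarrow> complex fls vec set" where
  "diag_lat m V i = {w \<in> carrier_vec m. \<forall>j. map_vec (\<lambda>c. fls_nth c j) w \<in> V i j}"

lemma lattice_diagram_of_models:
  assumes M: "models k n M m \<Lambda>" and V: "configuration k n m V" and L: "\<And>i. \<Lambda> i = diag_lat m V i"
  shows "lattice_diagram k n M V"
proof -
  obtain \<phi> where P: "presents k n M \<phi>" and lat: "\<And>i. lat (\<phi> i) = \<Lambda> i" and r: "rk M = m" by (rule modelsD[OF M]) metis
  note D = presentsD[OF P]
  have "bij_betw (\<lambda>v. \<phi> i *\<^sub>v map_vec fps_to_fls v) (carrier_vec (rk M))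
          {w \<in> carrier_vec (rk M). \<forall>j. map_vec (\<lambda>c. fls_nth c j) w \<in> V i j}" for i
    unfolding bij_betw_def
  proof
    show "inj_on (\<lambda>v. \<phi> i *\<^sub>v map_vec fps_to_fls v) (carrier_vec (rk M))"
      by (rule inj_onI) (rule basis_vec_inj[OF D(2,3)])
    show "(\<lambda>v. \<phi> i *\<^sub>v map_vec fps_to_fls v) ` carrier_vec (rk M) = {w \<in> carrier_vec (rk M). \<forall>j. map_vec (\<lambda>c. fls_nth c j) w \<in> V i j}"
      using lat_fps[OF D(2), of i] lat[of i] L[of i] r by (simp add: diag_lat_def)
  qed
  then show ?thesis unfolding lattice_diagram_def tpow_1[symmetric]
    using D V r by (intro conjI exI[of _ \<phi>] allI) simp_all
qed

lemma presents_of_lattice_diagram: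
  assumes "lattice_diagram k n M V"
  obtains \<phi> where "presents k n M \<phi>" "\<And>i. lat (\<phi> i) = diag_lat (rk M) V i"
proof -
  let ?m = "rk M"
  obtain \<phi> where all: "\<forall>i. \<phi> i \<in> carrier_mat ?m ?m \<and> \<phi> i * toK (xmap M i) = \<phi> (i - 1) \<and>
    \<phi> (i - 1) * toK (ymap M i) = fls_X \<cdot>\<^sub>m \<phi> i \<and>
    bij_betw (\<lambda>v. \<phi> i *\<^sub>v map_vec fps_to_fls v) (carrier_vec ?m)
          {w \<in> carrier_vec ?m. \<forall>j. map_vec (\<lambda>c. fls_nth c j) w \<in> V i j}"
    using assms unfolding lattice_diagram_def by (elim conjE exE) (rule that)
  have \<phi>: "\<phi> i \<in> carrier_mat ?m ?m" "\<phi> i * toK (xmap M i) = \<phi> (i - 1)"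
    "\<phi> (i - 1) * toK (ymap M i) = fls_X \<cdot>\<^sub>m \<phi> i"
    "bij_betw (\<lambda>v. \<phi> i *\<^sub>v map_vec fps_to_fls v) (carrier_vec ?m)
          {w \<in> carrier_vec ?m. \<forall>j. map_vec (\<lambda>c. fls_nth c j) w \<in> V i j}" for i
    using all[rule_format, of i] by simp_all
  have CM: "CM k n M" using assms by (simp add: lattice_diagram_def)
  \<comment> \<open>A kernel vector over K can be rescaled to be integral, and injectivity on
    integral vectors excludes it.\<close>
  have det: "det (\<phi> i) \<noteq> 0" for i
  proof
    assume "det (\<phi> i) = 0"
    then obtain v where v: "v \<in> carrier_vec ?m" "v \<noteq> 0\<^sub>v ?m" "\<phi> i *\<^sub>v v = 0\<^sub>v ?m"
      using det_0_iff_vec_prod_zero_field[OF \<phi>(1)] by blast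
    obtain d where d: "\<forall>l\<in>{..<?m}. v $ l \<in> tO d" using tO_exists_bound_finite[of "{..<?m}" "\<lambda>l. v $ l"] by auto
    have "tpow (- d) \<cdot>\<^sub>v v \<in> int_vecs ?m" using v(1) d by (auto simp: int_vecs_def)
    then obtain x where x: "x \<in> carrier_vec ?m" "map_vec fps_to_fls x = tpow (- d) \<cdot>\<^sub>v v" unfolding int_vecs_fps by auto
    have z: "\<phi> i *\<^sub>v map_vec fps_to_fls x = 0\<^sub>v ?m" unfolding x(2) mult_mat_vec[OF \<phi>(1) v(1)] v(3) by (auto intro!: eq_vecI)
    have z0: "\<phi> i *\<^sub>v map_vec fps_to_fls (0\<^sub>v ?m) = 0\<^sub>v ?m"
    unfolding fps_fls.vec_hom_zero using \<phi>(1)[of i] by (auto intro!: eq_vecI)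
    have "x = 0\<^sub>v ?m" using inj_onD[OF bij_betw_imp_inj_on[OF \<phi>(4)] _ x(1), of i "0\<^sub>v ?m"] z z0 by simp
    then have "tpow (- d) \<cdot>\<^sub>v v = 0\<^sub>v ?m" using x(2) by (metis fps_fls.vec_hom_zero)
    then have "tpow d \<cdot>\<^sub>v (tpow (- d) \<cdot>\<^sub>v v) = 0\<^sub>v ?m" by (auto intro!: eq_vecI)
    then show False using v(2) by (simp add: smult_smult_assoc one_smult_vec)
  qed
  have "presents k n M \<phi>" unfolding presents_def using CM \<phi> det by (simp add: tpow_1)
  moreover have "lat (\<phi> i) = diag_lat ?m V i" for i
    using lat_fps[OF \<phi>(1), of i] bij_betw_imp_surj_on[OF \<phi>(4), of i] by (simp add: diag_lat_def)
  ultimately show ?thesis using that by blast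
qed

section \<open>Homogeneous components of maps between diagrams\<close>

definition coeff_mat :: "int \<Rightarrow> complex fls mat \<Rightarrow> complex mat" where
  "coeff_mat d A = map_mat (\<lambda>c. fls_nth c d) A"

text \<open>The map is probed with the homogeneous vectors v t^j: the coefficient of degree j + d of
  the image is the component of degree d applied to v.\<close>

lemma coeff_mat_maps:
  assumes F: "F \<in> carrier_mat m m" and Fl: "\<And>w. w \<in> diag_lat m V i \<Longrightarrow> F *\<^sub>v w \<in> diag_lat m V' i"
    and S: "VectorSpace.subspace class_ring (V i j) (module_vec TYPE(complex) m)"
    and Z: "\<And>l. 0\<^sub>v m \<in> V i l" and v: "v \<in> V i j"
  shows "coeff_mat d F *\<^sub>v v \<in> V' i (j + d)"
proof -
  have vc: "v \<in> carrier_vec m" using S v unfolding subspace_iff by blast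
  define w where "w = map_vec (\<lambda>c. fls_const c * tpow j) v"
  have nth: "fls_nth (fls_const c * tpow j) l = (if l = j then c else 0)" for c l
    by (simp add: tpow_coeff)
  have wc: "w \<in> carrier_vec m" using vc by (simp add: w_def)
  have "map_vec (\<lambda>c. fls_nth c l) w \<in> V i l" for l
  proof (cases "l = j")
    case True
    have "map_vec (\<lambda>c. fls_nth c l) w = v" using vc True by (intro eq_vecI) (auto simp: w_def nth tpow_coeff)
    then show ?thesis using v True by simp
  next
    case False
    have "map_vec (\<lambda>c. fls_nth c l) w = 0\<^sub>v m" using vc False by (intro eq_vecI) (auto simp: w_def nth tpow_coeff)
    then show ?thesis using Z by simp
  qed
  then have "w \<in> diag_lat m V i" using wc by (simp add: diag_lat_def)
  from Fl[OF this] have "map_vec (\<lambda>c. fls_nth c (j + d)) (F *\<^sub>v w) \<in> V' i (j + d)" by (simp add: diag_lat_def)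
  moreover have "map_vec (\<lambda>c. fls_nth c (j + d)) (F *\<^sub>v w) = coeff_mat d F *\<^sub>v v"
  proof (rule eq_vecI)
    fix r assume "r < dim_vec (coeff_mat d F *\<^sub>v v)"
    then have r: "r < m" using F by (simp add: coeff_mat_def)
    have s: "fls_nth (sum f A) e = (\<Sum>x\<in>A. fls_nth (f x) e)" for f :: "nat \<Rightarrow> complex fls" and A e
      by (induct A rule: infinite_finite_induct) auto
    have "(F *\<^sub>v w) $ r = (\<Sum>l = 0..<m. F $$ (r,l) * (fls_const (v $ l) * tpow j))"
      using r F vc by (simp add: scalar_prod_def w_def)
    also have "\<dots> = (\<Sum>l = 0..<m. fls_const (v $ l) * (tpow j * F $$ (r,l)))" by (simp add: ac_simps)
    finally have "fls_nth ((F *\<^sub>v w) $ r) (j + d) = (\<Sum>l = 0..<m. v $ l * fls_nth (F $$ (r,l)) d)"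
      by (simp add: s tpow_nth)
    then show "map_vec (\<lambda>c. fls_nth c (j + d)) (F *\<^sub>v w) $ r = (coeff_mat d F *\<^sub>v v) $ r"
      using r F vc by (simp add: coeff_mat_def scalar_prod_def mult.commute)
  qed (use F in \<open>auto simp: coeff_mat_def\<close>)
  ultimately show ?thesis by simp
qed

text \<open>Terms of y beyond degree b cannot reach degree 0 against a factor of order at least -b,
  so y may be replaced by the finite sum \<open>z\<close>.\<close>

lemma fls_nth_mult_0:
  assumes x: "x \<in> tO (- b)" and y: "y \<in> tO (- b)"
  shows "fls_nth (x * y) 0 = (\<Sum>d\<in>{-b..b}. fls_nth x (- d) * fls_nth y d)"
proof -
  define z where "z = (\<Sum>d\<in>{-b..b}. fls_const (fls_nth y d) * tpow d)"
  have s: "fls_nth (sum f A) e = (\<Sum>x\<in>A. fls_nth (f x) e)" for f :: "int \<Rightarrow> complex fls" and A e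
    by (induct A rule: infinite_finite_induct) auto
  have "fls_nth (y - z) j = 0" if "j < b + 1" for j
  proof (cases "- b \<le> j")
    case True
    have "fls_nth z j = (\<Sum>d\<in>{-b..b}. if d = j then fls_nth y d else 0)"
      unfolding z_def s by (intro sum.cong) (auto simp: tpow_coeff)
    also have "\<dots> = fls_nth y j" using True that by simp
    finally show ?thesis by simp
  next
    case False
    have "fls_nth z j = (\<Sum>d\<in>{-b..b}. 0)"
      unfolding z_def s using False by (intro sum.cong) (auto simp: tpow_coeff)
    then show ?thesis using y False by (simp add: tO_def)
  qed
  then have "y - z \<in> tO (b + 1)" by (simp add: tO_def)
  from tO_mult[OF x this] have "x * (y - z) \<in> tO 1" by simp
  then have "fls_nth (x * y) 0 = fls_nth (x * z) 0" by (simp add: tO_def algebra_simps)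
  also have "x * z = (\<Sum>d\<in>{-b..b}. fls_const (fls_nth y d) * (tpow d * x))" unfolding z_def sum_distrib_left by (intro sum.cong) (auto simp: ac_simps)
  also have "fls_nth \<dots> 0 = (\<Sum>d\<in>{-b..b}. fls_nth y d * fls_nth x (- d))" unfolding s by (simp add: tpow_nth)
  finally show ?thesis by (simp add: mult.commute)
qed

text \<open>The degree 0 part of G F = 1, with a finite range of degrees that serves all entries at
  once.\<close>

lemma coeff_mat_inverse:
  assumes G: "G \<in> carrier_mat m m" and F: "F \<in> carrier_mat m m" and GF: "G * F = 1\<^sub>m m"
  shows "\<exists>b. \<forall>r<m. \<forall>l<m. (\<Sum>d\<in>{-b..b}. (coeff_mat (- d) G * coeff_mat d F) $$ (r,l)) = 1\<^sub>m m $$ (r,l)"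
proof -
  obtain b1 where b1: "\<forall>x\<in>{..<m} \<times> {..<m}. F $$ x \<in> tO b1"
    using tO_exists_bound_finite[of "{..<m} \<times> {..<m}"] by (metis finite_cartesian_product finite_lessThan)
  obtain b2 where b2: "\<forall>x\<in>{..<m} \<times> {..<m}. G $$ x \<in> tO b2"
    using tO_exists_bound_finite[of "{..<m} \<times> {..<m}"] by (metis finite_cartesian_product finite_lessThan)
  define b where "b = - min b1 b2"
  have bF: "F $$ (r,l) \<in> tO (- b)" and bG: "G $$ (r,l) \<in> tO (- b)" if "r < m" "l < m" for r l
    using b1 b2 that by (auto simp: b_def intro: tO_mono[where d = b1] tO_mono[where d = b2])
  have s: "fls_nth (sum f A) e = (\<Sum>x\<in>A. fls_nth (f x) e)" for f :: "nat \<Rightarrow> complex fls" and A e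
    by (induct A rule: infinite_finite_induct) auto
  have "(\<Sum>d\<in>{-b..b}. (coeff_mat (- d) G * coeff_mat d F) $$ (r,l)) = 1\<^sub>m m $$ (r,l)" if rl: "r < m" "l < m" for r l
  proof -
    have "(\<Sum>d\<in>{-b..b}. (coeff_mat (- d) G * coeff_mat d F) $$ (r,l))
      = (\<Sum>d\<in>{-b..b}. \<Sum>x = 0..<m. fls_nth (G $$ (r,x)) (- d) * fls_nth (F $$ (x,l)) d)"
      using rl F G by (intro sum.cong) (auto simp: coeff_mat_def scalar_prod_def)
    also have "\<dots> = (\<Sum>x = 0..<m. \<Sum>d\<in>{-b..b}. fls_nth (G $$ (r,x)) (- d) * fls_nth (F $$ (x,l)) d)" by (rule sum.swap)
    also have "\<dots> = (\<Sum>x = 0..<m. fls_nth (G $$ (r,x) * F $$ (x,l)) 0)"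
      using rl bF bG by (intro sum.cong fls_nth_mult_0[symmetric]) auto
    also have "\<dots> = fls_nth ((G * F) $$ (r,l)) 0" unfolding s[symmetric] using rl F G by (simp add: scalar_prod_def)
    also have "\<dots> = 1\<^sub>m m $$ (r,l)" unfolding GF using rl by auto
    finally show ?thesis .
  qed
  then show ?thesis by blast
qed

definition scalar_endos :: "nat \<Rightarrow> (int \<Rightarrow> int \<Rightarrow> complex vec set) \<Rightarrow> bool" where
  "scalar_endos m V \<longleftrightarrow> (\<forall>A\<in>carrier_mat m m. (\<forall>i j. \<forall>v\<in>V i j. A *\<^sub>v v \<in> V i j) \<longrightarrow> (\<exists>c. A = c \<cdot>\<^sub>m 1\<^sub>m m))"

text \<open>The isomorphism between two diagrams of one module has homogeneous components. If all
  endomorphisms of degree 0 are scalar, then one of these components is itself an isomorphism.\<close>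

lemma diagram_unique_up_to_shift:
  assumes V: "lattice_diagram k n M V" and V': "lattice_diagram k n M V'" and pos: "0 < rk M"
    and sc: "scalar_endos (rk M) V" and kn: "k \<le> n"
    and im: "\<And>i j. \<exists>r. \<exists>A\<in>carrier_mat (rk M) r. inj_on (\<lambda>v. A *\<^sub>v v) (carrier_vec r) \<and> V i j = (\<lambda>v. A *\<^sub>v v) ` carrier_vec r"
  obtains d where "\<And>i j. multiplicity_at (rk M) V' i (j + d) = multiplicity_at (rk M) V i j"
proof -
  let ?m = "rk M"
  obtain \<phi> where P: "presents k n M \<phi>" and lat: "\<And>i. lat (\<phi> i) = diag_lat ?m V i" by (rule presents_of_lattice_diagram[OF V]) metis
  obtain \<psi> where Q: "presents k n M \<psi>" and lat': "\<And>i. lat (\<psi> i) = diag_lat ?m V' i" by (rule presents_of_lattice_diagram[OF V']) metis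
  note id = is_hom_id[OF presentsD(1)[OF P]]
  have S: "VectorSpace.subspace class_ring (V i j) (module_vec TYPE(complex) ?m)"
    "VectorSpace.subspace class_ring (V' i j) (module_vec TYPE(complex) ?m)" for i j
    using V V' by (auto simp: lattice_diagram_def configuration_def)
  have Z: "0\<^sub>v ?m \<in> V i j" "0\<^sub>v ?m \<in> V' i j" for i j using S unfolding subspace_iff by blast+
  from hom_matrix[OF P Q id] obtain F where F: "F \<in> carrier_mat ?m ?m" "\<And>i. \<psi> i * toK (hom_id M i) = F * \<phi> i" by metis
  from hom_matrix[OF Q P id] obtain G where G: "G \<in> carrier_mat ?m ?m" "\<And>i. \<phi> i * toK (hom_id M i) = G * \<psi> i" by metis
  have "G * F = 1\<^sub>m ?m"
  proof (rule mat_right_cancel[OF mult_carrier_mat[OF G(1) F(1)] one_carrier_mat presentsD(2)[OF P] presentsD(3)[OF P]])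
    show "G * F * \<phi> 0 = 1\<^sub>m ?m * \<phi> 0"
      using hom_comp_matrix[OF P Q P id id F G, of 0] hom_comp_id(1)[OF id] hom_id_matrix[OF P, of 0] by simp
  qed
  from coeff_mat_inverse[OF G(1) F(1) this] obtain b where b: "\<forall>r<?m. \<forall>l<?m.
    (\<Sum>d\<in>{-b..b}. (coeff_mat (- d) G * coeff_mat d F) $$ (r,l)) = 1\<^sub>m ?m $$ (r,l)" ..
  have Fm: "coeff_mat d F *\<^sub>v v \<in> V' i (j + d)" if "v \<in> V i j" for v d i j
    by (rule coeff_mat_maps[where V = V and i = i and j = j, OF F(1) _ S(1) Z(1) that]) (use hom_lat[OF P Q id F] lat lat' in auto)
  have Gm: "coeff_mat d G *\<^sub>v v \<in> V i (j + d)" if "v \<in> V' i j" for v d i j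
    by (rule coeff_mat_maps[where V = V' and i = i and j = j, OF G(1) _ S(2) Z(2) that]) (use hom_lat[OF Q P id G] lat lat' in auto)
  have cc: "coeff_mat d F \<in> carrier_mat ?m ?m" "coeff_mat d G \<in> carrier_mat ?m ?m" for d using F G by (auto simp: coeff_mat_def)
  have cV: "v \<in> carrier_vec ?m" if "v \<in> V i j \<or> v \<in> V' i j" for v i j using S that unfolding subspace_iff by blast
  have "\<exists>c. coeff_mat (- d) G * coeff_mat d F = c \<cdot>\<^sub>m 1\<^sub>m ?m" for d
  proof -
    have "coeff_mat (- d) G * coeff_mat d F *\<^sub>v v \<in> V i j" if "v \<in> V i j" for v i j
      using Gm[OF Fm[OF that, of d], of "- d"] assoc_mult_mat_vec[OF cc(2) cc(1) cV, of v i j] that by simp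
    then show ?thesis using sc mult_carrier_mat[OF cc(2) cc(1)] unfolding scalar_endos_def by blast
  qed
  then obtain c where c: "\<And>d. coeff_mat (- d) G * coeff_mat d F = c d \<cdot>\<^sub>m 1\<^sub>m ?m" by metis
  \<comment> \<open>The products of components of opposite degrees add up to the identity, so they
    are not all zero; a nonzero scalar makes the component of that degree invertible.\<close>
  have "\<exists>d. c d \<noteq> 0"
  proof (rule ccontr)
    assume "\<nexists>d. c d \<noteq> 0"
    then have "(\<Sum>d\<in>{-b..b}. (coeff_mat (- d) G * coeff_mat d F) $$ (0,0)) = 0" unfolding c using pos by (intro sum.neutral) auto
    then show False using b pos by simp
  qed
  then obtain d where d: "c d \<noteq> 0" by blast
  define P where "P = coeff_mat d F"
  define R where "R = (1 / c d) \<cdot>\<^sub>m coeff_mat (- d) G"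
  have Pc: "P \<in> carrier_mat ?m ?m" and Rc: "R \<in> carrier_mat ?m ?m" using cc by (auto simp: P_def R_def)
  have RP: "R * P = 1\<^sub>m ?m"
  proof -
    have "R * P = (1 / c d) \<cdot>\<^sub>m (coeff_mat (- d) G * coeff_mat d F)" unfolding R_def P_def by (rule mult_smult_assoc_mat[OF cc(2) cc(1)])
    then show ?thesis unfolding c using d by (auto intro!: eq_matI)
  qed
  have PR: "P * R = 1\<^sub>m ?m" by (rule mat_mult_left_right_inverse[OF Rc Pc RP])
  have "multiplicity_at ?m V' i (j + d) = multiplicity_at ?m V i j" for i j
  proof -
    obtain r A where A: "A \<in> carrier_mat ?m r" "inj_on (\<lambda>v. A *\<^sub>v v) (carrier_vec r)" "V i j = (\<lambda>v. A *\<^sub>v v) ` carrier_vec r" using im by blast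
    have PA: "P * A *\<^sub>v v = P *\<^sub>v (A *\<^sub>v v)" if "v \<in> carrier_vec r" for v by (rule assoc_mult_mat_vec[OF Pc A(1) that])
    have Rback: "R *\<^sub>v (P *\<^sub>v v) = v" if "v \<in> carrier_vec ?m" for v
      using assoc_mult_mat_vec[OF Rc Pc that] RP that by simp
    have Pback: "P *\<^sub>v (R *\<^sub>v v) = v" if "v \<in> carrier_vec ?m" for v
      using assoc_mult_mat_vec[OF Pc Rc that] PR that by simp
    have "multiplicity_at ?m V' i (j + d) = r"
    proof (rule multiplicity_image)
      show "P * A \<in> carrier_mat ?m r" by (rule mult_carrier_mat[OF Pc A(1)])
      show "inj_on (\<lambda>v. P * A *\<^sub>v v) (carrier_vec r)"
      proof (rule inj_onI)
        fix x y assume xy: "x \<in> carrier_vec r" "y \<in> carrier_vec r" "P * A *\<^sub>v x = P * A *\<^sub>v y"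
        then have "A *\<^sub>v x = A *\<^sub>v y" unfolding PA[OF xy(1)] PA[OF xy(2)]
          using Rback[OF mult_mat_vec_carrier[OF A(1) xy(1)]] Rback[OF mult_mat_vec_carrier[OF A(1) xy(2)]] by metis
        then show "x = y" using A(2) xy by (auto dest: inj_onD)
      qed
      show "V' i (j + d) = (\<lambda>v. P * A *\<^sub>v v) ` carrier_vec r"
      proof (intro equalityI subsetI)
        fix v assume v: "v \<in> V' i (j + d)"
        have vc: "v \<in> carrier_vec ?m" using cV v by blast
        have gv: "coeff_mat (- d) G *\<^sub>v v \<in> V i j" using Gm[OF v, of "- d"] by simp
        have "R *\<^sub>v v = (1 / c d) \<cdot>\<^sub>v (coeff_mat (- d) G *\<^sub>v v)"
          unfolding R_def using cc(2)[of "- d"] vc by (intro eq_vecI) (auto simp: scalar_prod_def sum_distrib_left mult.assoc)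
        then have "R *\<^sub>v v \<in> V i j" using S(1)[of i j] gv unfolding subspace_iff by metis
        then obtain x where "x \<in> carrier_vec r" "R *\<^sub>v v = A *\<^sub>v x" using A(3) by blast
        then have "P * A *\<^sub>v x = v" using PA Pback[OF vc] by metis
        then show "v \<in> (\<lambda>v. P * A *\<^sub>v v) ` carrier_vec r" using \<open>x \<in> carrier_vec r\<close> by blast
      next
        fix v assume "v \<in> (\<lambda>v. P * A *\<^sub>v v) ` carrier_vec r"
        then obtain x where x: "x \<in> carrier_vec r" "v = P *\<^sub>v (A *\<^sub>v x)" using PA by auto
        then have "A *\<^sub>v x \<in> V i j" using A(3) by blast
        then show "v \<in> V' i (j + d)" unfolding x(2) P_def by (rule Fm)
      qed
    qed
    moreover have "multiplicity_at ?m V i j = r" by (rule multiplicity_image[where V = V, OF A(1,2,3)])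
    ultimately show ?thesis by simp
  qed
  then show ?thesis using that by blast
qed

section \<open>Profiles read off one configuration with scalar endomorphisms\<close>

lemma filtered_k_subset: "filtered k n M P \<Longrightarrow> J \<in> set P \<Longrightarrow> k_subset k n J"
  by (induct rule: filtered.induct) auto

lemma residue_self: "x \<in> {1..int n} \<Longrightarrow> residue n x = x"
  by (simp add: residue_def)

text \<open>The subset is recovered from the vertices at which the rim does not drop, which a
  constant shift leaves unchanged.\<close>

lemma rim_determines:
  assumes J: "k_subset k n J" "k_subset k n J'" and h: "is_rim n J h" "is_rim n J' h'" and e: "\<And>i. h' i = h i + d"
  shows "J = J'"
proof -
  have 1: "residue n i \<in> J \<longleftrightarrow> h i = h (i - 1)" "residue n i \<in> J' \<longleftrightarrow> h' i = h' (i - 1)" for i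
    using h unfolding is_rim_def by (metis diff_add_cancel less_irrefl zless_add1_eq)+
  have "x \<in> J \<longleftrightarrow> x \<in> J'" if "x \<in> {1..int n}" for x
    using 1[of x] residue_self[OF that] e by simp
  then show ?thesis using J by (auto simp: k_subset_def)
qed

text \<open>In any other diagram the multiplicities are those of \<open>V\<close> moved by a
  constant degree, so its contours are shifted rims and name the same subsets in the same
  order.\<close>

lemma has_profileI:
  assumes F: "filtered k n M P" and len: "length P = rk M" and V: "lattice_diagram k n M V" and pos: "0 < rk M"
    and sc: "scalar_endos (rk M) V" and kn: "k \<le> n"
    and im: "\<And>i j. \<exists>r. \<exists>A\<in>carrier_mat (rk M) r. inj_on (\<lambda>v. A *\<^sub>v v) (carrier_vec r) \<and> V i j = (\<lambda>v. A *\<^sub>v v) ` carrier_vec r"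
    and rims: "\<And>d. d < rk M \<Longrightarrow> is_rim n (P ! d) (h d)"
      "\<And>d i j. d < rk M \<Longrightarrow> d < multiplicity_at (rk M) V i j \<longleftrightarrow> h d i \<le> j"
  shows "has_profile k n M P"
  unfolding has_profile_def
proof (intro allI iffI)
  fix Q assume "Q = P"
  then show "generic_filtration k n M Q" unfolding generic_filtration_def using F len V rims by blast
next
  fix Q assume "generic_filtration k n M Q"
  then obtain V' where Q: "filtered k n M Q" "length Q = rk M" and V': "lattice_diagram k n M V'"
    and rims': "\<And>d. d < rk M \<Longrightarrow> \<exists>h. is_rim n (Q ! d) h \<and> (\<forall>i j. d < multiplicity_at (rk M) V' i j \<longleftrightarrow> h i \<le> j)"
    unfolding generic_filtration_def by blast
  obtain e where e: "\<And>i j. multiplicity_at (rk M) V' i (j + e) = multiplicity_at (rk M) V i j"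
    by (rule diagram_unique_up_to_shift[OF V V' pos sc kn im]) metis
  show "Q = P"
  proof (rule nth_equalityI)
    fix d assume "d < length Q"
    then have d: "d < rk M" using Q by simp
    obtain h' where h': "is_rim n (Q ! d) h'" "\<And>i j. d < multiplicity_at (rk M) V' i j \<longleftrightarrow> h' i \<le> j" using rims'[OF d] by blast
    have le: "h d i \<le> j \<longleftrightarrow> h' i \<le> j + e" for i j using rims(2)[OF d, of i j] h'(2)[of i "j + e"] e[of i j] by simp
    have "h' i = h d i + e" for i using le[of i "h d i"] le[of i "h' i - e"] by simp
    then have "P ! d = Q ! d"
      by (intro rim_determines[of k n, OF _ _ rims(1)[OF d] h'(1)] filtered_k_subset[OF F] filtered_k_subset[OF Q(1)])
        (use d Q len in auto)
    then show "Q ! d = P ! d" ..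
  qed (use Q len in simp)
qed

section \<open>The profiles\<close>

text \<open>A parametrisation carries the dimension of the subspace together with the injectivity
  that the comparison of diagrams asks for.\<close>

definition is_image :: "nat \<Rightarrow> nat \<Rightarrow> complex vec set \<Rightarrow> bool" where
  "is_image m r S \<longleftrightarrow> (\<exists>A\<in>carrier_mat m r. inj_on (\<lambda>v. A *\<^sub>v v) (carrier_vec r) \<and> S = (\<lambda>v. A *\<^sub>v v) ` carrier_vec r)"

lemma multiplicity_is_image: "is_image m r (V i j) \<Longrightarrow> multiplicity_at m V i j = r"
  unfolding is_image_def using multiplicity_image by blast

lemma is_image_zero: "is_image m 0 {0\<^sub>v m}"
  unfolding is_image_def
proof (intro bexI conjI)
  have e: "v = w" if "v \<in> carrier_vec 0" "w \<in> carrier_vec 0" for v w :: "complex vec" using that by (intro eq_vecI) auto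
  show "inj_on (\<lambda>v. (0\<^sub>m m 0 :: complex mat) *\<^sub>v v) (carrier_vec 0)" using e by (auto intro: inj_onI)
  have z: "(0\<^sub>m m 0 :: complex mat) *\<^sub>v v = 0\<^sub>v m" if "v \<in> carrier_vec 0" for v using that by (auto intro!: eq_vecI simp: scalar_prod_def)
  show "{0\<^sub>v m} = (\<lambda>v. (0\<^sub>m m 0 :: complex mat) *\<^sub>v v) ` carrier_vec 0"
    using z[of "0\<^sub>v 0"] z by (auto intro!: image_eqI[of _ _ "0\<^sub>v 0"])
qed auto

lemma is_image_full: "is_image m m (carrier_vec m)"
  unfolding is_image_def by (intro bexI[of _ "1\<^sub>m m"] conjI) (auto intro!: inj_onI)

lemma is_image_line:
  assumes "u \<in> carrier_vec m" "l < m" "u $ l \<noteq> 0"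
  shows "is_image m 1 {c \<cdot>\<^sub>v u | c. True}"
proof -
  define A where "A = mat_of_cols m [u]"
  have A: "A \<in> carrier_mat m 1" using mat_of_cols_carrier(1)[of m "[u]"] by (simp add: A_def)
  have Av: "A *\<^sub>v v = v $ 0 \<cdot>\<^sub>v u" if "v \<in> carrier_vec 1" for v
    using mat_vec_1[OF A that] assms(1) by (simp add: A_def)
  have "inj_on (\<lambda>v. A *\<^sub>v v) (carrier_vec 1)"
  proof (rule inj_onI)
    fix v w assume vw: "v \<in> carrier_vec 1" "w \<in> carrier_vec 1" "A *\<^sub>v v = A *\<^sub>v w"
    then have "(v $ 0 \<cdot>\<^sub>v u) $ l = (w $ 0 \<cdot>\<^sub>v u) $ l" using Av by metis
    then show "v = w" using assms vw by (simp add: vec_eq1)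
  qed
  moreover have "{c \<cdot>\<^sub>v u | c. True} = (\<lambda>v. A *\<^sub>v v) ` carrier_vec 1"
  proof (intro equalityI subsetI)
    fix x assume "x \<in> {c \<cdot>\<^sub>v u | c. True}"
    then obtain c where "x = c \<cdot>\<^sub>v u" by blast
    then show "x \<in> (\<lambda>v. A *\<^sub>v v) ` carrier_vec 1" using Av[of "vec1 c"] by (intro image_eqI[of _ _ "vec1 c"]) auto
  qed (use Av in auto)
  ultimately show ?thesis using A unfolding is_image_def by blast
qed

lemma is_image_plane:
  assumes "u \<in> carrier_vec m" "w \<in> carrier_vec m" "l < m" "l' < m" "u $ l = 1" "w $ l = 0" "u $ l' = 0" "w $ l' = 1"
  shows "is_image m 2 {c \<cdot>\<^sub>v u + d \<cdot>\<^sub>v w | c d. True}"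
proof -
  define A where "A = mat_of_cols m [u, w]"
  have A: "A \<in> carrier_mat m 2" using mat_of_cols_carrier(1)[of m "[u, w]"] by (simp add: A_def numeral_2_eq_2)
  have Av: "A *\<^sub>v v = v $ 0 \<cdot>\<^sub>v u + v $ 1 \<cdot>\<^sub>v w" if "v \<in> carrier_vec 2" for v
  proof -
    have "col A 0 = u" "col A 1 = w" unfolding A_def using assms by (auto intro!: col_mat_of_cols)
    then show ?thesis using mat_vec_2[OF A that] by simp
  qed
  have "inj_on (\<lambda>v. A *\<^sub>v v) (carrier_vec 2)"
  proof (rule inj_onI)
    fix v v' :: "complex vec" assume vw: "v \<in> carrier_vec 2" "v' \<in> carrier_vec 2" "A *\<^sub>v v = A *\<^sub>v v'"
    have e: "(v $ 0 \<cdot>\<^sub>v u + v $ 1 \<cdot>\<^sub>v w) $ x = (v' $ 0 \<cdot>\<^sub>v u + v' $ 1 \<cdot>\<^sub>v w) $ x" for x using vw Av by metis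
    show "v = v'" using e[of l] e[of l'] assms vw by (simp add: vec_eq2)
  qed
  moreover have "{c \<cdot>\<^sub>v u + d \<cdot>\<^sub>v w | c d. True} = (\<lambda>v. A *\<^sub>v v) ` carrier_vec 2"
  proof (intro equalityI subsetI)
    fix x assume "x \<in> {c \<cdot>\<^sub>v u + d \<cdot>\<^sub>v w | c d. True}"
    then obtain c d where "x = c \<cdot>\<^sub>v u + d \<cdot>\<^sub>v w" by blast
    then show "x \<in> (\<lambda>v. A *\<^sub>v v) ` carrier_vec 2" using Av[of "vec2 c d"] by (intro image_eqI[of _ _ "vec2 c d"]) auto
  qed (use Av in auto)
  ultimately show ?thesis using A unfolding is_image_def by blast
qed

lemma set_line: "(\<And>v. v \<in> S \<Longrightarrow> v = f v \<cdot>\<^sub>v u) \<Longrightarrow> (\<And>c. c \<cdot>\<^sub>v u \<in> S) \<Longrightarrow> S = {c \<cdot>\<^sub>v u | c. True}"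
  by blast

lemma set_plane:
  "(\<And>v. v \<in> S \<Longrightarrow> v = f v \<cdot>\<^sub>v u + g v \<cdot>\<^sub>v w) \<Longrightarrow> (\<And>c d. c \<cdot>\<^sub>v u + d \<cdot>\<^sub>v w \<in> S) \<Longrightarrow>
    S = {c \<cdot>\<^sub>v u + d \<cdot>\<^sub>v w | c d. True}"
  by blast

definition half :: "complex fls" where "half = fls_const (1 / 2)"
definition third :: "complex fls" where "third = fls_const (1 / 3)"

lemma half_third: "half * 2 = 1" "third * 3 = 1"
proof -
  have e: "(2 :: complex fls) = fls_const 2" "(3 :: complex fls) = fls_const 3" by (simp_all add: fls_const_numeral)
  show "half * 2 = 1" unfolding half_def e(1) fls_const_mult_const by simp
  show "third * 3 = 1" unfolding third_def e(2) fls_const_mult_const by simp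
qed

lemma half_third_tO: "x \<in> tO d \<Longrightarrow> half * x \<in> tO d" "x \<in> tO d \<Longrightarrow> third * x \<in> tO d"
  by (simp_all add: half_def third_def const_mult_tO)

lemma dbl: "half * x + half * x = x"
proof -
  have "half * x + half * x = (half * 2) * x" by (simp add: algebra_simps)
  then show ?thesis using half_third by simp
qed

lemma tpl: "third * x + third * x + third * x = x"
proof -
  have "third * x + third * x + third * x = (third * 3) * x" by (simp add: algebra_simps)
  then show ?thesis using half_third by simp
qed

lemma annihilator_subspace:
  assumes "T \<subseteq> carrier_vec m"
  shows "VectorSpace.subspace class_ring {v \<in> carrier_vec m. \<forall>\<alpha>\<in>T. \<alpha> \<bullet> v = 0} (module_vec TYPE(complex) m)"
proof -
  have Tc: "\<alpha> \<in> carrier_vec m" if "\<alpha> \<in> T" for \<alpha> using assms that by blast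
  have "\<alpha> \<bullet> (u + v) = \<alpha> \<bullet> u + \<alpha> \<bullet> v" "\<alpha> \<bullet> (c \<cdot>\<^sub>v u) = c * (\<alpha> \<bullet> u)"
    if "\<alpha> \<in> T" "u \<in> carrier_vec m" "v \<in> carrier_vec m" for \<alpha> u v c
    using that Tc by (simp_all add: scalar_prod_add_distrib[of _ m] scalar_prod_smult_distrib[of _ m])
  moreover have "\<alpha> \<bullet> 0\<^sub>v m = 0" if "\<alpha> \<in> T" for \<alpha> using Tc[OF that] by simp
  ultimately show ?thesis unfolding subspace_iff by auto
qed

lemma ball_if: "(\<forall>\<alpha>\<in>(if P then {x} else {}). Q \<alpha>) \<longleftrightarrow> (P \<longrightarrow> Q x)"
  by simp

lemma residue_eq_iff: "0 < n \<Longrightarrow> residue n i = residue n x \<longleftrightarrow> int n dvd i - x"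
  unfolding residue_def by (simp add: mod_eq_dvd_iff)

lemma residue_range: "0 < n \<Longrightarrow> residue n x \<in> {1..int n}"
proof -
  assume "0 < n"
  then have "0 \<le> (x - 1) mod int n" "(x - 1) mod int n < int n" by simp_all
  then show ?thesis unfolding residue_def atLeastAtMost_iff by linarith
qed

lemma line_lat_iff [simp]: "v \<in> line_lat h i \<longleftrightarrow> v \<in> carrier_vec 1 \<and> v $ 0 \<in> tO (h i)"
  by (simp add: line_lat_def)

section \<open>The configurations of the rank 2 module and of the middle term\<close>

context three_peaks
begin

definition Is where "Is = {residue n a, residue n b, residue n c}"
definition Xs where "Xs = {residue n (a - 2), residue n (b - 2), residue n (c - 2)}"
definition Ys where "Ys = {residue n (a - 1), residue n (b - 1), residue n (c - 1)}"

lemma mem_residues: "residue n i \<in> {residue n x, residue n y, residue n z} \<longleftrightarrow> int n dvd i - x \<or> int n dvd i - y \<or> int n dvd i - z"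
  using residue_eq_iff[OF three_le(2)] by auto

lemma rims: "is_rim n Is hI" "is_rim n Xs hX" "is_rim n Ys hY"
proof -
  show "is_rim n Is hI" unfolding is_rim_def Is_def mem_residues
    by (intro allI rimfun3(2)[of hI 0 a b c]) (use gaps in \<open>auto simp: h_defs\<close>)
  show "is_rim n Xs hX" unfolding is_rim_def Xs_def mem_residues
    by (intro allI rimfun3(2)[of hX "-1" "a - 2" "b - 2" "c - 2"]) (use gaps in \<open>auto simp: h_defs\<close>)
  show "is_rim n Ys hY" unfolding is_rim_def Ys_def mem_residues
    by (intro allI rimfun3(2)[of hY 0 "a - 1" "b - 1" "c - 1"]) (use gaps in \<open>auto simp: h_defs\<close>)
qed

lemma k_subset_residues:
  assumes "x < y" "y < z" "z < x + int n"
  shows "k_subset 3 n {residue n x, residue n y, residue n z}"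
proof -
  have d: "residue n u \<noteq> residue n v" if "u < v" "v < u + int n" for u v
    using residue_eq_iff[OF three_le(2), of v u] not_dvd_close[of "v - u"] that by auto
  then have "card {residue n x, residue n y, residue n z} = 3" using assms d[of x y] d[of y z] d[of x z] by simp
  then show ?thesis using residue_range[OF three_le(2)] by (simp add: k_subset_def)
qed

lemma k_subsets: "k_subset 3 n Is" "k_subset 3 n Xs" "k_subset 3 n Ys"
  unfolding Is_def Xs_def Ys_def using gaps by (auto intro!: k_subset_residues)

lemma rank1_Is: "models 3 n (rank1 n Is) 1 (line_lat hI)"
  by (rule rank1_models[OF rims(1) rimfun_hI three_le(1)])
lemma rank1_Xs: "models 3 n (rank1 n Xs) 1 (line_lat hX)"
  by (rule rank1_models[OF rims(2) rimfun_hX three_le(1)])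
lemma rank1_Ys: "models 3 n (rank1 n Ys) 1 (line_lat hY)"
  by (rule rank1_models[OF rims(3) rimfun_hY three_le(1)])

text \<open>The seven kinds of vertices: \<open>full\<close> at the lifts of \<open>X\<close>;
  \<open>p1\<close>, \<open>p2\<close>, \<open>p3\<close> at the peaks, where \<open>hI\<close>
  still equals \<open>hX\<close>; and \<open>l1\<close>, \<open>l2\<close>, \<open>l3\<close> on the
  rest of each segment, where \<open>hI\<close> exceeds \<open>hX\<close> too. The last kind is
  absent when the corresponding gap is 2.\<close>

lemma segments:
  obtains (full) "g1 i = hX i" "g2 i = hX i" "g3 i = hX i" "hI i = hX i" "hY i = hX i" "k1 i = hX i" "k2 i = hX i" "k3 i = hX i"
  | (p1) "g1 i = hX i + 1" "g2 i = hX i" "g3 i = hX i" "hI i = hX i" "hY i = hX i + 1" "k1 i = hX i" "k2 i = hX i" "k3 i = hX i"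
  | (p2) "g1 i = hX i" "g2 i = hX i + 1" "g3 i = hX i" "hI i = hX i" "hY i = hX i + 1" "k1 i = hX i" "k2 i = hX i" "k3 i = hX i"
  | (p3) "g1 i = hX i" "g2 i = hX i" "g3 i = hX i + 1" "hI i = hX i" "hY i = hX i + 1" "k1 i = hX i" "k2 i = hX i" "k3 i = hX i"
  | (l1) "g1 i = hX i + 1" "g2 i = hX i" "g3 i = hX i" "hI i = hX i + 1" "hY i = hX i + 1" "k1 i = hX i + 1" "k2 i = hX i" "k3 i = hX i"
  | (l2) "g1 i = hX i" "g2 i = hX i + 1" "g3 i = hX i" "hI i = hX i + 1" "hY i = hX i + 1" "k1 i = hX i" "k2 i = hX i + 1" "k3 i = hX i"
  | (l3) "g1 i = hX i" "g2 i = hX i" "g3 i = hX i + 1" "hI i = hX i + 1" "hY i = hX i + 1" "k1 i = hX i" "k2 i = hX i" "k3 i = hX i + 1"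
proof -
  obtain p q where p: "i = p + q * int n" "a - 2 \<le> p" "p < a - 2 + int n" using vertex .
  note v = h_val[OF p(2,3)]
  consider "p = a - 2 \<or> p = b - 2 \<or> p = c - 2" | "p = a - 1" | "p = b - 1" | "p = c - 1"
    | "a \<le> p \<and> p < b - 2" | "b \<le> p \<and> p < c - 2" | "c \<le> p" using p by linarith
  then show ?thesis
  proof cases
    case 1 show ?thesis by (rule that(1)) (unfold p(1) h_shift, unfold v, use gaps p 1 in auto)
  next
    case 2 show ?thesis by (rule that(2)) (unfold p(1) h_shift, unfold v, use gaps p 2 in auto)
  next
    case 3 show ?thesis by (rule that(3)) (unfold p(1) h_shift, unfold v, use gaps p 3 in auto)
  next
    case 4 show ?thesis by (rule that(4)) (unfold p(1) h_shift, unfold v, use gaps p 4 in auto)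
  next
    case 5 show ?thesis by (rule that(5)) (unfold p(1) h_shift, unfold v, use gaps p 5 in auto)
  next
    case 6 show ?thesis by (rule that(6)) (unfold p(1) h_shift, unfold v, use gaps p 6 in auto)
  next
    case 7 show ?thesis by (rule that(7)) (unfold p(1) h_shift, unfold v, use gaps p 7 in auto)
  qed
qed

text \<open>Degree by degree, an order condition on a functional says that the functional vanishes
  on the coefficients below its bound; \<open>VM\<close> arises from \<open>LM\<close> in the same
  way.\<close>

definition VN :: "int \<Rightarrow> int \<Rightarrow> complex vec set" where
  "VN i j = {v \<in> carrier_vec 2. (j < g1 i \<longrightarrow> v $ 0 = 0) \<and> (j < g2 i \<longrightarrow> v $ 1 = 0) \<and> (j < g3 i \<longrightarrow> v $ 0 + v $ 1 = 0)}"

definition VM :: "int \<Rightarrow> int \<Rightarrow> complex vec set" where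
  "VM i j = {v \<in> carrier_vec 3. (j < g1 i \<longrightarrow> v $ 0 = 0) \<and> (j < g2 i \<longrightarrow> v $ 1 = 0) \<and> (j < g3 i \<longrightarrow> v $ 2 = 0)
     \<and> (j < hI i \<longrightarrow> v $ 0 + v $ 1 + v $ 2 = 0)}"

lemma rim_steps:
  assumes "rimfun 3 n g"
  shows "j < g i \<Longrightarrow> j < g (i - 1)" "j + 1 < g (i - 1) \<Longrightarrow> j < g i" "j < g (i + int n) \<longleftrightarrow> j + int n - 3 < g i"
proof -
  have r: "g i \<le> g (i - 1)" "g (i - 1) \<le> g i + 1" "g (i + int n) = g i - (int n - 3)" using assms by (auto simp: rimfun_def)
  show "j < g i \<Longrightarrow> j < g (i - 1)" using r by simp
  show "j + 1 < g (i - 1) \<Longrightarrow> j < g i" using r by simp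
  show "j < g (i + int n) \<longleftrightarrow> j + int n - 3 < g i" using r by auto
qed

lemma zero_below: "j < hX i \<Longrightarrow> j < g1 i \<and> j < g2 i \<and> j < g3 i \<and> j < hI i"
  using h_le(1,4,6,8)[of i] by linarith
lemma all_above: "hX i + 1 \<le> j \<Longrightarrow> \<not> j < g1 i \<and> \<not> j < g2 i \<and> \<not> j < g3 i \<and> \<not> j < hI i"
  using h_le(2,3,5,7,9)[of i] by linarith

lemma VN_configuration: "configuration 3 n 2 VN"
  unfolding configuration_def
proof (intro conjI allI)
  fix i j
  show "VectorSpace.subspace class_ring (VN i j) (module_vec TYPE(complex) 2)"
  proof -
    have "VN i j = {v \<in> carrier_vec 2. \<forall>\<alpha>\<in>(if j < g1 i then {vec2 1 0} else {}) \<union> (if j < g2 i then {vec2 0 1} else {})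
      \<union> (if j < g3 i then {vec2 1 1} else {}). \<alpha> \<bullet> v = 0}"
      unfolding VN_def ball_Un ball_if by (rule Collect_cong, rule conj_cong[OF refl]) (simp add: vec2_scalar)
    then show ?thesis by (simp only:) (rule annihilator_subspace, simp)
  qed
  show "VN (i - 1) j \<subseteq> VN i j" unfolding VN_def
    using rim_steps(1)[OF rimfun_g1, of j i] rim_steps(1)[OF rimfun_g2, of j i] rim_steps(1)[OF rimfun_g3, of j i] by blast
  show "VN i j \<subseteq> VN (i - 1) (j + 1)" unfolding VN_def
    using rim_steps(2)[OF rimfun_g1, of j i] rim_steps(2)[OF rimfun_g2, of j i] rim_steps(2)[OF rimfun_g3, of j i] by blast
  show "VN (i + int n) j = VN i (j + int n - int 3)" unfolding VN_def
    by (simp add: rim_steps(3)[OF rimfun_g1] rim_steps(3)[OF rimfun_g2] rim_steps(3)[OF rimfun_g3])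
next
  fix i
  show "\<exists>a b. (\<forall>j\<le>a. VN i j = {0\<^sub>v 2}) \<and> (\<forall>j\<ge>b. VN i j = carrier_vec 2)"
  proof (intro exI conjI allI impI)
    fix j assume "j \<le> hX i - 1"
    then show "VN i j = {0\<^sub>v 2}" unfolding VN_def using zero_below[of j i] by (auto simp: vec_eq2)
  next
    fix j assume "hX i + 1 \<le> j"
    then show "VN i j = carrier_vec 2" unfolding VN_def using all_above[of i j] by auto
  qed
qed

lemma VM_configuration: "configuration 3 n 3 VM"
  unfolding configuration_def
proof (intro conjI allI)
  fix i j
  show "VectorSpace.subspace class_ring (VM i j) (module_vec TYPE(complex) 3)"
  proof -
    have "VM i j = {v \<in> carrier_vec 3. \<forall>\<alpha>\<in>(if j < g1 i then {vec3 1 0 0} else {}) \<union> (if j < g2 i then {vec3 0 1 0} else {})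
      \<union> (if j < g3 i then {vec3 0 0 1} else {}) \<union> (if j < hI i then {vec3 1 1 1} else {}). \<alpha> \<bullet> v = 0}"
      unfolding VM_def ball_Un ball_if by (rule Collect_cong, rule conj_cong[OF refl]) (simp add: vec3_scalar)
    then show ?thesis by (simp only:) (rule annihilator_subspace, simp)
  qed
  show "VM (i - 1) j \<subseteq> VM i j" unfolding VM_def
    using rim_steps(1)[OF rimfun_g1, of j i] rim_steps(1)[OF rimfun_g2, of j i] rim_steps(1)[OF rimfun_g3, of j i] rim_steps(1)[OF rimfun_hI, of j i] by blast
  show "VM i j \<subseteq> VM (i - 1) (j + 1)" unfolding VM_def
    using rim_steps(2)[OF rimfun_g1, of j i] rim_steps(2)[OF rimfun_g2, of j i] rim_steps(2)[OF rimfun_g3, of j i] rim_steps(2)[OF rimfun_hI, of j i] by blast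
  show "VM (i + int n) j = VM i (j + int n - int 3)" unfolding VM_def
    by (simp add: rim_steps(3)[OF rimfun_g1] rim_steps(3)[OF rimfun_g2] rim_steps(3)[OF rimfun_g3] rim_steps(3)[OF rimfun_hI])
next
  fix i
  show "\<exists>a b. (\<forall>j\<le>a. VM i j = {0\<^sub>v 3}) \<and> (\<forall>j\<ge>b. VM i j = carrier_vec 3)"
  proof (intro exI conjI allI impI)
    fix j assume "j \<le> hX i - 1"
    then show "VM i j = {0\<^sub>v 3}" unfolding VM_def using zero_below[of j i] by (auto simp: vec_eq3)
  next
    fix j assume "hX i + 1 \<le> j"
    then show "VM i j = carrier_vec 3" unfolding VM_def using all_above[of i j] by auto
  qed
qed

lemma LN_diag: "LN i = diag_lat 2 VN i"
  unfolding LN_def diag_lat_def VN_def by (auto simp: tO_def)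

lemma LM_diag: "LM i = diag_lat 3 VM i"
  unfolding LM_def diag_lat_def VM_def by (auto simp: tO_def)

lemma VN_image: "is_image 2 (if j < hX i then 0 else if j < hY i then 1 else 2) (VN i j)"
proof -
  consider "j < hX i" | "hY i \<le> j" | "\<not> j < hX i" "j < hY i" by linarith
  then show ?thesis
  proof cases
    case 1
    then have "VN i j = {0\<^sub>v 2}" unfolding VN_def using zero_below[of j i] by (auto simp: vec_eq2)
    then show ?thesis using 1 is_image_zero by simp
  next
    case 2
    have "\<not> j < g1 i \<and> \<not> j < g2 i \<and> \<not> j < g3 i" using 2 h_le(5,7,9)[of i] by linarith
    then have "VN i j = carrier_vec 2" unfolding VN_def by auto
    then show ?thesis using 2 is_image_full[of 2] h_le(1,2)[of i] by simp
  next
    case 3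
    have j: "j = hX i" "hY i = hX i + 1" using 3 h_le(3)[of i] by auto
    have 1: "is_image 2 1 (VN i j)" if "VN i j = {c \<cdot>\<^sub>v vec2 x y | c. True}" "x \<noteq> 0 \<or> y \<noteq> 0" for x y
      unfolding that(1) using is_image_line[of "vec2 x y" 2 0] is_image_line[of "vec2 x y" 2 1] that(2) by auto
    show ?thesis
    proof (cases rule: segments[of i])
      case full then show ?thesis using j by simp
    next
      case p1
      have "VN i j = {c \<cdot>\<^sub>v vec2 0 1 | c. True}"
        by (rule set_line[where f = "\<lambda>v. v $ 1"], subst vec_eq2)
          (use p1 in \<open>auto simp: VN_def j(1) add_eq_0_iff\<close>)
      from 1[OF this] show ?thesis using 3 by simp
    next
      case l1
      have "VN i j = {c \<cdot>\<^sub>v vec2 0 1 | c. True}"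
        by (rule set_line[where f = "\<lambda>v. v $ 1"], subst vec_eq2)
          (use l1 in \<open>auto simp: VN_def j(1) add_eq_0_iff\<close>)
      from 1[OF this] show ?thesis using 3 by simp
    next
      case p2
      have "VN i j = {c \<cdot>\<^sub>v vec2 1 0 | c. True}"
        by (rule set_line[where f = "\<lambda>v. v $ 0"], subst vec_eq2)
          (use p2 in \<open>auto simp: VN_def j(1) add_eq_0_iff\<close>)
      from 1[OF this] show ?thesis using 3 by simp
    next
      case l2
      have "VN i j = {c \<cdot>\<^sub>v vec2 1 0 | c. True}"
        by (rule set_line[where f = "\<lambda>v. v $ 0"], subst vec_eq2)
          (use l2 in \<open>auto simp: VN_def j(1) add_eq_0_iff\<close>)
      from 1[OF this] show ?thesis using 3 by simp
    next
      case p3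
      have "VN i j = {c \<cdot>\<^sub>v vec2 1 (-1) | c. True}"
        by (rule set_line[where f = "\<lambda>v. v $ 0"], subst vec_eq2)
          (use p3 in \<open>auto simp: VN_def j(1) add_eq_0_iff\<close>)
      from 1[OF this] show ?thesis using 3 by simp
    next
      case l3
      have "VN i j = {c \<cdot>\<^sub>v vec2 1 (-1) | c. True}"
        by (rule set_line[where f = "\<lambda>v. v $ 0"], subst vec_eq2)
          (use l3 in \<open>auto simp: VN_def j(1) add_eq_0_iff\<close>)
      from 1[OF this] show ?thesis using 3 by simp
    qed
  qed
qed

text \<open>Proper nonzero subspaces occur in degree \<open>hX\<close> only: coordinate planes at
  the peaks, and on the rest of each segment the line in that plane on which the sum of the
  coordinates vanishes.\<close>

lemma VM_image: "is_image 3 (if j < hX i then 0 else if j < hI i then 1 else if j < hY i then 2 else 3) (VM i j)"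
proof -
  consider "j < hX i" | "hY i \<le> j" | "\<not> j < hX i" "j < hY i" by linarith
  then show ?thesis
  proof cases
    case 1
    then have "VM i j = {0\<^sub>v 3}" unfolding VM_def using zero_below[of j i] by (auto simp: vec_eq3)
    then show ?thesis using 1 is_image_zero by simp
  next
    case 2
    have "\<not> j < g1 i \<and> \<not> j < g2 i \<and> \<not> j < g3 i \<and> \<not> j < hI i" using 2 h_le(2,5,7,9)[of i] by linarith
    then have "VM i j = carrier_vec 3" unfolding VM_def by auto
    then show ?thesis using 2 is_image_full[of 3] h_le(1,2)[of i] by simp
  next
    case 3
    have j: "j = hX i" "hY i = hX i + 1" using 3 h_le(3)[of i] by auto
    have 1: "is_image 3 1 (VM i j)" if "VM i j = {e \<cdot>\<^sub>v vec3 x y z | e. True}" "x \<noteq> 0 \<or> y \<noteq> 0 \<or> z \<noteq> 0" for x y z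
      unfolding that(1) using is_image_line[of "vec3 x y z" 3 0] is_image_line[of "vec3 x y z" 3 1] is_image_line[of "vec3 x y z" 3 2] that(2) by auto
    show ?thesis
    proof (cases rule: segments[of i])
      case full then show ?thesis using j by simp
    next
      case p1
      have "VM i j = {e \<cdot>\<^sub>v vec3 0 1 0 + d \<cdot>\<^sub>v vec3 0 0 1 | e d. True}"
        by (rule set_plane[where f = "\<lambda>v. v $ 1" and g = "\<lambda>v. v $ 2"], subst vec_eq3)
          (use p1 in \<open>auto simp: VM_def j(1)\<close>)
      then show ?thesis using 3 p1 j is_image_plane[of "vec3 0 1 0" 3 "vec3 0 0 1" 1 2] by simp
    next
      case p2
      have "VM i j = {e \<cdot>\<^sub>v vec3 1 0 0 + d \<cdot>\<^sub>v vec3 0 0 1 | e d. True}"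
        by (rule set_plane[where f = "\<lambda>v. v $ 0" and g = "\<lambda>v. v $ 2"], subst vec_eq3)
          (use p2 in \<open>auto simp: VM_def j(1)\<close>)
      then show ?thesis using 3 p2 j is_image_plane[of "vec3 1 0 0" 3 "vec3 0 0 1" 0 2] by simp
    next
      case p3
      have "VM i j = {e \<cdot>\<^sub>v vec3 1 0 0 + d \<cdot>\<^sub>v vec3 0 1 0 | e d. True}"
        by (rule set_plane[where f = "\<lambda>v. v $ 0" and g = "\<lambda>v. v $ 1"], subst vec_eq3)
          (use p3 in \<open>auto simp: VM_def j(1)\<close>)
      then show ?thesis using 3 p3 j is_image_plane[of "vec3 1 0 0" 3 "vec3 0 1 0" 0 1] by simp
    next
      case l1
      have "VM i j = {e \<cdot>\<^sub>v vec3 0 1 (-1) | e. True}"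
        by (rule set_line[where f = "\<lambda>v. v $ 1"], subst vec_eq3)
          (use l1 in \<open>auto simp: VM_def j(1) add_eq_0_iff\<close>)
      from 1[OF this] show ?thesis using 3 l1 j by simp
    next
      case l2
      have "VM i j = {e \<cdot>\<^sub>v vec3 1 0 (-1) | e. True}"
        by (rule set_line[where f = "\<lambda>v. v $ 0"], subst vec_eq3)
          (use l2 in \<open>auto simp: VM_def j(1) add_eq_0_iff\<close>)
      from 1[OF this] show ?thesis using 3 l2 j by simp
    next
      case l3
      have "VM i j = {e \<cdot>\<^sub>v vec3 1 (-1) 0 | e. True}"
        by (rule set_line[where f = "\<lambda>v. v $ 0"], subst vec_eq3)
          (use l3 in \<open>auto simp: VM_def j(1) add_eq_0_iff\<close>)
      from 1[OF this] show ?thesis using 3 l3 j by simp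
    qed
  qed
qed

text \<open>In degree \<open>hX\<close> the three peaks carry three distinct lines of the plane, and
  all of them have to be preserved.\<close>

lemma VN_scalar: "scalar_endos 2 VN"
  unfolding scalar_endos_def
proof (intro ballI impI)
  fix A :: "complex mat" assume A: "A \<in> carrier_mat 2 2" and pres: "\<forall>i j. \<forall>v\<in>VN i j. A *\<^sub>v v \<in> VN i j"
  have Av: "A *\<^sub>v vec2 x y = vec2 (A $$ (0,0) * x + A $$ (0,1) * y) (A $$ (1,0) * x + A $$ (1,1) * y)" for x y
    using A by (intro eq_vecI) (auto simp: less2 scalar_prod_def sum2)
  have "vec2 0 1 \<in> VN (a - 1) (hX (a - 1))" "vec2 1 0 \<in> VN (b - 1) (hX (b - 1))" "vec2 1 (-1) \<in> VN (c - 1) (hX (c - 1))"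
    unfolding VN_def using h_peaks by auto
  then have "A *\<^sub>v vec2 0 1 \<in> VN (a - 1) (hX (a - 1))" "A *\<^sub>v vec2 1 0 \<in> VN (b - 1) (hX (b - 1))" "A *\<^sub>v vec2 1 (-1) \<in> VN (c - 1) (hX (c - 1))"
    using pres by auto
  then have "A $$ (0,1) = 0" "A $$ (1,0) = 0" "A $$ (0,0) = A $$ (1,1)"
    unfolding Av VN_def using h_peaks by auto
  then have "A = A $$ (0,0) \<cdot>\<^sub>m 1\<^sub>m 2" using A by (intro eq_matI) (auto simp: less2)
  then show "\<exists>c. A = c \<cdot>\<^sub>m 1\<^sub>m 2" ..
qed

text \<open>The coordinate planes at the peaks make A diagonal. The gap hypotheses put
  \<open>a\<close> and \<open>b\<close> on the parts \<open>l1\<close> and \<open>l2\<close>, where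
  the lines spanned by (0,1,-1) and (1,0,-1) identify the diagonal entries.\<close>

lemma VM_scalar:
  assumes "a + 3 \<le> b" "b + 3 \<le> c"
  shows "scalar_endos 3 VM"
  unfolding scalar_endos_def
proof (intro ballI impI)
  fix A :: "complex mat" assume A: "A \<in> carrier_mat 3 3" and pres: "\<forall>i j. \<forall>v\<in>VM i j. A *\<^sub>v v \<in> VM i j"
  have Av: "A *\<^sub>v vec3 x y z = vec3 (A $$ (0,0) * x + A $$ (0,1) * y + A $$ (0,2) * z) (A $$ (1,0) * x + A $$ (1,1) * y + A $$ (1,2) * z)
      (A $$ (2,0) * x + A $$ (2,1) * y + A $$ (2,2) * z)" for x y z
    using A by (intro eq_vecI) (auto simp: less3 scalar_prod_def sum3)
  have ha: "g1 a = hX a + 1" "g2 a = hX a" "g3 a = hX a" "hI a = hX a + 1" using assms gaps by (auto simp: h_val)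
  have hb: "g1 b = hX b" "g2 b = hX b + 1" "g3 b = hX b" "hI b = hX b + 1" using assms gaps by (auto simp: h_val)
  have mem: "vec3 0 1 0 \<in> VM (a - 1) (hX (a - 1))" "vec3 0 0 1 \<in> VM (a - 1) (hX (a - 1))"
    "vec3 1 0 0 \<in> VM (b - 1) (hX (b - 1))" "vec3 0 0 1 \<in> VM (b - 1) (hX (b - 1))"
    "vec3 1 0 0 \<in> VM (c - 1) (hX (c - 1))" "vec3 0 1 0 \<in> VM (c - 1) (hX (c - 1))"
    "vec3 0 1 (-1) \<in> VM a (hX a)" "vec3 1 0 (-1) \<in> VM b (hX b)"
    unfolding VM_def using h_peaks ha hb by auto
  note im = mem[THEN pres[rule_format], unfolded Av VM_def]
  have z: "A $$ (0,1) = 0" "A $$ (0,2) = 0" "A $$ (1,0) = 0" "A $$ (1,2) = 0" "A $$ (2,0) = 0" "A $$ (2,1) = 0"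
    using im(1-6) h_peaks by auto
  have "A $$ (1,1) = A $$ (2,2)" "A $$ (0,0) = A $$ (2,2)" using im(7,8) ha hb z by auto
  then have "A = A $$ (0,0) \<cdot>\<^sub>m 1\<^sub>m 3" using A z by (intro eq_matI) (auto simp: less3)
  then show "\<exists>c. A = c \<cdot>\<^sub>m 1\<^sub>m 3" ..
qed

end

section \<open>Filtrations with rank 1 factors\<close>

lemma short_exact_of_models:
  assumes A: "models k n A p \<Lambda>" and E: "models k n E q \<Lambda>'" and C: "models k n C s \<Lambda>''" and kn: "k \<le> n"
    and F: "F \<in> carrier_mat q p" and G: "G \<in> carrier_mat s q"
    and Fl: "\<And>i v. v \<in> \<Lambda> i \<Longrightarrow> F *\<^sub>v v \<in> \<Lambda>' i"
    and Gl: "\<And>i v. v \<in> \<Lambda>' i \<Longrightarrow> G *\<^sub>v v \<in> \<Lambda>'' i"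
    and inj: "\<And>u v. u \<in> carrier_vec p \<Longrightarrow> v \<in> carrier_vec p \<Longrightarrow> F *\<^sub>v u = F *\<^sub>v v \<Longrightarrow> u = v"
    and GF: "\<And>v. v \<in> carrier_vec p \<Longrightarrow> G *\<^sub>v (F *\<^sub>v v) = 0\<^sub>v s"
    and ker: "\<And>i v. v \<in> \<Lambda>' i \<Longrightarrow> G *\<^sub>v v = 0\<^sub>v s \<Longrightarrow> \<exists>u\<in>\<Lambda> i. F *\<^sub>v u = v"
    and surj: "\<And>i w. w \<in> \<Lambda>'' i \<Longrightarrow> \<exists>v\<in>\<Lambda>' i. G *\<^sub>v v = w"
  shows "\<exists>f g. short_exact k n A E C f g"
proof -
  obtain \<phi> where P: "presents k n A \<phi>" and l1: "\<And>i. lat (\<phi> i) = \<Lambda> i" and r1: "rk A = p" by (rule modelsD[OF A]) metis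
  obtain \<psi> where Q: "presents k n E \<psi>" and l2: "\<And>i. lat (\<psi> i) = \<Lambda>' i" and r2: "rk E = q" by (rule modelsD[OF E]) metis
  obtain \<chi> where R: "presents k n C \<chi>" and l3: "\<And>i. lat (\<chi> i) = \<Lambda>'' i" and r3: "rk C = s" by (rule modelsD[OF C]) metis
  obtain f g where "short_exact k n A E C f g"
    by (rule short_exact_of_matrices[OF P Q R kn, unfolded l1 l2 l3 r1 r2 r3, OF F G Fl Gl inj GF ker surj]) blast+
  then show ?thesis by blast
qed

lemma zero_module:
  assumes "k \<le> n" "0 < n"
  obtains Z where "models k n Z 0 (\<lambda>_. carrier_vec 0)"
proof -
  have c: "c \<cdot>\<^sub>v v \<in> carrier_vec 0" if "v \<in> carrier_vec 0" for c and v :: "complex fls vec" using that by simp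
  have "lat_family k n 0 (\<lambda>_. carrier_vec 0)"
    unfolding lat_family_def lattice_def using c by auto
  from model_exists[OF this assms] show ?thesis using that by blast
qed

lemma filtered_rank1:
  assumes J: "k_subset k n J" and R: "models k n (rank1 n J) 1 (line_lat h)" and M: "models k n M 1 (line_lat h)" and kn: "k \<le> n" "0 < n"
  shows "filtered k n M [J]"
proof -
  obtain Z where Z: "models k n Z 0 (\<lambda>_. carrier_vec 0)" using zero_module[OF kn] .
  have e: "v = w" if "v \<in> carrier_vec 0" "w \<in> carrier_vec 0" for v w :: "complex fls vec" using that by (intro eq_vecI) auto
  have G0: "(0\<^sub>m 0 1 :: complex fls mat) *\<^sub>v v \<in> carrier_vec 0" if "v \<in> carrier_vec 1" for v
    using that by (intro mult_mat_vec_carrier[of _ 0 1]) auto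
  have "\<exists>f g. short_exact k n (rank1 n J) M Z f g"
  proof (rule short_exact_of_models[OF R M Z kn(1), of "1\<^sub>m 1" "0\<^sub>m 0 1"])
    show "\<exists>v\<in>line_lat h i. (0\<^sub>m 0 1 :: complex fls mat) *\<^sub>v v = w" if "w \<in> carrier_vec 0" for i w
      using e[OF G0 that, of "vec1 0"] by (intro bexI[of _ "vec1 0"]) auto
    show "(0\<^sub>m 0 1 :: complex fls mat) *\<^sub>v (1\<^sub>m 1 *\<^sub>v v) = 0\<^sub>v 0" if "v \<in> carrier_vec 1" for v
      using that G0[of v] by (intro e) auto
  qed (use G0 in auto)
  then obtain f g where S: "short_exact k n (rank1 n J) M Z f g" by blast
  have "filtered k n Z []" using Z by (intro filtered.zero) (auto simp: models_def presents_def)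
  from filtered.step[OF J S this] show ?thesis by simp
qed

context three_peaks
begin

text \<open>The submodule is cut out by the line through (1,1), which none of the three functionals
  annihilates; a multiple of this vector therefore satisfies all three bounds at once, and their
  maximum is \<open>hY\<close>. The quotient map is the difference of the coordinates.\<close>

lemma rank2_exact:
  assumes N: "models 3 n N 2 LN"
  shows "\<exists>f g. short_exact 3 n (rank1 n Ys) N (rank1 n Xs) f g"
proof -
  define F :: "complex fls mat" where "F = mat_of_rows 1 [vec1 1, vec1 1]"
  define G :: "complex fls mat" where "G = mat_of_rows 2 [vec2 1 (-1)]"
  have Fc: "F \<in> carrier_mat 2 1" and Gc: "G \<in> carrier_mat 1 2" by (simp_all add: F_def G_def del: One_nat_def)
  have v1: "vec1 x \<bullet> v = x * v $ 0" if "v \<in> carrier_vec 1" for x :: "complex fls" and v using that by (simp add: scalar_prod_def)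
  have Fv: "F *\<^sub>v v = vec2 (v $ 0) (v $ 0)" if "v \<in> carrier_vec 1" for v
    unfolding F_def using rows2_vec[of "vec1 1" 1 "vec1 1" v] v1[OF that] by simp
  have Gv: "G *\<^sub>v v = vec1 (v $ 0 - v $ 1)" if "v \<in> carrier_vec 2" for v
    unfolding G_def using that by (simp add: rows1_vec vec2_scalar)
  have diag: "vec2 x x \<in> LN i \<longleftrightarrow> x \<in> tO (hY i)" for x i
  proof -
    have "x + x \<in> tO (g3 i) \<longleftrightarrow> x \<in> tO (g3 i)" using numeral_tO[of "num.Bit0 num.One" x "g3 i"] by (simp only: mult_2)
    then show ?thesis unfolding LN_def h_le(10)[of i] by (auto simp: max_def elim: tO_mono)
  qed
  show ?thesis
  proof (rule short_exact_of_models[OF rank1_Ys N rank1_Xs three_le(1) Fc Gc])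
    show "F *\<^sub>v v \<in> LN i" if "v \<in> line_lat hY i" for i v using that by (simp add: Fv diag)
    show "G *\<^sub>v v \<in> line_lat hX i" if "v \<in> LN i" for i v
      using that LN_bounds[OF that] by (auto simp: Gv LN_def intro: tO_diff)
    show "u = v" if "u \<in> carrier_vec 1" "v \<in> carrier_vec 1" "F *\<^sub>v u = F *\<^sub>v v" for u v
      using that by (simp add: Fv vec_eq1 vec_eq2)
    show "\<exists>u\<in>line_lat hY i. F *\<^sub>v u = v" if v: "v \<in> LN i" "G *\<^sub>v v = 0\<^sub>v 1" for i v
    proof -
      have vc: "v \<in> carrier_vec 2" using v by (simp add: LN_def)
      have "v $ 0 = v $ 1" using v(2) by (simp add: Gv vc vec_eq1)
      then have ve: "v = vec2 (v $ 0) (v $ 0)" using vc by (subst vec_eq2) auto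
      then have "v $ 0 \<in> tO (hY i)" using v(1) diag[of "v $ 0" i] by simp
      then show ?thesis using ve by (intro bexI[of _ "vec1 (v $ 0)"]) (auto simp: Fv)
    qed
    show "\<exists>v\<in>LN i. G *\<^sub>v v = w" if w: "w \<in> line_lat hX i" for i w
    proof -
      have wc: "w \<in> carrier_vec 1" and w0: "w $ 0 \<in> tO (hX i)" using w by auto
      have I: ?thesis if "vec2 x y \<in> LN i" "x - y = w $ 0" for x y
        using that wc by (intro bexI[of _ "vec2 x y"]) (auto simp: Gv vec_eq1)
      note hw = half_third_tO(1)[OF w0]
      show ?thesis
      proof (cases rule: segments[of i])
        case full then show ?thesis using w0 by (intro I[of "w $ 0" 0]) (auto simp: LN_def)
      next
        case p1 then show ?thesis using w0 by (intro I[of 0 "- w $ 0"]) (auto simp: LN_def)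
      next
        case l1 then show ?thesis using w0 by (intro I[of 0 "- w $ 0"]) (auto simp: LN_def)
      next
        case p2 then show ?thesis using w0 by (intro I[of "w $ 0" 0]) (auto simp: LN_def)
      next
        case l2 then show ?thesis using w0 by (intro I[of "w $ 0" 0]) (auto simp: LN_def)
      next
        case p3 then show ?thesis using hw dbl[of "w $ 0"] by (intro I[of "half * w $ 0" "- (half * w $ 0)"]) (auto simp: LN_def)
      next
        case l3 then show ?thesis using hw dbl[of "w $ 0"] by (intro I[of "half * w $ 0" "- (half * w $ 0)"]) (auto simp: LN_def)
      qed
    qed
  qed (simp add: Fv Gv vec_eq1)
qed

text \<open>The quotient of the middle term by \<open>L\<^sub>Y\<close> in the coordinates \<open>v\<^sub>0 - v\<^sub>1\<close>, \<open>v\<^sub>1 - v\<^sub>2\<close>.\<close>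

definition LQ :: "int \<Rightarrow> complex fls vec set" where
  "LQ i = {v \<in> carrier_vec 2. v $ 0 \<in> tO (hX i) \<and> v $ 1 \<in> tO (hX i) \<and> 2 * v $ 0 + v $ 1 \<in> tO (k1 i)
     \<and> v $ 0 - v $ 1 \<in> tO (k2 i) \<and> v $ 0 + 2 * v $ 1 \<in> tO (k3 i)}"

lemma LQ_family: "lat_family 3 n 2 LQ"
proof -
  have "LQ = flat 2 [(vec2 1 0, hX), (vec2 0 1, hX), (vec2 2 1, k1), (vec2 1 (-1), k2), (vec2 1 2, k3)]"
    by (intro ext) (auto simp: LQ_def flat_def vec2_scalar)
  moreover have "lat_family 3 n 2 (flat 2 [(vec2 1 0, hX), (vec2 0 1, hX), (vec2 2 1, k1), (vec2 1 (-1), k2), (vec2 1 2, k3)])"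
    by (rule flat_family) (auto simp: rimfun_hX rimfun_k1 rimfun_k2 rimfun_k3 less2 unit_vec2)
  ultimately show ?thesis by simp
qed

text \<open>The vector (1,0) has nonzero value under the three functionals with bounds
  \<open>k1\<close>, \<open>k2\<close>, \<open>k3\<close>, whose maximum is \<open>hI\<close>; hence
  the line through it gives \<open>L_I\<close>, and the second coordinate gives
  \<open>L_X\<close>.\<close>

lemma quotient_exact:
  assumes Q: "models 3 n Q 2 LQ"
  shows "\<exists>f g. short_exact 3 n (rank1 n Is) Q (rank1 n Xs) f g"
proof -
  define F :: "complex fls mat" where "F = mat_of_rows 1 [vec1 1, vec1 0]"
  define G :: "complex fls mat" where "G = mat_of_rows 2 [vec2 0 1]"
  have Fc: "F \<in> carrier_mat 2 1" and Gc: "G \<in> carrier_mat 1 2" by (simp_all add: F_def G_def del: One_nat_def)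
  have v1: "vec1 x \<bullet> v = x * v $ 0" if "v \<in> carrier_vec 1" for x :: "complex fls" and v using that by (simp add: scalar_prod_def)
  have Fv: "F *\<^sub>v v = vec2 (v $ 0) 0" if "v \<in> carrier_vec 1" for v
    unfolding F_def using rows2_vec[of "vec1 1" 1 "vec1 0" v] v1[OF that] by simp
  have Gv: "G *\<^sub>v v = vec1 (v $ 1)" if "v \<in> carrier_vec 2" for v
    unfolding G_def using that by (simp add: rows1_vec vec2_scalar)
  have ax: "vec2 x 0 \<in> LQ i \<longleftrightarrow> x \<in> tO (hI i)" for x i
    unfolding LQ_def using h_le(1,11,13,15,20)[of i] by (auto simp: numeral_tO max_def split: if_splits elim: tO_mono)
  show ?thesis
  proof (rule short_exact_of_models[OF rank1_Is Q rank1_Xs three_le(1) Fc Gc])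
    show "F *\<^sub>v v \<in> LQ i" if "v \<in> line_lat hI i" for i v using that by (simp add: Fv ax)
    show "G *\<^sub>v v \<in> line_lat hX i" if "v \<in> LQ i" for i v using that by (simp add: Gv LQ_def)
    show "u = v" if "u \<in> carrier_vec 1" "v \<in> carrier_vec 1" "F *\<^sub>v u = F *\<^sub>v v" for u v
      using that by (simp add: Fv vec_eq1 vec_eq2)
    show "G *\<^sub>v (F *\<^sub>v v) = 0\<^sub>v 1" if "v \<in> carrier_vec 1" for v using that by (simp add: Fv Gv vec_eq1)
    show "\<exists>u\<in>line_lat hI i. F *\<^sub>v u = v" if v: "v \<in> LQ i" "G *\<^sub>v v = 0\<^sub>v 1" for i v
    proof -
      have vc: "v \<in> carrier_vec 2" using v by (simp add: LQ_def)
      have "v $ 1 = 0" using v(2) by (simp add: Gv vc vec_eq1)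
      then have ve: "v = vec2 (v $ 0) 0" using vc by (subst vec_eq2) auto
      then have "v $ 0 \<in> tO (hI i)" using v(1) ax[of "v $ 0" i] by simp
      then show ?thesis using ve by (intro bexI[of _ "vec1 (v $ 0)"]) (auto simp: Fv)
    qed
    show "\<exists>v\<in>LQ i. G *\<^sub>v v = w" if w: "w \<in> line_lat hX i" for i w
    proof -
      have wc: "w \<in> carrier_vec 1" and w0: "w $ 0 \<in> tO (hX i)" using w by auto
      have I: ?thesis if "vec2 x (w $ 0) \<in> LQ i" for x
        using that wc by (intro bexI[of _ "vec2 x (w $ 0)"]) (auto simp: Gv vec_eq1)
      note hw = half_third_tO(1)[OF w0]
      have "2 * (- (half * w $ 0)) + w $ 0 = w $ 0 - (half * w $ 0 + half * w $ 0)" by (simp add: algebra_simps)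
      then have z: "2 * (- (half * w $ 0)) + w $ 0 = 0" unfolding dbl by simp
      \<comment> \<open>The first coordinate must meet the one condition that may be sharper.
        Equality with the second coordinate annihilates the functional of \<open>k2\<close>; for
        \<open>k1\<close> and \<open>k3\<close> the solutions are -w/2 and -2w, used in the cases
        \<open>l1\<close> and \<open>l3\<close>.\<close>
      have D: ?thesis if "k1 i = hX i" "k3 i = hX i"
      proof (rule I[of "w $ 0"])
        have "2 * w $ 0 \<in> tO (hX i)" using w0 numeral_tO by blast
        then have "2 * w $ 0 + w $ 0 \<in> tO (hX i)" "w $ 0 + 2 * w $ 0 \<in> tO (hX i)" using w0 by (metis tO_add)+
        then show "vec2 (w $ 0) (w $ 0) \<in> LQ i" using w0 that by (simp add: LQ_def)
      qed
      show ?thesis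
      proof (cases rule: segments[of i])
        case l1
        have "2 * w $ 0 \<in> tO (hX i)" using w0 numeral_tO by blast
        then have q: "- (half * w $ 0) + 2 * w $ 0 \<in> tO (hX i)" "- (half * w $ 0) - w $ 0 \<in> tO (hX i)" "- (half * w $ 0) \<in> tO (hX i)"
          using w0 hw tO_uminus_iff by (metis tO_add, metis tO_diff, metis)
        have "vec2 (- (half * w $ 0)) (w $ 0) \<in> LQ i"
          unfolding LQ_def mem_Collect_eq vec2_simps z l1 by (intro conjI vec2_simps(1) tO_0 w0 q)
        then show ?thesis by (rule I)
      next
        case l3
        have u: "2 * w $ 0 \<in> tO (hX i)" "2 * (2 * w $ 0) \<in> tO (hX i)" using w0 numeral_tO by blast+
        then have "- (2 * w $ 0) - w $ 0 \<in> tO (hX i)" "- (2 * (2 * w $ 0)) + w $ 0 \<in> tO (hX i)" "- (2 * w $ 0) \<in> tO (hX i)"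
          using w0 tO_uminus_iff by (metis tO_diff, metis tO_add, metis)
        with l3 w0 show ?thesis by (intro I[of "- (2 * w $ 0)"]) (simp add: LQ_def)
      qed (use D in auto)
    qed
  qed
qed

lemma rank3_exact:
  assumes M: "models 3 n M 3 LM" and Q: "models 3 n Q 2 LQ"
  shows "\<exists>f g. short_exact 3 n (rank1 n Ys) M Q f g"
proof -
  define F :: "complex fls mat" where "F = mat_of_rows 1 [vec1 1, vec1 1, vec1 1]"
  define G :: "complex fls mat" where "G = mat_of_rows 3 [vec3 1 (-1) 0, vec3 0 1 (-1)]"
  have Fc: "F \<in> carrier_mat 3 1" and Gc: "G \<in> carrier_mat 2 3" by (simp_all add: F_def G_def del: One_nat_def)
  have v1: "vec1 x \<bullet> v = x * v $ 0" if "v \<in> carrier_vec 1" for x :: "complex fls" and v using that by (simp add: scalar_prod_def)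
  have Fv: "F *\<^sub>v v = vec3 (v $ 0) (v $ 0) (v $ 0)" if "v \<in> carrier_vec 1" for v
    unfolding F_def using rows3_vec[of "vec1 1" 1 "vec1 1" "vec1 1" v] v1[OF that] by simp
  have Gv: "G *\<^sub>v v = vec2 (v $ 0 - v $ 1) (v $ 1 - v $ 2)" if "v \<in> carrier_vec 3" for v
    unfolding G_def using that by (simp add: rows2_vec vec3_scalar)
  have ax: "vec3 x x x \<in> LM i \<longleftrightarrow> x \<in> tO (hY i)" for x i
  proof -
    have "x + x + x = 3 * x" by (simp add: algebra_simps)
    then have "x + x + x \<in> tO (hI i) \<longleftrightarrow> x \<in> tO (hI i)" using numeral_tO by simp
    then show ?thesis unfolding LM_def using h_le(2)[of i] h_le(10)[of i] by (auto simp: max_def split: if_splits elim: tO_mono)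
  qed
  show ?thesis
  proof (rule short_exact_of_models[OF rank1_Ys M Q three_le(1) Fc Gc])
    show "F *\<^sub>v v \<in> LM i" if "v \<in> line_lat hY i" for i v using that by (simp add: Fv ax)
    show "G *\<^sub>v v \<in> LQ i" if v: "v \<in> LM i" for i v
    proof -
      let ?\<sigma> = "v $ 0 + v $ 1 + v $ 2"
      have vM: "v \<in> carrier_vec 3" "v $ 0 \<in> tO (g1 i)" "v $ 1 \<in> tO (g2 i)" "v $ 2 \<in> tO (g3 i)" "?\<sigma> \<in> tO (hI i)"
        using v by (auto simp: LM_def)
      have x: "v $ 0 \<in> tO (hX i)" "v $ 1 \<in> tO (hX i)" "v $ 2 \<in> tO (hX i)" using vM h_le(4,6,8)[of i] by (auto elim: tO_mono)
      have k: "3 * v $ 0 \<in> tO (k1 i)" "3 * v $ 1 \<in> tO (k2 i)" "3 * v $ 2 \<in> tO (k3 i)" "?\<sigma> \<in> tO (k1 i)" "?\<sigma> \<in> tO (k2 i)" "?\<sigma> \<in> tO (k3 i)"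
        unfolding numeral_tO using vM h_le(12,14,16,17,18,19)[of i] by (auto elim: tO_mono)
      \<comment> \<open>This explains the functionals in \<open>LQ\<close>: in the new coordinates
        they are 3 v_j minus the sum, up to sign, hence bounded by both g_j and \<open>hI\<close>,
        and so by k_j.\<close>
      have e: "2 * (v $ 0 - v $ 1) + (v $ 1 - v $ 2) = 3 * v $ 0 - ?\<sigma>" "(v $ 0 - v $ 1) - (v $ 1 - v $ 2) = ?\<sigma> - 3 * v $ 1"
        "(v $ 0 - v $ 1) + 2 * (v $ 1 - v $ 2) = ?\<sigma> - 3 * v $ 2" by (simp_all add: algebra_simps)
      show ?thesis unfolding Gv[OF vM(1)] LQ_def mem_Collect_eq vec2_simps e
        by (intro conjI tO_diff x k) simp
    qed
    show "u = v" if "u \<in> carrier_vec 1" "v \<in> carrier_vec 1" "F *\<^sub>v u = F *\<^sub>v v" for u v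
      using that by (simp add: Fv vec_eq1 vec_eq3)
    show "G *\<^sub>v (F *\<^sub>v v) = 0\<^sub>v 2" if "v \<in> carrier_vec 1" for v using that by (simp add: Fv Gv vec_eq2)
    show "\<exists>u\<in>line_lat hY i. F *\<^sub>v u = v" if v: "v \<in> LM i" "G *\<^sub>v v = 0\<^sub>v 2" for i v
    proof -
      have vc: "v \<in> carrier_vec 3" using v by (simp add: LM_def)
      have "v $ 0 = v $ 1" "v $ 1 = v $ 2" using v(2) by (simp_all add: Gv vc vec_eq2)
      then have ve: "v = vec3 (v $ 0) (v $ 0) (v $ 0)" using vc by (subst vec_eq3) auto
      then have "v $ 0 \<in> tO (hY i)" using v(1) ax[of "v $ 0" i] by simp
      then show ?thesis using ve by (intro bexI[of _ "vec1 (v $ 0)"]) (auto simp: Fv)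
    qed
    show "\<exists>v\<in>LM i. G *\<^sub>v v = w" if w: "w \<in> LQ i" for i w
    proof -
      have wc: "w \<in> carrier_vec 2" using w by (simp add: LQ_def)
      let ?p = "w $ 0" and ?q = "w $ 1"
      \<comment> \<open>The preimage with coordinate sum zero. It already has the required orders
        away from the peaks; at the j-th peak the multiple of (1,1,1) that annihilates its j-th
        coordinate is subtracted, which keeps the sum within \<open>hI\<close> because
        \<open>hI\<close> equals \<open>hX\<close> there.\<close>
      define x y z where "x = third * (2 * ?p + ?q)" and "y = - (third * (?p - ?q))" and "z = - (third * (?p + 2 * ?q))"
      note xyz = this
      have k: "x \<in> tO (k1 i)" "y \<in> tO (k2 i)" "z \<in> tO (k3 i)" using w unfolding xyz LQ_def tO_uminus_iff by (auto intro!: half_third_tO)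
      have hx: "x \<in> tO (hX i)" "y \<in> tO (hX i)" "z \<in> tO (hX i)" using k h_le(11,13,15)[of i] by (auto elim: tO_mono)
      have "x - y = third * ?p + third * ?p + third * ?p" "y - z = third * ?q + third * ?q + third * ?q" "x + y + z = 0"
        unfolding xyz mult_2 by (simp_all only: distrib_left right_diff_distrib) simp_all
      then have d: "x - y = ?p" "y - z = ?q" and s0: "x + y + z = 0" unfolding tpl .
      have I: ?thesis if "vec3 (x - u) (y - u) (z - u) \<in> LM i" for u
        using that d wc by (intro bexI[of _ "vec3 (x - u) (y - u) (z - u)"]) (auto simp: Gv vec_eq2)
      have s: "(x - u) + (y - u) + (z - u) = - (3 * u)" for u
      proof -
        have "(x - u) + (y - u) + (z - u) = (x + y + z) - 3 * u" by (simp add: algebra_simps)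
        then show ?thesis using s0 by simp
      qed
      have J: ?thesis if "u \<in> tO (hX i)" "hI i = hX i" "x - u \<in> tO (g1 i)" "y - u \<in> tO (g2 i)" "z - u \<in> tO (g3 i)" for u
        by (rule I[of u]) (use that s[of u] in \<open>simp add: LM_def numeral_tO\<close>)
      show ?thesis
      proof (cases rule: segments[of i])
        case full then show ?thesis using hx by (intro J[of 0]) auto
      next
        case p1 then show ?thesis using hx by (intro J[of x]) (auto intro: tO_diff)
      next
        case p2 then show ?thesis using hx by (intro J[of y]) (auto intro: tO_diff)
      next
        case p3 then show ?thesis using hx by (intro J[of z]) (auto intro: tO_diff)
      next
        case l1 then show ?thesis using k s0 by (intro I[of 0]) (auto simp: LM_def)
      next
        case l2 then show ?thesis using k s0 by (intro I[of 0]) (auto simp: LM_def)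
      next
        case l3 then show ?thesis using k s0 by (intro I[of 0]) (auto simp: LM_def)
      qed
    qed
  qed
qed

lemma rank2_profile:
  assumes N: "models 3 n N 2 LN"
  shows "has_profile 3 n N [Xs, Ys]"
proof (rule has_profileI[where V = VN and h = "\<lambda>d. if d = 0 then hX else hY"])
  obtain f g where S: "short_exact 3 n (rank1 n Ys) N (rank1 n Xs) f g" using rank2_exact[OF N] by blast
  have "filtered 3 n (rank1 n Xs) [Xs]" by (rule filtered_rank1[OF k_subsets(2) rank1_Xs rank1_Xs three_le])
  from filtered.step[OF k_subsets(3) S this] show "filtered 3 n N [Xs, Ys]" by simp
  have rk: "rk N = 2" using N by (simp add: models_def)
  then show "length [Xs, Ys] = rk N" "0 < rk N" by simp_all
  show "lattice_diagram 3 n N VN" by (rule lattice_diagram_of_models[OF N VN_configuration LN_diag])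
  show "scalar_endos (rk N) VN" unfolding rk by (rule VN_scalar)
  show "\<exists>r. \<exists>A\<in>carrier_mat (rk N) r. inj_on (\<lambda>v. A *\<^sub>v v) (carrier_vec r) \<and> VN i j = (\<lambda>v. A *\<^sub>v v) ` carrier_vec r" for i j
    using VN_image[of j i] unfolding rk is_image_def by blast
  show "is_rim n ([Xs, Ys] ! d) (if d = 0 then hX else hY)" if "d < rk N" for d
    using that rims rk by (auto simp: less2)
  show "d < multiplicity_at (rk N) VN i j \<longleftrightarrow> (if d = 0 then hX else hY) i \<le> j" if "d < rk N" for d i j
    unfolding rk multiplicity_is_image[where V = VN, OF VN_image] using that h_le(1,2)[of i] rk by (auto simp: less2)
qed (rule three_le)

lemma rank3_profile:
  assumes M: "models 3 n M 3 LM" and gap: "a + 3 \<le> b" "b + 3 \<le> c"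
  shows "has_profile 3 n M [Xs, Is, Ys]"
proof (rule has_profileI[where V = VM and h = "\<lambda>d. if d = 0 then hX else if d = 1 then hI else hY"])
  obtain Q where Q: "models 3 n Q 2 LQ" using model_exists[OF LQ_family three_le] .
  obtain f g where S: "short_exact 3 n (rank1 n Ys) M Q f g" using rank3_exact[OF M Q] by blast
  obtain f' g' where S': "short_exact 3 n (rank1 n Is) Q (rank1 n Xs) f' g'" using quotient_exact[OF Q] by blast
  have "filtered 3 n (rank1 n Xs) [Xs]" by (rule filtered_rank1[OF k_subsets(2) rank1_Xs rank1_Xs three_le])
  from filtered.step[OF k_subsets(3) S filtered.step[OF k_subsets(1) S' this]] show "filtered 3 n M [Xs, Is, Ys]" by simp
  have rk: "rk M = 3" using M by (simp add: models_def)
  then show "length [Xs, Is, Ys] = rk M" "0 < rk M" by simp_all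
  show "lattice_diagram 3 n M VM" by (rule lattice_diagram_of_models[OF M VM_configuration LM_diag])
  show "scalar_endos (rk M) VM" unfolding rk by (rule VM_scalar[OF gap])
  show "\<exists>r. \<exists>A\<in>carrier_mat (rk M) r. inj_on (\<lambda>v. A *\<^sub>v v) (carrier_vec r) \<and> VM i j = (\<lambda>v. A *\<^sub>v v) ` carrier_vec r" for i j
    using VM_image[of j i] unfolding rk is_image_def by blast
  show "is_rim n ([Xs, Is, Ys] ! d) (if d = 0 then hX else if d = 1 then hI else hY)" if "d < rk M" for d
    using that rims rk by (auto simp: less3)
  show "d < multiplicity_at (rk M) VM i j \<longleftrightarrow> (if d = 0 then hX else if d = 1 then hI else hY) i \<le> j" if "d < rk M" for d i j
    unfolding rk multiplicity_is_image[where V = VM, OF VM_image] using that h_le(1,2)[of i] rk by (auto simp: less3)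
qed (rule three_le)

lemma rank2_is_rank2:
  assumes N: "models 3 n N 2 LN"
  shows "is_rank2 3 n Xs Ys N"
  unfolding is_rank2_def
  using rank2_rigid[OF N] rank2_indecomposable[OF N] rank2_exact[OF N] rank2_profile[OF N] N
  by (auto simp: models_def rigid_def)

end

section \<open>Classification of the extensions\<close>

lemma models_change2:
  assumes M: "models k n M 2 \<Lambda>" and D: "a * d - b * c \<noteq> 0"
    and L: "\<And>i x y. vec2 x y \<in> \<Lambda> i \<longleftrightarrow> vec2 (a * x + b * y) (c * x + d * y) \<in> \<Lambda>' i"
    and c: "\<And>i. \<Lambda>' i \<subseteq> carrier_vec 2"
  shows "models k n M 2 \<Lambda>'"
proof (rule models_change[OF M])
  let ?P = "mat_of_rows 2 [vec2 a b, vec2 c d]"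
  show P: "?P \<in> carrier_mat 2 2" by simp
  have Pv: "?P *\<^sub>v v = vec2 (a * v $ 0 + b * v $ 1) (c * v $ 0 + d * v $ 1)" if "v \<in> carrier_vec 2" for v
    using that by (simp add: rows2_vec vec2_scalar)
  show "det ?P \<noteq> 0"
  proof
    assume "det ?P = 0"
    then obtain v where v: "v \<in> carrier_vec 2" "v \<noteq> 0\<^sub>v 2" "?P *\<^sub>v v = 0\<^sub>v 2"
      using det_0_iff_vec_prod_zero_field[OF P] by blast
    have z: "a * v $ 0 + b * v $ 1 = 0" "c * v $ 0 + d * v $ 1 = 0" using v(3) unfolding Pv[OF v(1)] by (auto simp: vec_eq2)
    have "(a * d - b * c) * v $ 0 = d * (a * v $ 0 + b * v $ 1) - b * (c * v $ 0 + d * v $ 1)"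
      "(a * d - b * c) * v $ 1 = a * (c * v $ 0 + d * v $ 1) - c * (a * v $ 0 + b * v $ 1)"
      by (simp_all add: algebra_simps)
    then have "v $ 0 = 0" "v $ 1 = 0" unfolding z using D by simp_all
    then show False using v(1,2) by (simp add: vec_eq2)
  qed
  show "v \<in> \<Lambda> i \<longleftrightarrow> ?P *\<^sub>v v \<in> \<Lambda>' i" if "v \<in> carrier_vec 2" for i v
    unfolding Pv[OF that] using L[of "v $ 0" "v $ 1" i] vec2_eta[OF that] by simp
qed (rule c)

text \<open>When each condition involves one coordinate, the chain is the direct sum of two rank 1
  chains.\<close>

lemma not_indecomposable_if_split2:
  assumes M: "models k n M 2 (\<lambda>i. {v \<in> carrier_vec 2. v $ 0 \<in> tO (A i) \<and> v $ 1 \<in> tO (B i)})"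
    and A: "rimfun k n A" and B: "rimfun k n B" and kn: "k \<le> n" "0 < n"
  shows "\<not> indecomposable k n M"
proof (rule not_indecomposable_if_split[OF _ line_lat_family[OF A] line_lat_family[OF B] kn])
  have "{v \<in> carrier_vec 2. v $ 0 \<in> tO (A i) \<and> v $ 1 \<in> tO (B i)} = {u @\<^sub>v w | u w. u \<in> line_lat A i \<and> w \<in> line_lat B i}" for i
  proof (intro equalityI subsetI)
    fix v assume "v \<in> {v \<in> carrier_vec 2. v $ 0 \<in> tO (A i) \<and> v $ 1 \<in> tO (B i)}"
    then have v: "v \<in> carrier_vec 2" "v $ 0 \<in> tO (A i)" "v $ 1 \<in> tO (B i)" by auto
    have "v = vec1 (v $ 0) @\<^sub>v vec1 (v $ 1)" using v(1) by (intro eq_vecI) (auto simp: less2 less_Suc_eq)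
    then show "v \<in> {u @\<^sub>v w | u w. u \<in> line_lat A i \<and> w \<in> line_lat B i}" using v by (force simp del: One_nat_def)
  next
    fix v assume "v \<in> {u @\<^sub>v w | u w. u \<in> line_lat A i \<and> w \<in> line_lat B i}"
    then obtain u w where v: "v = u @\<^sub>v w" "u \<in> carrier_vec 1" "w \<in> carrier_vec 1" and uw: "u $ 0 \<in> tO (A i)" "w $ 0 \<in> tO (B i)"
      by (auto simp del: One_nat_def)
    have "v \<in> carrier_vec (1 + 1)" unfolding v(1) by (rule append_carrier_vec[OF v(2,3)])
    moreover have "v $ 0 = u $ 0" "v $ 1 = w $ 0" unfolding v(1) using v(2,3) by (simp_all add: index_append_vec)
    ultimately show "v \<in> {v \<in> carrier_vec 2. v $ 0 \<in> tO (A i) \<and> v $ 1 \<in> tO (B i)}" using uw by (simp add: numeral_2_eq_2)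
  qed
  then show "models k n M (1 + 1) (\<lambda>i. {u @\<^sub>v w | u w. u \<in> line_lat A i \<and> w \<in> line_lat B i})"
    using M unfolding one_add_one by presburger
qed simp_all

lemma presents_vec_zero:
  assumes P: "presents k n M \<phi>" and x: "x \<in> carrier_vec (rk M)" and z: "\<phi> i *\<^sub>v map_vec fps_to_fls x = 0\<^sub>v (rk M)"
  shows "x = 0\<^sub>v (rk M)"
proof -
  have mx: "map_vec fps_to_fls x \<in> carrier_vec (rk M)" using x by simp
  have "map_vec fps_to_fls x = 0\<^sub>v (rk M)"
    using det_0_iff_vec_prod_zero_field[OF presentsD(2)[OF P, of i]] presentsD(3)[OF P, of i] mx z by blast
  then have "map_vec fps_to_fls x $ l = 0" if "l < rk M" for l using that by simp
  then show ?thesis using x by (intro eq_vecI) auto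
qed

text \<open>Coordinates are chosen so that the submodule is the first axis and the quotient map the
  second coordinate. A lift of the generator of C at vertex i then has the form t^hC(i) (s i, 1),
  and the function \<open>s\<close> is a cocycle describing the extension.\<close>

lemma rank2_extension:
  assumes S: "short_exact k n A N C f g" and A: "models k n A 1 (line_lat hA)" and C: "models k n C 1 (line_lat hC)"
    and rN: "rk N = 2" and kn: "k \<le> n"
  shows "\<exists>s. models k n N 2 (\<lambda>i. {v \<in> carrier_vec 2. v $ 1 \<in> tO (hC i) \<and> v $ 0 - s i * v $ 1 \<in> tO (hA i)})"
proof -
  note SD = short_exactD[OF S]
  obtain \<phi> where PA: "presents k n A \<phi>" and lA: "\<And>i. lat (\<phi> i) = line_lat hA i" and rA: "rk A = 1" by (rule modelsD[OF A]) metis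
  obtain \<chi> where PC: "presents k n C \<chi>" and lC: "\<And>i. lat (\<chi> i) = line_lat hC i" and rC: "rk C = 1" by (rule modelsD[OF C]) metis
  obtain \<psi> where PN: "presents k n N \<psi>" using presents_exists[OF SD(2)] .
  have N: "models k n N 2 (\<lambda>i. lat (\<psi> i))" using PN rN by (auto simp: models_def)
  obtain F where F: "F \<in> carrier_mat (rk N) (rk A)" "\<And>i. \<psi> i * toK (f i) = F * \<phi> i" by (rule hom_matrix[OF PA PN SD(4)]) metis
  obtain G where G: "G \<in> carrier_mat (rk C) (rk N)" "\<And>i. \<chi> i * toK (g i) = G * \<psi> i" by (rule hom_matrix[OF PN PC SD(5)]) metis
  have Fc: "F \<in> carrier_mat 2 1" and Gc: "G \<in> carrier_mat 1 2" using F G rA rC rN by auto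
  define p where "p = col F 0"
  define \<gamma> where "\<gamma> = row G 0"
  have pc: "p \<in> carrier_vec 2" unfolding p_def by (rule col_carrier_vec[OF _ Fc]) simp
  have gc: "\<gamma> \<in> carrier_vec 2" unfolding \<gamma>_def by (rule row_carrier_vec[OF _ Gc]) simp
  have Fv: "F *\<^sub>v vec1 x = x \<cdot>\<^sub>v p" for x using mat_vec_1[OF Fc vec1_simps(1), of x] by (simp add: p_def)
  have Gv: "G *\<^sub>v v = vec1 (\<gamma> \<bullet> v)" if "v \<in> carrier_vec 2" for v
    using Gc by (intro eq_vecI) (auto simp: \<gamma>_def)
  let ?L = "\<lambda>i. lat (\<psi> i)"
  have Lc: "v \<in> carrier_vec 2" if "v \<in> ?L i" for v i using lat_carrier[OF PN that] rN by simp
  have image: "x \<cdot>\<^sub>v p \<in> ?L i" if "x \<in> tO (hA i)" for x i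
    using hom_lat[OF PA PN SD(4) F, of "vec1 x" i] that lA by (simp add: Fv)
  have quot: "\<gamma> \<bullet> v \<in> tO (hC i)" if "v \<in> ?L i" for v i
    using hom_lat[OF PN PC SD(5) G that] lC by (simp add: Gv[OF Lc[OF that]])
  have ker: "\<exists>x\<in>tO (hA i). v = x \<cdot>\<^sub>v p" if v: "v \<in> ?L i" "\<gamma> \<bullet> v = 0" for v i
  proof -
    obtain y where y: "y \<in> carrier_vec (rk N)" "v = \<psi> i *\<^sub>v map_vec fps_to_fls y" using v(1) lat_fps[OF presentsD(2)[OF PN]] by auto
    have gy: "g i *\<^sub>v y \<in> carrier_vec (rk C)" by (rule mult_mat_vec_carrier[OF is_homD(1)[OF SD(5)] y(1)])
    have "\<chi> i *\<^sub>v map_vec fps_to_fls (g i *\<^sub>v y) = G *\<^sub>v v"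
      using hom_vec[OF presentsD(2)[OF PC] presentsD(2)[OF PN] is_homD(1)[OF SD(5)] G(1) G(2) y(1)] y(2) by simp
    also have "\<dots> = 0\<^sub>v 1" using v Gv[OF Lc[OF v(1)]] by (simp add: vec_eq1)
    finally have "\<chi> i *\<^sub>v map_vec fps_to_fls (g i *\<^sub>v y) = 0\<^sub>v (rk C)" using rC by simp
    then have "g i *\<^sub>v y = 0\<^sub>v (rk C)" by (rule presents_vec_zero[OF PC gy])
    then have "y \<in> mat_kernel (g i)" using y(1) is_homD(1)[OF SD(5), of i] by (auto simp: mat_kernel_def)
    then obtain x where x: "x \<in> carrier_vec (rk A)" "y = f i *\<^sub>v x" using SD(7)[of i] by blast
    let ?u = "\<phi> i *\<^sub>v map_vec fps_to_fls x"
    have "v = F *\<^sub>v ?u"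
      using hom_vec[OF presentsD(2)[OF PN] presentsD(2)[OF PA] is_homD(1)[OF SD(4)] F(1) F(2) x(1)] x(2) y(2) by simp
    moreover have "?u \<in> line_lat hA i" using x(1) lat_fps[OF presentsD(2)[OF PA]] lA by auto
    ultimately show ?thesis using Fv[of "?u $ 0"] vec1_eta[of ?u] by auto
  qed
  have surj: "\<exists>v\<in>?L i. \<gamma> \<bullet> v = x" if "x \<in> tO (hC i)" for x i
  proof -
    obtain v where "v \<in> ?L i" "G *\<^sub>v v = vec1 x" by (rule exact_surj_lat[OF S PN PC G, of "vec1 x" i]) (use \<open>x \<in> tO (hC i)\<close> lC in auto)
    then show ?thesis using Gv[OF Lc] by (intro bexI[of _ v]) (auto simp: vec_eq1)
  qed
  have "\<gamma> \<bullet> (tpow (hA 0) \<cdot>\<^sub>v p) = 0"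
  proof -
    have "vec1 (tpow (hA 0)) \<in> lat (\<phi> 0)" using lA by simp
    then obtain x where x: "x \<in> carrier_vec (rk A)" "vec1 (tpow (hA 0)) = \<phi> 0 *\<^sub>v map_vec fps_to_fls x"
      using lat_fps[OF presentsD(2)[OF PA]] by auto
    have fx: "f 0 *\<^sub>v x \<in> mat_kernel (g 0)" using SD(7)[of 0] x(1) by blast
    then have fxc: "f 0 *\<^sub>v x \<in> carrier_vec (rk N)" and z: "g 0 *\<^sub>v (f 0 *\<^sub>v x) = 0\<^sub>v (rk C)"
      using is_homD(1)[OF SD(5), of 0] by (auto simp: mat_kernel_def)
    have 1: "F *\<^sub>v vec1 (tpow (hA 0)) = \<psi> 0 *\<^sub>v map_vec fps_to_fls (f 0 *\<^sub>v x)"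
      using hom_vec[OF presentsD(2)[OF PN] presentsD(2)[OF PA] is_homD(1)[OF SD(4)] F(1) F(2) x(1)] x(2) by simp
    have "G *\<^sub>v (F *\<^sub>v vec1 (tpow (hA 0))) = \<chi> 0 *\<^sub>v map_vec fps_to_fls (g 0 *\<^sub>v (f 0 *\<^sub>v x))"
      unfolding 1 using hom_vec[OF presentsD(2)[OF PC] presentsD(2)[OF PN] is_homD(1)[OF SD(5)] G(1) G(2) fxc] by simp
    also have "\<dots> = \<chi> 0 *\<^sub>v 0\<^sub>v 1" unfolding z rC by (rule arg_cong[of _ _ "(*\<^sub>v) (\<chi> 0)"]) (auto intro: eq_vecI)
    also have "\<dots> = 0\<^sub>v 1" using presentsD(2)[OF PC, of 0] rC by (intro eq_vecI) (auto simp: scalar_prod_def)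
    finally show ?thesis using Gv[of "tpow (hA 0) \<cdot>\<^sub>v p"] pc by (simp add: Fv vec_eq1)
  qed
  then have gp: "\<gamma> \<bullet> p = 0" using gc pc by simp
  have gp': "\<gamma> $ 0 * p $ 0 + \<gamma> $ 1 * p $ 1 = 0" using gp gc pc by (simp add: scalar_prod_def sum2)
  have g0: "\<gamma> $ 0 \<noteq> 0 \<or> \<gamma> $ 1 \<noteq> 0"
  proof (rule ccontr)
    assume "\<not> ?thesis"
    moreover obtain v where "v \<in> ?L 0" "\<gamma> \<bullet> v = tpow (hC 0)" using surj[of "tpow (hC 0)" 0] by auto
    ultimately show False using Lc[of v 0] gc by (auto simp: scalar_prod_def sum2)
  qed
  have p0: "p $ 0 \<noteq> 0 \<or> p $ 1 \<noteq> 0"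
  proof (rule ccontr)
    assume z: "\<not> ?thesis"
    define y where "y = (vec1 1 :: complex fps vec)"
    have y: "y \<in> carrier_vec (rk A)" using rA by (simp add: y_def)
    have "F *\<^sub>v v = 0\<^sub>v 2" if "v \<in> carrier_vec 1" for v
      using Fv[of "v $ 0"] vec1_eta[OF that] z pc by (auto intro!: eq_vecI simp: less2)
    then have "\<psi> 0 *\<^sub>v map_vec fps_to_fls (f 0 *\<^sub>v y) = 0\<^sub>v (rk N)"
      using hom_vec[OF presentsD(2)[OF PN] presentsD(2)[OF PA] is_homD(1)[OF SD(4)] F(1) F(2) y, of 0]
        mult_mat_vec_carrier[OF presentsD(2)[OF PA, of 0], of "map_vec fps_to_fls y"] y rA rN by simp
    moreover have fy: "f 0 *\<^sub>v y \<in> carrier_vec (rk N)" by (rule mult_mat_vec_carrier[OF is_homD(1)[OF SD(4)] y])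
    ultimately have "f 0 *\<^sub>v y = 0\<^sub>v (rk N)" by (intro presents_vec_zero[OF PN])
    also have "\<dots> = f 0 *\<^sub>v 0\<^sub>v (rk A)" using is_homD(1)[OF SD(4), of 0] by (intro eq_vecI) auto
    finally have "y = 0\<^sub>v (rk A)" using inj_onD[OF SD(6)[of 0], of y "0\<^sub>v (rk A)"] y by simp
    then show False using rA by (simp add: y_def vec_eq1)
  qed
  \<comment> \<open>A functional with value 1 on p, supported on a nonzero coordinate of p. Together
    with \<gamma>, which annihilates p, it gives coordinates of the plane.\<close>
  define \<alpha> \<beta> where "\<alpha> = (if p $ 0 \<noteq> 0 then inverse (p $ 0) else 0)" and "\<beta> = (if p $ 0 \<noteq> 0 then 0 else inverse (p $ 1))"
  have up: "\<alpha> * p $ 0 + \<beta> * p $ 1 = 1" using p0 by (auto simp: \<alpha>_def \<beta>_def)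
  define u where "u v = \<alpha> * v $ 0 + \<beta> * v $ 1" for v :: "complex fls vec"
  define l where "l v = \<gamma> $ 0 * v $ 0 + \<gamma> $ 1 * v $ 1" for v :: "complex fls vec"
  have gl: "\<gamma> \<bullet> v = l v" if "v \<in> carrier_vec 2" for v using that gc by (simp add: l_def scalar_prod_def sum2)
  have det: "\<alpha> * \<gamma> $ 1 - \<beta> * \<gamma> $ 0 \<noteq> 0"
  proof
    assume z: "\<alpha> * \<gamma> $ 1 - \<beta> * \<gamma> $ 0 = 0"
    have "\<gamma> $ 0 = \<alpha> * (\<gamma> $ 0 * p $ 0 + \<gamma> $ 1 * p $ 1) - p $ 1 * (\<alpha> * \<gamma> $ 1 - \<beta> * \<gamma> $ 0)
      + \<gamma> $ 0 * (1 - (\<alpha> * p $ 0 + \<beta> * p $ 1))"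
      "\<gamma> $ 1 = \<beta> * (\<gamma> $ 0 * p $ 0 + \<gamma> $ 1 * p $ 1) + p $ 0 * (\<alpha> * \<gamma> $ 1 - \<beta> * \<gamma> $ 0)
      + \<gamma> $ 1 * (1 - (\<alpha> * p $ 0 + \<beta> * p $ 1))" by (simp_all add: algebra_simps)
    then have "\<gamma> $ 0 = 0" "\<gamma> $ 1 = 0" unfolding z gp' up by simp_all
    then show False using g0 by simp
  qed
  have "\<exists>v. v \<in> ?L i \<and> l v = tpow (hC i)" for i using surj[of "tpow (hC i)" i] gl[OF Lc] by auto
  then obtain w where w: "\<And>i. w i \<in> ?L i" "\<And>i. l (w i) = tpow (hC i)" by metis
  define s where "s i = tpow (- hC i) * u (w i)" for i
  have uw: "u (w i) = s i * tpow (hC i)" for i by (simp add: s_def mult.commute)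
  have lin: "u (x + y) = u x + u y" "l (x + y) = l x + l y" "u (c \<cdot>\<^sub>v x) = c * u x" "l (c \<cdot>\<^sub>v x) = c * l x"
    if "x \<in> carrier_vec 2" "y \<in> carrier_vec 2" for x y c using that by (auto simp: u_def l_def algebra_simps)
  have inj: "v = v'" if "v \<in> carrier_vec 2" "v' \<in> carrier_vec 2" "u v = u v'" "l v = l v'" for v v'
  proof -
    have e: "(\<alpha> * \<gamma> $ 1 - \<beta> * \<gamma> $ 0) * x $ 0 = \<gamma> $ 1 * u x - \<beta> * l x"
      "(\<alpha> * \<gamma> $ 1 - \<beta> * \<gamma> $ 0) * x $ 1 = \<alpha> * l x - \<gamma> $ 0 * u x" for x
      by (simp_all add: u_def l_def algebra_simps)
    have "(\<alpha> * \<gamma> $ 1 - \<beta> * \<gamma> $ 0) * v $ 0 = (\<alpha> * \<gamma> $ 1 - \<beta> * \<gamma> $ 0) * v' $ 0"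
      "(\<alpha> * \<gamma> $ 1 - \<beta> * \<gamma> $ 0) * v $ 1 = (\<alpha> * \<gamma> $ 1 - \<beta> * \<gamma> $ 0) * v' $ 1"
      unfolding e that(3,4) by (rule refl)+
    then have "v $ 0 = v' $ 0" "v $ 1 = v' $ 1" using det by (simp_all only: mult_cancel_left) simp_all
    then show ?thesis using that(1,2) by (simp add: vec_eq2)
  qed
  have upl: "u p = 1" "l p = 0" using up gp' by (simp_all add: u_def l_def)
  have key: "v \<in> ?L i \<longleftrightarrow> l v \<in> tO (hC i) \<and> u v - s i * l v \<in> tO (hA i)" if vc: "v \<in> carrier_vec 2" for v i
  proof
    assume v: "v \<in> ?L i"
    have lv: "l v \<in> tO (hC i)" using quot[OF v] gl[OF vc] by simp
    define d where "d = tpow (- hC i) * l v"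
    have d: "- d \<in> tO 0" using lv by (simp add: d_def)
    have dl: "d * tpow (hC i) = l v" by (simp add: d_def mult.commute)
    note W = lattice_lat[OF presentsD(2,3)[OF PN], of i]
    have wc: "w i \<in> carrier_vec 2" by (rule Lc[OF w(1)])
    let ?v = "v + (- d) \<cdot>\<^sub>v w i"
    have vL: "?v \<in> ?L i" by (rule latticeD(2)[OF W v latticeD(3)[OF W d w(1)]])
    have "l ?v = 0" using lin[OF vc smult_carrier_vec[THEN iffD2, OF wc]] lin[OF wc wc] by (simp add: w(2) dl)
    then obtain x where x: "x \<in> tO (hA i)" "?v = x \<cdot>\<^sub>v p" using ker[OF vL] gl[OF Lc[OF vL]] by auto
    have "u ?v = x" unfolding x(2) lin(3)[OF pc pc] upl by simp
    then have "u v - d * u (w i) = x" using lin(1)[OF vc smult_carrier_vec[THEN iffD2, OF wc]] lin(3)[OF wc wc] by simp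
    moreover have "d * u (w i) = s i * l v" unfolding uw dl[symmetric] by (simp add: ac_simps)
    ultimately show "l v \<in> tO (hC i) \<and> u v - s i * l v \<in> tO (hA i)" using lv x(1) by simp
  next
    assume h: "l v \<in> tO (hC i) \<and> u v - s i * l v \<in> tO (hA i)"
    define d where "d = tpow (- hC i) * l v"
    have d: "d \<in> tO 0" using h by (simp add: d_def)
    have dl: "d * tpow (hC i) = l v" by (simp add: d_def mult.commute)
    note W = lattice_lat[OF presentsD(2,3)[OF PN], of i]
    have wc: "w i \<in> carrier_vec 2" by (rule Lc[OF w(1)])
    let ?x = "u v - s i * l v"
    let ?v = "d \<cdot>\<^sub>v w i + ?x \<cdot>\<^sub>v p"
    have vL: "?v \<in> ?L i" by (rule latticeD(2)[OF W latticeD(3)[OF W d w(1)] image]) (use h in simp)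
    have dw: "d * u (w i) = s i * l v" unfolding uw dl[symmetric] by (simp add: ac_simps)
    have "u ?v = u v" "l ?v = l v"
      using lin[OF smult_carrier_vec[THEN iffD2, OF wc] smult_carrier_vec[THEN iffD2, OF pc]] lin[OF wc wc] lin[OF pc pc] by (simp_all add: upl w(2) dl dw)
    from inj[OF Lc[OF vL] vc this] show "v \<in> ?L i" using vL by simp
  qed
  have "models k n N 2 (\<lambda>i. {v \<in> carrier_vec 2. v $ 1 \<in> tO (hC i) \<and> v $ 0 - s i * v $ 1 \<in> tO (hA i)})"
    by (rule models_change2[OF N det]) (use key in \<open>auto simp: u_def l_def\<close>)
  then show ?thesis by blast
qed

lemma tO_cong: "x - y \<in> tO d \<Longrightarrow> x \<in> tO d \<longleftrightarrow> y \<in> tO d"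
  using tO_add[of "x - y" d y] tO_diff[of x d "x - y"] by auto

lemma rimfun_max:
  assumes "rimfun k n g" "rimfun k n h"
  shows "rimfun k n (\<lambda>i. max (g i) (h i))"
  unfolding rimfun_def
proof (intro allI)
  fix i
  have "g i \<le> g (i - 1) \<and> g (i - 1) \<le> g i + 1 \<and> g (i + int n) = g i - (int n - int k)"
    "h i \<le> h (i - 1) \<and> h (i - 1) \<le> h i + 1 \<and> h (i + int n) = h i - (int n - int k)"
    using assms unfolding rimfun_def by blast+
  then show "max (g i) (h i) \<le> max (g (i - 1)) (h (i - 1)) \<and> max (g (i - 1)) (h (i - 1)) \<le> max (g i) (h i) + 1
     \<and> max (g (i + int n)) (h (i + int n)) = max (g i) (h i) - (int n - int k)" by linarith
qed

lemma tO_max: "x \<in> tO (max d e) \<longleftrightarrow> x \<in> tO d \<and> x \<in> tO e"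
  by (auto simp: max_def elim: tO_mono)

section \<open>Extensions of \<open>L_X\<close> by \<open>L_Y\<close> as twisted chains\<close>

context three_peaks
begin

text \<open>Each segment carries one complex number, the constant term to which the cocycle of the
  extension can be reduced there.\<close>

definition LT :: "complex \<Rightarrow> complex \<Rightarrow> complex \<Rightarrow> int \<Rightarrow> complex fls vec set" where
  "LT \<sigma>1 \<sigma>2 \<sigma>3 i = {v \<in> carrier_vec 2. v $ 1 \<in> tO (hX i) \<and> v $ 0 - fls_const \<sigma>1 * v $ 1 \<in> tO (g1 i)
     \<and> v $ 0 - fls_const \<sigma>2 * v $ 1 \<in> tO (g2 i) \<and> v $ 0 - fls_const \<sigma>3 * v $ 1 \<in> tO (g3 i)}"

lemma segment_ranges:
  assumes "i = p + q * int n" "a - 2 \<le> p" "p < a - 2 + int n"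
  shows "g1 i = hX i + 1 \<longleftrightarrow> a - 1 \<le> p \<and> p \<le> b - 3" "g2 i = hX i + 1 \<longleftrightarrow> b - 1 \<le> p \<and> p \<le> c - 3"
    "g3 i = hX i + 1 \<longleftrightarrow> c - 1 \<le> p"
  unfolding assms(1) h_shift h_val[OF assms(2,3)] using assms gaps by auto

text \<open>The chain conditions make \<open>s\<close> constant modulo \<open>t\<close> on each segment, and only this residue matters.\<close>

lemma extension_twist:
  assumes N: "models 3 n N 2 (\<lambda>i. {v \<in> carrier_vec 2. v $ 1 \<in> tO (hX i) \<and> v $ 0 - s i * v $ 1 \<in> tO (hY i)})"
  shows "\<exists>\<sigma>1 \<sigma>2 \<sigma>3. models 3 n N 2 (LT \<sigma>1 \<sigma>2 \<sigma>3)"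
proof -
  let ?E = "\<lambda>i. {v \<in> carrier_vec 2. v $ 1 \<in> tO (hX i) \<and> v $ 0 - s i * v $ 1 \<in> tO (hY i)}"
  note W = models_family[OF N three_le(1)]
  define e where "e i = vec2 (s i * tpow (hX i)) (tpow (hX i))" for i
  have e: "e i \<in> ?E i" for i by (simp add: e_def)
  have tp: "x * tpow d \<in> tO d' \<longleftrightarrow> x \<in> tO (d' - d)" for x d d' using tO_tpow[of d x d'] by (simp add: mult.commute)
  have f1: "s (i - 1) - s i \<in> tO (hY i - hX (i - 1))" for i
  proof -
    have "e (i - 1) \<in> ?E i" using lat_familyD(2)[OF W e[of "i - 1"]] .
    then have "(s (i - 1) - s i) * tpow (hX (i - 1)) \<in> tO (hY i)" by (simp add: e_def algebra_simps)
    then show ?thesis unfolding tp .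
  qed
  have f2: "s i - s (i - 1) \<in> tO (hY (i - 1) - (hX i + 1))" for i
  proof -
    have "tpow 1 \<cdot>\<^sub>v e i \<in> ?E (i - 1)" using lat_familyD(3)[OF W e[of i]] .
    then have "(s i - s (i - 1)) * tpow (hX i + 1) \<in> tO (hY (i - 1))" by (simp add: e_def algebra_simps tpow_add)
    then show ?thesis unfolding tp .
  qed
  have f3: "s (i + int n) - s i \<in> tO (hY i - hX i)" for i
  proof -
    have "tpow (int n - int 3) \<cdot>\<^sub>v e (i + int n) \<in> ?E i" using lat_familyD(4)[OF W, of "e (i + int n)" i] e[of "i + int n"] by (simp add: e_def)
    then have "tpow (int n - 3) * (s (i + int n) * tpow (hX (i + int n))) - s i * (tpow (int n - 3) * tpow (hX (i + int n))) \<in> tO (hY i)"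
      by (simp add: e_def)
    moreover have "tpow (int n - 3) * tpow (hX (i + int n)) = tpow (hX i)" by (simp add: h_shift1 tpow_add[symmetric])
    ultimately have "s (i + int n) * tpow (hX i) - s i * tpow (hX i) \<in> tO (hY i)" by (simp only: mult.left_commute[of "tpow (int n - 3)"])
    then have "(s (i + int n) - s i) * tpow (hX i) \<in> tO (hY i)" by (simp add: left_diff_distrib)
    then show ?thesis unfolding tp .
  qed
  \<comment> \<open>Where the rim of \<open>X\<close> stays level the arrow x gives the estimate,
    where it drops the arrow y does. Two consecutive vertices of one segment both have difference 1
    between \<open>hY\<close> and \<open>hX\<close>, so the cocycle does not change modulo t between
    them.\<close>
  have step: "s i - s (i - 1) \<in> tO (min (hY i - hX i) (hY (i - 1) - hX (i - 1)))" for i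
  proof -
    have "hX i \<le> hX (i - 1)" "hX (i - 1) \<le> hX i + 1" using rimfun_hX by (auto simp: rimfun_def)
    then consider "hX (i - 1) = hX i" | "hX (i - 1) = hX i + 1" by linarith
    then show ?thesis
    proof cases
      case 1
      then have "- (s (i - 1) - s i) \<in> tO (hY i - hX i)" using f1[of i] unfolding tO_uminus_iff by simp
      then show ?thesis by (auto elim!: tO_mono)
    next
      case 2
      then show ?thesis using f2[of i] by (auto elim!: tO_mono)
    qed
  qed
  have \<delta>: "0 \<le> hY i - hX i" for i using h_le(1,2)[of i] by simp
  have step0: "s i - s (i - 1) \<in> tO 0" for i by (rule tO_mono[OF step]) (use \<delta> in auto)
  \<comment> \<open>Subtracting the value at a - 2 corresponds to the shear of the plane applied at
    the end, and makes the cocycle integral.\<close>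
  define D where "D i = s i - s (a - 2)" for i
  have D0: "D i \<in> tO 0" for i
  proof (induct i rule: int_induct[where k = "a - 2"])
    case base show ?case by (simp add: D_def)
  next
    case (step1 i)
    have "D (i + 1) = D i + (s (i + 1) - s (i + 1 - 1))" by (simp add: D_def)
    then show ?case using tO_add[OF step1(2) step0[of "i + 1"]] by simp
  next
    case (step2 i)
    have "D (i - 1) = D i - (s i - s (i - 1))" by (simp add: D_def)
    then show ?case using tO_diff[OF step2(2) step0[of i]] by simp
  qed
  define \<sigma> where "\<sigma> i = fls_nth (D i) 0" for i
  have \<sigma>: "D i - fls_const (\<sigma> i) \<in> tO 1" for i
    using D0[of i] by (auto simp: tO_def \<sigma>_def)
  have \<sigma>_step: "\<sigma> i = \<sigma> (i - 1)" if "hY i - hX i = 1" "hY (i - 1) - hX (i - 1) = 1" for i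
  proof -
    have "D i - D (i - 1) \<in> tO 1" using step[of i] that by (simp add: D_def)
    then have "fls_nth (D i - D (i - 1)) 0 = 0" unfolding tO_def by simp
    then show ?thesis by (simp add: \<sigma>_def)
  qed
  have \<sigma>_shift: "\<sigma> (i + q * int n) = \<sigma> i" if "hY i - hX i = 1" for i q
  proof -
    have s1: "\<sigma> (j + int n) = \<sigma> j" if "hY j - hX j = 1" for j
    proof -
      have "D (j + int n) - D j \<in> tO 1" using f3[of j] that by (simp add: D_def)
      then have "fls_nth (D (j + int n) - D j) 0 = 0" unfolding tO_def by simp
      then show ?thesis by (simp add: \<sigma>_def)
    qed
    have h: "hY (i + q * int n) - hX (i + q * int n) = 1" for q unfolding h_shift using that by simp
    show ?thesis
    proof (induct q rule: int_induct[where k = 0])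
      case (step1 q)
      have "i + (q + 1) * int n = i + q * int n + int n" by (simp add: algebra_simps)
      then show ?case using s1[OF h[of q]] step1(2) by (simp only:)
    next
      case (step2 q)
      have "i + q * int n = i + (q - 1) * int n + int n" by (simp add: algebra_simps)
      then show ?case using s1[OF h[of "q - 1"]] step2(2) by (simp only:)
    qed simp
  qed
  have seg: "\<sigma> p = \<sigma> x" if "x \<le> p" "\<And>j. x \<le> j \<Longrightarrow> j \<le> p \<Longrightarrow> hY j - hX j = 1" for x p
    using that
  proof (induct p rule: int_ge_induct)
    case (step p)
    have "\<sigma> (p + 1) = \<sigma> p" using \<sigma>_step[of "p + 1"] step.hyps step.prems[of "p + 1"] step.prems[of p] by simp
    moreover have "\<sigma> p = \<sigma> x" using step by simp
    ultimately show ?case by simp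
  qed simp
  have non_full: "hY j - hX j = 1" if "a - 2 \<le> j" "j < a - 2 + int n" "j \<noteq> a - 2" "j \<noteq> b - 2" "j \<noteq> c - 2" for j
    unfolding h_val[OF that(1,2)] using that gaps by auto
  have S1: "D i - fls_const (\<sigma> (a - 1)) \<in> tO 1" if g: "g1 i = hX i + 1" for i
  proof -
    obtain p q where p: "i = p + q * int n" "a - 2 \<le> p" "p < a - 2 + int n" using vertex .
    have r: "a - 1 \<le> p" "p \<le> b - 3" using g segment_ranges(1)[OF p] by auto
    have "\<sigma> i = \<sigma> p" unfolding p(1) by (rule \<sigma>_shift, rule non_full) (use p r gaps in auto)
    also have "\<dots> = \<sigma> (a - 1)" by (rule seg, rule r(1), rule non_full) (use p r gaps in auto)
    finally show ?thesis using \<sigma>[of i] by simp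
  qed
  have S2: "D i - fls_const (\<sigma> (b - 1)) \<in> tO 1" if g: "g2 i = hX i + 1" for i
  proof -
    obtain p q where p: "i = p + q * int n" "a - 2 \<le> p" "p < a - 2 + int n" using vertex .
    have r: "b - 1 \<le> p" "p \<le> c - 3" using g segment_ranges(2)[OF p] by auto
    have "\<sigma> i = \<sigma> p" unfolding p(1) by (rule \<sigma>_shift, rule non_full) (use p r gaps in auto)
    also have "\<dots> = \<sigma> (b - 1)" by (rule seg, rule r(1), rule non_full) (use p r gaps in auto)
    finally show ?thesis using \<sigma>[of i] by simp
  qed
  have S3: "D i - fls_const (\<sigma> (c - 1)) \<in> tO 1" if g: "g3 i = hX i + 1" for i
  proof -
    obtain p q where p: "i = p + q * int n" "a - 2 \<le> p" "p < a - 2 + int n" using vertex .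
    have r: "c - 1 \<le> p" using g segment_ranges(3)[OF p] by auto
    have "\<sigma> i = \<sigma> p" unfolding p(1) by (rule \<sigma>_shift, rule non_full) (use p r gaps in auto)
    also have "\<dots> = \<sigma> (c - 1)" by (rule seg, rule r(1), rule non_full) (use p r gaps in auto)
    finally show ?thesis using \<sigma>[of i] by simp
  qed
  have "models 3 n N 2 (LT (\<sigma> (a - 1)) (\<sigma> (b - 1)) (\<sigma> (c - 1)))"
  proof (rule models_change2[OF N, of 1 1 "- s (a - 2)" 0])
    fix i x y
    let ?u = "x - s (a - 2) * y"
    have low: "?u - z * y \<in> tO (hX i) \<longleftrightarrow> ?u \<in> tO (hX i)" if "z \<in> tO 0" "y \<in> tO (hX i)" for z
      by (rule tO_cong) (use tO_scale[OF that] in simp)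
    have Ey: "x - s i * y = ?u - D i * y" by (simp add: D_def algebra_simps)
    have high: "?u - D i * y \<in> tO (hX i + 1) \<longleftrightarrow> ?u - z * y \<in> tO (hX i + 1)" if "D i - z \<in> tO 1" "y \<in> tO (hX i)" for z
    proof (rule tO_cong)
      have "(?u - D i * y) - (?u - z * y) = - ((D i - z) * y)" by (simp add: algebra_simps)
      moreover have "(D i - z) * y \<in> tO (hX i + 1)" using tO_mult[OF that] by (simp add: add.commute)
      ultimately show "(?u - D i * y) - (?u - z * y) \<in> tO (hX i + 1)" unfolding tO_uminus_iff by simp
    qed
    have down: "?u - z * y \<in> tO (hX i + 1) \<Longrightarrow> ?u - z * y \<in> tO (hX i)" for z by (erule tO_mono) simp
    have "?u - D i * y \<in> tO (hY i) \<longleftrightarrow> ?u - fls_const (\<sigma> (a - 1)) * y \<in> tO (g1 i) \<and> ?u - fls_const (\<sigma> (b - 1)) * y \<in> tO (g2 i)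
       \<and> ?u - fls_const (\<sigma> (c - 1)) * y \<in> tO (g3 i)" if y: "y \<in> tO (hX i)"
    proof -
      note lo = low[OF D0 y] low[OF fls_const_in_tO y]
      note hi = high[OF S1 y] high[OF S2 y] high[OF S3 y]
      have dn: "?u - z * y \<in> tO (hX i + 1) \<Longrightarrow> z \<in> tO 0 \<Longrightarrow> ?u \<in> tO (hX i)" for z using down low[OF _ y] by blast
      note dd = dn[OF _ fls_const_in_tO]
      show ?thesis
      proof (cases rule: segments[of i])
        case full show ?thesis unfolding full(1-3,5) lo by simp
      next
        case p1 show ?thesis unfolding p1(1-3,5) hi(1)[OF p1(1)] lo using dd by blast
      next
        case l1 show ?thesis unfolding l1(1-3,5) hi(1)[OF l1(1)] lo using dd by blast
      next
        case p2 show ?thesis unfolding p2(1-3,5) hi(2)[OF p2(2)] lo using dd by blast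
      next
        case l2 show ?thesis unfolding l2(1-3,5) hi(2)[OF l2(2)] lo using dd by blast
      next
        case p3 show ?thesis unfolding p3(1-3,5) hi(3)[OF p3(3)] lo using dd by blast
      next
        case l3 show ?thesis unfolding l3(1-3,5) hi(3)[OF l3(3)] lo using dd by blast
      qed
    qed
    then show "vec2 x y \<in> ?E i \<longleftrightarrow> vec2 (1 * x + - s (a - 2) * y) (0 * x + 1 * y) \<in> LT (\<sigma> (a - 1)) (\<sigma> (b - 1)) (\<sigma> (c - 1)) i"
      by (simp add: LT_def Ey) blast
  qed (auto simp: LT_def)
  then show ?thesis by blast
qed

text \<open>If the two numbers differ, both functionals can serve as coordinates, as their
  difference recovers v_1 up to a constant. If they agree, the single functional and v_1 are
  coordinates. Either way the chain splits into rank 1 chains.\<close>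

lemma twist_two_conditions:
  assumes N: "models 3 n N 2 (\<lambda>i. {v \<in> carrier_vec 2. v $ 1 \<in> tO (hX i) \<and> v $ 0 - fls_const \<sigma> * v $ 1 \<in> tO (A i)
      \<and> v $ 0 - fls_const \<tau> * v $ 1 \<in> tO (B i)})"
    and A: "rimfun 3 n A" "\<And>i. hX i \<le> A i" and B: "rimfun 3 n B" "\<And>i. hX i \<le> B i"
  shows "\<not> indecomposable 3 n N"
proof (cases "\<sigma> = \<tau>")
  case True
  have "models 3 n N 2 (\<lambda>i. {v \<in> carrier_vec 2. v $ 0 \<in> tO (max (A i) (B i)) \<and> v $ 1 \<in> tO (hX i)})"
    by (rule models_change2[OF N, of 1 1 "- fls_const \<sigma>" 0]) (auto simp: True tO_max)
  then show ?thesis by (rule not_indecomposable_if_split2[OF _ rimfun_max[OF A(1) B(1)] rimfun_hX three_le])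
next
  case False
  have "models 3 n N 2 (\<lambda>i. {v \<in> carrier_vec 2. v $ 0 \<in> tO (A i) \<and> v $ 1 \<in> tO (B i)})"
  proof (rule models_change2[OF N, of 1 "- fls_const \<tau>" "- fls_const \<sigma>" 1])
    have "fls_const \<sigma> - fls_const \<tau> \<noteq> 0" unfolding fls_minus_const using False by simp
    then show "1 * - fls_const \<tau> - - fls_const \<sigma> * 1 \<noteq> 0" using False by simp
    fix i x y
    have "y \<in> tO (hX i)" if u: "x - fls_const \<sigma> * y \<in> tO (A i)" "x - fls_const \<tau> * y \<in> tO (B i)"
    proof -
      have "(x - fls_const \<tau> * y) - (x - fls_const \<sigma> * y) \<in> tO (hX i)" by (rule tO_diff[OF tO_mono[OF u(2) B(2)] tO_mono[OF u(1) A(2)]])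
      moreover have "(x - fls_const \<tau> * y) - (x - fls_const \<sigma> * y) = fls_const (\<sigma> - \<tau>) * y"
        unfolding fls_minus_const[symmetric] by (simp add: algebra_simps)
      ultimately have "fls_const (inverse (\<sigma> - \<tau>)) * (fls_const (\<sigma> - \<tau>) * y) \<in> tO (hX i)" by (metis const_mult_tO)
      then show ?thesis using False by (simp add: mult.assoc[symmetric])
    qed
    then show "vec2 x y \<in> {v \<in> carrier_vec 2. v $ 1 \<in> tO (hX i) \<and> v $ 0 - fls_const \<sigma> * v $ 1 \<in> tO (A i) \<and> v $ 0 - fls_const \<tau> * v $ 1 \<in> tO (B i)}
      \<longleftrightarrow> vec2 (1 * x + - fls_const \<sigma> * y) (1 * x + - fls_const \<tau> * y) \<in> {v \<in> carrier_vec 2. v $ 0 \<in> tO (A i) \<and> v $ 1 \<in> tO (B i)}"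
      by auto
  qed auto
  then show ?thesis by (rule not_indecomposable_if_split2[OF _ A(1) B(1) three_le])
qed

text \<open>Two equal numbers merge two conditions into one whose bound is the maximum of the two
  rims, and two conditions leave a decomposable chain.\<close>

lemma twist_indecomposable:
  assumes N: "models 3 n N 2 (LT \<sigma>1 \<sigma>2 \<sigma>3)" and ind: "indecomposable 3 n N"
  shows "\<sigma>1 \<noteq> \<sigma>2" "\<sigma>2 \<noteq> \<sigma>3" "\<sigma>3 \<noteq> \<sigma>1"
proof -
  have m: "rimfun 3 n (\<lambda>i. max (g1 i) (g2 i))" "rimfun 3 n (\<lambda>i. max (g2 i) (g3 i))" "rimfun 3 n (\<lambda>i. max (g3 i) (g1 i))"
    by (intro rimfun_max rimfun_g1 rimfun_g2 rimfun_g3)+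
  have le: "hX i \<le> max (g1 i) (g2 i)" "hX i \<le> max (g2 i) (g3 i)" "hX i \<le> max (g3 i) (g1 i)" for i using h_le(4,6,8)[of i] by auto
  show "\<sigma>1 \<noteq> \<sigma>2"
  proof
    assume "\<sigma>1 = \<sigma>2"
    then have "LT \<sigma>1 \<sigma>2 \<sigma>3 = (\<lambda>i. {v \<in> carrier_vec 2. v $ 1 \<in> tO (hX i) \<and> v $ 0 - fls_const \<sigma>1 * v $ 1 \<in> tO (max (g1 i) (g2 i))
      \<and> v $ 0 - fls_const \<sigma>3 * v $ 1 \<in> tO (g3 i)})" by (intro ext) (auto simp: LT_def tO_max)
    from twist_two_conditions[OF N[unfolded this] m(1) le(1) rimfun_g3 h_le(8)] ind show False by simp
  qed
  show "\<sigma>2 \<noteq> \<sigma>3"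
  proof
    assume "\<sigma>2 = \<sigma>3"
    then have "LT \<sigma>1 \<sigma>2 \<sigma>3 = (\<lambda>i. {v \<in> carrier_vec 2. v $ 1 \<in> tO (hX i) \<and> v $ 0 - fls_const \<sigma>2 * v $ 1 \<in> tO (max (g2 i) (g3 i))
      \<and> v $ 0 - fls_const \<sigma>1 * v $ 1 \<in> tO (g1 i)})" by (intro ext) (auto simp: LT_def tO_max)
    from twist_two_conditions[OF N[unfolded this] m(2) le(2) rimfun_g1 h_le(4)] ind show False by simp
  qed
  show "\<sigma>3 \<noteq> \<sigma>1"
  proof
    assume "\<sigma>3 = \<sigma>1"
    then have "LT \<sigma>1 \<sigma>2 \<sigma>3 = (\<lambda>i. {v \<in> carrier_vec 2. v $ 1 \<in> tO (hX i) \<and> v $ 0 - fls_const \<sigma>3 * v $ 1 \<in> tO (max (g3 i) (g1 i))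
      \<and> v $ 0 - fls_const \<sigma>2 * v $ 1 \<in> tO (g2 i)})" by (intro ext) (auto simp: LT_def tO_max)
    from twist_two_conditions[OF N[unfolded this] m(3) le(3) rimfun_g2 h_le(6)] ind show False by simp
  qed
qed

text \<open>The three functionals \<open>v\<^sub>0 - \<sigma>\<^sub>j v\<^sub>1\<close> satisfy one linear relation. Rescaled so that their sum
  is zero, they become the three functionals that define \<open>LN\<close>.\<close>

lemma twist_models:
  assumes N: "models 3 n N 2 (LT \<sigma>1 \<sigma>2 \<sigma>3)" and ne: "\<sigma>1 \<noteq> \<sigma>2" "\<sigma>2 \<noteq> \<sigma>3" "\<sigma>3 \<noteq> \<sigma>1"
  shows "models 3 n N 2 LN"
proof -
  define l1 l2 l3 where "l1 = \<sigma>2 - \<sigma>3" and "l2 = \<sigma>3 - \<sigma>1" and "l3 = \<sigma>1 - \<sigma>2"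
  have l: "l1 \<noteq> 0" "l2 \<noteq> 0" "l3 \<noteq> 0" using ne by (auto simp: l1_def l2_def l3_def)
  have cm: "fls_const l * x \<in> tO d \<longleftrightarrow> x \<in> tO d" if "l \<noteq> 0" for l x d
  proof
    assume "fls_const l * x \<in> tO d"
    then have "fls_const (inverse l) * (fls_const l * x) \<in> tO d" by (rule const_mult_tO)
    then show "x \<in> tO d" using that by (simp add: mult.assoc[symmetric])
  qed (rule const_mult_tO)
  show ?thesis
  proof (rule models_change2[OF N, of "fls_const l1" "- (fls_const l2 * fls_const \<sigma>2)" "- (fls_const l1 * fls_const \<sigma>1)" "fls_const l2"])
    have "fls_const l1 * - (fls_const l2 * fls_const \<sigma>2) - - (fls_const l1 * fls_const \<sigma>1) * fls_const l2
      = fls_const l1 * fls_const l2 * (fls_const \<sigma>1 - fls_const \<sigma>2)" by (simp add: algebra_simps del: fls_const_mult_const)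
    also have "\<dots> = fls_const l1 * fls_const l2 * fls_const l3" unfolding l3_def fls_minus_const ..
    also have "\<dots> \<noteq> 0" using l by (simp del: fls_const_mult_const)
    finally show "fls_const l1 * - (fls_const l2 * fls_const \<sigma>2) - - (fls_const l1 * fls_const \<sigma>1) * fls_const l2 \<noteq> 0" .
    fix i x y
    let ?a = "x - fls_const \<sigma>1 * y" and ?b = "x - fls_const \<sigma>2 * y" and ?c = "x - fls_const \<sigma>3 * y"
    have e: "fls_const l1 * x + - (fls_const l1 * fls_const \<sigma>1) * y = fls_const l1 * ?a"
      "fls_const l2 * x + - (fls_const l2 * fls_const \<sigma>2) * y = fls_const l2 * ?b" by (simp_all add: algebra_simps)
    have e3: "fls_const l1 * ?a + fls_const l2 * ?b = - (fls_const l3 * ?c)"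
      unfolding l1_def l2_def l3_def fls_minus_const[symmetric] by (simp add: algebra_simps)
    have y: "y \<in> tO (hX i)" if "?a \<in> tO (g1 i)" "?b \<in> tO (g2 i)"
    proof -
      have "?b - ?a \<in> tO (hX i)" by (rule tO_diff[OF tO_mono[OF that(2) h_le(6)] tO_mono[OF that(1) h_le(4)]])
      moreover have "?b - ?a = fls_const l3 * y" unfolding l3_def fls_minus_const[symmetric] by (simp add: algebra_simps)
      ultimately show ?thesis using cm[OF l(3)] by simp
    qed
    have "vec2 x y \<in> LT \<sigma>1 \<sigma>2 \<sigma>3 i \<longleftrightarrow> ?a \<in> tO (g1 i) \<and> ?b \<in> tO (g2 i) \<and> ?c \<in> tO (g3 i)" unfolding LT_def using y by auto
    also have "\<dots> \<longleftrightarrow> vec2 (fls_const l1 * ?a) (fls_const l2 * ?b) \<in> LN i"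
      unfolding LN_def mem_Collect_eq vec2_simps e3 tO_uminus_iff cm[OF l(1)] cm[OF l(2)] cm[OF l(3)] by simp
    finally show "vec2 x y \<in> LT \<sigma>1 \<sigma>2 \<sigma>3 i \<longleftrightarrow> vec2 (fls_const l1 * x + - (fls_const l1 * fls_const \<sigma>1) * y)
        (fls_const l2 * x + - (fls_const l2 * fls_const \<sigma>2) * y) \<in> LN i" unfolding e .
  qed (auto simp: LN_def)
qed

lemma is_rank2_models:
  assumes "is_rank2 3 n Xs Ys N"
  shows "models 3 n N 2 LN"
proof -
  obtain f g where S: "short_exact 3 n (rank1 n Ys) N (rank1 n Xs) f g" and rk: "rk N = 2" and ind: "indecomposable 3 n N"
    using assms unfolding is_rank2_def by blast
  obtain s where "models 3 n N 2 (\<lambda>i. {v \<in> carrier_vec 2. v $ 1 \<in> tO (hX i) \<and> v $ 0 - s i * v $ 1 \<in> tO (hY i)})"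
    using rank2_extension[OF S rank1_Ys rank1_Xs rk three_le(1)] by blast
  from extension_twist[OF this] obtain \<sigma>1 \<sigma>2 \<sigma>3 where T: "models 3 n N 2 (LT \<sigma>1 \<sigma>2 \<sigma>3)" by blast
  show ?thesis by (rule twist_models[OF T twist_indecomposable[OF T ind]])
qed

text \<open>With two gaps equal to 2 the rim \<open>hI\<close> exceeds \<open>hX\<close> on the
  third segment only, where \<open>g3\<close> exceeds it as well. So \<open>hI\<close> is at most
  \<open>g3\<close>, the condition on the sum becomes one on the first two coordinates, and the
  third coordinate splits off.\<close>

lemma rank3_decomposes:
  assumes M: "models 3 n M 3 LM" and gap: "b = a + 2" "c = b + 2"
  shows "\<not> indecomposable 3 n M"
proof -
  have hg: "hI i \<le> g3 i" for i
  proof -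
    obtain p q where p: "i = p + q * int n" "a - 2 \<le> p" "p < a - 2 + int n" using vertex .
    show ?thesis unfolding p(1) h_shift h_val[OF p(2,3)] using p gap by auto
  qed
  define A where "A = flat 2 [(vec2 1 0, g1), (vec2 0 1, g2), (vec2 1 1, hI)]"
  have A: "A i = {v \<in> carrier_vec 2. v $ 0 \<in> tO (g1 i) \<and> v $ 1 \<in> tO (g2 i) \<and> v $ 0 + v $ 1 \<in> tO (hI i)}" for i
    by (auto simp: A_def flat_def vec2_scalar)
  have fam: "lat_family 3 n 2 A" unfolding A_def
    by (rule flat_family) (auto simp: rimfun_g1 rimfun_g2 rimfun_hI less2 unit_vec2)
  have "LM i = {u @\<^sub>v w | u w. u \<in> A i \<and> w \<in> line_lat g3 i}" for i
  proof (intro equalityI subsetI)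
    fix v assume v: "v \<in> LM i"
    then have vc: "v \<in> carrier_vec 3" by (simp add: LM_def)
    have "v $ 2 \<in> tO (hI i)" using v hg[of i] by (auto simp: LM_def elim: tO_mono)
    from tO_diff[OF _ this, of "v $ 0 + v $ 1 + v $ 2"] have "v $ 0 + v $ 1 \<in> tO (hI i)" using v by (simp add: LM_def)
    then have "vec2 (v $ 0) (v $ 1) \<in> A i" "vec1 (v $ 2) \<in> line_lat g3 i" using v by (simp_all add: LM_def A)
    moreover have "v = vec2 (v $ 0) (v $ 1) @\<^sub>v vec1 (v $ 2)" using vc by (intro eq_vecI) (auto simp: less3 less_Suc_eq numeral_2_eq_2)
    ultimately show "v \<in> {u @\<^sub>v w | u w. u \<in> A i \<and> w \<in> line_lat g3 i}" by blast
  next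
    fix v assume "v \<in> {u @\<^sub>v w | u w. u \<in> A i \<and> w \<in> line_lat g3 i}"
    then obtain u w where v: "v = u @\<^sub>v w" "u \<in> A i" "w \<in> line_lat g3 i" by blast
    have uc: "u \<in> carrier_vec 2" "w \<in> carrier_vec 1" using v by (auto simp: A)
    have "v \<in> carrier_vec (2 + 1)" unfolding v(1) by (rule append_carrier_vec[OF uc])
    moreover have "v $ 0 = u $ 0" "v $ 1 = u $ 1" "v $ 2 = w $ 0" unfolding v(1) using uc by (simp_all add: index_append_vec)
    moreover have "w $ 0 \<in> tO (hI i)" using v(3) hg[of i] by (auto elim: tO_mono)
    ultimately show "v \<in> LM i" using v(2,3) by (auto simp: A LM_def intro: tO_add)
  qed
  then have e: "LM = (\<lambda>i. {u @\<^sub>v w | u w. u \<in> A i \<and> w \<in> line_lat g3 i})" by blast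
  have "models 3 n M (2 + 1) (\<lambda>i. {u @\<^sub>v w | u w. u \<in> A i \<and> w \<in> line_lat g3 i})" using M unfolding e by simp
  then show ?thesis by (rule not_indecomposable_if_split[OF _ fam line_lat_family[OF rimfun_g3] three_le]) simp_all
qed

section \<open>Rotation of the lifts, and transfer to arbitrary almost split sequences\<close>

lemma residue_shift: "residue n (x + int n) = residue n x"
  unfolding residue_eq_iff[OF three_le(2)] by simp

lemma rotate_sets:
  "three_peaks.Is n b c (a + int n) = Is" "three_peaks.Xs n b c (a + int n) = Xs" "three_peaks.Ys n b c (a + int n) = Ys"
proof -
  interpret R: three_peaks n b c "a + int n" by (rule rotate)
  have "residue n (a + int n - 2) = residue n (a - 2)" "residue n (a + int n - 1) = residue n (a - 1)"
    using residue_shift[of "a - 2"] residue_shift[of "a - 1"] by (simp_all add: algebra_simps)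
  then show "R.Is = Is" "R.Xs = Xs" "R.Ys = Ys"
    unfolding R.Is_def R.Xs_def R.Ys_def Is_def Xs_def Ys_def residue_shift by auto
qed

lemma rank2_exists: "\<exists>N. is_rank2 3 n Xs Ys N"
proof -
  obtain N where "models 3 n N 2 LN" using model_exists[OF LN_family three_le] .
  then show ?thesis using rank2_is_rank2 by blast
qed

lemma rank2_AR_sequence:
  assumes "models 3 n N 2 LN"
  shows "\<exists>M f g. models 3 n M 3 LM \<and> AR_sequence 3 n N M (rank1 n Is) f g"
proof -
  obtain M where M: "models 3 n M 3 LM" using model_exists[OF LM_family three_le] .
  obtain f g where "AR_sequence 3 n N M (rank1 n Is) f g" by (rule AR_sequence_exists[OF assms M rank1_Is])
  with M show ?thesis by blast
qed

text \<open>The constructed sequence and the given one end at the same module, so uniqueness of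
  almost split sequences carries the chains over to the given modules.\<close>

lemma AR_sequence_models:
  assumes AR: "AR_sequence 3 n N M (rank1 n Is) f g"
  shows "models 3 n N 2 LN" "models 3 n M 3 LM"
proof -
  obtain N0 where N0: "models 3 n N0 2 LN" using model_exists[OF LN_family three_le] .
  obtain M0 f0 g0 where M0: "models 3 n M0 3 LM" and AR0: "AR_sequence 3 n N0 M0 (rank1 n Is) f0 g0"
    using rank2_AR_sequence[OF N0] by blast
  note CM = short_exactD(1,2)[OF AR_D(1)[OF AR]]
  show "models 3 n N 2 LN" by (rule models_iso[OF N0 AR_unique(2)[OF AR0 AR] CM(1)])
  show "models 3 n M 3 LM" by (rule models_iso[OF M0 AR_unique(1)[OF AR0 AR] CM(2)])
qed

lemma AR_sequence_profile:
  assumes AR: "AR_sequence 3 n N M (rank1 n Is) f g" and ind: "indecomposable 3 n M"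
  shows "has_profile 3 n M [Xs, Is, Ys]"
proof -
  interpret R: three_peaks n b c "a + int n" by (rule rotate)
  interpret R': three_peaks n c "a + int n" "b + int n" by (rule R.rotate)
  have ARs: "AR_sequence 3 n N M (rank1 n R.Is) f g" "AR_sequence 3 n N M (rank1 n R'.Is) f g"
    using AR by (simp_all add: R.rotate_sets rotate_sets)
  note M = AR_sequence_models(2)[OF AR] R.AR_sequence_models(2)[OF ARs(1)] R'.AR_sequence_models(2)[OF ARs(2)]
  note split = rank3_decomposes[OF M(1)] R.rank3_decomposes[OF M(2)] R'.rank3_decomposes[OF M(3)]
  note profile = rank3_profile[OF M(1)] R.rank3_profile[OF M(2)] R'.rank3_profile[OF M(3)]
  \<comment> \<open>Any two of the three gaps are consecutive in the cyclic order, so after a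
    rotation either the first two are at least 3, or the first two are equal to 2.\<close>
  consider "a + 3 \<le> b" "b + 3 \<le> c" | "b + 3 \<le> c" "c + 3 \<le> a + int n" | "c + 3 \<le> a + int n" "a + int n + 3 \<le> b + int n"
    | "b = a + 2" "c = b + 2" | "c = b + 2" "a + int n = c + 2" | "a + int n = c + 2" "b + int n = a + int n + 2"
    using gaps by linarith
  then show ?thesis
  proof cases
    case 1 then show ?thesis by (rule profile(1))
  next
    case 2 then show ?thesis using profile(2) by (simp add: rotate_sets)
  next
    case 3 then show ?thesis using profile(3) by (simp add: R.rotate_sets rotate_sets)
  next
    case 4 then show ?thesis using split(1) ind by blast
  next
    case 5 then show ?thesis using split(2) ind by blast
  next
    case 6 then show ?thesis using split(3) ind by blast
  qed
qed

end

section \<open>From a subset with three peaks to integer lifts\<close>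

lemma three_peaks_isolated:
  assumes n: "0 < n" and I: "k_subset 3 n I" and pk: "card (peaks n I) = 3" and x: "x \<in> I"
  shows "residue n (x - 1) \<notin> I"
proof -
  have fin: "finite I" and card: "card I = 3" using I by (auto simp: k_subset_def intro: card_ge_0_finite)
  \<comment> \<open>Every peak is the predecessor of an element of \<open>I\<close>. As there are
    three of each, every predecessor is a peak and hence outside \<open>I\<close>.\<close>
  have "peaks n I \<subseteq> (\<lambda>x. residue n (x - 1)) ` I"
  proof
    fix i assume i: "i \<in> peaks n I"
    have "residue n (residue n (i + 1) - 1) = residue n i"
      unfolding residue_def by (simp add: mod_simps)
    also have "\<dots> = i" using i by (intro residue_self) (simp add: peaks_def)
    finally show "i \<in> (\<lambda>x. residue n (x - 1)) ` I" using i by (force simp: peaks_def)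
  qed
  moreover have "card ((\<lambda>x. residue n (x - 1)) ` I) \<le> card (peaks n I)" using card_image_le[OF fin] card pk by metis
  ultimately have "peaks n I = (\<lambda>x. residue n (x - 1)) ` I" using fin by (intro card_seteq) auto
  then have "residue n (x - 1) \<in> peaks n I" using x by blast
  then show ?thesis by (simp add: peaks_def)
qed

lemma three_peaks_sorted:
  assumes n: "0 < n" and I: "k_subset 3 n {p, q, r}" and pk: "card (peaks n {p, q, r}) = 3" and less: "p < q" "q < r"
  shows "three_peaks n p q r"
proof
  have range: "1 \<le> p" "r \<le> int n" using I by (auto simp: k_subset_def)
  have self: "residue n x = x" if "1 \<le> x" "x \<le> int n" for x using that by (intro residue_self) simp
  note iso = three_peaks_isolated[OF n I pk]
  have "q - 1 \<noteq> p" using iso[of q] self[of "q - 1"] range less by auto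
  then show "p + 2 \<le> q" using less by linarith
  have "r - 1 \<noteq> q" using iso[of r] self[of "r - 1"] range less by auto
  then show "q + 2 \<le> r" using less by linarith
  show "r + 2 \<le> p + int n"
  \<comment> \<open>The gap across the end of the period can only fail when p = 1 and r = n, and
    then the predecessor of 1 would be n.\<close>
  proof (cases "p = 1")
    case True
    have "(- 1) mod int n = int n - 1" by (rule zmod_minus1) (use n in simp)
    moreover have "p - 1 - 1 = - 1" using True by simp
    ultimately have "residue n (p - 1) = int n" unfolding residue_def by (simp only: diff_add_cancel)
    then have "int n \<noteq> r" using iso[of p] by (metis insertCI)
    then show ?thesis using range True by linarith
  next
    case False then show ?thesis using range by simp
  qed
qed

theorem theorem6p5:
  fixes n :: nat and i1 i2 i3 :: int and I X Y :: "int set"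
  assumes "n \<ge> 7"
    and "I = {i1, i2, i3}" and "k_subset 3 n I" and "cyclic_less3 i1 i2 i3"
    and "card (peaks n I) = 3"
    and "X = {residue n (i1 - 2), residue n (i2 - 2), residue n (i3 - 2)}"
    and "Y = {residue n (i1 - 1), residue n (i2 - 1), residue n (i3 - 1)}"
  shows "(\<exists>N. is_rank2 3 n X Y N) \<and>
         (\<forall>N. is_rank2 3 n X Y N \<longrightarrow> (\<exists>M f g. AR_sequence 3 n N M (rank1 n I) f g)) \<and>
         (\<forall>N M f g. AR_sequence 3 n N M (rank1 n I) f g \<longrightarrow>
            is_rank2 3 n X Y N \<and>
            (indecomposable 3 n M \<longrightarrow> has_profile 3 n M [X, I, Y]))"
proof -
  have n: "0 < n" using assms(1) by simp
  \<comment> \<open>Exactly one of the three rotations of the cyclically ordered triple is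
    increasing; rotation does not change the sets.\<close>
  obtain a b c where abc: "a < b" "b < c" and sets: "I = {a, b, c}"
    "X = {residue n (a - 2), residue n (b - 2), residue n (c - 2)}" "Y = {residue n (a - 1), residue n (b - 1), residue n (c - 1)}"
  proof -
    consider "i1 < i2" "i2 < i3" | "i2 < i3" "i3 < i1" | "i3 < i1" "i1 < i2" using assms(4) unfolding cyclic_less3_def by blast
    then show ?thesis
    proof cases
      case 1 then show ?thesis by (rule that) (simp_all add: assms)
    next
      case 2 then show ?thesis by (rule that) (auto simp: assms)
    next
      case 3 then show ?thesis by (rule that) (auto simp: assms)
    qed
  qed
  interpret three_peaks n a b c
    using three_peaks_sorted[OF n _ _ abc] assms(3,5) unfolding sets by blast
  have "residue n x = x" if "x \<in> I" for x using that assms(3) by (intro residue_self) (auto simp: k_subset_def)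
  then have e: "I = Is" "X = Xs" "Y = Ys" unfolding Is_def Xs_def Ys_def using sets by auto
  show ?thesis unfolding e
  proof (intro conjI allI impI)
    show "\<exists>N. is_rank2 3 n Xs Ys N" by (rule rank2_exists)
    show "\<exists>M f g. AR_sequence 3 n N M (rank1 n Is) f g" if "is_rank2 3 n Xs Ys N" for N
      using rank2_AR_sequence[OF is_rank2_models[OF that]] by blast
    show "is_rank2 3 n Xs Ys N" if "AR_sequence 3 n N M (rank1 n Is) f g" for N M f g
      by (rule rank2_is_rank2[OF AR_sequence_models(1)[OF that]])
    show "has_profile 3 n M [Xs, Is, Ys]" if "AR_sequence 3 n N M (rank1 n Is) f g" "indecomposable 3 n M" for N M f g
      by (rule AR_sequence_profile[OF that])
  qed
qed

end
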